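(* For any degree $d$ and any integer $r$ with $\frac{d+1}{2}\le r\le d$ (i.e. any typical rank $r$ for real binary forms of degree $d$), the algebraic boundary $\partial_{\mathrm{alg}}(\mathcal{R}_{d,r})\subset\mathbb{P}(\mathbb{C}[x,y]_d)$ is a union of dual varieties $(\Delta_\lambda)^\vee$ to coincident root loci $\Delta_\lambda$, where the $\lambda$ are suitable partitions of $d$.
   Context: Real rank. For $f\in\mathbb{R}[x,y]_d$, the real rank $\mathrm{rk}_{\mathbb{R}}(f)$ is the minimum integer $r$ such that $f=\sum_{i=1}^r\alpha_i\ell_i^d$ with $\alpha_i\in\mathbb{R}$ and $\ell_i\in\mathbb{R}[x,y]_1$. Let $\mathcal{R}_{d,r}$ be the interior (Euclidean topology) of $\{f\in\mathbb{R}[x,y]_d:\mathrm{rk}_{\mathbb{R}}(f)=r\}$ in the real vector space $\mathbb{R}[x,y]_d$. The rank $r$ is called typical for degree $d$ if $\mathcal{R}_{d,r}\neq\emptyset$; it is known that this holds if and only if $\frac{d+1}{2}\le r\le d$. Boundaries. The topological boundary $\partial(\mathcal{R}_{d,r})$ is the set-theoretic difference of the closure of $\mathcal{R}_{d,r}$ and the interior of the closure of $\mathcal{R}_{d,r}$ (Euclidean topology). The algebraic boundary $\partial_{\mathrm{alg}}(\mathcal{R}_{d,r})$ is the Zariski closure of (the image of) $\partial(\mathcal{R}_{d,r})$ in the complex projective space $\mathbb{P}(\mathbb{C}[x,y]_d)$. Coincident root loci and duals. For a partition $\lambda=[\lambda_1,\ldots,\lambda_n]$ of $d$ (unordered list of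 positive integers with sum $d$), the coincident root locus $\Delta_\lambda$ is the set of binary forms of degree $d$ over $\mathbb{C}$, up to scalars, that factor as $\prod_{i=1}^n\ell_i^{\lambda_i}$ with $\ell_i$ nonzero linear forms. Here $\Delta_\lambda$ is viewed in $\mathbb{P}(\mathbb{C}[\partial_x,\partial_y]_d)$, and its dual variety $(\Delta_\lambda)^\vee$ is the closure in $\mathbb{P}(\mathbb{C}[x,y]_d)$ of the set of $f$ such that the hyperplane $\{g: g(f)=0\}\subset\mathbb{P}(\mathbb{C}[\partial_x,\partial_y]_d)$ contains the projective tangent space to $\Delta_\lambda$ at some smooth point, where $g(f)\in\mathbb{C}$ is the result of applying the differential operator $g$ to $f$. The union is allowed to be empty (when the boundary is empty). *)

theory Defs
  imports
    "HOL-Analysis.Analysis"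
    "HOL-Computational_Algebra.Polynomial"
    "HOL-Library.Poly_Mapping"
    "HOL-Library.Multiset"
    "HOL-Library.Extended_Nat"
begin

section \<open>Binary forms\<close>

text \<open>
  The ring \<open>K[x,y]\<close> is rendered as \<open>(K[y])[x]\<close>, so that
  \<open>coeff (coeff p i) j\<close> is the coefficient of \<open>x\<^sup>i y\<^sup>j\<close>.
  The same type serves for \<open>K[\<partial>\<^sub>x,\<partial>\<^sub>y]\<close>, with the outer
  variable standing for \<open>\<partial>\<^sub>x\<close> and the inner one for \<open>\<partial>\<^sub>y\<close>.
\<close>

type_synonym 'a bipoly = "'a poly poly"

definition binary_forms :: "nat \<Rightarrow> 'a::zero bipoly set" where
  "binary_forms d = {p. \<forall>i j. coeff (coeff p i) j \<noteq> 0 \<longrightarrow> i + j = d}"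

definition scale :: "'a::comm_semiring_0 \<Rightarrow> 'a bipoly \<Rightarrow> 'a bipoly" where
  "scale c p = smult [:c:] p"

interpretation bipoly: vector_space "scale :: 'a::field \<Rightarrow> 'a bipoly \<Rightarrow> 'a bipoly"
  by unfold_locales (simp_all add: scale_def smult_add_right smult_add_left[symmetric] one_pCons[symmetric] mult.commute)

text \<open>The coordinates of a form of degree \<open>d\<close>: the \<open>i\<close>-th one is the
  coefficient of \<open>x\<^sup>i y\<^sup>(\<^sup>d\<^sup>-\<^sup>i\<^sup>)\<close>, and all those with \<open>i > d\<close> vanish.\<close>

definition coords :: "nat \<Rightarrow> 'a::zero bipoly \<Rightarrow> nat \<Rightarrow> 'a" where
  "coords d p i = coeff (coeff p i) (d - i)"

definition apply_operator :: "'a::idom bipoly \<Rightarrow> 'a bipoly \<Rightarrow> 'a bipoly" where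
  "apply_operator g f =
     (\<Sum>i\<le>degree g. \<Sum>j\<le>degree (coeff g i).
        scale (coeff (coeff g i) j) ((pderiv ^^ i) ((map_poly pderiv ^^ j) f)))"

section \<open>Real rank and its typical regions\<close>

definition real_rank :: "nat \<Rightarrow> real bipoly \<Rightarrow> nat" where
  "real_rank d f =
     (LEAST r. \<exists>\<alpha> l. (\<forall>i<r. l i \<in> binary_forms 1) \<and> f = (\<Sum>i<r. scale (\<alpha> i) (l i ^ d)))"

text \<open>The coordinate map embeds the forms of degree \<open>d\<close> linearly into
  \<open>nat \<Rightarrow> real\<close> with image of dimension \<open>d + 1\<close>, on which the product
  topology of \<open>nat \<Rightarrow> real\<close> restricts to the Euclidean one.\<close>

definition form_topology :: "nat \<Rightarrow> real bipoly topology" where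
  "form_topology d = pullback_topology (binary_forms d) (coords d) euclidean"

definition rank_region :: "nat \<Rightarrow> nat \<Rightarrow> real bipoly set" where
  "rank_region d r = form_topology d interior_of {f \<in> binary_forms d. real_rank d f = r}"

definition rank_boundary :: "nat \<Rightarrow> nat \<Rightarrow> real bipoly set" where
  "rank_boundary d r =
     (form_topology d closure_of rank_region d r) -
     (form_topology d interior_of (form_topology d closure_of rank_region d r))"

section \<open>The complex projective space of binary forms\<close>

text \<open>The points are the classes \<open>proj_point f\<close> of nonzero forms \<open>f\<close>.\<close>

definition proj_point :: "complex bipoly \<Rightarrow> complex bipoly set" where
  "proj_point f = {scale c f | c. c \<noteq> 0}"

text \<open>Polynomials in the variables \<open>X\<^sub>0, X\<^sub>1, \<dots>\<close>: a monomial maps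
  each index to its exponent, a polynomial maps each monomial to its coefficient.\<close>

type_synonym mpolynomial = "(nat \<Rightarrow>\<^sub>0 nat) \<Rightarrow>\<^sub>0 complex"

definition homogeneous_polys :: "nat \<Rightarrow> mpolynomial set" where
  "homogeneous_polys d =
     {F :: mpolynomial. \<exists>k. \<forall>m \<in> Poly_Mapping.keys F.
        Poly_Mapping.keys m \<subseteq> {..d} \<and> (\<Sum>i\<in>Poly_Mapping.keys m. Poly_Mapping.lookup m i) = k}"

definition eval_poly :: "mpolynomial \<Rightarrow> (nat \<Rightarrow> complex) \<Rightarrow> complex" where
  "eval_poly F x =
     (\<Sum>m\<in>Poly_Mapping.keys F.
        Poly_Mapping.lookup F m * (\<Prod>i\<in>Poly_Mapping.keys m. x i ^ Poly_Mapping.lookup m i))"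

definition partial_deriv :: "nat \<Rightarrow> mpolynomial \<Rightarrow> (nat \<Rightarrow> complex) \<Rightarrow> complex" where
  "partial_deriv i F x = deriv (\<lambda>t. eval_poly F (x(i := t))) (x i)"

definition zero_locus :: "nat \<Rightarrow> mpolynomial set \<Rightarrow> complex bipoly set set" where
  "zero_locus d S =
     proj_point ` {f \<in> binary_forms d - {0}. \<forall>F\<in>S. eval_poly F (coords d f) = 0}"

definition vanishing_polys :: "nat \<Rightarrow> complex bipoly set set \<Rightarrow> mpolynomial set" where
  "vanishing_polys d V =
     {F \<in> homogeneous_polys d. \<forall>f. proj_point f \<in> V \<longrightarrow> eval_poly F (coords d f) = 0}"

definition zariski_closed :: "nat \<Rightarrow> complex bipoly set set \<Rightarrow> bool" where
  "zariski_closed d Z \<longleftrightarrow> (\<exists>S \<subseteq> homogeneous_polys d. Z = zero_locus d S)"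

definition zariski_closure :: "nat \<Rightarrow> complex bipoly set set \<Rightarrow> complex bipoly set set" where
  "zariski_closure d A = \<Inter> {Z. zariski_closed d Z \<and> A \<subseteq> Z}"

definition zariski_irreducible :: "nat \<Rightarrow> complex bipoly set set \<Rightarrow> bool" where
  "zariski_irreducible d Z \<longleftrightarrow>
     Z \<noteq> {} \<and>
     (\<forall>Z1 Z2. zariski_closed d Z1 \<longrightarrow> zariski_closed d Z2 \<longrightarrow> Z \<subseteq> Z1 \<union> Z2 \<longrightarrow> Z \<subseteq> Z1 \<or> Z \<subseteq> Z2)"

text \<open>Krull dimension of a closed subset, as a chain length.\<close>

definition zariski_dim :: "nat \<Rightarrow> complex bipoly set set \<Rightarrow> enat" where
  "zariski_dim d V =
     Sup {enat n | n. \<exists>C. (\<forall>i\<le>n. zariski_closed d (C i) \<and> zariski_irreducible d (C i) \<and> C i \<subseteq> V) \<and>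
                          (\<forall>i<n. C i \<subset> C (Suc i))}"

text \<open>The linear subspace of \<open>C[x,y]\<^sub>d\<close> whose projectivization is the
  projective tangent space at the point represented by \<open>g\<close>.\<close>

definition tangent_subspace :: "nat \<Rightarrow> complex bipoly set set \<Rightarrow> complex bipoly \<Rightarrow> complex bipoly set" where
  "tangent_subspace d V g =
     {h \<in> binary_forms d. \<forall>F \<in> vanishing_polys d V.
        (\<Sum>i\<le>d. partial_deriv i F (coords d g) * coords d h i) = 0}"

definition proj_tangent_space ::
    "nat \<Rightarrow> complex bipoly set set \<Rightarrow> complex bipoly \<Rightarrow> complex bipoly set set" where
  "proj_tangent_space d V g = proj_point ` (tangent_subspace d V g - {0})"

text \<open>Jacobian criterion for an irreducible variety \<open>V\<close>, whose local dimension
  is the same at all points: the projective tangent space has dimension \<open>dim V\<close>,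
  and the linear space above it one more.\<close>

definition smooth_point :: "nat \<Rightarrow> complex bipoly set set \<Rightarrow> complex bipoly \<Rightarrow> bool" where
  "smooth_point d V g \<longleftrightarrow>
     proj_point g \<in> V \<and> enat (bipoly.dim (tangent_subspace d V g)) = zariski_dim d V + 1"

section \<open>Algebraic boundaries\<close>

definition complexify :: "real bipoly \<Rightarrow> complex bipoly" where
  "complexify = map_poly (map_poly complex_of_real)"

definition algebraic_boundary :: "nat \<Rightarrow> nat \<Rightarrow> complex bipoly set set" where
  "algebraic_boundary d r =
     zariski_closure d (proj_point ` complexify ` (rank_boundary d r - {0}))"

section \<open>Coincident root loci and dual varieties\<close>

definition partitions :: "nat \<Rightarrow> nat multiset set" where
  "partitions d = {\<mu>. 0 \<notin># \<mu> \<and> sum_mset \<mu> = d}"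

definition coincident_root_locus :: "nat multiset \<Rightarrow> complex bipoly set set" where
  "coincident_root_locus \<mu> =
     {proj_point (\<Prod>i<length ns. l i ^ (ns ! i)) | ns l.
        mset ns = \<mu> \<and> (\<forall>i<length ns. l i \<in> binary_forms 1 - {0})}"

definition hyperplane :: "nat \<Rightarrow> complex bipoly \<Rightarrow> complex bipoly set set" where
  "hyperplane d f = proj_point ` {g \<in> binary_forms d - {0}. apply_operator g f = 0}"

definition dual_variety :: "nat \<Rightarrow> complex bipoly set set \<Rightarrow> complex bipoly set set" where
  "dual_variety d V =
     zariski_closure d
       {proj_point f | f. f \<in> binary_forms d - {0} \<and>
          (\<exists>g. smooth_point d V g \<and> proj_tangent_space d V g \<subseteq> hyperplane d f)}"

end

theory Submission
  imports Defs "HOL-Computational_Algebra.Computational_Algebra"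
begin

text \<open>
  A form \<open>f\<close> of degree \<open>d\<close> is encoded by the sequence \<open>nrm d f\<close> of its coefficients times
  \<open>i! (d - i)!\<close>, and operators by their dehomogenizations. Applying an operator \<open>q\<close> of degree \<open>k\<close>
  then becomes a contraction of sequences, and \<open>kills d k q (nrm d f)\<close> says that \<open>q\<close> annihilates
  \<open>f\<close>. By the apolarity lemma, \<open>f\<close> is a combination of the \<open>d\<close>-th powers of \<open>r\<close> pairwise
  non-proportional real linear forms if and only if it is annihilated by a product of \<open>r\<close> distinct
  real linear forms. So the set of forms of real rank at most \<open>r\<close> lies between \<open>Wdist d r\<close>, where
  the factors are distinct, and its closure \<open>Wbar d r\<close>, where they may coincide.

  Boundary forms are degenerate. Let \<open>f\<close> be annihilated by \<open>q L\<close>, where \<open>L\<close> is the product of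
  \<open>n\<close> distinct real linear forms and \<open>q\<close> contains the repetitions. If the contraction of \<open>f\<close> by
  \<open>q\<close> is transversal, that is, of maximal rank in degree \<open>n\<close>, then an annihilator of the form
  \<open>q L'\<close> can be found for all forms near \<open>f\<close>, with \<open>L'\<close> close to \<open>L\<close> and therefore still a
  product of distinct real linear forms. Forms of rank at most \<open>r\<close> then contain a dense open subset
  of a neighbourhood of \<open>f\<close>. Comparing this for \<open>r\<close> and \<open>r - 1\<close> shows that \<open>f\<close> cannot be in the
  boundary. If transversality fails, then \<open>f\<close> is annihilated by a product \<open>\<Prod> l\<^sub>i ^ (\<nu>\<^sub>i - 1)\<close> with
  \<open>\<nu>\<^sub>i \<ge> 2\<close> and \<open>\<Sum> \<nu>\<^sub>i \<le> d\<close>. This is \<open>boundary_degenerate\<close>.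

  Such annihilators describe dual varieties. At a general point \<open>\<Prod> l\<^sub>i ^ \<lambda>\<^sub>i\<close> of a coincident root
  locus, the tangent space consists of the multiples of \<open>\<Prod> l\<^sub>i ^ (\<lambda>\<^sub>i - 1)\<close>. Hence every form that
  is annihilated by \<open>\<Prod> l\<^sub>i ^ (\<lambda>\<^sub>i - 1)\<close> for general \<open>l\<^sub>i\<close> is in the dual variety
  (\<open>generic_forms_in_dual_variety\<close>), and the forms from which the dual variety is generated are
  annihilated by such a product (\<open>tangent_hyperplane_imp_kills\<close>).

  For the theorem, take all partitions whose dual variety is contained in the algebraic boundary,
  and let \<open>Z\<close> be the union of these dual varieties. Suppose that some boundary form \<open>p\<close> is not in
  \<open>Z\<close>. The degenerate forms are covered by finitely many families that are parametrized by roots and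
  initial values of linear recurrences. A family with \<open>\<Sum> \<nu>\<^sub>i < d\<close> has fewer than \<open>d\<close> parameters.
  A family with \<open>\<Sum> \<nu>\<^sub>i = d\<close> has \<open>d\<close> parameters, but those of its members that are boundary forms
  outside \<open>Z\<close> satisfy an equation: either the dual variety is not contained in the algebraic
  boundary, and then some equation of the latter is not an identity on the family, or it is contained
  in \<open>Z\<close>, and then the roots are not general. In both cases the cone with a vertex \<open>a\<close> over these
  boundary forms satisfies a non-trivial polynomial equation in the \<open>d + 1\<close> coefficients. Choose \<open>a\<close>
  in the region near \<open>p\<close>, and an open set near \<open>p\<close> outside the closure of the region. All segments
  from \<open>a\<close> into this open set meet the boundary, near \<open>p\<close> and so outside \<open>Z\<close>; therefore the open
  set is contained in the union of the cones, which is impossible.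

  All bounds on dimensions come from one fact, that \<open>N + 1\<close> polynomial functions of \<open>N\<close> variables
  are algebraically dependent (\<open>algebraically_dependent\<close>). It also gives the Krull dimension of a
  coincident root locus, which the smoothness of its general points refers to.
\<close>

section \<open>Polynomial functions\<close>

text \<open>Polynomials are handled as functions of a sequence of variables, of which only those in \<open>I\<close>
  may occur, so that substitution is composition.\<close>

inductive_set polyfun :: "nat set \<Rightarrow> ((nat \<Rightarrow> complex) \<Rightarrow> complex) set" for I where
  polyfun_const: "(\<lambda>x. c) \<in> polyfun I"
| polyfun_coord: "i \<in> I \<Longrightarrow> (\<lambda>x. x i) \<in> polyfun I"
| polyfun_add: "f \<in> polyfun I \<Longrightarrow> g \<in> polyfun I \<Longrightarrow> (\<lambda>x. f x + g x) \<in> polyfun I"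
| polyfun_mult: "f \<in> polyfun I \<Longrightarrow> g \<in> polyfun I \<Longrightarrow> (\<lambda>x. f x * g x) \<in> polyfun I"

lemma polyfun_uminus: "f \<in> polyfun I \<Longrightarrow> (\<lambda>x. - f x) \<in> polyfun I"
  using polyfun_mult[OF polyfun_const[of "-1"]] by simp

lemma polyfun_diff: "f \<in> polyfun I \<Longrightarrow> g \<in> polyfun I \<Longrightarrow> (\<lambda>x. f x - g x) \<in> polyfun I"
  using polyfun_add[OF _ polyfun_uminus] by simp

lemma polyfun_sum: "(\<And>i. i \<in> A \<Longrightarrow> f i \<in> polyfun I) \<Longrightarrow> (\<lambda>x. \<Sum>i\<in>A. f i x) \<in> polyfun I"
  by (induction A rule: infinite_finite_induct) (auto intro: polyfun_const polyfun_add)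

lemma polyfun_prod: "(\<And>i. i \<in> A \<Longrightarrow> f i \<in> polyfun I) \<Longrightarrow> (\<lambda>x. \<Prod>i\<in>A. f i x) \<in> polyfun I"
  by (induction A rule: infinite_finite_induct) (auto intro: polyfun_const polyfun_mult)

lemma polyfun_power: "f \<in> polyfun I \<Longrightarrow> (\<lambda>x. f x ^ n) \<in> polyfun I"
  by (induction n) (auto intro: polyfun_const polyfun_mult)

lemmas polyfun_intros = polyfun_const polyfun_coord polyfun_add polyfun_mult polyfun_uminus
  polyfun_diff polyfun_sum polyfun_prod polyfun_power

lemma polyfun_mono:
  assumes "f \<in> polyfun I" "I \<subseteq> J" shows "f \<in> polyfun J"
  using assms by (induction rule: polyfun.induct) (auto intro: polyfun_intros)

lemma polyfun_compose:
  assumes "f \<in> polyfun I" "\<And>i. i \<in> I \<Longrightarrow> g i \<in> polyfun J"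
  shows "(\<lambda>x. f (\<lambda>i. g i x)) \<in> polyfun J"
  using assms by (induction rule: polyfun.induct) (auto intro: polyfun_intros)

lemma polyfun_cong:
  assumes "f \<in> polyfun I" "\<And>i. i \<in> I \<Longrightarrow> x i = y i" shows "f x = f y"
  using assms by (induction rule: polyfun.induct) auto

lemma polyfun_along_line:
  assumes "f \<in> polyfun I"
  shows "\<exists>p. \<forall>t. f (\<lambda>i. a i + t * b i) = poly p t"
  using assms
proof (induction rule: polyfun.induct)
  case (polyfun_const c) show ?case by (rule exI[of _ "[:c:]"]) simp
next
  case (polyfun_coord i) show ?case by (rule exI[of _ "[:a i, b i:]"]) simp
next
  case (polyfun_add f g) then show ?case by (metis poly_add)
next
  case (polyfun_mult f g) then show ?case by (metis poly_mult)
qed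

text \<open>On the line that joins \<open>a\<close> to \<open>b\<close> both factors are nonzero polynomials in one variable.\<close>

lemma polyfun_mult_nonzero:
  assumes "f \<in> polyfun I" "g \<in> polyfun J" "f a \<noteq> 0" "g b \<noteq> 0"
  shows "\<exists>x. f x * g x \<noteq> 0"
proof -
  let ?l = "\<lambda>t i. a i + t * (b i - a i)"
  obtain p where p: "\<And>t. f (?l t) = poly p t" using polyfun_along_line[OF assms(1)] by metis
  obtain q where q: "\<And>t. g (?l t) = poly q t" using polyfun_along_line[OF assms(2)] by metis
  have "poly p 0 \<noteq> 0" using p[of 0] assms(3) by simp
  moreover have "poly q 1 \<noteq> 0" using q[of 1] assms(4) by simp
  ultimately have "p * q \<noteq> 0" by auto
  then have "finite {t. poly (p * q) t = 0}" by (rule poly_roots_finite)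
  then have "{t. poly (p * q) t = 0} \<noteq> UNIV" using infinite_UNIV_char_0[where 'a=complex] by metis
  then obtain t where "poly (p * q) t \<noteq> 0" by blast
  then have "f (?l t) * g (?l t) \<noteq> 0" unfolding p q by simp
  then show ?thesis by blast
qed

lemma polyfun_prod_nonzero:
  assumes "finite A" "\<And>i. i \<in> A \<Longrightarrow> f i \<in> polyfun I" "\<And>i. i \<in> A \<Longrightarrow> \<exists>x. f i x \<noteq> 0"
  shows "\<exists>x. (\<Prod>i\<in>A. f i x) \<noteq> 0"
  using assms
proof (induction A rule: finite_induct)
  case (insert a A)
  then obtain x y where "f a x \<noteq> 0" "(\<Prod>i\<in>A. f i y) \<noteq> 0" by blast
  moreover have "f a \<in> polyfun I" "(\<lambda>x. \<Prod>i\<in>A. f i x) \<in> polyfun I"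
    using insert by (auto intro: polyfun_prod)
  ultimately obtain z where "f a z * (\<Prod>i\<in>A. f i z) \<noteq> 0"
    using polyfun_mult_nonzero[of "f a" I "\<lambda>x. \<Prod>i\<in>A. f i x" I x y] by auto
  then show ?case using insert(1,2) by auto
qed simp

text \<open>The line from the centre of the box to a real point has infinitely many points in the box, and
  the polynomial that \<open>f\<close> induces on it vanishes. A complex point \<open>x\<close> is the point with parameter
  \<open>\<i>\<close> on the line \<open>t \<mapsto> Re x + t Im x\<close>, whose points with real parameter are real.\<close>

lemma polyfun_zero_on_real_box:
  fixes a :: "nat \<Rightarrow> real"
  assumes "f \<in> polyfun I" "finite I" "e > 0"
    and zero: "\<And>y :: nat \<Rightarrow> real. (\<And>i. i \<in> I \<Longrightarrow> \<bar>y i - a i\<bar> < e) \<Longrightarrow> f (\<lambda>i. of_real (y i)) = 0"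
  shows "f x = 0"
proof -
  have real: "f (\<lambda>i. of_real (y i)) = 0" for y :: "nat \<Rightarrow> real"
  proof -
    obtain p where p: "\<And>t. f (\<lambda>i. of_real (a i) + t * of_real (y i - a i)) = poly p t"
      using polyfun_along_line[OF assms(1), of "\<lambda>i. of_real (a i)" "\<lambda>i. of_real (y i - a i)"] by blast
    define M where "M = 1 + (\<Sum>i\<in>I. \<bar>y i - a i\<bar>)"
    have M: "M > 0" "\<And>i. i \<in> I \<Longrightarrow> \<bar>y i - a i\<bar> < M"
    proof -
      show "M > 0" unfolding M_def by (simp add: add_pos_nonneg sum_nonneg)
      fix i assume "i \<in> I"
      then have "\<bar>y i - a i\<bar> \<le> (\<Sum>i\<in>I. \<bar>y i - a i\<bar>)"
        using assms(2) by (intro member_le_sum) auto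
      then show "\<bar>y i - a i\<bar> < M" unfolding M_def by simp
    qed
    have "poly p (of_real t) = 0" if t: "t \<in> {0..e/M}" for t
    proof -
      have "f (\<lambda>i. of_real (a i + t * (y i - a i))) = 0"
      proof (rule zero)
        fix i assume i: "i \<in> I"
        have "\<bar>a i + t * (y i - a i) - a i\<bar> = t * \<bar>y i - a i\<bar>" using t by (simp add: abs_mult)
        also have "\<dots> < e"
        proof (cases "t = 0")
          case False
          then have "t * \<bar>y i - a i\<bar> < t * M" using t M(2)[OF i] by simp
          also have "\<dots> \<le> e" using t M(1) by (simp add: field_simps)
          finally show ?thesis .
        qed (use \<open>e > 0\<close> in simp)
        finally show "\<bar>a i + t * (y i - a i) - a i\<bar> < e" .
      qed
      then show ?thesis using p[of "of_real t"] by simp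
    qed
    then have "of_real ` {0..e/M} \<subseteq> {t. poly p t = 0}" by auto
    moreover have "infinite ((of_real :: real \<Rightarrow> complex) ` {0..e/M})"
      using M(1) \<open>e > 0\<close> by (subst finite_image_iff) (auto simp: inj_on_def infinite_Icc_iff)
    ultimately have "p = 0" using poly_roots_finite finite_subset by blast
    then show ?thesis using p[of 1] by simp
  qed
  obtain p where p: "\<And>t. f (\<lambda>i. of_real (Re (x i)) + t * of_real (Im (x i))) = poly p t"
    using polyfun_along_line[OF assms(1), of "\<lambda>i. of_real (Re (x i))" "\<lambda>i. of_real (Im (x i))"] by blast
  have "poly p (of_real t) = 0" for t
    using real[of "\<lambda>i. Re (x i) + t * Im (x i)"] p[of "of_real t"] by simp
  then have "range of_real \<subseteq> {t. poly p t = 0}" by auto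
  moreover have "infinite (range (of_real :: real \<Rightarrow> complex))"
    using infinite_UNIV_char_0[where 'a=real] by (subst finite_image_iff) (auto simp: inj_on_def)
  ultimately have "p = 0" using poly_roots_finite finite_subset by blast
  then have "f (\<lambda>i. of_real (Re (x i)) + \<i> * of_real (Im (x i))) = 0" using p[of \<i>] by simp
  then show ?thesis by (simp add: complex_eq[symmetric])
qed

lemma polyfun_expand_variable:
  assumes "f \<in> polyfun (insert v I)"
  shows "\<exists>P n. (\<forall>m. (\<lambda>x. coeff (P x) m) \<in> polyfun I) \<and> (\<forall>x. degree (P x) \<le> n) \<and>
               f = (\<lambda>x. poly (P x) (x v))"
  using assms
proof (induction rule: polyfun.induct)
  case (polyfun_const c)
  show ?case by (rule exI[of _ "\<lambda>x. [:c:]"]) (auto simp: coeff_pCons intro!: polyfun_intros split: nat.split)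
next
  case (polyfun_coord i)
  show ?case
  proof (cases "i = v")
    case True
    then show ?thesis
      by (intro exI[of _ "\<lambda>x. [:0, 1:]"] exI[of _ 1])
         (auto simp: coeff_pCons intro!: polyfun_const split: nat.split)
  next
    case False
    then have "i \<in> I" using polyfun_coord by auto
    then have "(\<lambda>x. coeff [:x i:] m) \<in> polyfun I" for m
      by (cases m) (auto intro: polyfun_intros)
    then show ?thesis by (intro exI[of _ "\<lambda>x. [:x i:]"]) auto
  qed
next
  case (polyfun_add f g)
  then obtain P n Q m where "\<And>k. (\<lambda>x. coeff (P x) k) \<in> polyfun I" "\<And>x. degree (P x) \<le> n"
    "f = (\<lambda>x. poly (P x) (x v))" "\<And>k. (\<lambda>x. coeff (Q x) k) \<in> polyfun I" "\<And>x. degree (Q x) \<le> m"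
    "g = (\<lambda>x. poly (Q x) (x v))" by blast
  then show ?case
    by (intro exI[of _ "\<lambda>x. P x + Q x"] exI[of _ "max n m"])
       (auto intro!: polyfun_intros degree_add_le intro: max.coboundedI1 max.coboundedI2)
next
  case (polyfun_mult f g)
  then obtain P n Q m where *: "\<And>k. (\<lambda>x. coeff (P x) k) \<in> polyfun I" "\<And>x. degree (P x) \<le> n"
    "f = (\<lambda>x. poly (P x) (x v))" "\<And>k. (\<lambda>x. coeff (Q x) k) \<in> polyfun I" "\<And>x. degree (Q x) \<le> m"
    "g = (\<lambda>x. poly (Q x) (x v))" by blast
  have "degree (P x * Q x) \<le> n + m" for x
    using degree_mult_le[of "P x" "Q x"] *(2,5)[of x] by linarith
  then show ?case using *
    by (intro exI[of _ "\<lambda>x. P x * Q x"] exI[of _ "n + m"])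
       (auto simp: coeff_mult intro!: polyfun_sum intro: polyfun_intros)
qed

section \<open>Algebraic dependence\<close>

text \<open>One equation and one unknown are eliminated at a time.\<close>

lemma homogeneous_system_nontrivial_solution:
  fixes M :: "'a \<Rightarrow> 'b \<Rightarrow> 'c::field"
  assumes "finite B" "finite A" "card B < card A"
  shows "\<exists>c. (\<exists>a\<in>A. c a \<noteq> 0) \<and> (\<forall>b\<in>B. (\<Sum>a\<in>A. c a * M a b) = 0)"
  using assms
proof (induction B arbitrary: A M rule: finite_induct)
  case empty
  then obtain a where "a \<in> A" by fastforce
  then show ?case by (intro exI[of _ "\<lambda>_. 1"]) auto
next
  case (insert b B)
  show ?case
  proof (cases "\<forall>a\<in>A. M a b = 0")
    case True
    then show ?thesis using insert.IH[OF insert.prems(1), of M] insert by auto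
  next
    case False
    then obtain a0 where a0: "a0 \<in> A" "M a0 b \<noteq> 0" by blast
    have "card B < card (A - {a0})" using insert a0 by simp
    then obtain c where c: "\<exists>a\<in>A - {a0}. c a \<noteq> 0"
      "\<And>b'. b' \<in> B \<Longrightarrow> (\<Sum>a\<in>A - {a0}. c a * (M a b' - M a b / M a0 b * M a0 b')) = 0"
      using insert.IH[of "A - {a0}" "\<lambda>a b'. M a b' - M a b / M a0 b * M a0 b'"] insert.prems by blast
    define s where "s = - (\<Sum>a\<in>A - {a0}. c a * M a b) / M a0 b"
    define c' where "c' = c(a0 := s)"
    have split: "(\<Sum>a\<in>A. c' a * M a b') = s * M a0 b' + (\<Sum>a\<in>A - {a0}. c a * M a b')" for b'
      unfolding c'_def using a0 insert.prems(1)
      by (subst sum.remove[of _ a0]) (auto intro!: sum.cong)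
    have "(\<Sum>a\<in>A. c' a * M a b) = 0" unfolding split s_def using a0 by simp
    moreover have "(\<Sum>a\<in>A. c' a * M a b') = 0" if "b' \<in> B" for b'
    proof -
      have "s * M a0 b' = - (\<Sum>a\<in>A - {a0}. c a * (M a b / M a0 b * M a0 b'))"
        unfolding s_def by (simp add: sum_distrib_right sum_divide_distrib mult.assoc)
      then show ?thesis unfolding split using c(2)[OF that]
        by (simp add: right_diff_distrib sum_subtractf)
    qed
    moreover have "\<exists>a\<in>A. c' a \<noteq> 0" using c(1) unfolding c'_def by auto
    ultimately show ?thesis by blast
  qed
qed

text \<open>The exponents are bounded separately in each variable, which makes the number of monomials a power.\<close>

definition monomial_span :: "nat set \<Rightarrow> nat \<Rightarrow> ((nat \<Rightarrow> complex) \<Rightarrow> complex) set" where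
  "monomial_span I M = {f. \<exists>c. f = (\<lambda>x. \<Sum>\<alpha>\<in>PiE I (\<lambda>_. {..M}). c \<alpha> * (\<Prod>i\<in>I. x i ^ \<alpha> i))}"

lemma monomial_span_sum:
  assumes "\<And>j. j \<in> A \<Longrightarrow> f j \<in> monomial_span I M"
  shows "(\<lambda>x. \<Sum>j\<in>A. f j x) \<in> monomial_span I M"
proof -
  have "\<forall>j\<in>A. \<exists>c. f j = (\<lambda>x. \<Sum>\<alpha>\<in>PiE I (\<lambda>_. {..M}). c \<alpha> * (\<Prod>i\<in>I. x i ^ \<alpha> i))"
    using assms unfolding monomial_span_def by blast
  from bchoice[OF this] obtain c
    where c: "\<And>j. j \<in> A \<Longrightarrow> f j = (\<lambda>x. \<Sum>\<alpha>\<in>PiE I (\<lambda>_. {..M}). c j \<alpha> * (\<Prod>i\<in>I. x i ^ \<alpha> i))"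
    by blast
  show ?thesis unfolding monomial_span_def mem_Collect_eq
    by (intro exI[of _ "\<lambda>\<alpha>. \<Sum>j\<in>A. c j \<alpha>"])
       (auto simp: c sum_distrib_right intro: sum.swap)
qed

lemma monomial_span_monomial:
  assumes "finite I" "\<And>i. i \<in> I \<Longrightarrow> \<alpha> i \<le> M"
  shows "(\<lambda>x. c * (\<Prod>i\<in>I. x i ^ \<alpha> i)) \<in> monomial_span I M"
proof -
  let ?a = "restrict \<alpha> I"
  have mem: "?a \<in> PiE I (\<lambda>_. {..M})" using assms by auto
  have "(\<Sum>\<beta>\<in>PiE I (\<lambda>_. {..M}). (if \<beta> = ?a then c else 0) * (\<Prod>i\<in>I. x i ^ \<beta> i)) =
     (\<Sum>\<beta>\<in>PiE I (\<lambda>_. {..M}). (if \<beta> = ?a then c * (\<Prod>i\<in>I. x i ^ \<alpha> i) else 0))" for x :: "nat \<Rightarrow> complex"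
    by (intro sum.cong) auto
  also have "\<dots> x = c * (\<Prod>i\<in>I. x i ^ \<alpha> i)" for x
    using mem assms(1) by (subst sum.delta) (auto intro: finite_PiE)
  finally show ?thesis unfolding monomial_span_def mem_Collect_eq
    by (intro exI[of _ "\<lambda>\<beta>. if \<beta> = ?a then c else 0"]) auto
qed

lemma monomial_span_mono:
  assumes "finite I" "f \<in> monomial_span I M" "M \<le> N" shows "f \<in> monomial_span I N"
proof -
  from assms(2) obtain c where c: "f = (\<lambda>x. \<Sum>\<alpha>\<in>PiE I (\<lambda>_. {..M}). c \<alpha> * (\<Prod>i\<in>I. x i ^ \<alpha> i))"
    unfolding monomial_span_def by blast
  show ?thesis unfolding c using assms
    by (intro monomial_span_sum monomial_span_monomial) (auto dest!: PiE_mem)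
qed

lemma monomial_span_mult:
  assumes "finite I" "f \<in> monomial_span I M" "g \<in> monomial_span I N"
  shows "(\<lambda>x. f x * g x) \<in> monomial_span I (M + N)"
proof -
  from assms(2) obtain c where c: "f = (\<lambda>x. \<Sum>\<alpha>\<in>PiE I (\<lambda>_. {..M}). c \<alpha> * (\<Prod>i\<in>I. x i ^ \<alpha> i))"
    unfolding monomial_span_def by blast
  from assms(3) obtain e where e: "g = (\<lambda>x. \<Sum>\<alpha>\<in>PiE I (\<lambda>_. {..N}). e \<alpha> * (\<Prod>i\<in>I. x i ^ \<alpha> i))"
    unfolding monomial_span_def by blast
  have "(\<lambda>x. f x * g x) = (\<lambda>x. \<Sum>\<alpha>\<in>PiE I (\<lambda>_. {..M}). \<Sum>\<beta>\<in>PiE I (\<lambda>_. {..N}).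
          (c \<alpha> * e \<beta>) * (\<Prod>i\<in>I. x i ^ (\<alpha> i + \<beta> i)))"
    unfolding c e by (simp add: sum_product power_add prod.distrib mult_ac)
  also have "\<dots> \<in> monomial_span I (M + N)"
    using assms(1) by (intro monomial_span_sum monomial_span_monomial) (auto intro!: add_mono dest!: PiE_mem)
  finally show ?thesis .
qed

lemma polyfun_in_monomial_span:
  assumes "f \<in> polyfun I" "finite I"
  shows "\<exists>M. f \<in> monomial_span I M"
  using assms(1)
proof (induction rule: polyfun.induct)
  case (polyfun_const c)
  show ?case using monomial_span_monomial[OF assms(2), of "\<lambda>_. 0" 0 c] by auto
next
  case (polyfun_coord i)
  have "(\<Prod>j\<in>I. x j ^ (if j = i then 1 else 0)) = x i" for x :: "nat \<Rightarrow> complex"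
    using polyfun_coord assms(2) by (subst prod.remove[of _ i]) auto
  then show ?case using monomial_span_monomial[OF assms(2), of "\<lambda>j. if j = i then 1 else 0" 1 1]
    by (intro exI[of _ 1]) auto
next
  case (polyfun_add f g)
  then obtain M N where "f \<in> monomial_span I M" "g \<in> monomial_span I N" by blast
  then have "f \<in> monomial_span I (max M N)" "g \<in> monomial_span I (max M N)"
    using monomial_span_mono[OF assms(2)] by (metis max.cobounded1 max.cobounded2)+
  then show ?case
    using monomial_span_sum[of "{0,1}" "\<lambda>j::nat. if j = 0 then f else g" I "max M N"]
    by (intro exI[of _ "max M N"]) simp
next
  case (polyfun_mult f g) then show ?case using monomial_span_mult[OF assms(2)] by blast
qed

text \<open>Induction on the number of variables: for fixed values of the other variables the sum is a
  polynomial in \<open>x v\<close> without nonzero coefficients.\<close>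

lemma monomials_linearly_independent:
  fixes c :: "(nat \<Rightarrow> nat) \<Rightarrow> complex"
  assumes "finite I" "\<And>x. (\<Sum>\<alpha>\<in>PiE I (\<lambda>_. {..M}). c \<alpha> * (\<Prod>i\<in>I. x i ^ \<alpha> i)) = 0"
    "\<alpha> \<in> PiE I (\<lambda>_. {..M})"
  shows "c \<alpha> = 0"
  using assms
proof (induction I arbitrary: c \<alpha> rule: finite_induct)
  case (insert v I)
  let ?Q = "\<lambda>m x. \<Sum>\<beta>\<in>PiE I (\<lambda>_. {..M}). c (\<beta>(v := m)) * (\<Prod>i\<in>I. x i ^ \<beta> i)"
  have inj: "inj_on (\<lambda>(y, g). g(v := y)) ({..M} \<times> PiE I (\<lambda>_. {..M}))"
    using inj_combinator[OF insert(2), of "\<lambda>_. {..M}"] by simp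
  have expand: "(\<Sum>m\<le>M. ?Q m x * x v ^ m) = 0" for x
  proof -
    have "0 = (\<Sum>\<alpha>\<in>(\<lambda>(y, g). g(v := y)) ` ({..M} \<times> PiE I (\<lambda>_. {..M})). c \<alpha> * (\<Prod>i\<in>insert v I. x i ^ \<alpha> i))"
      using insert.prems(1)[of x] unfolding PiE_insert_eq by simp
    also have "\<dots> = (\<Sum>(m, \<beta>)\<in>{..M} \<times> PiE I (\<lambda>_. {..M}).
        c (\<beta>(v := m)) * (\<Prod>i\<in>insert v I. x i ^ (\<beta>(v := m)) i))"
      unfolding sum.reindex[OF inj] by (simp add: case_prod_beta o_def)
    also have "\<dots> = (\<Sum>(m, \<beta>)\<in>{..M} \<times> PiE I (\<lambda>_. {..M}).
        c (\<beta>(v := m)) * (\<Prod>i\<in>I. x i ^ \<beta> i) * x v ^ m)"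
    proof (intro sum.cong refl, clarify)
      fix m \<beta>
      have "(\<Prod>i\<in>I. x i ^ (\<beta>(v := m)) i) = (\<Prod>i\<in>I. x i ^ \<beta> i)"
        using insert(2) by (intro prod.cong) auto
      then show "c (\<beta>(v := m)) * (\<Prod>i\<in>insert v I. x i ^ (\<beta>(v := m)) i) =
         c (\<beta>(v := m)) * (\<Prod>i\<in>I. x i ^ \<beta> i) * x v ^ m"
        using insert(1,2) by simp
    qed
    also have "\<dots> = (\<Sum>m\<le>M. ?Q m x * x v ^ m)"
      by (simp add: sum.cartesian_product[symmetric] sum_distrib_right)
    finally show ?thesis by simp
  qed
  have zero: "?Q m x = 0" if "m \<le> M" for m x
  proof -
    have "?Q m (x(v := t)) = ?Q m x" for m t
      using insert(2) by (intro sum.cong refl arg_cong2[of _ _ _ _ "(*)"] prod.cong) auto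
    then have "(\<Sum>m\<le>M. ?Q m x * t ^ m) = 0" for t using expand[of "x(v := t)"] by simp
    then show ?thesis using polyfun_eq_coeffs[of "\<lambda>m. ?Q m x" M "\<lambda>_. 0"] that by simp
  qed
  have "\<alpha> v \<le> M" "restrict \<alpha> I \<in> PiE I (\<lambda>_. {..M})" using insert.prems(2) by auto
  then have "c ((restrict \<alpha> I)(v := \<alpha> v)) = 0"
    using insert.IH[of "\<lambda>\<beta>. c (\<beta>(v := \<alpha> v))" "restrict \<alpha> I"] zero by blast
  moreover have "(restrict \<alpha> I)(v := \<alpha> v) = \<alpha>"
    using insert.prems(2) by (auto simp: fun_eq_iff PiE_def extensional_def)
  ultimately show ?case by simp
qed auto

text \<open>There are \<open>(k + 1) ^ (N + 1)\<close> monomials in the \<open>g j\<close> with exponents at most \<open>k\<close>, and all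
  of them are combinations of \<open>(M k (N + 1) + 1) ^ N\<close> monomials in the variables. The choice
  \<open>k = (M (N + 1) + 1) ^ N\<close> makes the first number the larger one.\<close>

lemma algebraically_dependent:
  assumes "finite W" "card W = N" "\<And>j. j \<le> N \<Longrightarrow> g j \<in> polyfun W"
  shows "\<exists>P \<in> polyfun {..N}. (\<exists>X. P X \<noteq> 0) \<and> (\<forall>x. P (\<lambda>j. g j x) = 0)"
proof -
  have "\<forall>j\<in>{..N}. \<exists>M. g j \<in> monomial_span W M"
    using polyfun_in_monomial_span assms by auto
  then obtain M0 where M0: "\<And>j. j \<le> N \<Longrightarrow> g j \<in> monomial_span W (M0 j)" by (metis atMost_iff)
  define M where "M = Max (M0 ` {..N})"
  have M: "g j \<in> monomial_span W M" if "j \<le> N" for j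
    using monomial_span_mono[OF assms(1) M0[OF that]] that unfolding M_def by simp
  define k where "k = (M * (N + 1) + 1) ^ N"
  define A where "A = PiE {..N} (\<lambda>_. {..k})"
  define B where "B = PiE W (\<lambda>_. {..M * k * (N + 1)})"
  have pw: "(\<lambda>x. g j x ^ e) \<in> monomial_span W (M * e)" if "j \<le> N" for j e
  proof (induction e)
    case 0
    then show ?case using monomial_span_monomial[OF assms(1), of "\<lambda>_. 0" 0 1] by simp
  next
    case (Suc e)
    then show ?case using monomial_span_mult[OF assms(1) M[OF that] Suc] by (simp add: mult_ac)
  qed
  have pr: "(\<lambda>x. \<Prod>j\<in>J. g j x ^ \<beta> j) \<in> monomial_span W (M * k * card J)"
    if "finite J" "J \<subseteq> {..N}" "\<And>j. j \<in> J \<Longrightarrow> \<beta> j \<le> k" for J \<beta>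
    using that
  proof (induction J rule: finite_induct)
    case empty
    then show ?case using monomial_span_monomial[OF assms(1), of "\<lambda>_. 0" 0 1] by simp
  next
    case (insert j J)
    have "(\<lambda>x. g j x ^ \<beta> j) \<in> monomial_span W (M * k)"
      using insert.prems by (intro monomial_span_mono[OF assms(1) pw]) auto
    then show ?case using monomial_span_mult[OF assms(1), of _ "M * k" _ "M * k * card J"] insert
      by (auto simp: algebra_simps)
  qed
  have "\<forall>\<beta>\<in>A. \<exists>c. (\<lambda>x. \<Prod>j\<le>N. g j x ^ \<beta> j) = (\<lambda>x. \<Sum>\<alpha>\<in>B. c \<alpha> * (\<Prod>i\<in>W. x i ^ \<alpha> i))"
  proof
    fix \<beta> assume "\<beta> \<in> A"
    then show "\<exists>c. (\<lambda>x. \<Prod>j\<le>N. g j x ^ \<beta> j) = (\<lambda>x. \<Sum>\<alpha>\<in>B. c \<alpha> * (\<Prod>i\<in>W. x i ^ \<alpha> i))"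
      using pr[of "{..N}" \<beta>] unfolding A_def B_def monomial_span_def by (auto dest: PiE_mem)
  qed
  from bchoice[OF this] obtain c where
    "\<forall>\<beta>\<in>A. (\<lambda>x. \<Prod>j\<le>N. g j x ^ \<beta> j) = (\<lambda>x. \<Sum>\<alpha>\<in>B. c \<beta> \<alpha> * (\<Prod>i\<in>W. x i ^ \<alpha> i))" by blast
  then have c: "(\<Prod>j\<le>N. g j x ^ \<beta> j) = (\<Sum>\<alpha>\<in>B. c \<beta> \<alpha> * (\<Prod>i\<in>W. x i ^ \<alpha> i))" if "\<beta> \<in> A" for \<beta> x
    using that by (auto dest: fun_cong)
  have fin: "finite A" "finite B" unfolding A_def B_def using assms(1) by (auto intro: finite_PiE)
  have "card B = (M * k * (N + 1) + 1) ^ N"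
    unfolding B_def using assms by (simp add: card_PiE)
  also have "\<dots> \<le> ((M * (N + 1) + 1) * (k + 1)) ^ N"
    by (intro power_mono) (auto simp: algebra_simps)
  also have "\<dots> = k * (k + 1) ^ N" by (simp only: power_mult_distrib k_def[symmetric])
  also have "\<dots> < (k + 1) ^ (N + 1)" by simp
  also have "\<dots> = card A" unfolding A_def by (simp add: card_PiE)
  finally have card: "card B < card A" .
  obtain a where a: "\<exists>\<beta>\<in>A. a \<beta> \<noteq> 0" "\<And>\<alpha>. \<alpha> \<in> B \<Longrightarrow> (\<Sum>\<beta>\<in>A. a \<beta> * c \<beta> \<alpha>) = 0"
    using homogeneous_system_nontrivial_solution[OF fin(2,1) card, of c] by blast
  define P where "P = (\<lambda>X :: nat \<Rightarrow> complex. \<Sum>\<beta>\<in>A. a \<beta> * (\<Prod>j\<le>N. X j ^ \<beta> j))"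
  have "P \<in> polyfun {..N}" unfolding P_def by (auto intro!: polyfun_intros)
  moreover have "\<exists>X. P X \<noteq> 0"
    using monomials_linearly_independent[of "{..N}" a k] a(1) unfolding P_def A_def by auto
  moreover have "P (\<lambda>j. g j x) = 0" for x
  proof -
    have "P (\<lambda>j. g j x) = (\<Sum>\<beta>\<in>A. \<Sum>\<alpha>\<in>B. a \<beta> * c \<beta> \<alpha> * (\<Prod>i\<in>W. x i ^ \<alpha> i))"
      unfolding P_def by (simp add: c sum_distrib_left mult.assoc)
    also have "\<dots> = (\<Sum>\<alpha>\<in>B. (\<Sum>\<beta>\<in>A. a \<beta> * c \<beta> \<alpha>) * (\<Prod>i\<in>W. x i ^ \<alpha> i))"
      by (subst sum.swap) (simp add: sum_distrib_right)
    finally show ?thesis using a(2) by simp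
  qed
  ultimately show ?thesis by blast
qed

text \<open>The image of the hypersurface \<open>G = 0\<close> under \<open>D\<close> functions of \<open>D\<close> variables is not dense. A
  relation between the \<open>g j\<close> and \<open>G\<close> is expanded in powers of \<open>G\<close> and divided by the highest
  possible power; what remains at \<open>G = 0\<close> is the lowest coefficient, a nonzero polynomial in the
  \<open>g j\<close>.\<close>

lemma algebraically_dependent_modulo:
  assumes "finite W" "card W \<le> D" "\<And>j. j < D \<Longrightarrow> g j \<in> polyfun W" "G \<in> polyfun W" "G a \<noteq> 0"
  shows "\<exists>H \<in> polyfun {..<D}. (\<exists>X. H X \<noteq> 0) \<and> (\<forall>x. G x = 0 \<longrightarrow> H (\<lambda>j. g j x) = 0)"
proof -
  obtain W' where W': "finite W'" "card W' = D" "W \<subseteq> W'"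
  proof -
    have "infinite (UNIV - W)" using assms(1) by (simp add: Diff_infinite_finite)
    then obtain T where "T \<subseteq> UNIV - W" "finite T" "card T = D - card W"
      using infinite_arbitrarily_large by metis
    then have "card (W \<union> T) = D" using assms(1,2) card_Un_disjoint[of W T] by fastforce
    then show ?thesis using that[of "W \<union> T"] \<open>finite T\<close> assms(1) by simp
  qed
  define h where "h j = (if j = D then G else g j)" for j
  have "h j \<in> polyfun W'" if "j \<le> D" for j
    unfolding h_def using assms that by (auto intro: polyfun_mono[OF _ W'(3)])
  then obtain P where P: "P \<in> polyfun {..D}" "\<exists>X. P X \<noteq> 0" "\<And>x. P (\<lambda>j. h j x) = 0"
    using algebraically_dependent[OF W'(1,2), of h] by blast
  have "{..D} = insert D {..<D}" by auto
  then obtain Q n where Q: "\<And>m. (\<lambda>X. coeff (Q X) m) \<in> polyfun {..<D}" "\<And>X. degree (Q X) \<le> n"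
      "P = (\<lambda>X. poly (Q X) (X D))"
    using polyfun_expand_variable[of P D "{..<D}"] P(1) by auto
  have ex: "\<exists>m. \<exists>X. coeff (Q X) m \<noteq> 0"
  proof (rule ccontr)
    assume "\<not> ?thesis"
    then have "Q X = 0" for X by (auto simp: poly_eq_iff)
    then show False using P(2) Q(3) by simp
  qed
  define m where "m = (LEAST m. \<exists>X. coeff (Q X) m \<noteq> 0)"
  have m: "\<exists>X. coeff (Q X) m \<noteq> 0" unfolding m_def using ex by (rule LeastI_ex)
  have below: "coeff (Q X) l = 0" if "l < m" for l X
    using not_less_Least[of l "\<lambda>m. \<exists>X. coeff (Q X) m \<noteq> 0"] that unfolding m_def by auto
  define R where "R = (\<lambda>x. \<Sum>l\<le>n. coeff (Q (\<lambda>j. g j x)) (l + m) * G x ^ l)"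
  have QG: "Q (\<lambda>j. h j x) = Q (\<lambda>j. g j x)" for x
  proof -
    have "coeff (Q (\<lambda>j. h j x)) k = coeff (Q (\<lambda>j. g j x)) k" for k
      by (rule polyfun_cong[OF Q(1)]) (auto simp: h_def)
    then show ?thesis by (simp add: poly_eq_iff)
  qed
  have GR: "G x ^ m * R x = 0" for x
  proof -
    let ?c = "\<lambda>l. coeff (Q (\<lambda>j. g j x)) l"
    have "0 = poly (Q (\<lambda>j. g j x)) (G x)" using P(3)[of x] unfolding Q(3) QG by (simp add: h_def)
    also have "\<dots> = (\<Sum>l\<le>n + m. ?c l * G x ^ l)"
      using Q(2)[of "\<lambda>j. g j x"] by (intro poly_altdef[THEN trans] sum.mono_neutral_left)
        (auto simp: coeff_eq_0 not_le)
    also have "\<dots> = (\<Sum>l\<in>{m..n + m}. ?c l * G x ^ l)"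
      by (intro sum.mono_neutral_right) (auto simp: below not_le)
    also have "\<dots> = (\<Sum>l\<le>n. ?c (l + m) * G x ^ (l + m))"
      by (rule sum.reindex_bij_witness[of _ "\<lambda>l. l + m" "\<lambda>l. l - m"]) auto
    also have "\<dots> = G x ^ m * R x" unfolding R_def by (simp add: sum_distrib_left power_add mult_ac)
    finally show ?thesis by simp
  qed
  have gW: "(\<lambda>x. coeff (Q (\<lambda>j. g j x)) l) \<in> polyfun W" for l
    using polyfun_compose[OF Q(1), of g W l] assms(3) by auto
  have "R \<in> polyfun W" unfolding R_def using gW assms(4) by (auto intro!: polyfun_intros)
  then have R0: "R x = 0" for x
    using polyfun_mult_nonzero[of "\<lambda>x. G x ^ m" W R W a x] polyfun_power[OF assms(4), of m] GR assms(5)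
    by auto
  have "coeff (Q (\<lambda>j. g j x)) m = 0" if "G x = 0" for x
  proof -
    have "R x = (\<Sum>l\<le>n. if l = 0 then coeff (Q (\<lambda>j. g j x)) m else 0)"
      unfolding R_def using that by (intro sum.cong) auto
    then show ?thesis using R0[of x] by simp
  qed
  then show ?thesis using Q(1)[of m] m by (intro bexI[of _ "\<lambda>X. coeff (Q X) m"]) auto
qed

section \<open>Homogeneous polynomial functions\<close>

inductive hpoly :: "nat set \<Rightarrow> nat \<Rightarrow> ((nat \<Rightarrow> complex) \<Rightarrow> complex) \<Rightarrow> bool" for I where
  hpoly_const: "hpoly I 0 (\<lambda>x. c)"
| hpoly_zero: "hpoly I k (\<lambda>x. 0)"
| hpoly_coord: "i \<in> I \<Longrightarrow> hpoly I (Suc 0) (\<lambda>x. x i)"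
| hpoly_add: "hpoly I k f \<Longrightarrow> hpoly I k g \<Longrightarrow> hpoly I k (\<lambda>x. f x + g x)"
| hpoly_mult: "hpoly I k f \<Longrightarrow> hpoly I l g \<Longrightarrow> hpoly I (k + l) (\<lambda>x. f x * g x)"

lemma hpoly_cmult: "hpoly I k f \<Longrightarrow> hpoly I k (\<lambda>x. c * f x)"
  using hpoly_mult[OF hpoly_const, of I k f c] by simp

lemma hpoly_sum: "(\<And>i. i \<in> A \<Longrightarrow> hpoly I k (f i)) \<Longrightarrow> hpoly I k (\<lambda>x. \<Sum>i\<in>A. f i x)"
  by (induction A rule: infinite_finite_induct) (auto intro: hpoly_zero hpoly_add)

lemma hpoly_prod:
  "(\<And>i. i \<in> A \<Longrightarrow> hpoly I (k i) (f i)) \<Longrightarrow> hpoly I (\<Sum>i\<in>A. k i) (\<lambda>x. \<Prod>i\<in>A. f i x)"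
  by (induction A rule: infinite_finite_induct) (auto intro: hpoly_const hpoly_mult)

lemma hpoly_power: "hpoly I k f \<Longrightarrow> hpoly I (n * k) (\<lambda>x. f x ^ n)"
  by (induction n) (auto intro: hpoly_const hpoly_mult)

lemma hpoly_coord_power: "i \<in> I \<Longrightarrow> hpoly I n (\<lambda>x. x i ^ n)"
  using hpoly_power[OF hpoly_coord, of i I n] by simp

lemma hpoly_mono: "hpoly I k f \<Longrightarrow> I \<subseteq> J \<Longrightarrow> hpoly J k f"
  by (induction rule: hpoly.induct) (auto intro: hpoly.intros)

lemma hpoly_imp_polyfun: "hpoly I k f \<Longrightarrow> f \<in> polyfun I"
  by (induction rule: hpoly.induct) (auto intro: polyfun_intros)

lemma hpoly_scale: "hpoly I k f \<Longrightarrow> f (\<lambda>i. t * x i) = t ^ k * f x"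
  by (induction rule: hpoly.induct) (auto simp: power_add algebra_simps)

lemma hpoly_set_variable_zero: "hpoly (insert v I) k f \<Longrightarrow> hpoly I k (\<lambda>x. f (x(v := 0)))"
proof (induction rule: hpoly.induct)
  case (hpoly_coord i)
  then show ?case by (cases "i = v") (auto intro: hpoly.intros)
qed (auto intro: hpoly.intros)

text \<open>The components are the coefficients of the polynomial \<open>s \<mapsto> f (s x)\<close>, which is constructed along
  with \<open>f\<close>.\<close>

lemma polyfun_decompose:
  assumes "f \<in> polyfun I"
  shows "\<exists>h n. (\<forall>k. hpoly I k (h k)) \<and> f = (\<lambda>x. \<Sum>k\<le>n. h k x)"
proof -
  have "\<exists>P n. (\<forall>k. hpoly I k (\<lambda>x. coeff (P x) k)) \<and> (\<forall>x. degree (P x) \<le> n) \<and> f = (\<lambda>x. poly (P x) 1)"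
    using assms
  proof (induction rule: polyfun.induct)
    case (polyfun_const c)
    have "hpoly I k (\<lambda>x. coeff [:c:] k)" for k
      by (cases k) (auto intro: hpoly.intros)
    then show ?case by (intro exI[of _ "\<lambda>x. [:c:]"]) auto
  next
    case (polyfun_coord i)
    have "hpoly I k (\<lambda>x. coeff [:0, x i:] k)" for k
    proof -
      consider "k = 0" | "k = Suc 0" | l where "k = Suc (Suc l)" by (metis not0_implies_Suc)
      then show ?thesis using polyfun_coord by cases (auto intro: hpoly.intros)
    qed
    then show ?case by (intro exI[of _ "\<lambda>x. [:0, x i:]"] exI[of _ 1]) auto
  next
    case (polyfun_add f g)
    then obtain P n Q m where "\<And>k. hpoly I k (\<lambda>x. coeff (P x) k)" "\<And>x. degree (P x) \<le> n"
      "f = (\<lambda>x. poly (P x) 1)" "\<And>k. hpoly I k (\<lambda>x. coeff (Q x) k)" "\<And>x. degree (Q x) \<le> m"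
      "g = (\<lambda>x. poly (Q x) 1)" by blast
    then show ?case
      by (intro exI[of _ "\<lambda>x. P x + Q x"] exI[of _ "max n m"])
         (auto intro!: hpoly.intros degree_add_le intro: max.coboundedI1 max.coboundedI2)
  next
    case (polyfun_mult f g)
    then obtain P n Q m where *: "\<And>k. hpoly I k (\<lambda>x. coeff (P x) k)" "\<And>x. degree (P x) \<le> n"
      "f = (\<lambda>x. poly (P x) 1)" "\<And>k. hpoly I k (\<lambda>x. coeff (Q x) k)" "\<And>x. degree (Q x) \<le> m"
      "g = (\<lambda>x. poly (Q x) 1)" by blast
    have "degree (P x * Q x) \<le> n + m" for x
      using degree_mult_le[of "P x" "Q x"] *(2,5)[of x] by linarith
    moreover have "hpoly I k (\<lambda>x. coeff (P x * Q x) k)" for k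
      unfolding coeff_mult
    proof (rule hpoly_sum)
      fix i assume "i \<in> {..k}"
      then show "hpoly I k (\<lambda>x. coeff (P x) i * coeff (Q x) (k - i))"
        using hpoly_mult[OF *(1)[of i] *(4)[of "k - i"]] by simp
    qed
    ultimately show ?case using *
      by (intro exI[of _ "\<lambda>x. P x * Q x"] exI[of _ "n + m"]) auto
  qed
  then obtain P n where P: "\<And>k. hpoly I k (\<lambda>x. coeff (P x) k)" "\<And>x. degree (P x) \<le> n"
     "f = (\<lambda>x. poly (P x) 1)" by blast
  have "f = (\<lambda>x. \<Sum>k\<le>n. coeff (P x) k)"
  proof
    fix x
    show "f x = (\<Sum>k\<le>n. coeff (P x) k)"
      using P(2)[of x] unfolding P(3) poly_altdef
      by (auto intro!: sum.mono_neutral_left coeff_eq_0)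
  qed
  then show ?thesis using P(1) by (intro exI[of _ "\<lambda>k x. coeff (P x) k"] exI[of _ n]) simp
qed

text \<open>Along the line through a point of the cone, the sum of the components is a polynomial in the
  scaling factor with infinitely many zeros.\<close>

lemma hpoly_components_vanish_on_cone:
  assumes "\<And>k. hpoly I k (h k)" "\<And>x t. x \<in> S \<Longrightarrow> t \<noteq> 0 \<Longrightarrow> (\<lambda>i. t * x i) \<in> S"
    "\<And>x. x \<in> S \<Longrightarrow> (\<Sum>k\<le>n. h k x) = 0" "x \<in> S" "k \<le> n"
  shows "h k x = 0"
proof -
  define p where "p = (\<Sum>k\<le>n. monom (h k x) k)"
  have "poly p t = 0" if "t \<noteq> 0" for t
    using assms(3)[OF assms(2)[OF assms(4) that]]
    by (simp add: p_def poly_sum poly_monom hpoly_scale[OF assms(1)] mult.commute)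
  then have "UNIV - {0} \<subseteq> {t. poly p t = 0}" by auto
  moreover have "infinite (UNIV - {0 :: complex})" using infinite_UNIV_char_0 by simp
  ultimately have "p = 0" using poly_roots_finite finite_subset by blast
  then have "coeff p k = 0" by simp
  then show ?thesis using assms(5) by (simp add: p_def coeff_sum)
qed

lemma polyfun_nonvanishing_hpoly:
  assumes "f \<in> polyfun I" "\<And>x t. x \<in> S \<Longrightarrow> t \<noteq> 0 \<Longrightarrow> (\<lambda>i. t * x i) \<in> S"
    "\<And>x. x \<in> S \<Longrightarrow> f x = 0" "f z \<noteq> 0"
  shows "\<exists>k h. hpoly I k h \<and> (\<forall>x\<in>S. h x = 0) \<and> h z \<noteq> 0"
proof -
  obtain h n where h: "\<And>k. hpoly I k (h k)" "f = (\<lambda>x. \<Sum>k\<le>n. h k x)"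
    using polyfun_decompose[OF assms(1)] by blast
  have van: "h k x = 0" if "k \<le> n" "x \<in> S" for k x
    by (rule hpoly_components_vanish_on_cone[where h = h and n = n and S = S])
       (use assms(2,3) h that in auto)
  obtain k where "k \<le> n" "h k z \<noteq> 0"
    using assms(4) h(2) by (metis (no_types, lifting) atMost_iff sum.neutral)
  then show ?thesis using h(1) van by blast
qed

definition pder :: "nat \<Rightarrow> ((nat \<Rightarrow> complex) \<Rightarrow> complex) \<Rightarrow> (nat \<Rightarrow> complex) \<Rightarrow> complex" where
  "pder i f x = deriv (\<lambda>t. f (x(i := t))) (x i)"

lemma partial_deriv_eq_pder: "partial_deriv i F = pder i (eval_poly F)"
  by (simp add: partial_deriv_def pder_def fun_eq_iff)

text \<open>The chain rule along arbitrary curves is used as definition, because it allows the gradient to be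
  constructed by induction on \<open>f\<close>, together with the degree of its components.\<close>

definition is_gradient ::
  "nat set \<Rightarrow> nat \<Rightarrow> ((nat \<Rightarrow> complex) \<Rightarrow> complex) \<Rightarrow> (nat \<Rightarrow> (nat \<Rightarrow> complex) \<Rightarrow> complex) \<Rightarrow> bool" where
  "is_gradient I k f D \<longleftrightarrow> (\<forall>i. (k = 0 \<longrightarrow> D i = (\<lambda>_. 0)) \<and> hpoly I (k - 1) (D i)) \<and>
    (\<forall>x y s. (\<forall>i\<in>I. ((\<lambda>t. x t i) has_field_derivative y i) (at s)) \<longrightarrow>
       ((\<lambda>t. f (x t)) has_field_derivative (\<Sum>i\<in>I. D i (x s) * y i)) (at s))"

lemma is_gradientD:
  assumes "is_gradient I k f D"
  shows "k = 0 \<Longrightarrow> D i = (\<lambda>_. 0)" "hpoly I (k - 1) (D i)"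
    "(\<And>i. i \<in> I \<Longrightarrow> ((\<lambda>t. x t i) has_field_derivative y i) (at s)) \<Longrightarrow>
       ((\<lambda>t. f (x t)) has_field_derivative (\<Sum>i\<in>I. D i (x s) * y i)) (at s)"
  using assms unfolding is_gradient_def by auto

lemma is_gradientI:
  assumes "\<And>i. k = 0 \<Longrightarrow> D i = (\<lambda>_. 0)" "\<And>i. hpoly I (k - 1) (D i)"
    "\<And>(x :: complex \<Rightarrow> nat \<Rightarrow> complex) y s.
       (\<And>i. i \<in> I \<Longrightarrow> ((\<lambda>t. x t i) has_field_derivative y i) (at s)) \<Longrightarrow>
       ((\<lambda>t. f (x t)) has_field_derivative (\<Sum>i\<in>I. D i (x s) * y i)) (at s)"
  shows "is_gradient I k f D"
  using assms unfolding is_gradient_def by auto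

lemma hpoly_gradient_ex:
  assumes "hpoly I k f" "finite I" shows "\<exists>D. is_gradient I k f D"
  using assms(1)
proof (induction rule: hpoly.induct)
  case (hpoly_const c)
  show ?case by (rule exI[of _ "\<lambda>_ _. 0"], rule is_gradientI) (auto intro: hpoly.intros)
next
  case (hpoly_zero k)
  show ?case by (rule exI[of _ "\<lambda>_ _. 0"], rule is_gradientI) (auto intro: hpoly.intros)
next
  case (hpoly_coord i)
  have "(\<Sum>j\<in>I. (if j = i then 1 else 0) * y j) = y i" for y :: "nat \<Rightarrow> complex"
  proof -
    have "(\<Sum>j\<in>I. (if j = i then 1 else 0) * y j) = (\<Sum>j\<in>I. if j = i then y i else 0)"
      by (intro sum.cong) auto
    then show ?thesis using hpoly_coord assms(2) by simp
  qed
  then show ?case using hpoly_coord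
    by (intro exI[of _ "\<lambda>j _. if j = i then 1 else 0"] is_gradientI) (auto intro: hpoly.intros)
next
  case (hpoly_add k f g)
  then obtain D E where D: "is_gradient I k f D" and E: "is_gradient I k g E" by blast
  show ?case
  proof (intro exI is_gradientI)
    show "k = 0 \<Longrightarrow> (\<lambda>x. D i x + E i x) = (\<lambda>_. 0)" for i
      using is_gradientD(1)[OF D] is_gradientD(1)[OF E] by simp
    show "hpoly I (k - 1) (\<lambda>x. D i x + E i x)" for i
      using is_gradientD(2)[OF D] is_gradientD(2)[OF E] by (rule hpoly.hpoly_add)
    fix x :: "complex \<Rightarrow> nat \<Rightarrow> complex" and y s
    assume *: "\<And>i. i \<in> I \<Longrightarrow> ((\<lambda>t. x t i) has_field_derivative y i) (at s)"
    show "((\<lambda>t. f (x t) + g (x t)) has_field_derivative (\<Sum>i\<in>I. (D i (x s) + E i (x s)) * y i)) (at s)"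
    proof -
      have "((\<lambda>t. f (x t)) has_field_derivative (\<Sum>i\<in>I. D i (x s) * y i)) (at s)"
        "((\<lambda>t. g (x t)) has_field_derivative (\<Sum>i\<in>I. E i (x s) * y i)) (at s)"
        using is_gradientD(3)[OF D] is_gradientD(3)[OF E] * by auto
      from DERIV_add[OF this] show ?thesis by (simp add: algebra_simps sum.distrib)
    qed
  qed
next
  case (hpoly_mult k f l g)
  then obtain D E where D: "is_gradient I k f D" and E: "is_gradient I l g E" by blast
  show ?case
  proof (intro exI is_gradientI)
    show "k + l = 0 \<Longrightarrow> (\<lambda>x. D i x * g x + f x * E i x) = (\<lambda>_. 0)" for i
      using is_gradientD(1)[OF D] is_gradientD(1)[OF E] by simp
    show "hpoly I (k + l - 1) (\<lambda>x. D i x * g x + f x * E i x)" for i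
    proof (rule hpoly.hpoly_add)
      show "hpoly I (k + l - 1) (\<lambda>x. D i x * g x)"
      proof (cases "k = 0")
        case True then show ?thesis using is_gradientD(1)[OF D] by (simp add: hpoly_zero)
      next
        case False
        then have "k + l - 1 = (k - 1) + l" by simp
        then show ?thesis using hpoly.hpoly_mult[OF is_gradientD(2)[OF D] hpoly_mult.hyps(2)] by simp
      qed
      show "hpoly I (k + l - 1) (\<lambda>x. f x * E i x)"
      proof (cases "l = 0")
        case True then show ?thesis using is_gradientD(1)[OF E] by (simp add: hpoly_zero)
      next
        case False
        then have "k + l - 1 = k + (l - 1)" by simp
        then show ?thesis using hpoly.hpoly_mult[OF hpoly_mult.hyps(1) is_gradientD(2)[OF E]] by simp
      qed
    qed
    fix x :: "complex \<Rightarrow> nat \<Rightarrow> complex" and y s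
    assume *: "\<And>i. i \<in> I \<Longrightarrow> ((\<lambda>t. x t i) has_field_derivative y i) (at s)"
    show "((\<lambda>t. f (x t) * g (x t)) has_field_derivative
       (\<Sum>i\<in>I. (D i (x s) * g (x s) + f (x s) * E i (x s)) * y i)) (at s)"
    proof -
      have "((\<lambda>t. f (x t)) has_field_derivative (\<Sum>i\<in>I. D i (x s) * y i)) (at s)"
        "((\<lambda>t. g (x t)) has_field_derivative (\<Sum>i\<in>I. E i (x s) * y i)) (at s)"
        using is_gradientD(3)[OF D] is_gradientD(3)[OF E] * by auto
      from DERIV_mult[OF this] show ?thesis
        by (simp add: algebra_simps sum.distrib sum_distrib_left sum_distrib_right)
    qed
  qed
qed

lemma hpoly_pder:
  assumes "hpoly I k f" "finite I"
  shows "hpoly I (k - 1) (pder i f)"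
    and "\<And>(x :: complex \<Rightarrow> nat \<Rightarrow> complex) y s. (\<And>i. i \<in> I \<Longrightarrow> ((\<lambda>t. x t i) has_field_derivative y i) (at s)) \<Longrightarrow>
       ((\<lambda>t. f (x t)) has_field_derivative (\<Sum>i\<in>I. pder i f (x s) * y i)) (at s)"
    and "k = 0 \<Longrightarrow> pder i f x = 0"
proof -
  obtain D where "is_gradient I k f D" using hpoly_gradient_ex[OF assms] by blast
  note D = is_gradientD[OF this]
  have pd: "pder i f = (if i \<in> I then D i else (\<lambda>_. 0))" for i
  proof
    fix x
    have "((\<lambda>t. f (x(i := t))) has_field_derivative
       (\<Sum>j\<in>I. D j (x(i := x i)) * (if j = i then 1 else 0))) (at (x i))"
      by (rule D(3)) (auto intro!: derivative_eq_intros)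
    then have "pder i f x = (\<Sum>j\<in>I. D j x * (if j = i then 1 else 0))"
      unfolding pder_def by (simp add: DERIV_imp_deriv)
    also have "\<dots> = (\<Sum>j\<in>I. if j = i then D i x else 0)" by (intro sum.cong) auto
    finally show "pder i f x = (if i \<in> I then D i else (\<lambda>_. 0)) x" using assms(2) by simp
  qed
  show "hpoly I (k - 1) (pder i f)" unfolding pd using D(2) by (auto intro: hpoly_zero)
  show "k = 0 \<Longrightarrow> pder i f x = 0" unfolding pd using D(1) by simp
  show "((\<lambda>t. f (x t)) has_field_derivative (\<Sum>i\<in>I. pder i f (x s) * y i)) (at s)"
    if "\<And>i. i \<in> I \<Longrightarrow> ((\<lambda>t. x t i) has_field_derivative y i) (at s)" for x y s
    using D(3)[OF that] by (simp add: pd)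
qed

lemma hpoly_pder_zero_independent:
  assumes "hpoly (insert v I) k f" "finite I" "\<And>x. pder v f x = 0"
  shows "hpoly I k f"
proof -
  have "f (x(v := t)) = f (x(v := 0))" for x t
  proof -
    have "((\<lambda>t. f (x(v := t))) has_field_derivative 0) (at s)" for s
    proof -
      have "((\<lambda>t. f (x(v := t))) has_field_derivative
        (\<Sum>i\<in>insert v I. pder i f (x(v := s)) * (if i = v then 1 else 0))) (at s)"
        using assms(2) by (intro hpoly_pder(2)[OF assms(1)]) (auto intro!: derivative_eq_intros)
      moreover have "(\<Sum>i\<in>insert v I. pder i f (x(v := s)) * (if i = v then 1 else 0)) = 0"
        using assms(3) by (intro sum.neutral) auto
      ultimately show ?thesis by simp
    qed
    then obtain c where "\<And>t. f (x(v := t)) = c"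
      using has_field_derivative_zero_constant[of UNIV "\<lambda>t. f (x(v := t))"] by auto
    then show ?thesis by simp
  qed
  then have "f = (\<lambda>x. f (x(v := 0)))" by (metis fun_upd_triv)
  then show ?thesis using hpoly_set_variable_zero[OF assms(1)] by simp
qed

section \<open>Zariski closed sets\<close>

abbreviation mono_eval :: "(nat \<Rightarrow>\<^sub>0 nat) \<Rightarrow> (nat \<Rightarrow> complex) \<Rightarrow> complex" where
  "mono_eval m x \<equiv> (\<Prod>i\<in>Poly_Mapping.keys m. x i ^ Poly_Mapping.lookup m i)"

lemma mono_eval_superset:
  assumes "finite S" "Poly_Mapping.keys m \<subseteq> S"
  shows "mono_eval m x = (\<Prod>i\<in>S. x i ^ Poly_Mapping.lookup m i)"
  using assms by (intro prod.mono_neutral_left) (auto simp: in_keys_iff)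

lemma mono_eval_add: "mono_eval (m + n) x = mono_eval m x * mono_eval n x"
proof -
  let ?S = "Poly_Mapping.keys m \<union> Poly_Mapping.keys n"
  have "mono_eval (m + n) x = (\<Prod>i\<in>?S. x i ^ Poly_Mapping.lookup (m + n) i)"
    using Poly_Mapping.keys_add[of m n] by (intro mono_eval_superset) auto
  also have "\<dots> = (\<Prod>i\<in>?S. x i ^ Poly_Mapping.lookup m i) * (\<Prod>i\<in>?S. x i ^ Poly_Mapping.lookup n i)"
    by (simp add: lookup_add power_add prod.distrib)
  finally show ?thesis by (simp add: mono_eval_superset[of ?S])
qed

lemma eval_poly_superset:
  assumes "finite S" "Poly_Mapping.keys F \<subseteq> S"
  shows "eval_poly F x = (\<Sum>m\<in>S. Poly_Mapping.lookup F m * mono_eval m x)"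
  unfolding eval_poly_def using assms by (intro sum.mono_neutral_left) (auto simp: in_keys_iff)

lemma eval_poly_add: "eval_poly (F + G) x = eval_poly F x + eval_poly G x"
proof -
  let ?S = "Poly_Mapping.keys F \<union> Poly_Mapping.keys G"
  have "eval_poly (F + G) x = (\<Sum>m\<in>?S. Poly_Mapping.lookup (F + G) m * mono_eval m x)"
    using Poly_Mapping.keys_add[of F G] by (intro eval_poly_superset) auto
  then show ?thesis
    by (simp add: lookup_add distrib_right sum.distrib eval_poly_superset[of ?S])
qed

lemma eval_poly_single: "eval_poly (Poly_Mapping.single m c) x = c * mono_eval m x"
  by (simp add: eval_poly_def)

definition homogeneous_of_degree :: "nat \<Rightarrow> nat \<Rightarrow> mpolynomial \<Rightarrow> bool" where
  "homogeneous_of_degree d k F \<longleftrightarrow> (\<forall>m\<in>Poly_Mapping.keys F. Poly_Mapping.keys m \<subseteq> {..d} \<and>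
     (\<Sum>i\<in>Poly_Mapping.keys m. Poly_Mapping.lookup m i) = k)"

lemma homogeneous_polys_iff: "F \<in> homogeneous_polys d \<longleftrightarrow> (\<exists>k. homogeneous_of_degree d k F)"
  by (simp add: homogeneous_polys_def homogeneous_of_degree_def)

lemma homogeneous_of_degree_imp_hpoly:
  assumes "homogeneous_of_degree d k F" shows "hpoly {..d} k (eval_poly F)"
  unfolding eval_poly_def
proof (intro hpoly_sum hpoly_cmult)
  fix m assume m: "m \<in> Poly_Mapping.keys F"
  have "hpoly {..d} (\<Sum>i\<in>Poly_Mapping.keys m. Poly_Mapping.lookup m i) (mono_eval m)"
    using assms m by (intro hpoly_prod hpoly_coord_power) (auto simp: homogeneous_of_degree_def)
  then show "hpoly {..d} k (mono_eval m)"
    using assms m by (auto simp: homogeneous_of_degree_def)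
qed

lemma degree_add_poly_mapping:
  fixes m n :: "nat \<Rightarrow>\<^sub>0 nat"
  shows "(\<Sum>i\<in>Poly_Mapping.keys (m + n). Poly_Mapping.lookup (m + n) i) =
    (\<Sum>i\<in>Poly_Mapping.keys m. Poly_Mapping.lookup m i) + (\<Sum>i\<in>Poly_Mapping.keys n. Poly_Mapping.lookup n i)"
proof -
  let ?S = "Poly_Mapping.keys m \<union> Poly_Mapping.keys n"
  have sup: "(\<Sum>i\<in>Poly_Mapping.keys p. Poly_Mapping.lookup p i) = (\<Sum>i\<in>?S. Poly_Mapping.lookup p i)"
    if "Poly_Mapping.keys p \<subseteq> ?S" for p :: "nat \<Rightarrow>\<^sub>0 nat"
    using that by (intro sum.mono_neutral_left) (auto simp: in_keys_iff)
  have "Poly_Mapping.keys (m + n) \<subseteq> ?S" using Poly_Mapping.keys_add[of m n] by auto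
  then have "(\<Sum>i\<in>Poly_Mapping.keys (m + n). Poly_Mapping.lookup (m + n) i) = (\<Sum>i\<in>?S. Poly_Mapping.lookup (m + n) i)"
    by (rule sup)
  then show ?thesis by (simp only: lookup_add sum.distrib sup[of m, OF Un_upper1] sup[of n, OF Un_upper2])
qed

text \<open>This and its converse above permit equations of closed sets to be given as functions.\<close>

lemma hpoly_imp_homogeneous_of_degree:
  assumes "hpoly {..d} k f"
  shows "\<exists>F. homogeneous_of_degree d k F \<and> eval_poly F = f"
  using assms
proof (induction rule: hpoly.induct)
  case (hpoly_const c)
  show ?case
    by (rule exI[of _ "Poly_Mapping.single 0 c"])
       (auto simp: homogeneous_of_degree_def eval_poly_single fun_eq_iff split: if_splits)
next
  case (hpoly_zero k)
  show ?case by (rule exI[of _ 0]) (auto simp: homogeneous_of_degree_def eval_poly_def)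
next
  case (hpoly_coord i)
  show ?case using hpoly_coord
    by (intro exI[of _ "Poly_Mapping.single (Poly_Mapping.single i 1) 1"])
       (auto simp: homogeneous_of_degree_def eval_poly_single fun_eq_iff split: if_splits)
next
  case (hpoly_add k f g)
  then obtain F G where "homogeneous_of_degree d k F" "eval_poly F = f"
    "homogeneous_of_degree d k G" "eval_poly G = g" by blast
  then show ?case using Poly_Mapping.keys_add[of F G]
    by (intro exI[of _ "F + G"]) (auto simp: homogeneous_of_degree_def eval_poly_add)
next
  case (hpoly_mult k f l g)
  then obtain F G where FG: "homogeneous_of_degree d k F" "eval_poly F = f"
    "homogeneous_of_degree d l G" "eval_poly G = g" by blast
  let ?Q = "\<lambda>h. \<exists>H. homogeneous_of_degree d (k + l) H \<and> eval_poly H = h"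
  have Qsum: "?Q (\<lambda>x. \<Sum>j\<in>A. h j x)" if "\<And>j. j \<in> A \<Longrightarrow> ?Q (h j)" "finite A"
    for h :: "(nat \<Rightarrow>\<^sub>0 nat) \<Rightarrow> _" and A
    using that(2,1)
  proof (induction A rule: finite_induct)
    case empty
    show ?case by (rule exI[of _ 0]) (auto simp: homogeneous_of_degree_def eval_poly_def)
  next
    case (insert j A)
    then obtain H1 H2 where "homogeneous_of_degree d (k + l) H1" "eval_poly H1 = h j"
      "homogeneous_of_degree d (k + l) H2" "eval_poly H2 = (\<lambda>x. \<Sum>j\<in>A. h j x)" by blast
    moreover have "homogeneous_of_degree d (k + l) (H1 + H2)"
      using calculation(1,3) Poly_Mapping.keys_add[of H1 H2] unfolding homogeneous_of_degree_def by blast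
    ultimately show ?case using insert(1,2)
      by (intro exI[of _ "H1 + H2"]) (auto simp: eval_poly_add fun_eq_iff)
  qed
  have "(\<lambda>x. f x * g x) = (\<lambda>x. \<Sum>m\<in>Poly_Mapping.keys F. \<Sum>n\<in>Poly_Mapping.keys G.
      (Poly_Mapping.lookup F m * Poly_Mapping.lookup G n) * mono_eval (m + n) x)"
    unfolding FG(2,4)[symmetric] eval_poly_def sum_product mono_eval_add by (simp add: mult_ac)
  moreover have "?Q \<dots>"
  proof (intro Qsum)
    fix m n assume "m \<in> Poly_Mapping.keys F" "n \<in> Poly_Mapping.keys G"
    then have "homogeneous_of_degree d (k + l) (Poly_Mapping.single (m + n) (Poly_Mapping.lookup F m * Poly_Mapping.lookup G n))"
    proof -
      assume mn: "m \<in> Poly_Mapping.keys F" "n \<in> Poly_Mapping.keys G"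
      have "Poly_Mapping.keys (m + n) \<subseteq> {..d}"
        using FG(1,3) Poly_Mapping.keys_add[of m n] mn unfolding homogeneous_of_degree_def by blast
      then show ?thesis using FG(1,3) mn
        by (auto simp: homogeneous_of_degree_def degree_add_poly_mapping)
    qed
    then show "?Q (\<lambda>x. (Poly_Mapping.lookup F m * Poly_Mapping.lookup G n) * mono_eval (m + n) x)"
      by (metis eval_poly_single ext)
  qed auto
  ultimately show ?case by simp
qed

lemma eval_poly_hpoly: "F \<in> homogeneous_polys d \<Longrightarrow> \<exists>k. hpoly {..d} k (eval_poly F)"
  using homogeneous_of_degree_imp_hpoly homogeneous_polys_iff by blast

lemma hpoly_eval_poly:
  assumes "hpoly {..d} k f" shows "\<exists>F\<in>homogeneous_polys d. eval_poly F = f"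
  using hpoly_imp_homogeneous_of_degree[OF assms] homogeneous_polys_iff by blast

lemma coords_scale: "coords d (scale c f) i = c * coords d f i"
  by (simp add: coords_def scale_def)

lemma scale_in_binary_forms: "f \<in> binary_forms d \<Longrightarrow> scale c f \<in> binary_forms d"
  by (auto simp: binary_forms_def scale_def dest: mult_not_zero)

lemma scale_one [simp]: "scale 1 f = (f :: 'a::field bipoly)"
  unfolding scale_def one_pCons[symmetric] by simp

lemma scale_scale [simp]: "scale a (scale b f) = scale (a * b) f"
  by (simp add: scale_def mult.commute)

lemma scale_eq_0_iff [simp]: "scale c f = 0 \<longleftrightarrow> c = 0 \<or> f = (0 :: 'a::field bipoly)"
  by (simp add: scale_def)

lemma proj_point_self: "f \<in> proj_point f"
  unfolding proj_point_def by (intro CollectI exI[of _ 1]) simp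

lemma proj_point_eq_iff: "proj_point f = proj_point g \<longleftrightarrow> (\<exists>c. c \<noteq> 0 \<and> f = scale c g)"
proof
  assume "proj_point f = proj_point g"
  then have "f \<in> proj_point g" using proj_point_self by auto
  then show "\<exists>c. c \<noteq> 0 \<and> f = scale c g" by (auto simp: proj_point_def)
next
  assume "\<exists>c. c \<noteq> 0 \<and> f = scale c g"
  then obtain c where c: "c \<noteq> 0" "f = scale c g" by blast
  have "\<exists>e. e \<noteq> 0 \<and> scale b g = scale e (scale c g)" if "b \<noteq> 0" for b
    using c that by (intro exI[of _ "b / c"]) simp
  then show "proj_point f = proj_point g" using c unfolding proj_point_def by fastforce
qed

lemma eval_poly_coords_scale:
  assumes "F \<in> homogeneous_polys d" "c \<noteq> 0"
  shows "eval_poly F (coords d (scale c f)) = 0 \<longleftrightarrow> eval_poly F (coords d f) = 0"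
proof -
  obtain k where "hpoly {..d} k (eval_poly F)" using eval_poly_hpoly[OF assms(1)] by blast
  moreover have "coords d (scale c f) = (\<lambda>i. c * coords d f i)" by (simp add: coords_scale fun_eq_iff)
  ultimately show ?thesis using hpoly_scale[of "{..d}" k "eval_poly F" c "coords d f"] assms(2) by simp
qed

lemma proj_point_in_zero_locus:
  assumes "S \<subseteq> homogeneous_polys d"
  shows "proj_point f \<in> zero_locus d S \<longleftrightarrow>
    f \<in> binary_forms d - {0} \<and> (\<forall>F\<in>S. eval_poly F (coords d f) = 0)"
proof
  assume "proj_point f \<in> zero_locus d S"
  then obtain g where g: "g \<in> binary_forms d - {0}" "\<forall>F\<in>S. eval_poly F (coords d g) = 0"
    "proj_point f = proj_point g" by (auto simp: zero_locus_def)
  then obtain c where c: "c \<noteq> 0" "f = scale c g" using proj_point_eq_iff by blast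
  have "eval_poly F (coords d f) = 0" if "F \<in> S" for F
    using eval_poly_coords_scale[of F d c g] that g(2) assms c by auto
  then show "f \<in> binary_forms d - {0} \<and> (\<forall>F\<in>S. eval_poly F (coords d f) = 0)"
    using g(1) c by (auto intro: scale_in_binary_forms)
qed (auto simp: zero_locus_def)

text \<open>A union is cut out by the products of one equation of either set.\<close>

lemma zariski_closed_Un:
  assumes "zariski_closed d Z1" "zariski_closed d Z2" shows "zariski_closed d (Z1 \<union> Z2)"
proof -
  obtain S1 where S1: "S1 \<subseteq> homogeneous_polys d" "Z1 = zero_locus d S1" using assms zariski_closed_def by auto
  obtain S2 where S2: "S2 \<subseteq> homogeneous_polys d" "Z2 = zero_locus d S2" using assms zariski_closed_def by auto
  define S where "S = {F \<in> homogeneous_polys d. \<exists>A\<in>S1. \<exists>B\<in>S2. eval_poly F = (\<lambda>x. eval_poly A x * eval_poly B x)}"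
  have S: "S \<subseteq> homogeneous_polys d" unfolding S_def by auto
  have prod: "\<exists>F\<in>S. eval_poly F = (\<lambda>x. eval_poly A x * eval_poly B x)" if AB: "A \<in> S1" "B \<in> S2" for A B
  proof -
    obtain k l where "hpoly {..d} k (eval_poly A)" "hpoly {..d} l (eval_poly B)"
      using eval_poly_hpoly S1(1) S2(1) AB by blast
    from hpoly_eval_poly[OF hpoly_mult[OF this]] show ?thesis using AB unfolding S_def by auto
  qed
  have "Z1 \<union> Z2 = zero_locus d S"
  proof
    show "Z1 \<union> Z2 \<subseteq> zero_locus d S"
      unfolding S1(2) S2(2) by (auto simp: zero_locus_def S_def)
    show "zero_locus d S \<subseteq> Z1 \<union> Z2"
    proof
      fix p assume "p \<in> zero_locus d S"
      then obtain f where f: "p = proj_point f" "f \<in> binary_forms d - {0}" "\<forall>F\<in>S. eval_poly F (coords d f) = 0"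
        by (auto simp: zero_locus_def)
      show "p \<in> Z1 \<union> Z2"
      proof (rule ccontr)
        assume "p \<notin> Z1 \<union> Z2"
        then obtain A B where AB: "A \<in> S1" "eval_poly A (coords d f) \<noteq> 0" "B \<in> S2" "eval_poly B (coords d f) \<noteq> 0"
          using f(1,2) unfolding S1(2) S2(2) zero_locus_def by blast
        then obtain F where "F \<in> S" "eval_poly F = (\<lambda>x. eval_poly A x * eval_poly B x)"
          using prod by blast
        then show False using f(3) AB by auto
      qed
    qed
  qed
  then show ?thesis using S zariski_closed_def by blast
qed

lemma zariski_closed_empty: "zariski_closed d {}"
proof -
  obtain F where F: "F \<in> homogeneous_polys d" "eval_poly F = (\<lambda>x. 1)"
    using hpoly_eval_poly[OF hpoly_const] by blast
  then have "zero_locus d {F} = {}" by (auto simp: zero_locus_def)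
  then show ?thesis using F(1) unfolding zariski_closed_def by (intro exI[of _ "{F}"]) auto
qed

lemma zariski_closed_finite_UN:
  "finite A \<Longrightarrow> (\<And>a. a \<in> A \<Longrightarrow> zariski_closed d (Z a)) \<Longrightarrow> zariski_closed d (\<Union>a\<in>A. Z a)"
  by (induction A rule: finite_induct) (auto intro: zariski_closed_empty zariski_closed_Un)

lemma zariski_closure_minimal: "zariski_closed d Z \<Longrightarrow> A \<subseteq> Z \<Longrightarrow> zariski_closure d A \<subseteq> Z"
  unfolding zariski_closure_def by blast

text \<open>The intersection is cut out by all equations of all closed sets that contain \<open>A\<close>. The
  hypothesis ensures that there is such a closed set; otherwise the empty intersection would contain
  more than classes of forms.\<close>

lemma zariski_closed_zariski_closure:
  assumes "A \<subseteq> zero_locus d {}"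
  shows "zariski_closed d (zariski_closure d A)"
proof -
  define S where "S = \<Union>{S. S \<subseteq> homogeneous_polys d \<and> A \<subseteq> zero_locus d S}"
  have S: "S \<subseteq> homogeneous_polys d" unfolding S_def by blast
  have sub: "zariski_closure d A \<subseteq> zero_locus d T" if "T \<subseteq> homogeneous_polys d" "A \<subseteq> zero_locus d T" for T
    using that by (intro zariski_closure_minimal) (auto simp: zariski_closed_def)
  have "zariski_closure d A = zero_locus d S"
  proof
    show "zariski_closure d A \<subseteq> zero_locus d S"
    proof
      fix p assume p: "p \<in> zariski_closure d A"
      then have "p \<in> zero_locus d {}" using sub[of "{}"] assms by blast
      then obtain f where f: "p = proj_point f" "f \<in> binary_forms d - {0}" by (auto simp: zero_locus_def)
      have "eval_poly F (coords d f) = 0" if "F \<in> S" for F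
      proof -
        obtain T where T: "T \<subseteq> homogeneous_polys d" "A \<subseteq> zero_locus d T" "F \<in> T"
          using \<open>F \<in> S\<close> by (auto simp: S_def)
        then have "p \<in> zero_locus d T" using p sub by blast
        then show ?thesis using proj_point_in_zero_locus[OF T(1)] T(3) f(1) by auto
      qed
      then show "p \<in> zero_locus d S" using f by (auto simp: zero_locus_def)
    qed
    show "zero_locus d S \<subseteq> zariski_closure d A"
    proof
      fix p assume "p \<in> zero_locus d S"
      then obtain f where f: "p = proj_point f" "f \<in> binary_forms d - {0}" "\<forall>F\<in>S. eval_poly F (coords d f) = 0"
        by (auto simp: zero_locus_def)
      have "p \<in> zero_locus d T" if "T \<subseteq> homogeneous_polys d" "A \<subseteq> zero_locus d T" for T
        using that f unfolding S_def by (auto simp: zero_locus_def)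
      then show "p \<in> zariski_closure d A" unfolding zariski_closure_def zariski_closed_def by blast
    qed
  qed
  then show ?thesis using S zariski_closed_def by blast
qed

lemma zariski_closure_superset: "A \<subseteq> zariski_closure d A"
  unfolding zariski_closure_def by blast

lemma not_in_zariski_closedE:
  assumes "zariski_closed d Z" "f \<in> binary_forms d - {0}" "proj_point f \<notin> Z"
  obtains k F where "hpoly {..d} k F" "F (coords d f) \<noteq> 0"
    "\<And>g. proj_point g \<in> Z \<Longrightarrow> F (coords d g) = 0"
proof -
  obtain S where S: "S \<subseteq> homogeneous_polys d" "Z = zero_locus d S" using assms(1) zariski_closed_def by auto
  then obtain F where F: "F \<in> S" "eval_poly F (coords d f) \<noteq> 0"
    using assms(2,3) proj_point_in_zero_locus by blast
  moreover obtain k where "hpoly {..d} k (eval_poly F)" using eval_poly_hpoly S F by blast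
  moreover have "eval_poly F (coords d g) = 0" if "proj_point g \<in> Z" for g
    using that proj_point_in_zero_locus[OF S(1)] F(1) S(2) by blast
  ultimately show ?thesis using that by blast
qed

lemma zariski_closedI:
  assumes "Z \<subseteq> zero_locus d {}"
    "\<And>f. f \<in> binary_forms d - {0} \<Longrightarrow> proj_point f \<notin> Z \<Longrightarrow>
       \<exists>k F. hpoly {..d} k F \<and> F (coords d f) \<noteq> 0 \<and> (\<forall>g. proj_point g \<in> Z \<longrightarrow> F (coords d g) = 0)"
  shows "zariski_closed d Z"
proof -
  have "p \<in> Z" if p: "p \<in> zero_locus d (vanishing_polys d Z)" for p
  proof (rule ccontr)
    assume "p \<notin> Z"
    moreover obtain f where f: "p = proj_point f" "f \<in> binary_forms d - {0}"
       "\<forall>F\<in>vanishing_polys d Z. eval_poly F (coords d f) = 0"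
      using p by (auto simp: zero_locus_def)
    ultimately obtain k F where F: "hpoly {..d} k F" "F (coords d f) \<noteq> 0"
      "\<forall>g. proj_point g \<in> Z \<longrightarrow> F (coords d g) = 0" using assms(2) by blast
    obtain G where "G \<in> homogeneous_polys d" "eval_poly G = F" using hpoly_eval_poly[OF F(1)] by blast
    then have "G \<in> vanishing_polys d Z" using F(3) by (simp add: vanishing_polys_def)
    then show False using f(3) F(2) \<open>eval_poly G = F\<close> by auto
  qed
  moreover have "p \<in> zero_locus d (vanishing_polys d Z)" if "p \<in> Z" for p
  proof -
    have "p \<in> zero_locus d {}" using assms(1) that by blast
    then obtain f where "p = proj_point f" "f \<in> binary_forms d - {0}" by (auto simp: zero_locus_def)
    then show ?thesis using that by (auto simp: zero_locus_def vanishing_polys_def)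
  qed
  ultimately have "Z = zero_locus d (vanishing_polys d Z)" by blast
  moreover have "vanishing_polys d Z \<subseteq> homogeneous_polys d" by (auto simp: vanishing_polys_def)
  ultimately show ?thesis unfolding zariski_closed_def by (intro exI conjI)
qed

section \<open>Binary forms as univariate polynomials of bounded degree\<close>

text \<open>The value at \<open>(\<xi>, \<eta>)\<close> of the form of degree \<open>m\<close> with dehomogenization \<open>p\<close>. The polynomial
  \<open>p\<close> does not know its roots at infinity \<open>(1, 0)\<close>; their number is \<open>m\<close> minus its degree.\<close>

definition hev :: "nat \<Rightarrow> 'a::field poly \<Rightarrow> 'a \<Rightarrow> 'a \<Rightarrow> 'a" where
  "hev m p \<xi> \<eta> = (\<Sum>i\<le>m. coeff p i * \<xi> ^ i * \<eta> ^ (m - i))"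

text \<open>The linear form with the root \<open>(\<xi>, \<eta>)\<close>. It is a constant polynomial if the root is at infinity.\<close>

definition lin :: "'a::field \<Rightarrow> 'a \<Rightarrow> 'a poly" where
  "lin \<xi> \<eta> = [:- \<xi>, \<eta>:]"

lemma degree_lin: "degree (lin \<xi> \<eta>) \<le> 1"
  by (simp add: lin_def)

lemma lin_eq_0_iff: "lin \<xi> \<eta> = 0 \<longleftrightarrow> \<xi> = 0 \<and> \<eta> = 0"
  by (auto simp: lin_def)

lemma hev_lin: "hev 1 (lin \<xi> \<eta>) a b = \<eta> * a - \<xi> * b"
  by (simp add: hev_def lin_def)

lemma hev_infinity: "hev m p \<xi> 0 = coeff p m * \<xi> ^ m"
proof -
  have "hev m p \<xi> 0 = (\<Sum>i\<le>m. if i = m then coeff p m * \<xi> ^ m else 0)"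
    unfolding hev_def by (intro sum.cong) (auto simp: power_0_left)
  then show ?thesis by simp
qed

lemma hev_affine:
  assumes "\<eta> \<noteq> 0" "degree p \<le> m" shows "hev m p \<xi> \<eta> = \<eta> ^ m * poly p (\<xi> / \<eta>)"
proof -
  have "poly p (\<xi> / \<eta>) = (\<Sum>i\<le>m. coeff p i * (\<xi> / \<eta>) ^ i)"
    unfolding poly_altdef using assms(2)
    by (intro sum.mono_neutral_left) (auto simp: coeff_eq_0)
  then have "\<eta> ^ m * poly p (\<xi> / \<eta>) = (\<Sum>i\<le>m. coeff p i * (\<xi> ^ i * (\<eta> ^ m / \<eta> ^ i)))"
    by (simp add: sum_distrib_left power_divide mult_ac)
  also have "\<dots> = hev m p \<xi> \<eta>"
    unfolding hev_def using assms(1) by (intro sum.cong) (auto simp: power_diff)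
  finally show ?thesis by simp
qed

lemma coeff_mult_at_bounds:
  fixes p q :: "'a::comm_ring_1 poly"
  assumes "degree p \<le> m" "degree q \<le> n"
  shows "coeff (p * q) (m + n) = coeff p m * coeff q n"
proof -
  have "coeff (p * q) (m + n) = (\<Sum>i\<le>m + n. if i = m then coeff p m * coeff q n else 0)"
    unfolding coeff_mult
  proof (intro sum.cong refl)
    fix i assume "i \<in> {..m + n}"
    consider "i < m" | "i = m" | "i > m" by linarith
    then show "coeff p i * coeff q (m + n - i) = (if i = m then coeff p m * coeff q n else 0)"
    proof cases
      case 1
      then have "coeff q (m + n - i) = 0" using assms(2) by (intro coeff_eq_0) simp
      then show ?thesis using 1 by simp
    next
      case 3
      then have "coeff p i = 0" using assms(1) by (intro coeff_eq_0) simp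
      then show ?thesis using 3 by simp
    qed simp
  qed
  then show ?thesis by simp
qed

lemma hev_mult:
  assumes "degree p \<le> m" "degree q \<le> n"
  shows "hev (m + n) (p * q) \<xi> \<eta> = hev m p \<xi> \<eta> * hev n q \<xi> \<eta>"
proof (cases "\<eta> = 0")
  case True
  then show ?thesis using coeff_mult_at_bounds[OF assms] by (simp add: hev_infinity power_add mult_ac)
next
  case False
  have "degree (p * q) \<le> m + n" using degree_mult_le[of p q] assms by linarith
  then show ?thesis using False assms by (simp add: hev_affine power_add)
qed

lemma hev_0_deg [simp]: "hev 0 p \<xi> \<eta> = coeff p 0"
  by (simp add: hev_def)

lemma hev_add: "hev m (p + q) \<xi> \<eta> = hev m p \<xi> \<eta> + hev m q \<xi> \<eta>"
  by (simp add: hev_def algebra_simps sum.distrib)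

lemma hev_smult: "hev m (smult c p) \<xi> \<eta> = c * hev m p \<xi> \<eta>"
  by (simp add: hev_def sum_distrib_left mult.assoc)

lemma hev_diff: "hev m (p - q) \<xi> \<eta> = hev m p \<xi> \<eta> - hev m q \<xi> \<eta>"
  by (simp add: hev_def algebra_simps sum_subtractf)

lemma hev_zero [simp]: "hev m 0 \<xi> \<eta> = 0"
  by (simp add: hev_def)

lemma hev_sum: "hev m (\<Sum>i\<in>A. p i) \<xi> \<eta> = (\<Sum>i\<in>A. hev m (p i) \<xi> \<eta>)"
  by (induction A rule: infinite_finite_induct) (auto simp: hev_add)

lemma degree_prod_le_sum:
  fixes p :: "'b \<Rightarrow> 'a::field poly"
  assumes "\<And>i. i \<in> A \<Longrightarrow> degree (p i) \<le> e i"
  shows "degree (\<Prod>i\<in>A. p i) \<le> (\<Sum>i\<in>A. e i)"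
  using assms
proof (induction A rule: infinite_finite_induct)
  case (insert i A)
  have "degree (p i * prod p A) \<le> degree (p i) + degree (prod p A)" by (rule degree_mult_le)
  also have "\<dots> \<le> e i + sum e A" using insert by (intro add_mono) auto
  finally show ?case using insert by simp
qed auto

lemma hev_prod:
  assumes "\<And>i. i \<in> A \<Longrightarrow> degree (p i) \<le> e i"
  shows "hev (\<Sum>i\<in>A. e i) (\<Prod>i\<in>A. p i) \<xi> \<eta> = (\<Prod>i\<in>A. hev (e i) (p i) \<xi> \<eta>)"
  using assms
proof (induction A rule: infinite_finite_induct)
  case (insert i A)
  then show ?case using hev_mult[of "p i" "e i" "prod p A" "sum e A" \<xi> \<eta>] degree_prod_le_sum[of A p e]
    by auto
qed auto

lemma degree_lin_power: "degree (lin \<xi> \<eta> ^ e) \<le> e"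
  using degree_power_le[of "lin \<xi> \<eta>" e] mult_le_mono1[OF degree_lin[of \<xi> \<eta>], of e] by linarith

lemma degree_prod_lin: "degree (\<Prod>i\<in>A. lin (x i) (y i)) \<le> card A"
  using degree_prod_le_sum[of A "\<lambda>i. lin (x i) (y i)" "\<lambda>_. 1"] degree_lin by auto

lemma degree_prod_lin_power: "degree (\<Prod>i\<in>A. lin (x i) (y i) ^ e i) \<le> (\<Sum>i\<in>A. e i)"
  by (intro degree_prod_le_sum degree_lin_power)

lemma hev_prod_lin:
  "hev (card A) (\<Prod>i\<in>A. lin (x i) (y i)) \<xi> \<eta> = (\<Prod>i\<in>A. y i * \<xi> - x i * \<eta>)"
proof -
  have "hev (\<Sum>i\<in>A. 1) (\<Prod>i\<in>A. lin (x i) (y i)) \<xi> \<eta> = (\<Prod>i\<in>A. hev 1 (lin (x i) (y i)) \<xi> \<eta>)"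
    by (intro hev_prod degree_lin)
  then show ?thesis by (simp only: hev_lin card_eq_sum)
qed

lemma lin_dvd_of_hev_zero:
  assumes "\<xi> \<noteq> 0 \<or> \<eta> \<noteq> 0" "degree p \<le> Suc m" "hev (Suc m) p \<xi> \<eta> = 0"
  shows "\<exists>q. p = lin \<xi> \<eta> * q \<and> degree q \<le> m"
proof (cases "\<eta> = 0")
  case True
  then have "coeff p (Suc m) = 0" using assms by (simp add: hev_infinity)
  then have "degree p \<le> m" using assms(2)
    by (intro degree_le) (metis Suc_lessI assms(2) coeff_eq_0 le_less_trans)
  moreover have "p = lin \<xi> \<eta> * smult (- 1 / \<xi>) p" using True assms(1) by (simp add: lin_def)
  moreover have "degree (smult (- 1 / \<xi>) p) \<le> m"
    using calculation(1) degree_smult_le[of "-1/\<xi>" p] by linarith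
  ultimately show ?thesis by blast
next
  case False
  then have "poly p (\<xi> / \<eta>) = 0" using assms by (simp add: hev_affine)
  then obtain r where r: "p = [:- (\<xi> / \<eta>), 1:] * r" using poly_eq_0_iff_dvd by blast
  have lin: "lin \<xi> \<eta> = smult \<eta> [:- (\<xi> / \<eta>), 1:]" using False by (simp add: lin_def)
  have "degree (smult (1 / \<eta>) r) \<le> m"
  proof (cases "r = 0")
    case False
    then have "degree p = 1 + degree r" unfolding r by (subst degree_mult_eq) auto
    then show ?thesis using assms(2) degree_smult_le[of "1/\<eta>" r] by linarith
  qed simp
  moreover have "p = lin \<xi> \<eta> * smult (1 / \<eta>) r" unfolding r lin using False by (simp add: smult_diff_right)
  ultimately show ?thesis by blast
qed

definition distinct_points :: "'i set \<Rightarrow> ('i \<Rightarrow> 'a::field) \<Rightarrow> ('i \<Rightarrow> 'a) \<Rightarrow> bool" where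
  "distinct_points I x y \<longleftrightarrow> (\<forall>i\<in>I. x i \<noteq> 0 \<or> y i \<noteq> 0) \<and>
     (\<forall>i\<in>I. \<forall>j\<in>I. i \<noteq> j \<longrightarrow> y i * x j - x i * y j \<noteq> 0)"

lemma distinct_points_subset: "distinct_points I x y \<Longrightarrow> J \<subseteq> I \<Longrightarrow> distinct_points J x y"
  by (simp add: distinct_points_def subset_iff)

text \<open>One linear factor is split off at a time.\<close>

lemma vanishing_at_distinct_points:
  assumes "finite I" "distinct_points I x y" "degree p \<le> n" "\<And>i. i \<in> I \<Longrightarrow> hev n p (x i) (y i) = 0"
  shows "p = 0 \<or> (\<exists>q. p = (\<Prod>i\<in>I. lin (x i) (y i)) * q \<and> degree q + card I \<le> n)"
  using assms
proof (induction I arbitrary: p n rule: finite_induct)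
  case empty
  then show ?case by auto
next
  case (insert i I)
  show ?case
  proof (cases n)
    case 0
    then have "p = 0" using insert.prems(2) insert.prems(3)[of i] by (auto dest!: degree_0_id[symmetric])
    then show ?thesis by simp
  next
    case (Suc m)
    have "x i \<noteq> 0 \<or> y i \<noteq> 0" using insert.prems(1) by (auto simp: distinct_points_def)
    then obtain q where q: "p = lin (x i) (y i) * q" "degree q \<le> m"
      using lin_dvd_of_hev_zero[of "x i" "y i" p m] insert.prems Suc by auto
    have "hev m q (x j) (y j) = 0" if "j \<in> I" for j
    proof -
      have "hev (1 + m) p (x j) (y j) = hev 1 (lin (x i) (y i)) (x j) (y j) * hev m q (x j) (y j)"
        unfolding q(1) by (intro hev_mult degree_lin q(2))
      moreover have "hev 1 (lin (x i) (y i)) (x j) (y j) \<noteq> 0"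
        using insert.prems(1) insert(2) that unfolding hev_lin distinct_points_def by (metis insertCI)
      ultimately show ?thesis using insert.prems(3)[of j] that Suc by simp
    qed
    then have "q = 0 \<or> (\<exists>r. q = (\<Prod>i\<in>I. lin (x i) (y i)) * r \<and> degree r + card I \<le> m)"
      using insert.IH[OF distinct_points_subset[OF insert.prems(1)] q(2)] by auto
    then show ?thesis using q(1) insert(1,2) Suc by (auto simp: mult.assoc)
  qed
qed

text \<open>The linear forms of the other points are multiplied, and the product is filled up to degree \<open>D\<close>
  with a linear form that does not vanish at the \<open>i\<close>-th point.\<close>

lemma lagrange_forms:
  fixes x y :: "'i \<Rightarrow> 'a::field"
  assumes "finite I" "distinct_points I x y" "card I \<le> D + 1"
  shows "\<exists>\<Lambda>. \<forall>i\<in>I. degree (\<Lambda> i) \<le> D \<and> (\<forall>j\<in>I. hev D (\<Lambda> i) (x j) (y j) = (if i = j then 1 else 0))"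
proof -
  have "\<exists>p. degree p \<le> D \<and> (\<forall>j\<in>I. hev D p (x j) (y j) = (if i = j then 1 else 0))" if i: "i \<in> I" for i
  proof -
    let ?J = "I - {i}"
    define m where "m = (if x i \<noteq> 0 then lin 0 1 else lin 1 (0 :: 'a))"
    define p where "p = (\<Prod>j\<in>?J. lin (x j) (y j)) * m ^ (D - card ?J)"
    have mnz: "hev 1 m (x i) (y i) \<noteq> 0"
      using assms(2) i by (auto simp: m_def hev_lin[simplified] distinct_points_def)
    have dm: "degree (m ^ e) \<le> e" for e unfolding m_def by (auto intro: degree_lin_power)
    have cJ: "card ?J \<le> D" using assms(1,3) i by simp
    have deg: "degree p \<le> D"
      unfolding p_def using degree_mult_le[of "\<Prod>j\<in>?J. lin (x j) (y j)" "m ^ (D - card ?J)"]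
        degree_prod_lin[of x y ?J] dm[of "D - card ?J"] cJ by linarith
    have "hev (card ?J + (D - card ?J)) p a b = (\<Prod>j\<in>?J. y j * a - x j * b) * hev (D - card ?J) (m ^ (D - card ?J)) a b" for a b
      unfolding p_def hev_prod_lin[symmetric] by (intro hev_mult degree_prod_lin dm)
    then have hp: "hev D p a b = (\<Prod>j\<in>?J. y j * a - x j * b) * hev (D - card ?J) (m ^ (D - card ?J)) a b" for a b
      using cJ by simp
    have dm1: "degree m \<le> 1" unfolding m_def by (simp add: degree_lin[simplified])
    have "hev (\<Sum>j\<in>{..<e}. 1) (\<Prod>j\<in>{..<e}. m) a b = (\<Prod>j\<in>{..<e}. hev 1 m a b)" for e :: nat and a b
      by (rule hev_prod) (rule dm1)
    then have hm: "hev e (m ^ e) a b = hev 1 m a b ^ e" for e a b by simp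
    have "hev D p (x i) (y i) \<noteq> 0"
      unfolding hp hm using mnz assms(1,2) i by (auto simp: distinct_points_def)
    moreover have "hev D p (x j) (y j) = 0" if "j \<in> I" "j \<noteq> i" for j
    proof -
      have "(\<Prod>k\<in>?J. y k * x j - x k * y j) = 0"
        using that assms(1) by (intro prod_zero) (auto intro!: bexI[of _ j])
      then show ?thesis unfolding hp by simp
    qed
    moreover have "degree (smult (1 / hev D p (x i) (y i)) p) \<le> D"
      using deg degree_smult_le[of _ p] le_trans by blast
    ultimately show ?thesis
      by (intro exI[of _ "smult (1 / hev D p (x i) (y i)) p"]) (auto simp: hev_smult)
  qed
  then show ?thesis by metis
qed

section \<open>Apolarity\<close>

text \<open>For \<open>a = nrm d f\<close> and \<open>p\<close> of formal degree \<open>d\<close>, this is the constant that results from the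
  application of the operator \<open>p\<close> to \<open>f\<close>; see \<open>apply_operator_same_degree\<close> below.\<close>

definition ap :: "(nat \<Rightarrow> 'a::field) \<Rightarrow> 'a poly \<Rightarrow> 'a" where
  "ap a p = (\<Sum>j\<le>degree p. coeff p j * a j)"

lemma ap_bound: "degree p \<le> n \<Longrightarrow> ap a p = (\<Sum>j\<le>n. coeff p j * a j)"
  unfolding ap_def by (intro sum.mono_neutral_left) (auto simp: coeff_eq_0)

lemma ap_add: "ap a (p + q) = ap a p + ap a q"
proof -
  let ?n = "max (degree p) (degree q)"
  have "ap a (p + q) = (\<Sum>j\<le>?n. coeff (p + q) j * a j)"
    by (rule ap_bound) (rule degree_add_le_max)
  then show ?thesis by (simp add: ap_bound[of _ ?n] algebra_simps sum.distrib)
qed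

lemma ap_smult: "ap a (smult c p) = c * ap a p"
  by (subst ap_bound[OF degree_smult_le]) (simp add: ap_def sum_distrib_left mult.assoc)

lemma ap_zero [simp]: "ap a 0 = 0"
  by (simp add: ap_def)

lemma ap_diff: "ap a (p - q) = ap a p - ap a q"
  using ap_add[of a p "smult (-1) q"] ap_smult[of a "-1" q] by simp

lemma ap_sum: "ap a (\<Sum>i\<in>A. p i) = (\<Sum>i\<in>A. ap a (p i))"
  by (induction A rule: infinite_finite_induct) (auto simp: ap_add)

lemma ap_mult_monom:
  assumes "degree q \<le> k" shows "ap a (q * monom 1 i) = (\<Sum>j\<le>k. coeff q j * a (i + j))"
proof -
  have deg: "degree (q * monom 1 i) \<le> k + i"
    using degree_mult_le[of q "monom 1 i"] degree_monom_le[of "1::'a" i] assms by linarith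
  have "ap a (q * monom 1 i) = (\<Sum>j\<le>k + i. coeff (q * monom 1 i) j * a j)"
    by (rule ap_bound[OF deg])
  also have "\<dots> = (\<Sum>j\<in>{i..k + i}. coeff q (j - i) * a j)"
    by (intro sum.mono_neutral_cong_right) (auto simp: mult.commute[of q] coeff_monom_mult)
  also have "\<dots> = (\<Sum>j\<le>k. coeff q j * a (i + j))"
    by (rule sum.reindex_bij_witness[of _ "\<lambda>j. j + i" "\<lambda>j. j - i"]) (auto simp: add.commute)
  finally show ?thesis .
qed

lemma ap_mult: "ap a (q * u) = ap (\<lambda>i. ap a (q * monom 1 i)) u"
proof -
  have "q * u = (\<Sum>i\<le>degree u. smult (coeff u i) (q * monom 1 i))"
    by (subst poly_as_sum_of_monoms[of u, symmetric])
       (simp add: sum_distrib_left smult_monom flip: mult_smult_right)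
  then have "ap a (q * u) = ap a (\<Sum>i\<le>degree u. smult (coeff u i) (q * monom 1 i))" by simp
  then show ?thesis by (simp only: ap_sum ap_smult) (simp add: ap_def[of _ u])
qed

text \<open>The operator \<open>q\<close> of formal degree \<open>k\<close> annihilates the form with the sequence \<open>a\<close>. As with
  \<open>hev\<close>, the formal degree accounts for the roots of \<open>q\<close> at infinity.\<close>

definition kills :: "nat \<Rightarrow> nat \<Rightarrow> 'a::field poly \<Rightarrow> (nat \<Rightarrow> 'a) \<Rightarrow> bool" where
  "kills d k q a \<longleftrightarrow> (\<forall>i. i + k \<le> d \<longrightarrow> (\<Sum>j\<le>k. coeff q j * a (i + j)) = 0)"

lemma kills_iff:
  fixes q :: "'a::field poly"
  assumes "degree q \<le> k"
  shows "kills d k q a \<longleftrightarrow> (\<forall>u. degree u + k \<le> d \<longrightarrow> ap a (q * u) = 0)"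
proof
  assume *: "kills d k q a"
  show "\<forall>u. degree u + k \<le> d \<longrightarrow> ap a (q * u) = 0"
  proof (intro allI impI)
    fix u :: "'a poly" assume u: "degree u + k \<le> d"
    show "ap a (q * u) = 0"
    proof -
      have "ap a (q * u) = ap (\<lambda>i. \<Sum>j\<le>k. coeff q j * a (i + j)) u"
        by (subst ap_mult) (simp add: ap_mult_monom[OF assms])
      also have "\<dots> = 0"
        unfolding ap_def[of _ u] using * u by (intro sum.neutral) (auto simp: kills_def)
      finally show ?thesis .
    qed
  qed
next
  assume *: "\<forall>u. degree u + k \<le> d \<longrightarrow> ap a (q * u) = 0"
  show "kills d k q a" unfolding kills_def
  proof (intro allI impI)
    fix i assume "i + k \<le> d"
    then have "ap a (q * monom 1 i) = 0" using * by (simp add: degree_monom_eq)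
    then show "(\<Sum>j\<le>k. coeff q j * a (i + j)) = 0" by (simp add: ap_mult_monom[OF assms])
  qed
qed

lemma kills_smult_iff: "c \<noteq> 0 \<Longrightarrow> kills d k (smult c q) a \<longleftrightarrow> kills d k q a"
  by (simp add: kills_def mult.assoc flip: sum_distrib_left)

lemma kills_mult:
  assumes "kills d k q a" "degree q \<le> k" "degree r \<le> l"
  shows "kills d (k + l) (q * r) a"
proof -
  have "degree (q * r) \<le> k + l" using degree_mult_le[of q r] assms by linarith
  moreover have "ap a (q * r * u) = 0" if "degree u + (k + l) \<le> d" for u
  proof -
    have "degree (r * u) + k \<le> d" using degree_mult_le[of r u] assms(3) that by linarith
    then show ?thesis using assms(1) kills_iff[OF assms(2)] by (simp add: mult.assoc)
  qed
  ultimately show ?thesis using kills_iff by blast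
qed

text \<open>The apolarity lemma of Sylvester: a form \<open>w\<close> minus its Lagrange interpolation vanishes at all the
  points, is hence a multiple of the product of the linear forms, and the functional vanishes on it.\<close>

lemma apolar_to_distinct_linear_forms:
  assumes "finite I" "distinct_points I x y" "card I \<le> D + 1"
    "kills D (card I) (\<Prod>i\<in>I. lin (x i) (y i)) a"
  shows "\<exists>\<alpha>. \<forall>w. degree w \<le> D \<longrightarrow> ap a w = (\<Sum>i\<in>I. \<alpha> i * hev D w (x i) (y i))"
proof -
  obtain \<Lambda> where L: "\<And>i. i \<in> I \<Longrightarrow> degree (\<Lambda> i) \<le> D"
    "\<And>i j. i \<in> I \<Longrightarrow> j \<in> I \<Longrightarrow> hev D (\<Lambda> i) (x j) (y j) = (if i = j then 1 else 0)"
    using lagrange_forms[OF assms(1-3)] by metis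
  have "ap a w = (\<Sum>i\<in>I. ap a (\<Lambda> i) * hev D w (x i) (y i))" if w: "degree w \<le> D" for w
  proof -
    define v where "v = w - (\<Sum>i\<in>I. smult (hev D w (x i) (y i)) (\<Lambda> i))"
    have "degree (\<Sum>i\<in>I. smult (hev D w (x i) (y i)) (\<Lambda> i)) \<le> D"
      using L(1) degree_smult_le le_trans by (intro degree_sum_le[OF assms(1)]) blast
    then have "degree v \<le> D" unfolding v_def using w by (rule degree_diff_le[rotated])
    moreover have "hev D v (x j) (y j) = 0" if j: "j \<in> I" for j
    proof -
      have "(\<Sum>i\<in>I. hev D w (x i) (y i) * hev D (\<Lambda> i) (x j) (y j)) =
            (\<Sum>i\<in>I. if i = j then hev D w (x j) (y j) else 0)"
        using L(2) j by (intro sum.cong) auto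
      then show ?thesis unfolding v_def using assms(1) j by (simp add: hev_diff hev_sum hev_smult)
    qed
    ultimately have "v = 0 \<or> (\<exists>q. v = (\<Prod>i\<in>I. lin (x i) (y i)) * q \<and> degree q + card I \<le> D)"
      by (intro vanishing_at_distinct_points[OF assms(1,2)])
    then have "ap a v = 0"
    proof
      assume "\<exists>q. v = (\<Prod>i\<in>I. lin (x i) (y i)) * q \<and> degree q + card I \<le> D"
      then show ?thesis using iffD1[OF kills_iff[OF degree_prod_lin] assms(4)] by auto
    qed simp
    then show ?thesis unfolding v_def by (simp add: ap_diff ap_sum ap_smult mult.commute)
  qed
  then show ?thesis by (intro exI[of _ "\<lambda>i. ap a (\<Lambda> i)"]) auto
qed

section \<open>Dehomogenization\<close>

definition deh :: "'a::field bipoly \<Rightarrow> 'a poly" where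
  "deh p = map_poly (\<lambda>q. poly q 1) p"

lemma coeff_deh: "coeff (deh p) i = poly (coeff p i) 1"
  by (simp add: deh_def coeff_map_poly)

lemma deh_add: "deh (p + q) = deh p + deh q"
  by (simp add: poly_eq_iff coeff_deh)

lemma deh_mult: "deh (p * q) = deh p * deh q"
  by (simp add: poly_eq_iff coeff_deh coeff_mult poly_sum)

lemma deh_0 [simp]: "deh 0 = 0"
  by (simp add: poly_eq_iff coeff_deh)

lemma deh_1 [simp]: "deh 1 = 1"
  by (auto simp: poly_eq_iff coeff_deh one_pCons coeff_pCons split: nat.split)

lemma deh_power: "deh (p ^ n) = deh p ^ n"
  by (induction n) (auto simp: deh_mult)

lemma deh_prod: "deh (\<Prod>i\<in>A. p i) = (\<Prod>i\<in>A. deh (p i))"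
  by (induction A rule: infinite_finite_induct) (auto simp: deh_mult)

lemma deh_sum: "deh (\<Sum>i\<in>A. p i) = (\<Sum>i\<in>A. deh (p i))"
  by (induction A rule: infinite_finite_induct) (auto simp: deh_add)

lemma deh_scale: "deh (scale c p) = smult c (deh p)"
  by (simp add: poly_eq_iff coeff_deh scale_def)

lemma binary_forms_coeff_0: "p \<in> binary_forms d \<Longrightarrow> i + j \<noteq> d \<Longrightarrow> coeff (coeff p i) j = 0"
  unfolding binary_forms_def by blast

lemma binary_forms_coeff_monom:
  assumes "p \<in> binary_forms d"
  shows "coeff p i = (if i \<le> d then monom (coords d p i) (d - i) else 0)"
proof -
  have "coeff (coeff p i) n = 0" if "i + n \<noteq> d" for n
    using assms that by (auto simp: binary_forms_def)
  then show ?thesis by (auto simp: poly_eq_iff coords_def)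
qed

lemma coeff_deh_binary_form:
  assumes "p \<in> binary_forms d"
  shows "coeff (deh p) i = (if i \<le> d then coords d p i else 0)"
  by (simp add: coeff_deh binary_forms_coeff_monom[OF assms] poly_monom)

lemma degree_deh: "p \<in> binary_forms d \<Longrightarrow> degree (deh p) \<le> d"
  by (intro degree_le) (auto simp: coeff_deh_binary_form)

lemma coords_eq_coeff_deh: "p \<in> binary_forms d \<Longrightarrow> coords d p = coeff (deh p)"
proof
  fix i assume p: "p \<in> binary_forms d"
  show "coords d p i = coeff (deh p) i"
    using binary_forms_coeff_monom[OF p, of i] by (cases "i \<le> d") (simp_all add: coeff_deh_binary_form[OF p] coords_def)
qed

definition form_of :: "nat \<Rightarrow> (nat \<Rightarrow> 'a::field) \<Rightarrow> 'a bipoly" where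
  "form_of d a = (\<Sum>i\<le>d. monom (monom (a i) (d - i)) i)"

lemma coeff_form_of: "coeff (form_of d a) i = (if i \<le> d then monom (a i) (d - i) else 0)"
proof -
  have "coeff (form_of d a) i = (\<Sum>j\<le>d. if j = i then monom (a i) (d - i) else 0)"
    unfolding form_of_def coeff_sum by (intro sum.cong) auto
  then show ?thesis by simp
qed

lemma form_of_in_binary_forms: "form_of d a \<in> binary_forms d"
  by (auto simp: binary_forms_def coeff_form_of split: if_splits)

lemma coords_form_of: "coords d (form_of d a) i = (if i \<le> d then a i else 0)"
  by (simp add: coords_def coeff_form_of)

lemma form_of_coords: "p \<in> binary_forms d \<Longrightarrow> form_of d (coords d p) = p"
  by (simp add: poly_eq_iff[of _ p] coeff_form_of binary_forms_coeff_monom)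

lemma deh_inj:
  "p \<in> binary_forms d \<Longrightarrow> q \<in> binary_forms d \<Longrightarrow> deh p = deh q \<Longrightarrow> p = q"
  by (metis coords_eq_coeff_deh form_of_coords)

lemma deh_eq_0_iff: "p \<in> binary_forms d \<Longrightarrow> deh p = 0 \<longleftrightarrow> p = 0"
  using deh_inj[of p d 0] by (auto simp: binary_forms_def)

lemma deh_form_of_coeff: "degree p \<le> d \<Longrightarrow> deh (form_of d (coeff p)) = p"
  by (auto simp: poly_eq_iff coeff_deh coeff_form_of poly_monom coeff_eq_0)

lemma form_of_deh: "p \<in> binary_forms d \<Longrightarrow> form_of d (coeff (deh p)) = p"
  by (metis coords_eq_coeff_deh form_of_coords)

lemma binary_forms_mult:
  assumes "p \<in> binary_forms m" "q \<in> binary_forms n" shows "p * q \<in> binary_forms (m + n)"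
  unfolding binary_forms_def
proof (intro CollectI allI impI)
  fix i j assume "coeff (coeff (p * q) i) j \<noteq> 0"
  then have "(\<Sum>k\<le>i. \<Sum>l\<le>j. coeff (coeff p k) l * coeff (coeff q (i - k)) (j - l)) \<noteq> 0"
    by (simp add: coeff_mult coeff_sum)
  then obtain k where k: "k \<le> i" "(\<Sum>l\<le>j. coeff (coeff p k) l * coeff (coeff q (i - k)) (j - l)) \<noteq> 0"
    by (meson atMost_iff sum.not_neutral_contains_not_neutral)
  then obtain l where l: "l \<le> j" "coeff (coeff p k) l * coeff (coeff q (i - k)) (j - l) \<noteq> 0"
    by (meson atMost_iff sum.not_neutral_contains_not_neutral)
  then have "coeff (coeff p k) l \<noteq> 0" "coeff (coeff q (i - k)) (j - l) \<noteq> 0" by auto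
  then have "k + l = m" "i - k + (j - l) = n" using assms unfolding binary_forms_def by blast+
  then show "i + j = m + n" using k l by linarith
qed

lemma binary_forms_1: "1 \<in> binary_forms 0"
  by (auto simp: binary_forms_def coeff_1 split: if_splits)

lemma binary_forms_power: "p \<in> binary_forms m \<Longrightarrow> p ^ n \<in> binary_forms (n * m)"
  by (induction n) (auto simp: binary_forms_1 intro: binary_forms_mult)

lemma binary_forms_prod:
  "(\<And>i. i \<in> A \<Longrightarrow> p i \<in> binary_forms (e i)) \<Longrightarrow> (\<Prod>i\<in>A. p i) \<in> binary_forms (\<Sum>i\<in>A. e i)"
  by (induction A rule: infinite_finite_induct) (auto simp: binary_forms_1 intro: binary_forms_mult)

lemma binary_forms_0: "0 \<in> binary_forms d"
  by (simp add: binary_forms_def)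

lemma binary_forms_add: "p \<in> binary_forms d \<Longrightarrow> q \<in> binary_forms d \<Longrightarrow> p + q \<in> binary_forms d"
  by (force simp: binary_forms_def)

lemma binary_forms_sum: "(\<And>i. i \<in> A \<Longrightarrow> p i \<in> binary_forms d) \<Longrightarrow> (\<Sum>i\<in>A. p i) \<in> binary_forms d"
  by (induction A rule: infinite_finite_induct) (auto intro: binary_forms_0 binary_forms_add)

section \<open>The differential pairing\<close>

text \<open>These are the values of the operators \<open>\<partial>\<^sub>x ^ i \<partial>\<^sub>y ^ (d - i)\<close> on \<open>f\<close>.\<close>

definition nrm :: "nat \<Rightarrow> 'a::field_char_0 bipoly \<Rightarrow> nat \<Rightarrow> 'a" where
  "nrm d f i = coords d f i * fact i * fact (d - i)"

definition of_nrm :: "nat \<Rightarrow> (nat \<Rightarrow> 'a::field_char_0) \<Rightarrow> 'a bipoly" where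
  "of_nrm d a = form_of d (\<lambda>i. a i / (fact i * fact (d - i)))"

lemma of_nrm_in_binary_forms: "of_nrm d a \<in> binary_forms d"
  by (simp add: of_nrm_def form_of_in_binary_forms)

lemma nrm_of_nrm: "nrm d (of_nrm d a) i = (if i \<le> d then a i else 0)"
  by (simp add: nrm_def of_nrm_def coords_form_of)

lemma of_nrm_nrm: "f \<in> binary_forms d \<Longrightarrow> of_nrm d (nrm d f) = f"
proof -
  assume "f \<in> binary_forms d"
  moreover have "(\<lambda>i. nrm d f i / (fact i * fact (d - i))) = coords d f" by (simp add: nrm_def fun_eq_iff)
  ultimately show ?thesis by (simp add: of_nrm_def form_of_coords)
qed

lemma kills_cong: "(\<And>i. i \<le> d \<Longrightarrow> a i = b i) \<Longrightarrow> kills d k q a \<longleftrightarrow> kills d k q b"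
  unfolding kills_def by (auto intro!: sum.cong)

lemma coeff_iterated_pderiv_0:
  fixes p :: "'b::{comm_semiring_1,semiring_no_zero_divisors} poly"
  shows "coeff ((pderiv ^^ i) p) n = pochhammer (of_nat (n + 1)) i * coeff p (n + i)"
proof (induction i arbitrary: n)
  case (Suc i)
  have "coeff ((pderiv ^^ Suc i) p) n = of_nat (Suc n) * coeff ((pderiv ^^ i) p) (Suc n)"
    by (simp add: coeff_pderiv)
  also have "\<dots> = of_nat (Suc n) * pochhammer (of_nat (Suc n + 1)) i * coeff p (n + Suc i)"
    unfolding Suc.IH by (simp add: mult.assoc)
  also have "of_nat (Suc n) * pochhammer (of_nat (Suc n + 1)) i = (pochhammer (of_nat (n + 1)) (Suc i) :: 'b)"
    by (simp add: pochhammer_rec add_ac)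
  finally show ?case .
qed simp

lemma coeff_iterated_map_pderiv: "coeff ((map_poly pderiv ^^ j) f) i = (pderiv ^^ j) (coeff f i)"
  by (induction j) (auto simp: coeff_map_poly)

lemma apply_operator_same_degree:
  fixes f g :: "complex bipoly"
  assumes g: "g \<in> binary_forms d" and f: "f \<in> binary_forms d"
  shows "apply_operator g f = 0 \<longleftrightarrow> ap (nrm d f) (deh g) = 0"
proof -
  have summand: "scale (coeff (coeff g i) j) ((pderiv ^^ i) ((map_poly pderiv ^^ j) f)) =
      (if i + j = d then [:[:coords d g i * nrm d f i:]:] else 0)" for i j
  proof (cases "i + j = d")
    case False
    then have "coeff (coeff g i) j = 0" using g by (auto simp: binary_forms_def)
    then show ?thesis using False by (simp add: scale_def)
  next
    case True
    have "coeff (coeff ((pderiv ^^ i) ((map_poly pderiv ^^ j) f)) m) l =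
       (if m = 0 \<and> l = 0 then fact i * fact j * coords d f i else 0)" for m l
    proof -
      have poch: "pochhammer (of_nat (m + 1)) i = ([:of_nat (pochhammer (m + 1) i):] :: complex poly)"
        by (simp only: pochhammer_of_nat) (simp only: of_nat_poly)
      have c: "coeff (coeff ((pderiv ^^ i) ((map_poly pderiv ^^ j) f)) m) l =
        of_nat (pochhammer (m + 1) i) * (pochhammer (of_nat (l + 1)) j * coeff (coeff f (m + i)) (l + j))"
        unfolding coeff_iterated_pderiv_0 coeff_iterated_map_pderiv poch by (simp add: coeff_iterated_pderiv_0)
      show ?thesis
      proof (cases "m = 0 \<and> l = 0")
        case False
        then have "coeff (coeff f (m + i)) (l + j) = 0"
          using True by (intro binary_forms_coeff_0[OF f]) linarith
        then show ?thesis unfolding c using False by (simp only: mult_zero_right if_False)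
      next
        case ml: True
        have "of_nat (pochhammer (0 + 1) i) = (fact i :: complex)"
          by (simp add: pochhammer_of_nat[symmetric] pochhammer_fact)
        moreover have "pochhammer (of_nat (0 + 1)) j = (fact j :: complex)" by (simp add: pochhammer_fact)
        moreover have "coords d f i = coeff (coeff f (0 + i)) (0 + j)" using True by (auto simp: coords_def)
        ultimately show ?thesis unfolding c using ml by (simp only: mult.assoc simp_thms if_True)
      qed
    qed
    then have "(pderiv ^^ i) ((map_poly pderiv ^^ j) f) = [:[:fact i * fact j * coords d f i:]:]"
      by (auto simp: poly_eq_iff coeff_pCons split: nat.split)
    moreover have "coeff (coeff g i) j = coords d g i" "d - i = j" using True by (auto simp: coords_def)
    ultimately show ?thesis using True by (simp add: scale_def nrm_def mult_ac)
  qed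
  have "apply_operator g f = (\<Sum>i\<le>degree g. \<Sum>j\<le>degree (coeff g i). if i + j = d then [:[:coords d g i * nrm d f i:]:] else 0)"
    unfolding apply_operator_def summand ..
  also have "\<dots> = (\<Sum>i\<le>degree g. if i \<le> d then [:[:coords d g i * nrm d f i:]:] else 0)"
  proof (intro sum.cong refl)
    fix i
    have "(\<Sum>j\<le>degree (coeff g i). if i + j = d then [:[:coords d g i * nrm d f i:]:] else 0) =
      (\<Sum>j\<le>degree (coeff g i). if j = d - i \<and> i \<le> d then [:[:coords d g i * nrm d f i:]:] else 0)"
      by (intro sum.cong) auto
    also have "\<dots> = (if i \<le> d \<and> d - i \<le> degree (coeff g i) then [:[:coords d g i * nrm d f i:]:] else 0)"
      by (auto simp: sum.delta)
    also have "\<dots> = (if i \<le> d then [:[:coords d g i * nrm d f i:]:] else 0)"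
      by (auto simp: coords_def coeff_eq_0)
    finally show "(\<Sum>j\<le>degree (coeff g i). if i + j = d then [:[:coords d g i * nrm d f i:]:] else 0) =
      (if i \<le> d then [:[:coords d g i * nrm d f i:]:] else 0)" .
  qed
  also have "\<dots> = (\<Sum>i\<le>d. [:[:coords d g i * nrm d f i:]:])"
    by (intro sum.mono_neutral_cong) (auto simp: coords_def coeff_eq_0)
  also have "\<dots> = [:[:\<Sum>i\<le>d. coords d g i * nrm d f i:]:]"
    by (auto simp: poly_eq_iff coeff_sum coeff_pCons split: nat.split)
  also have "(\<Sum>i\<le>d. coords d g i * nrm d f i) = ap (nrm d f) (deh g)"
    by (simp add: ap_bound[OF degree_deh[OF g]] coords_eq_coeff_deh[OF g])
  finally show ?thesis by simp
qed

lemma coords_complexify: "coords d (complexify f) i = of_real (coords d f i)"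
  by (simp add: coords_def complexify_def coeff_map_poly)

lemma complexify_in_binary_forms: "f \<in> binary_forms d \<Longrightarrow> complexify f \<in> binary_forms d"
  by (auto simp: binary_forms_def complexify_def coeff_map_poly)

lemma complexify_eq_0_iff: "complexify f = 0 \<longleftrightarrow> f = 0"
  by (auto simp: poly_eq_iff complexify_def coeff_map_poly)

lemma nrm_complexify: "nrm d (complexify f) i = of_real (nrm d f i)"
  by (simp add: nrm_def coords_complexify)

section \<open>Norms along the roots of a monic polynomial\<close>

definition polycoeff :: "nat set \<Rightarrow> ((nat \<Rightarrow> complex) \<Rightarrow> complex poly) \<Rightarrow> bool" where
  "polycoeff I P \<longleftrightarrow> (\<forall>k. (\<lambda>X. coeff (P X) k) \<in> polyfun I)"

lemma polycoeffD: "polycoeff I P \<Longrightarrow> (\<lambda>X. coeff (P X) k) \<in> polyfun I"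
  by (simp add: polycoeff_def)

lemma polycoeff_const: "polycoeff I (\<lambda>X. p)"
  by (simp add: polycoeff_def polyfun_const)

lemma polycoeff_pCons: "f \<in> polyfun I \<Longrightarrow> polycoeff I P \<Longrightarrow> polycoeff I (\<lambda>X. pCons (f X) (P X))"
  unfolding polycoeff_def
proof
  fix k assume "f \<in> polyfun I" "\<forall>k. (\<lambda>X. coeff (P X) k) \<in> polyfun I"
  then show "(\<lambda>X. coeff (pCons (f X) (P X)) k) \<in> polyfun I" by (cases k) auto
qed

lemma polycoeff_add: "polycoeff I P \<Longrightarrow> polycoeff I Q \<Longrightarrow> polycoeff I (\<lambda>X. P X + Q X)"
  by (simp add: polycoeff_def polyfun_add)

lemma polycoeff_mult: "polycoeff I P \<Longrightarrow> polycoeff I Q \<Longrightarrow> polycoeff I (\<lambda>X. P X * Q X)"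
  by (simp add: polycoeff_def coeff_mult polyfun_sum polyfun_mult)

lemma polycoeff_smult: "f \<in> polyfun I \<Longrightarrow> polycoeff I P \<Longrightarrow> polycoeff I (\<lambda>X. smult (f X) (P X))"
  by (simp add: polycoeff_def polyfun_mult)

lemma polycoeff_power: "polycoeff I P \<Longrightarrow> polycoeff I (\<lambda>X. P X ^ n)"
  by (induction n) (auto intro: polycoeff_const polycoeff_mult)

lemma polycoeff_prod:
  "(\<And>i. i \<in> A \<Longrightarrow> polycoeff I (P i)) \<Longrightarrow> polycoeff I (\<lambda>X. \<Prod>i\<in>A. P i X)"
  by (induction A rule: infinite_finite_induct) (auto intro: polycoeff_const polycoeff_mult)

lemma polycoeff_sum:
  "(\<And>i. i \<in> A \<Longrightarrow> polycoeff I (P i)) \<Longrightarrow> polycoeff I (\<lambda>X. \<Sum>i\<in>A. P i X)"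
  by (induction A rule: infinite_finite_induct) (auto intro: polycoeff_const polycoeff_add)

lemma polycoeff_lin:
  "f \<in> polyfun I \<Longrightarrow> g \<in> polyfun I \<Longrightarrow> polycoeff I (\<lambda>X. lin (f X) (g X))"
  unfolding lin_def by (intro polycoeff_pCons polycoeff_const polyfun_uminus)

lemmas polycoeff_intros = polycoeff_const polycoeff_pCons polycoeff_add polycoeff_mult polycoeff_smult
  polycoeff_power polycoeff_prod polycoeff_sum polycoeff_lin

text \<open>Newton's identities, from the derivative of the product of the \<open>1 - r\<^sub>j T\<close>: each cofactor is the
  product times a geometric series.\<close>

lemma newton_identity:
  fixes r :: "nat \<Rightarrow> complex" and d :: nat
  defines "c \<equiv> coeff (\<Prod>j<d. [:1, - r j:])"
  shows "of_nat (Suc k) * c (Suc k) = - (\<Sum>i\<le>k. c i * (\<Sum>j<d. r j ^ (Suc k - i)))"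
proof -
  let ?P = "\<Prod>j<d. [:1, - r j:]"
  let ?D = "\<lambda>j. \<Prod>i\<in>{..<d} - {j}. [:1, - r i:]"
  have D: "coeff (?D j) k = (\<Sum>i\<le>k. c i * r j ^ (k - i))" if "j < d" for j k
  proof (induction k)
    case 0
    have "?P = [:1, - r j:] * ?D j" using that by (simp add: prod.remove)
    then show ?case unfolding c_def by (simp add: coeff_mult)
  next
    case (Suc k)
    have "?P = [:1, - r j:] * ?D j" using that by (simp add: prod.remove)
    then have "c (Suc k) = coeff (?D j) (Suc k) - r j * coeff (?D j) k" unfolding c_def by simp
    then have "coeff (?D j) (Suc k) = c (Suc k) + (\<Sum>i\<le>k. c i * (r j * r j ^ (k - i)))"
      unfolding Suc.IH by (simp add: sum_distrib_left mult_ac)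
    also have "(\<Sum>i\<le>k. c i * (r j * r j ^ (k - i))) = (\<Sum>i\<le>k. c i * r j ^ (Suc k - i))"
      by (intro sum.cong) (auto simp: Suc_diff_le)
    finally show ?case by simp
  qed
  have "of_nat (Suc k) * c (Suc k) = coeff (pderiv ?P) k" by (simp add: c_def coeff_pderiv)
  also have "pderiv ?P = (\<Sum>j<d. smult (- r j) (?D j))"
    by (simp add: pderiv_prod pderiv_pCons mult.commute)
  also have "coeff \<dots> k = (\<Sum>j<d. - r j * (\<Sum>i\<le>k. c i * r j ^ (k - i)))"
    by (simp add: coeff_sum D)
  also have "\<dots> = - (\<Sum>j<d. \<Sum>i\<le>k. c i * r j ^ (Suc k - i))"
    by (simp add: sum_distrib_left sum_negf Suc_diff_le mult_ac)
  also have "\<dots> = - (\<Sum>i\<le>k. c i * (\<Sum>j<d. r j ^ (Suc k - i)))"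
    by (subst sum.swap) (simp add: sum_distrib_left)
  finally show ?thesis .
qed

lemma coeff_prod_reflect:
  fixes r :: "nat \<Rightarrow> complex"
  shows "coeff (\<Prod>j<d. [:1, - r j:]) k = (if k \<le> d then coeff (\<Prod>j<d. [:- r j, 1:]) (d - k) else 0)"
proof -
  have "reflect_poly [:- r j, 1:] = [:1, - r j:]" for j
    by (auto simp: poly_eq_iff coeff_reflect_poly coeff_pCons split: nat.split)
  then have "(\<Prod>j<d. [:1, - r j:]) = reflect_poly (\<Prod>j<d. [:- r j, 1:])"
    by (simp add: reflect_poly_prod)
  moreover have "degree (\<Prod>j<d. [:- r j, 1:]) = d"
    by (subst degree_prod_eq_sum_degree) auto
  ultimately show ?thesis by (simp add: coeff_reflect_poly)
qed

lemma coeff_prod_last: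
  fixes r :: "nat \<Rightarrow> complex"
  shows "coeff (\<Prod>j<d. [:1, - r j:]) d = (-1) ^ d * (\<Prod>j<d. r j)"
proof -
  have "coeff (\<Prod>j<d. [:1, - r j:]) d = poly (\<Prod>j<d. [:- r j, 1:]) 0"
    by (simp add: coeff_prod_reflect poly_0_coeff_0)
  also have "\<dots> = (\<Prod>j<d. - 1 * r j)" by (simp add: poly_prod)
  finally show ?thesis by (simp only: prod.distrib) simp
qed

lemma coeff_prod_0: "coeff (\<Prod>j<d. [:1, - r j:]) 0 = (1 :: complex)" for d :: nat
  by (simp add: poly_prod flip: poly_0_coeff_0)

text \<open>Newton's identities are solved for the power sums.\<close>

lemma power_sums_of_roots_polyfun:
  fixes d :: nat
  assumes "polycoeff I Q" "\<And>X. Q X = (\<Prod>j<d. [:- r X j, 1:])"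
  shows "(\<lambda>X. \<Sum>j<d. r X j ^ m) \<in> polyfun I"
proof (induction m rule: less_induct)
  case (less m)
  define c where "c X k = coeff (\<Prod>j<d. [:1, - r X j:]) k" for X k
  have c: "(\<lambda>X. c X k) \<in> polyfun I" for k
    using polycoeffD[OF assms(1), of "d - k"]
    unfolding c_def coeff_prod_reflect assms(2)[symmetric] by (cases "k \<le> d") (auto intro: polyfun_const)
  show ?case
  proof (cases m)
    case 0 then show ?thesis by (simp add: polyfun_const)
  next
    case (Suc k)
    have "(\<Sum>j<d. r X j ^ m) = - of_nat (Suc k) * c X (Suc k) - (\<Sum>i\<in>{1..k}. c X i * (\<Sum>j<d. r X j ^ (Suc k - i)))" for X
    proof -
      have "{..k} = insert 0 {1..k}" by auto
      then have "(\<Sum>i\<le>k. c X i * (\<Sum>j<d. r X j ^ (Suc k - i))) =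
        (\<Sum>j<d. r X j ^ m) + (\<Sum>i\<in>{1..k}. c X i * (\<Sum>j<d. r X j ^ (Suc k - i)))"
        using Suc by (simp add: c_def coeff_prod_0)
      then have eq: "of_nat (Suc k) * c X (Suc k) =
          - ((\<Sum>j<d. r X j ^ m) + (\<Sum>i\<in>{1..k}. c X i * (\<Sum>j<d. r X j ^ (Suc k - i))))"
        using newton_identity[where k = k and d = d and r = "r X"] unfolding c_def[symmetric] by (simp only:)
      show ?thesis unfolding mult_minus_left eq by simp
    qed
    moreover have "(\<lambda>X. - of_nat (Suc k) * c X (Suc k) - (\<Sum>i\<in>{1..k}. c X i * (\<Sum>j<d. r X j ^ (Suc k - i)))) \<in> polyfun I"
    proof (intro polyfun_diff polyfun_mult[OF polyfun_const c])
      show "(\<lambda>X. \<Sum>i\<in>{1..k}. c X i * (\<Sum>j<d. r X j ^ (Suc k - i))) \<in> polyfun I"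
      proof (rule polyfun_sum, rule polyfun_mult[OF c])
        fix i assume "i \<in> {1..k}"
        then show "(\<lambda>X. \<Sum>j<d. r X j ^ (Suc k - i)) \<in> polyfun I" using Suc by (intro less) auto
      qed
    qed
    ultimately show ?thesis by simp
  qed
qed

text \<open>Newton's identities are solved for the elementary symmetric functions, the last of which is the
  product.\<close>

lemma prod_polyfun_of_power_sums:
  fixes d :: nat
  assumes "\<And>m. (\<lambda>X. \<Sum>j<d. Y X j ^ m) \<in> polyfun I"
  shows "(\<lambda>X. \<Prod>j<d. Y X j) \<in> polyfun I"
proof -
  define c where "c X k = coeff (\<Prod>j<d. [:1, - Y X j:]) k" for X k
  have "(\<lambda>X. c X k) \<in> polyfun I" for k
  proof (induction k rule: less_induct)
    case (less k)
    show ?case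
    proof (cases k)
      case 0 then show ?thesis by (simp add: c_def coeff_prod_0 polyfun_const)
    next
      case (Suc l)
      have "c X k = (- 1 / of_nat (Suc l)) * (\<Sum>i\<le>l. c X i * (\<Sum>j<d. Y X j ^ (Suc l - i)))" for X
      proof -
        have "of_nat (Suc l) \<noteq> (0 :: complex)" by (simp only: of_nat_eq_0_iff)
        then show ?thesis
          using newton_identity[where k = l and d = d and r = "Y X"] Suc unfolding c_def[symmetric]
          by (simp add: field_simps del: of_nat_Suc)
      qed
      moreover have "(\<lambda>X. (- 1 / of_nat (Suc l)) * (\<Sum>i\<le>l. c X i * (\<Sum>j<d. Y X j ^ (Suc l - i)))) \<in> polyfun I"
      proof (rule polyfun_mult[OF polyfun_const], rule polyfun_sum, rule polyfun_mult[OF _ assms])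
        fix i assume "i \<in> {..l}"
        then show "(\<lambda>X. c X i) \<in> polyfun I" using Suc by (intro less) auto
      qed
      ultimately show ?thesis by simp
    qed
  qed
  then have "(\<lambda>X. (-1) ^ d * c X d) \<in> polyfun I" by (intro polyfun_mult polyfun_const)
  moreover have "(-1) ^ d * c X d = (\<Prod>j<d. Y X j)" for X
    unfolding c_def coeff_prod_last by (simp flip: mult.assoc power_mult_distrib)
  ultimately show ?thesis by simp
qed

text \<open>The power sums of the values \<open>E (X(v := r X j))\<close> are combinations of the power sums of the roots,
  and the product of the values is a polynomial in their power sums.\<close>

lemma norm_polyfun:
  fixes d :: nat
  assumes Q: "polycoeff I Q" "\<And>X. Q X = (\<Prod>j<d. [:- r X j, 1:])" and v: "v \<notin> I"
    and E: "E \<in> polyfun (insert v I)"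
  shows "(\<lambda>X. \<Prod>j<d. E (X(v := r X j))) \<in> polyfun I"
proof (rule prod_polyfun_of_power_sums)
  fix m
  obtain P n where P: "\<And>k. (\<lambda>X. coeff (P X) k) \<in> polyfun I" "\<And>X. degree (P X) \<le> n"
     "(\<lambda>X. E X ^ m) = (\<lambda>X. poly (P X) (X v))"
    using polyfun_expand_variable[OF polyfun_power[OF E, of m]] by blast
  have Pv: "P (X(v := t)) = P X" for X t
    using v by (auto simp: poly_eq_iff intro!: polyfun_cong[OF P(1)])
  have "(\<Sum>j<d. E (X(v := r X j)) ^ m) = (\<Sum>k\<le>n. coeff (P X) k * (\<Sum>j<d. r X j ^ k))" for X
  proof -
    have "E (X(v := t)) ^ m = (\<Sum>k\<le>n. coeff (P X) k * t ^ k)" for t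
    proof -
      have "E (X(v := t)) ^ m = poly (P X) t" using fun_cong[OF P(3), of "X(v := t)"] by (simp add: Pv)
      also have "\<dots> = (\<Sum>k\<le>n. coeff (P X) k * t ^ k)"
        unfolding poly_altdef using P(2)[of X] by (intro sum.mono_neutral_left) (auto simp: coeff_eq_0)
      finally show ?thesis .
    qed
    then have "(\<Sum>j<d. E (X(v := r X j)) ^ m) = (\<Sum>j<d. \<Sum>k\<le>n. coeff (P X) k * r X j ^ k)" by simp
    also have "\<dots> = (\<Sum>k\<le>n. coeff (P X) k * (\<Sum>j<d. r X j ^ k))"
      by (subst sum.swap) (simp add: sum_distrib_left)
    finally show ?thesis .
  qed
  moreover have "(\<lambda>X. \<Sum>k\<le>n. coeff (P X) k * (\<Sum>j<d. r X j ^ k)) \<in> polyfun I"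
    by (intro polyfun_sum polyfun_mult P(1) power_sums_of_roots_polyfun[OF Q])
  ultimately show "(\<lambda>X. \<Sum>j<d. E (X(v := r X j)) ^ m) \<in> polyfun I" by simp
qed

definition monic_of :: "nat \<Rightarrow> (nat \<Rightarrow> complex) \<Rightarrow> complex poly" where
  "monic_of d X = monom 1 d + (\<Sum>i<d. monom (X i) i)"

lemma coeff_monic_of: "coeff (monic_of d X) k = (if k < d then X k else if k = d then 1 else 0)"
proof -
  have "coeff (\<Sum>i<d. monom (X i) i) k = (\<Sum>i<d. if i = k then X k else 0)"
    unfolding coeff_sum by (intro sum.cong) auto
  then show ?thesis by (auto simp: monic_of_def)
qed

lemma polycoeff_monic_of: "{..<d} \<subseteq> I \<Longrightarrow> polycoeff I (monic_of d)"
  unfolding polycoeff_def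
proof
  fix k assume "{..<d} \<subseteq> I"
  then show "(\<lambda>X. coeff (monic_of d X) k) \<in> polyfun I"
    by (cases "k < d"; cases "k = d") (auto simp: coeff_monic_of intro: polyfun_const polyfun_coord)
qed

lemma monic_of_roots: "\<exists>r. \<forall>X. monic_of d X = (\<Prod>j<d. [:- r X j, 1:])"
proof -
  have "\<exists>s. monic_of d X = (\<Prod>j<d. [:- s j, 1:])" for X
  proof -
    have "degree (monic_of d X) = d"
      by (intro antisym degree_le le_degree) (auto simp: coeff_monic_of)
    moreover obtain root where "smult (lead_coeff (monic_of d X)) (\<Prod>i<degree (monic_of d X). [:-root i, 1:]) = monic_of d X"
      by (rule complex_poly_decompose')
    ultimately show ?thesis by (auto simp: coeff_monic_of intro!: exI[of _ root])
  qed
  then show ?thesis by metis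
qed

text \<open>The norm is taken one variable at a time: being zero somewhere on the tuples of roots is a
  polynomial condition on the coefficients.\<close>

lemma iterated_norm:
  assumes "E \<in> polyfun {..<d + n}"
  shows "\<exists>N \<in> polyfun {..<d}. \<forall>X. N X = 0 \<longleftrightarrow>
     (\<exists>t. (\<forall>i<n. poly (monic_of d X) (t i) = 0) \<and> E (\<lambda>i. if i < d then X i else t (i - d)) = 0)"
  using assms
proof (induction n arbitrary: E)
  case 0
  have "E (\<lambda>i. if i < d then X i else t (i - d)) = E X" for X t
    by (rule polyfun_cong[OF 0]) auto
  then show ?case using 0 by (intro bexI[of _ E]) auto
next
  case (Suc n)
  obtain r where r: "\<And>X. monic_of d X = (\<Prod>j<d. [:- r X j, 1:])" using monic_of_roots by metis
  have root: "poly (monic_of d X) s = 0 \<longleftrightarrow> (\<exists>j<d. s = r X j)" for X s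
    unfolding r poly_prod by auto
  define E' where "E' = (\<lambda>X. \<Prod>j<d. E (X(d + n := r X j)))"
  have "{..<d + Suc n} = insert (d + n) {..<d + n}" by auto
  then have "E' \<in> polyfun {..<d + n}"
    unfolding E'_def using Suc.prems by (intro norm_polyfun[OF polycoeff_monic_of r]) auto
  then obtain N where N: "N \<in> polyfun {..<d}" "\<And>X. N X = 0 \<longleftrightarrow>
     (\<exists>t. (\<forall>i<n. poly (monic_of d X) (t i) = 0) \<and> E' (\<lambda>i. if i < d then X i else t (i - d)) = 0)"
    using Suc.IH by blast
  have "N X = 0 \<longleftrightarrow> (\<exists>t. (\<forall>i<Suc n. poly (monic_of d X) (t i) = 0) \<and> E (\<lambda>i. if i < d then X i else t (i - d)) = 0)"
    (is "_ \<longleftrightarrow> ?R") for X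
  proof -
    let ?X = "\<lambda>t i. if i < d then X i else t (i - d)"
    have mX: "monic_of d (?X t) = monic_of d X" for t by (auto simp: poly_eq_iff coeff_monic_of)
    have E'0: "E' (?X t) = 0 \<longleftrightarrow> (\<exists>s. poly (monic_of d X) s = 0 \<and> E ((?X t)(d + n := s)) = 0)" for t
      unfolding E'_def using root[of "?X t"] unfolding mX by auto
    show ?thesis unfolding N(2) E'0
    proof
      assume "\<exists>t. (\<forall>i<n. poly (monic_of d X) (t i) = 0) \<and> (\<exists>s. poly (monic_of d X) s = 0 \<and> E ((?X t)(d + n := s)) = 0)"
      then obtain t s where ts: "\<And>i. i < n \<Longrightarrow> poly (monic_of d X) (t i) = 0" "poly (monic_of d X) s = 0"
        "E ((?X t)(d + n := s)) = 0" by blast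
      have "E (?X (t(n := s))) = E ((?X t)(d + n := s))"
        by (rule polyfun_cong[OF Suc.prems]) auto
      then show ?R using ts by (intro exI[of _ "t(n := s)"]) (auto simp: less_Suc_eq)
    next
      assume ?R
      then obtain t where t: "\<And>i. i < Suc n \<Longrightarrow> poly (monic_of d X) (t i) = 0" "E (?X t) = 0" by blast
      have "(?X t)(d + n := t n) = ?X t" by auto
      then show "\<exists>t. (\<forall>i<n. poly (monic_of d X) (t i) = 0) \<and> (\<exists>s. poly (monic_of d X) s = 0 \<and> E ((?X t)(d + n := s)) = 0)"
        using t by (intro exI[of _ t]) (auto intro!: exI[of _ "t n"])
    qed
  qed
  then show ?case using N(1) by blast
qed

section \<open>Coincident root loci are closed\<close>

definition rootprod :: "nat \<Rightarrow> (nat \<Rightarrow> nat) \<Rightarrow> (nat \<Rightarrow> 'a) \<Rightarrow> (nat \<Rightarrow> 'a) \<Rightarrow> 'a::field poly" where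
  "rootprod n e x y = (\<Prod>i<n. lin (x i) (y i) ^ e i)"

lemma degree_rootprod: "degree (rootprod n e x y) \<le> (\<Sum>i<n. e i)"
  unfolding rootprod_def by (rule degree_prod_lin_power)

lemma rootprod_monic:
  assumes "\<And>i. i < n \<Longrightarrow> y i \<noteq> 0"
  shows "rootprod n e x y = smult (\<Prod>i<n. y i ^ e i) (rootprod n e (\<lambda>i. x i / y i) (\<lambda>_. 1))"
proof -
  have "lin (x i) (y i) = smult (y i) (lin (x i / y i) 1)" if "i < n" for i
    using assms[OF that] by (simp add: lin_def)
  then have "rootprod n e x y = (\<Prod>i<n. smult (y i ^ e i) (lin (x i / y i) 1 ^ e i))"
    unfolding rootprod_def by (intro prod.cong) (auto simp: smult_power)
  then show ?thesis unfolding rootprod_def by (simp add: prod_smult)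
qed

lemma rootprod_unit_leading:
  "coeff (rootprod n e x (\<lambda>_. 1)) (\<Sum>i<n. e i) = 1"
  "degree (rootprod n e x (\<lambda>_. 1)) = (\<Sum>i<n. e i)"
proof -
  have nz: "lin (x i) 1 ^ e i \<noteq> 0" for i by (simp add: lin_eq_0_iff)
  have "degree (rootprod n e x (\<lambda>_. 1)) = (\<Sum>i<n. degree (lin (x i) 1 ^ e i))"
    unfolding rootprod_def by (rule degree_prod_eq_sum_degree) (use nz in blast)
  also have "\<dots> = (\<Sum>i<n. e i)"
    by (intro sum.cong refl) (simp add: degree_power_eq lin_eq_0_iff, simp add: lin_def)
  finally show d: "degree (rootprod n e x (\<lambda>_. 1)) = (\<Sum>i<n. e i)" .
  have "lead_coeff (rootprod n e x (\<lambda>_. 1)) = 1"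
    unfolding rootprod_def lead_coeff_prod by (simp add: lead_coeff_power) (simp add: lin_def)
  then show "coeff (rootprod n e x (\<lambda>_. 1)) (\<Sum>i<n. e i) = 1" using d by simp
qed

lemma coeff_rootprod_top:
  "coeff (rootprod n e x y) (\<Sum>i<n. e i) = (\<Prod>i<n. y i ^ e i)"
proof -
  have "hev (\<Sum>i<n. e i) (rootprod n e x y) 1 0 = (\<Prod>i<n. hev (e i) (lin (x i) (y i) ^ e i) 1 0)"
    unfolding rootprod_def by (intro hev_prod degree_lin_power)
  moreover have "coeff (lin a b ^ k) k = b ^ k" for a b :: 'a and k
  proof (induction k)
    case (Suc k)
    have "coeff (lin a b * lin a b ^ k) (1 + k) = coeff (lin a b) 1 * coeff (lin a b ^ k) k"
      by (rule coeff_mult_at_bounds[OF degree_lin degree_lin_power])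
    then show ?case using Suc by (simp add: lin_def)
  qed simp
  ultimately show ?thesis by (simp add: hev_infinity)
qed

text \<open>A polynomial \<open>q\<close> has the root pattern \<open>e\<close> if and only if it is equal to one of the products that
  can be formed from tuples \<open>t\<close> of its own roots. As \<open>p\<close> differs from all the finitely many products
  of this kind, one linear functional \<open>w\<close> tells it from all of them. The norm of the difference of
  the values of \<open>w\<close>, taken over all tuples of roots, is the equation sought.\<close>

lemma root_locus_equation_monic:
  assumes e: "\<And>i. i < n \<Longrightarrow> e i \<ge> 1" and d: "(\<Sum>i<n. e i) = d"
    and p: "coeff p d = 1" "degree p \<le> d" "\<And>t. p \<noteq> rootprod n e t (\<lambda>_. 1)"
  shows "\<exists>N \<in> polyfun {..<d}. N (coeff p) \<noteq> 0 \<and> (\<forall>t. N (coeff (rootprod n e t (\<lambda>_. 1))) = 0)"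
proof -
  have pm: "monic_of d (coeff p) = p"
    using p(1,2) by (auto simp: poly_eq_iff coeff_monic_of coeff_eq_0)
  then have pnz: "p \<noteq> 0" using p(1) by auto
  define T where "T = PiE {..<n} (\<lambda>_. {s. poly p s = 0})"
  have fin: "finite T" unfolding T_def using poly_roots_finite[OF pnz] by (intro finite_PiE) auto
  have ex: "\<exists>w. (\<Sum>i<d. w i * (coeff p i - coeff (rootprod n e t (\<lambda>_. 1)) i)) \<noteq> 0" for t
  proof -
    obtain i where i: "coeff p i \<noteq> coeff (rootprod n e t (\<lambda>_. 1)) i" using p(3)[of t] by (auto simp: poly_eq_iff)
    have "i < d"
    proof (rule ccontr)
      assume "\<not> i < d"
      then consider "i = d" | "i > d" by linarith
      then show False using i p(1,2) rootprod_unit_leading[where n=n and e=e and x=t] d by cases (auto simp: coeff_eq_0)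
    qed
    then have "(\<Sum>j<d. (if j = i then 1 else 0) * (coeff p j - coeff (rootprod n e t (\<lambda>_. 1)) j)) =
       coeff p i - coeff (rootprod n e t (\<lambda>_. 1)) i"
      by (simp add: if_distrib[of "\<lambda>a. a * _"] cong: if_cong)
    then show ?thesis using i by (intro exI[of _ "\<lambda>j. if j = i then 1 else 0"]) simp
  qed
  have "\<exists>w. (\<Prod>t\<in>T. \<Sum>i<d. w i * (coeff p i - coeff (rootprod n e t (\<lambda>_. 1)) i)) \<noteq> 0"
    by (rule polyfun_prod_nonzero[OF fin, where I = UNIV]) (rule polyfun_intros UNIV_I ex)+
  then obtain w where "(\<Prod>t\<in>T. \<Sum>i<d. w i * (coeff p i - coeff (rootprod n e t (\<lambda>_. 1)) i)) \<noteq> 0"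
    by blast
  then have w: "(\<Sum>i<d. w i * (coeff p i - coeff (rootprod n e t (\<lambda>_. 1)) i)) \<noteq> 0" if "t \<in> T" for t
    using that fin by auto
  define E where "E = (\<lambda>X. \<Sum>i<d. w i * (X i - coeff (rootprod n e (\<lambda>j. X (d + j)) (\<lambda>_. 1)) i))"
  have "polycoeff {..<d + n} (\<lambda>X. rootprod n e (\<lambda>j. X (d + j)) (\<lambda>_. 1))"
    unfolding rootprod_def by (intro polycoeff_intros polyfun_intros) auto
  then have E: "E \<in> polyfun {..<d + n}"
    unfolding E_def by (intro polyfun_sum polyfun_mult polyfun_diff polyfun_const polycoeffD polyfun_coord) auto
  obtain N where N1: "N \<in> polyfun {..<d}" and N2: "\<forall>X. N X = 0 \<longleftrightarrow>
     (\<exists>t. (\<forall>i<n. poly (monic_of d X) (t i) = 0) \<and> E (\<lambda>i. if i < d then X i else t (i - d)) = 0)"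
    using iterated_norm[OF E] by (elim bexE) (rule that)
  note N = N1 N2[rule_format]
  have Ev: "E (\<lambda>i. if i < d then X i else t (i - d)) = (\<Sum>i<d. w i * (X i - coeff (rootprod n e t (\<lambda>_. 1)) i))" for X t
    unfolding E_def by simp
  have rc: "rootprod n e (restrict t {..<n}) y = rootprod n e t y" for t y :: "nat \<Rightarrow> complex"
    unfolding rootprod_def by (intro prod.cong) auto
  have "N (coeff p) \<noteq> 0"
  proof
    assume "N (coeff p) = 0"
    then obtain t where t: "\<And>i. i < n \<Longrightarrow> poly p (t i) = 0"
      "(\<Sum>i<d. w i * (coeff p i - coeff (rootprod n e t (\<lambda>_. 1)) i)) = 0"
      unfolding N(2) Ev pm by blast
    have "restrict t {..<n} \<in> T" unfolding T_def using t(1) by auto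
    then show False using w[of "restrict t {..<n}"] t(2) by (simp add: rc)
  qed
  moreover have "N (coeff (rootprod n e t (\<lambda>_. 1))) = 0" for t
  proof -
    let ?q = "rootprod n e t (\<lambda>_. 1)"
    have qm: "monic_of d (coeff ?q) = ?q"
      using rootprod_unit_leading[where n=n and e=e and x=t] d by (auto simp: poly_eq_iff coeff_monic_of coeff_eq_0)
    have "poly ?q (t i) = 0" if i: "i < n" for i
      unfolding rootprod_def poly_prod using i e[OF i] by (auto simp: lin_def intro!: bexI[of _ i])
    then show ?thesis unfolding N(2) Ev qm by (intro exI[of _ t]) auto
  qed
  ultimately show ?thesis using N(1) by blast
qed

text \<open>The additional factor \<open>X d\<close> makes the form vanish on all polynomials with a root at infinity.\<close>

lemma homogenization:
  assumes "N \<in> polyfun {..<d}"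
  shows "\<exists>k F. hpoly {..d} (Suc k) F \<and> (\<forall>X. F X = X d ^ Suc k * N (\<lambda>i. X i / X d))"
proof -
  obtain h M where h: "\<And>k. hpoly {..<d} k (h k)" "N = (\<lambda>X. \<Sum>k\<le>M. h k X)"
    using polyfun_decompose[OF assms] by blast
  define F where "F = (\<lambda>X. X d * (\<Sum>k\<le>M. h k X * X d ^ (M - k)))"
  have "hpoly {..d} M (\<lambda>X. \<Sum>k\<le>M. h k X * X d ^ (M - k))"
  proof (rule hpoly_sum)
    fix k assume "k \<in> {..M}"
    moreover have "hpoly {..d} (k + (M - k)) (\<lambda>X. h k X * X d ^ (M - k))"
      by (intro hpoly_mult hpoly_coord_power hpoly_mono[OF h(1)]) auto
    ultimately show "hpoly {..d} M (\<lambda>X. h k X * X d ^ (M - k))" by simp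
  qed
  from hpoly_mult[OF hpoly_coord this, of d] have "hpoly {..d} (Suc M) F" unfolding F_def by simp
  moreover have "F X = X d ^ Suc M * N (\<lambda>i. X i / X d)" for X
  proof (cases "X d = 0")
    case False
    have "h k X * X d ^ (M - k) = X d ^ M * h k (\<lambda>i. X i / X d)" if "k \<le> M" for k
    proof -
      have "h k (\<lambda>i. X i / X d) = inverse (X d) ^ k * h k X"
        using hpoly_scale[OF h(1), of k "inverse (X d)" X] by (simp add: field_simps)
      moreover have "X d ^ M = X d ^ (M - k) * X d ^ k" using that by (simp flip: power_add)
      ultimately show ?thesis using False by (simp add: power_inverse)
    qed
    then show ?thesis unfolding F_def h(2) by (simp add: sum_distrib_left mult.assoc)
  qed (simp add: F_def)
  ultimately show ?thesis by blast
qed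

text \<open>The form of degree \<open>d\<close> that results from the substitution of \<open>\<eta> + \<tau> \<xi>\<close> for \<open>\<eta>\<close>. It moves the
  point at infinity.\<close>

definition shear :: "nat \<Rightarrow> complex \<Rightarrow> complex poly \<Rightarrow> complex poly" where
  "shear d \<tau> p = (\<Sum>i\<le>d. smult (coeff p i) (monom 1 i * [:1, \<tau>:] ^ (d - i)))"

lemma degree_shear_summand: "i \<le> d \<Longrightarrow> degree (monom 1 i * [:1, \<tau>:] ^ (d - i)) \<le> d" for \<tau> :: complex
proof -
  assume i: "i \<le> d"
  have "degree (monom 1 i * [:1, \<tau>:] ^ (d - i)) \<le> i + (d - i)"
    using degree_mult_le[of "monom 1 i" "[:1, \<tau>:] ^ (d - i)"] degree_monom_le[of "1 :: complex" i]
      degree_lin_power[of "-1" \<tau> "d - i"] by (simp add: lin_def)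
  then show ?thesis using i by simp
qed

lemma degree_shear: "degree (shear d \<tau> p) \<le> d"
  unfolding shear_def
  by (intro degree_sum_le) (auto intro: order_trans[OF degree_smult_le] degree_shear_summand)

lemma hev_shear: "hev d (shear d \<tau> p) \<xi> \<eta> = hev d p \<xi> (\<eta> + \<tau> * \<xi>)"
proof -
  have "hev d (monom 1 i * [:1, \<tau>:] ^ (d - i)) \<xi> \<eta> = \<xi> ^ i * (\<eta> + \<tau> * \<xi>) ^ (d - i)" if i: "i \<le> d" for i
  proof -
    have lin: "[:1, \<tau>:] = lin (-1) \<tau>" by (simp add: lin_def)
    have "hev (i + (d - i)) (monom 1 i * lin (-1) \<tau> ^ (d - i)) \<xi> \<eta> =
       hev i (monom 1 i) \<xi> \<eta> * hev (d - i) (lin (-1) \<tau> ^ (d - i)) \<xi> \<eta>"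
      by (intro hev_mult degree_monom_le degree_lin_power)
    moreover have "hev i (monom 1 i) \<xi> \<eta> = \<xi> ^ i"
    proof -
      have "hev i (monom 1 i) \<xi> \<eta> = (\<Sum>j\<le>i. if j = i then \<xi> ^ i else 0)"
        unfolding hev_def by (intro sum.cong) auto
      then show ?thesis by simp
    qed
    moreover have "hev m (lin (-1) \<tau> ^ m) \<xi> \<eta> = (\<eta> + \<tau> * \<xi>) ^ m" for m
      using hev_prod_lin[of "{..<m}" "\<lambda>_. -1" "\<lambda>_. \<tau>" \<xi> \<eta>] by (simp add: add.commute)
    ultimately show ?thesis using i lin by simp
  qed
  then show ?thesis unfolding shear_def hev_sum hev_smult
    by (simp add: hev_def[of d p] mult.assoc)
qed

lemma hev_inject:
  fixes p q :: "complex poly"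
  assumes "degree p \<le> d" "degree q \<le> d" "\<And>\<xi> \<eta>. hev d p \<xi> \<eta> = hev d q \<xi> \<eta>" shows "p = q"
proof -
  have "poly p \<xi> = poly q \<xi>" for \<xi>
    using assms(3)[of \<xi> 1] hev_affine[of 1 p d \<xi>] hev_affine[of 1 q d \<xi>] assms(1,2) by simp
  then show ?thesis by (auto simp flip: poly_eq_poly_eq_iff)
qed

lemma hev_rootprod: "hev (\<Sum>i<n. e i) (rootprod n e x y) \<xi> \<eta> = (\<Prod>i<n. (y i * \<xi> - x i * \<eta>) ^ e i)"
proof -
  have "hev (e i) (lin (x i) (y i) ^ e i) \<xi> \<eta> = (y i * \<xi> - x i * \<eta>) ^ e i" for i
    using hev_prod_lin[of "{..<e i}" "\<lambda>_. x i" "\<lambda>_. y i" \<xi> \<eta>] by simp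
  then show ?thesis unfolding rootprod_def by (subst hev_prod) (auto intro: degree_lin_power)
qed

lemma shear_rootprod:
  assumes "(\<Sum>i<n. e i) = d"
  shows "shear d \<tau> (smult c (rootprod n e x y)) = smult c (rootprod n e x (\<lambda>i. y i - \<tau> * x i))"
proof (rule hev_inject[of _ d])
  show "degree (smult c (rootprod n e x (\<lambda>i. y i - \<tau> * x i))) \<le> d"
    using degree_rootprod[of n e x] assms degree_smult_le le_trans by blast
  show "hev d (shear d \<tau> (smult c (rootprod n e x y))) \<xi> \<eta> =
        hev d (smult c (rootprod n e x (\<lambda>i. y i - \<tau> * x i))) \<xi> \<eta>" for \<xi> \<eta>
  proof -
    have h: "hev d (rootprod n e x y) \<xi> \<eta> = (\<Prod>i<n. (y i * \<xi> - x i * \<eta>) ^ e i)" for x y \<xi> \<eta>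
      using hev_rootprod[of e n x y \<xi> \<eta>] assms by simp
    show ?thesis unfolding hev_shear hev_smult h by (simp add: algebra_simps)
  qed
qed (rule degree_shear)

lemma shear_inverse: "degree p \<le> d \<Longrightarrow> shear d (- \<tau>) (shear d \<tau> p) = p"
  by (rule hev_inject[of _ d]) (auto simp: degree_shear hev_shear)

lemma hpoly_compose_linear:
  "hpoly I k f \<Longrightarrow> (\<And>i. i \<in> I \<Longrightarrow> hpoly J (Suc 0) (g i)) \<Longrightarrow> hpoly J k (\<lambda>x. f (\<lambda>i. g i x))"
  by (induction rule: hpoly.induct) (auto intro: hpoly.intros)

text \<open>After a general shear \<open>p\<close> has no root at infinity, and the equation of the monic case can be
  homogenized.\<close>

lemma root_locus_equation:
  assumes e: "\<And>i. i < n \<Longrightarrow> e i \<ge> 1" and d: "(\<Sum>i<n. e i) = d"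
    and p: "p \<noteq> 0" "degree p \<le> d" "\<And>c x y. p \<noteq> smult c (rootprod n e x y)"
  shows "\<exists>k F. hpoly {..d} k F \<and> F (coeff p) \<noteq> 0 \<and> (\<forall>c x y. F (coeff (smult c (rootprod n e x y))) = 0)"
proof -
  have "(\<Sum>i\<le>d. monom (coeff p i) (d - i)) \<noteq> 0"
  proof
    assume 0: "(\<Sum>i\<le>d. monom (coeff p i) (d - i)) = 0"
    have "coeff p j = 0" if "j \<le> d" for j
    proof -
      have "coeff (\<Sum>i\<le>d. monom (coeff p i) (d - i)) (d - j) = (\<Sum>i\<le>d. if i = j then coeff p j else 0)"
        unfolding coeff_sum using that by (intro sum.cong) (auto simp: )
      then show ?thesis using 0 that by simp
    qed
    then have "p = 0" using p(2) by (metis leading_coeff_0_iff)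
    then show False using p(1) by simp
  qed
  then have "finite {t. poly (\<Sum>i\<le>d. monom (coeff p i) (d - i)) t = 0}" by (rule poly_roots_finite)
  then have "{t. poly (\<Sum>i\<le>d. monom (coeff p i) (d - i)) t = 0} \<noteq> UNIV"
    using infinite_UNIV_char_0[where 'a=complex] by metis
  then obtain \<tau> where "poly (\<Sum>i\<le>d. monom (coeff p i) (d - i)) \<tau> \<noteq> 0" by blast
  then have "hev d p 1 \<tau> \<noteq> 0" by (simp add: hev_def poly_sum poly_monom)
  moreover define q where "q = shear d \<tau> p"
  ultimately have a: "coeff q d \<noteq> 0" using hev_shear[of d \<tau> p 1 0] by (simp add: hev_infinity)
  define a where "a = coeff q d"
  define q1 where "q1 = smult (1 / a) q"
  have "degree q \<le> d" unfolding q_def by (rule degree_shear)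
  then have q1: "coeff q1 d = 1" "degree q1 \<le> d" using a by (auto simp: q1_def a_def)
  have "q1 \<noteq> rootprod n e t (\<lambda>_. 1)" for t
  proof
    assume "q1 = rootprod n e t (\<lambda>_. 1)"
    moreover have "q = smult a q1" using a by (simp add: q1_def a_def)
    ultimately have "q = smult a (rootprod n e t (\<lambda>_. 1))" by simp
    then have "p = smult a (rootprod n e t (\<lambda>i. 1 - (- \<tau>) * t i))"
      using shear_inverse[OF p(2), of \<tau>] shear_rootprod[OF d, of "- \<tau>" a t "\<lambda>_. 1"] by (simp add: q_def)
    then show False using p(3) by blast
  qed
  then obtain N where N: "N \<in> polyfun {..<d}" "N (coeff q1) \<noteq> 0"
    "\<And>t. N (coeff (rootprod n e t (\<lambda>_. 1))) = 0"
    using root_locus_equation_monic[OF e d q1] by blast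
  obtain k F where F: "hpoly {..d} (Suc k) F" "\<And>X. F X = X d ^ Suc k * N (\<lambda>i. X i / X d)"
    using homogenization[OF N(1)] by blast
  have F0: "F (coeff (smult c (rootprod n e x y))) = 0" for c x y
  proof (cases "coeff (smult c (rootprod n e x y)) d = 0")
    case False
    then have nz: "c \<noteq> 0" "(\<Prod>i<n. y i ^ e i) \<noteq> 0"
      using coeff_rootprod_top[of n e x y] d by auto
    then have y: "y i \<noteq> 0" if "i < n" for i using that e[OF that] by auto
    have "coeff (smult c (rootprod n e x y)) i / coeff (smult c (rootprod n e x y)) d =
       coeff (rootprod n e (\<lambda>i. x i / y i) (\<lambda>_. 1)) i" for i
      using nz rootprod_unit_leading(1)[of n e "\<lambda>i. x i / y i"] d
      by (simp add: rootprod_monic[of n y e x, OF y])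
    then show ?thesis using N(3) F(2) by simp
  qed (use F(2) in simp)
  define G where "G = (\<lambda>X. F (\<lambda>j. coeff (shear d \<tau> (\<Sum>i\<le>d. monom (X i) i)) j))"
  have lift: "(\<Sum>i\<le>d. monom (coeff r i) i) = r" if "degree r \<le> d" for r :: "complex poly"
    using that by (rule poly_as_sum_of_monoms')
  have "hpoly {..d} (Suc 0) (\<lambda>X. coeff (shear d \<tau> (\<Sum>i\<le>d. monom (X i) i)) j)" for j
  proof -
    have "coeff (shear d \<tau> (\<Sum>i\<le>d. monom (X i) i)) j =
       (\<Sum>i\<le>d. coeff (monom 1 i * [:1, \<tau>:] ^ (d - i)) j * X i)" for X
      unfolding shear_def coeff_sum by (intro sum.cong) (auto simp: coeff_sum)
    then show ?thesis by (simp, intro hpoly_sum hpoly_cmult hpoly_coord) auto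
  qed
  then have "hpoly {..d} (Suc k) G" unfolding G_def by (intro hpoly_compose_linear[OF F(1)])
  moreover have "G (coeff p) \<noteq> 0"
  proof -
    have "G (coeff p) = F (coeff q)" unfolding G_def lift[OF p(2)] q_def ..
    moreover have "(\<lambda>i. coeff q i / coeff q d) = coeff q1" by (auto simp: q1_def a_def)
    ultimately show ?thesis using F(2)[of "coeff q"] N(2) a by simp
  qed
  moreover have "G (coeff (smult c (rootprod n e x y))) = 0" for c x y
  proof -
    have "degree (smult c (rootprod n e x y)) \<le> d"
      using degree_rootprod[of n e x y] d degree_smult_le le_trans by blast
    then show ?thesis unfolding G_def using F0 by (simp only: lift shear_rootprod[OF d])
  qed
  ultimately show ?thesis by blast
qed

section \<open>The tangent spaces of a coincident root locus\<close>

lemma polyfun_zero_on_dense: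
  assumes "G \<in> polyfun I" "D \<in> polyfun J" "D b \<noteq> 0" "\<And>X. D X \<noteq> 0 \<Longrightarrow> G X = 0"
  shows "G X = 0"
proof (rule ccontr)
  assume "G X \<noteq> 0"
  then obtain Y where "G Y * D Y \<noteq> 0" using polyfun_mult_nonzero[OF assms(1,2) _ assms(3)] by blast
  then show False using assms(4)[of Y] by auto
qed

lemma pder_other_variable: "f \<in> polyfun I \<Longrightarrow> i \<notin> I \<Longrightarrow> pder i f x = 0"
proof -
  assume f: "f \<in> polyfun I" "i \<notin> I"
  have "f (x(i := t)) = f x" for t using f(2) by (intro polyfun_cong[OF f(1)]) auto
  then show ?thesis by (simp add: pder_def)
qed

lemma lin_of_degree_1: "degree w \<le> 1 \<Longrightarrow> w = lin (- coeff w 0) (coeff w 1)"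
  unfolding lin_def by (intro poly_eqI) (auto simp: coeff_pCons coeff_eq_0 split: nat.split)

lemma coeff_power_derivative:
  fixes R l w :: "complex poly"
  shows "((\<lambda>t. coeff (R * (l + smult t w) ^ a) k) has_field_derivative
           coeff (R * (smult (of_nat a) (l ^ (a - 1)) * w)) k) (at 0)"
proof (induction a arbitrary: R)
  case 0
  then show ?case by simp
next
  case (Suc a)
  have eq: "coeff (R * (l + smult t w) ^ Suc a) k =
     coeff ((R * l) * (l + smult t w) ^ a) k + t * coeff ((R * w) * (l + smult t w) ^ a) k" for t
  proof -
    have "R * (l + smult t w) ^ Suc a = (R * l) * (l + smult t w) ^ a + smult t ((R * w) * (l + smult t w) ^ a)"
      by (simp add: algebra_simps)
    then show ?thesis by simp
  qed
  have "((\<lambda>t. coeff ((R * l) * (l + smult t w) ^ a) k + t * coeff ((R * w) * (l + smult t w) ^ a) k)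
     has_field_derivative
     coeff ((R * l) * (smult (of_nat a) (l ^ (a - 1)) * w)) k + coeff ((R * w) * l ^ a) k) (at 0)"
    using DERIV_add[OF Suc.IH[of "R * l"] DERIV_mult[OF DERIV_ident Suc.IH[of "R * w"]]] by simp
  moreover have "coeff ((R * l) * (smult (of_nat a) (l ^ (a - 1)) * w)) k + coeff ((R * w) * l ^ a) k =
     coeff (R * (smult (of_nat (Suc a)) (l ^ (Suc a - 1)) * w)) k"
  proof (cases a)
    case (Suc b)
    have "(R * l) * (smult (of_nat a) (l ^ (a - 1)) * w) + (R * w) * l ^ a =
       R * (smult (of_nat (Suc a)) (l ^ (Suc a - 1)) * w)"
    proof -
      have "(R * l) * (smult (of_nat a) (l ^ (a - 1)) * w) = smult (of_nat a) (R * (l ^ a * w))"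
        using Suc by (simp add: mult_ac)
      moreover have "R * (smult (of_nat (Suc a)) (l ^ (Suc a - 1)) * w) = smult (of_nat (Suc a)) (R * (l ^ a * w))"
        by simp
      moreover have "(R * w) * l ^ a = R * (l ^ a * w)" by (simp add: mult_ac)
      moreover have "smult (of_nat (Suc a)) (R * (l ^ a * w)) = smult (of_nat a) (R * (l ^ a * w)) + R * (l ^ a * w)"
        by (simp add: smult_add_left)
      ultimately show ?thesis by simp
    qed
    then show ?thesis by (metis coeff_add)
  qed (simp add: mult_ac)
  ultimately show ?case unfolding eq by simp
qed

locale root_locus =
  fixes n d :: nat and e :: "nat \<Rightarrow> nat"
  assumes e_pos: "\<And>i. i < n \<Longrightarrow> e i \<ge> 1" and sum_e: "(\<Sum>i<n. e i) = d" and n_pos: "n > 0"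
begin

abbreviation e1 :: "nat \<Rightarrow> nat" where "e1 \<equiv> (\<lambda>i. e i - 1)"

definition locus :: "complex bipoly set set" where
  "locus = coincident_root_locus (mset (map e [0..<n]))"

lemma sum_e1: "(\<Sum>i<n. e1 i) + n = d"
proof -
  have "(\<Sum>i<n. e1 i) + n = (\<Sum>i<n. e1 i + 1)" by (simp only: sum.distrib) simp
  also have "\<dots> = (\<Sum>i<n. e i)" using e_pos by (intro sum.cong) (auto simp: Suc_le_eq)
  finally show ?thesis using sum_e by simp
qed

lemma degree_rootprod_e: "degree (rootprod n e x y) \<le> d"
  using degree_rootprod[of n e x y] sum_e by simp

lemma degree_rootprod_e1: "degree (rootprod n e1 x y) + n \<le> d"
  using degree_rootprod[of n e1 x y] sum_e1 by simp

lemma locus_iff: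
  "proj_point f \<in> locus \<longleftrightarrow> f \<in> binary_forms d \<and> f \<noteq> 0 \<and> (\<exists>c x y. deh f = smult c (rootprod n e x y))"
proof
  assume "proj_point f \<in> locus"
  then obtain ns l where nl: "proj_point f = proj_point (\<Prod>i<length ns. l i ^ (ns ! i))"
    "mset ns = mset (map e [0..<n])" "\<forall>i<length ns. l i \<in> binary_forms 1 - {0}"
    unfolding locus_def coincident_root_locus_def by auto
  obtain p where p: "p permutes {..<n}" "permute_list p (map e [0..<n]) = ns"
    using mset_eq_permutation[OF nl(2)] by auto
  have len: "length ns = n" using mset_eq_length[OF nl(2)] by simp
  have ns: "ns ! i = e (p i)" if "i < n" for i
    using p that permutes_in_image[OF p(1), of i] by (auto simp: permute_list_def)
  have l: "l i \<in> binary_forms 1" "l i \<noteq> 0" if "i < n" for i using nl(3) that len by auto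
  define g where "g = (\<Prod>i<n. l i ^ e (p i))"
  have g: "(\<Prod>i<length ns. l i ^ (ns ! i)) = g" unfolding g_def len by (intro prod.cong) (auto simp: ns)
  have "g \<in> binary_forms (\<Sum>i<n. e (p i) * 1)"
    unfolding g_def using l(1) by (intro binary_forms_prod binary_forms_power) auto
  moreover have "(\<Sum>i<n. e (p i) * 1) = d"
    using sum.permute[OF p(1), of e] sum_e by (simp add: o_def)
  ultimately have gd: "g \<in> binary_forms d" by simp
  have g0: "g \<noteq> 0" unfolding g_def using l(2) by auto
  obtain c where c: "c \<noteq> 0" "f = scale c g" using nl(1) g proj_point_eq_iff by auto
  define x where "x j = - coeff (deh (l (inv p j))) 0" for j
  define y where "y j = coeff (deh (l (inv p j))) 1" for j
  have lin: "deh (l i) = lin (x (p i)) (y (p i))" if "i < n" for i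
    using lin_of_degree_1[OF degree_deh[OF l(1)[OF that]]] permutes_inverses(2)[OF p(1)]
    unfolding x_def y_def by simp
  have "deh g = (\<Prod>i<n. lin (x (p i)) (y (p i)) ^ e (p i))"
    unfolding g_def deh_prod deh_power by (intro prod.cong) (auto simp: lin)
  also have "\<dots> = rootprod n e x y"
    unfolding rootprod_def using prod.permute[OF p(1), of "\<lambda>i. lin (x i) (y i) ^ e i"] by (simp add: o_def)
  finally have "deh f = smult c (rootprod n e x y)" using c by (simp add: deh_scale)
  then show "f \<in> binary_forms d \<and> f \<noteq> 0 \<and> (\<exists>c x y. deh f = smult c (rootprod n e x y))"
    using c g0 gd by (auto intro: scale_in_binary_forms)
next
  assume "f \<in> binary_forms d \<and> f \<noteq> 0 \<and> (\<exists>c x y. deh f = smult c (rootprod n e x y))"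
  then obtain c x y where f: "f \<in> binary_forms d" "f \<noteq> 0" "deh f = smult c (rootprod n e x y)" by blast
  have "deh f \<noteq> 0" using f deh_eq_0_iff by blast
  then have c: "c \<noteq> 0" and "rootprod n e x y \<noteq> 0" using f(3) by auto
  then have lin0: "lin (x i) (y i) \<noteq> 0" if "i < n" for i
    using that e_pos[OF that] unfolding rootprod_def by auto
  define l where "l i = form_of 1 (coeff (lin (x i) (y i)))" for i
  have dl: "deh (l i) = lin (x i) (y i)" for i unfolding l_def by (intro deh_form_of_coeff degree_lin)
  have l: "l i \<in> binary_forms 1" for i unfolding l_def by (rule form_of_in_binary_forms)
  have l0: "l i \<noteq> 0" if "i < n" for i using dl[of i] lin0[OF that] by auto
  have g: "(\<Prod>i<n. l i ^ e i) \<in> binary_forms d"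
  proof -
    have "(\<Prod>i<n. l i ^ e i) \<in> binary_forms (\<Sum>i<n. e i * 1)"
      using l by (intro binary_forms_prod binary_forms_power)
    then show ?thesis using sum_e by simp
  qed
  have "f = scale c (\<Prod>i<n. l i ^ e i)"
    using f(3) by (intro deh_inj[OF f(1) scale_in_binary_forms[OF g]])
      (simp add: deh_scale deh_prod deh_power dl rootprod_def)
  then have "proj_point f = proj_point (\<Prod>i<n. l i ^ e i)" using c proj_point_eq_iff by blast
  also have "(\<Prod>i<n. l i ^ e i) = (\<Prod>i<length (map e [0..<n]). l i ^ (map e [0..<n] ! i))"
    by (auto intro!: prod.cong)
  finally show "proj_point f \<in> locus"
    unfolding locus_def coincident_root_locus_def using l l0
    by (intro CollectI exI[of _ "map e [0..<n]"] exI[of _ l]) auto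
qed

lemma locus_points: "p \<in> locus \<Longrightarrow> \<exists>f. p = proj_point f \<and> f \<in> binary_forms d - {0}"
proof -
  assume p: "p \<in> locus"
  then obtain f where "p = proj_point f" unfolding locus_def coincident_root_locus_def by blast
  then show ?thesis using p locus_iff by blast
qed

lemma locus_closed: "zariski_closed d locus"
proof (rule zariski_closedI)
  show "locus \<subseteq> zero_locus d {}" using locus_points by (fastforce simp: zero_locus_def)
next
  fix f assume f: "f \<in> binary_forms d - {0}" "proj_point f \<notin> locus"
  have "deh f \<noteq> 0" using f(1) deh_eq_0_iff by blast
  moreover have "degree (deh f) \<le> d" using f(1) degree_deh by blast
  moreover have "deh f \<noteq> smult c (rootprod n e x y)" for c x y using f locus_iff by blast
  ultimately obtain k F where F: "hpoly {..d} k F" "F (coeff (deh f)) \<noteq> 0"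
      "\<And>c x y. F (coeff (smult c (rootprod n e x y))) = 0"
    using root_locus_equation[OF e_pos sum_e] by blast
  have "F (coords d g) = 0" if "proj_point g \<in> locus" for g
    using that F(3) unfolding locus_iff by (metis coords_eq_coeff_deh)
  moreover have "F (coords d f) \<noteq> 0" using F(2) f(1) by (simp add: coords_eq_coeff_deh)
  ultimately show "\<exists>k F. hpoly {..d} k F \<and> F (coords d f) \<noteq> 0 \<and> (\<forall>g. proj_point g \<in> locus \<longrightarrow> F (coords d g) = 0)"
    using F(1) by blast
qed

lemma form_in_locus:
  assumes "smult c (rootprod n e x y) \<noteq> 0"
  shows "proj_point (form_of d (coeff (smult c (rootprod n e x y)))) \<in> locus"
proof -
  have "degree (smult c (rootprod n e x y)) \<le> d"
    using degree_rootprod_e degree_smult_le le_trans by blast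
  then have "deh (form_of d (coeff (smult c (rootprod n e x y)))) = smult c (rootprod n e x y)"
    by (rule deh_form_of_coeff)
  then show ?thesis unfolding locus_iff using assms form_of_in_binary_forms by (metis deh_0)
qed

text \<open>Equations are tested on the parametrization of the cone over the locus, which turns them into
  identities of polynomial functions.\<close>

definition on_locus :: "((nat \<Rightarrow> complex) \<Rightarrow> complex) \<Rightarrow> bool" where
  "on_locus G \<longleftrightarrow> (\<forall>c x y. G (coeff (smult c (rootprod n e x y))) = 0)"

lemma polycoeff_rootprod:
  "polycoeff UNIV (\<lambda>X. rootprod n f (\<lambda>i. X (2 * i)) (\<lambda>i. X (2 * i + 1)))"
  unfolding rootprod_def by (intro polycoeff_intros polyfun_coord UNIV_I)

text \<open>The two coordinates of each root are packed into one sequence of variables.\<close>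

lemma odd_even_coords:
  fixes x y :: "nat \<Rightarrow> complex"
  shows "\<exists>X. (\<forall>i. X (2 * i) = x i) \<and> (\<forall>i. X (2 * i + 1) = y i)"
  by (rule exI[of _ "\<lambda>k. if even k then x (k div 2) else y (k div 2)"]) auto

text \<open>Products without a root at infinity are dense in the cone over the locus.\<close>

lemma on_locusI:
  assumes "G \<in> polyfun {..d}" "\<And>c t. c \<noteq> 0 \<Longrightarrow> G (coeff (smult c (rootprod n e t (\<lambda>_. 1)))) = 0"
  shows "on_locus G"
  unfolding on_locus_def
proof (intro allI)
  fix c :: complex and x y :: "nat \<Rightarrow> complex"
  let ?R = "\<lambda>X. rootprod n e (\<lambda>i. X (2 * i)) (\<lambda>i. X (2 * i + 1))"
  let ?G = "\<lambda>X. G (coeff (smult (X (2 * n)) (?R X)))"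
  obtain X where X: "\<And>i. X (2 * i) = (if i = n then c else x i)" "\<And>i. X (2 * i + 1) = y i"
    using odd_even_coords[of "\<lambda>i. if i = n then c else x i" y] by metis
  have "?G X = 0"
  proof (rule polyfun_zero_on_dense[where G = ?G and X = X and D = "\<lambda>X. X (2 * n) * (\<Prod>i<n. X (2 * i + 1))" and b = "\<lambda>_. 1" and J = UNIV and I = UNIV])
    show "?G \<in> polyfun UNIV"
      by (rule polyfun_compose[OF assms(1)])
         (intro polycoeffD polycoeff_smult polycoeff_rootprod polyfun_coord UNIV_I)
    show "(\<lambda>X. X (2 * n) * (\<Prod>i<n. X (2 * i + 1))) \<in> polyfun UNIV" by (intro polyfun_intros UNIV_I)
  next
    fix X :: "nat \<Rightarrow> complex"
    assume nz: "X (2 * n) * (\<Prod>i<n. X (2 * i + 1)) \<noteq> 0"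
    then have y: "\<And>i. i < n \<Longrightarrow> X (2 * i + 1) \<noteq> 0" by auto
    then have "smult (X (2 * n)) (?R X) =
      smult (X (2 * n) * (\<Prod>i<n. X (2 * i + 1) ^ e i)) (rootprod n e (\<lambda>i. X (2 * i) / X (2 * i + 1)) (\<lambda>_. 1))"
      by (subst rootprod_monic) auto
    then show "?G X = 0" using assms(2) nz y by simp
  qed simp
  moreover have "?R X = rootprod n e x y" unfolding rootprod_def X by (intro prod.cong) auto
  ultimately show "G (coeff (smult c (rootprod n e x y))) = 0" using X(1)[of n] by simp
qed

lemma on_locus_iff:
  assumes "hpoly {..d} k F"
  shows "on_locus F \<longleftrightarrow> (\<forall>f. proj_point f \<in> locus \<longrightarrow> F (coords d f) = 0)"
proof
  assume *: "on_locus F"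
  show "\<forall>f. proj_point f \<in> locus \<longrightarrow> F (coords d f) = 0"
    using * unfolding locus_iff on_locus_def by (metis coords_eq_coeff_deh)
next
  assume *: "\<forall>f. proj_point f \<in> locus \<longrightarrow> F (coords d f) = 0"
  show "on_locus F"
  proof (rule on_locusI[OF hpoly_imp_polyfun[OF assms]])
    fix c :: complex and t :: "nat \<Rightarrow> complex" assume c: "c \<noteq> 0"
    let ?p = "smult c (rootprod n e t (\<lambda>_. 1))"
    have "coeff (rootprod n e t (\<lambda>_. 1)) d = 1" using rootprod_unit_leading(1)[of n e t] sum_e by simp
    then have nz: "?p \<noteq> 0" using c by auto
    have deg: "degree ?p \<le> d" using degree_rootprod_e degree_smult_le le_trans by blast
    have "coords d (form_of d (coeff ?p)) = coeff ?p"
      using coords_eq_coeff_deh[OF form_of_in_binary_forms] deh_form_of_coeff[OF deg] by metis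
    then show "F (coeff ?p) = 0" using * form_in_locus[OF nz] by metis
  qed
qed

lemma on_locus_homogeneousI:
  assumes "hpoly {..d} k F" "\<And>t. F (coeff (rootprod n e t (\<lambda>_. 1))) = 0" shows "on_locus F"
proof (rule on_locusI[OF hpoly_imp_polyfun[OF assms(1)]])
  fix c :: complex and t :: "nat \<Rightarrow> complex"
  have "coeff (smult c (rootprod n e t (\<lambda>_. 1))) = (\<lambda>i. c * coeff (rootprod n e t (\<lambda>_. 1)) i)" by auto
  then show "F (coeff (smult c (rootprod n e t (\<lambda>_. 1)))) = 0"
    using hpoly_scale[OF assms(1)] assms(2) by simp
qed

text \<open>Lagrange forms of degree \<open>n\<close> for the \<open>n\<close> points are multiples of the cofactors, with linear
  quotients. What interpolation leaves over is a multiple of the full product and can be added to any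
  one of the summands.\<close>

lemma linear_combinations_of_cofactors:
  assumes "distinct_points {..<n} x y" "degree u \<le> n"
  shows "\<exists>w. (\<forall>i<n. degree (w i) \<le> 1) \<and> u = (\<Sum>i<n. w i * (\<Prod>j\<in>{..<n} - {i}. lin (x j) (y j)))"
proof -
  let ?C = "\<lambda>i. \<Prod>j\<in>{..<n} - {i}. lin (x j) (y j)"
  obtain \<Lambda> where L: "\<And>i. i < n \<Longrightarrow> degree (\<Lambda> i) \<le> n"
    "\<And>i j. i < n \<Longrightarrow> j < n \<Longrightarrow> hev n (\<Lambda> i) (x j) (y j) = (if i = j then 1 else 0)"
    using lagrange_forms[OF _ assms(1), of n] by auto
  have "\<exists>q. \<Lambda> i = q * ?C i \<and> degree q \<le> 1" if i: "i < n" for i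
  proof -
    have "\<Lambda> i = 0 \<or> (\<exists>q. \<Lambda> i = ?C i * q \<and> degree q + card ({..<n} - {i}) \<le> n)"
      using L i by (intro vanishing_at_distinct_points distinct_points_subset[OF assms(1)]) auto
    then show ?thesis
    proof
      assume "\<Lambda> i = 0" then show ?thesis by (intro exI[of _ 0]) simp
    next
      assume "\<exists>q. \<Lambda> i = ?C i * q \<and> degree q + card ({..<n} - {i}) \<le> n"
      then show ?thesis using i by (auto simp: mult.commute)
    qed
  qed
  then obtain q where q: "\<And>i. i < n \<Longrightarrow> \<Lambda> i = q i * ?C i" "\<And>i. i < n \<Longrightarrow> degree (q i) \<le> 1" by metis
  define v where "v = u - (\<Sum>i<n. smult (hev n u (x i) (y i)) (\<Lambda> i))"
  have "degree (\<Sum>i<n. smult (hev n u (x i) (y i)) (\<Lambda> i)) \<le> n"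
    using L(1) by (intro degree_sum_le) (auto intro: order_trans[OF degree_smult_le])
  then have "degree v \<le> n" unfolding v_def using assms(2) by (intro degree_diff_le) auto
  moreover have "hev n v (x j) (y j) = 0" if j: "j < n" for j
  proof -
    have "(\<Sum>i<n. hev n u (x i) (y i) * hev n (\<Lambda> i) (x j) (y j)) =
          (\<Sum>i<n. if i = j then hev n u (x j) (y j) else 0)"
      using L(2) j by (intro sum.cong) auto
    then show ?thesis unfolding v_def using j by (simp add: hev_diff hev_sum hev_smult)
  qed
  ultimately have "v = 0 \<or> (\<exists>r. v = (\<Prod>i<n. lin (x i) (y i)) * r \<and> degree r + card {..<n} \<le> n)"
    using assms(1) by (intro vanishing_at_distinct_points) auto
  then obtain r where r: "v = (\<Prod>i<n. lin (x i) (y i)) * r" "degree r = 0" by fastforce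
  define w where "w i = smult (hev n u (x i) (y i)) (q i) + (if i = 0 then lin (x 0) (y 0) * r else 0)" for i
  have "degree (lin (x 0) (y 0) * r) \<le> 1"
    using degree_mult_le[of "lin (x 0) (y 0)" r] degree_lin[of "x 0" "y 0"] r(2) by linarith
  then have "degree (w i) \<le> 1" if "i < n" for i
    unfolding w_def using q(2)[OF that] by (intro degree_add_le) (auto intro: order_trans[OF degree_smult_le])
  moreover have "u = (\<Sum>i<n. w i * ?C i)"
  proof -
    have "(\<Sum>i<n. w i * ?C i) = (\<Sum>i<n. smult (hev n u (x i) (y i)) (\<Lambda> i)) +
       (\<Sum>i<n. if i = 0 then lin (x 0) (y 0) * r * ?C 0 else 0)"
      unfolding w_def sum.distrib[symmetric] by (intro sum.cong) (auto simp: q(1) algebra_simps)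
    also have "(\<Sum>i<n. if i = 0 then lin (x 0) (y 0) * r * ?C 0 else 0) = lin (x 0) (y 0) * r * ?C 0"
      using n_pos by simp
    also have "lin (x 0) (y 0) * r * ?C 0 = v"
      unfolding r(1) using n_pos by (subst (2) prod.remove[of _ 0]) (auto simp: mult_ac)
    finally show ?thesis unfolding v_def by simp
  qed
  ultimately show ?thesis by blast
qed

text \<open>If the \<open>i\<close>-th linear factor moves in the direction \<open>w\<close>, the product moves in the direction of
  \<open>w\<close> times \<open>rootprod n e1 x y\<close> times the product of the other linear factors. For distinct roots
  these directions span all multiples of \<open>rootprod n e1 x y\<close>.\<close>

lemma tangent_at_distinct_roots:
  assumes F: "hpoly {..d} k F" "on_locus F" and dist: "distinct_points {..<n} x y" and u: "degree u \<le> n"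
  shows "(\<Sum>m\<le>d. pder m F (coeff (rootprod n e x y)) * coeff (rootprod n e1 x y * u) m) = 0"
proof -
  let ?g = "coeff (rootprod n e x y)" and ?q = "rootprod n e1 x y"
  let ?C = "\<lambda>i. \<Prod>j\<in>{..<n} - {i}. lin (x j) (y j)"
  have one: "(\<Sum>m\<le>d. pder m F ?g * coeff (?q * (w * ?C i)) m) = 0" if i: "i < n" and w: "degree w \<le> 1" for i w
  proof -
    define R where "R = (\<Prod>j\<in>{..<n} - {i}. lin (x j) (y j) ^ e j)"
    define l where "l = lin (x i) (y i)"
    have RC: "(\<Prod>j\<in>{..<n} - {i}. lin (x j) (y j) ^ e1 j) * ?C i = R"
      unfolding R_def prod.distrib[symmetric]
    proof (intro prod.cong refl)
      fix j assume "j \<in> {..<n} - {i}"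
      then have "e j = Suc (e1 j)" using e_pos[of j] by simp
      then show "lin (x j) (y j) ^ e1 j * lin (x j) (y j) = lin (x j) (y j) ^ e j" by (metis power_Suc2)
    qed
    have q: "?q * (w * ?C i) = R * (l ^ (e i - 1) * w)"
    proof -
      have "?q = l ^ e1 i * (\<Prod>j\<in>{..<n} - {i}. lin (x j) (y j) ^ e1 j)"
        unfolding rootprod_def l_def using i by (simp add: prod.remove)
      then show ?thesis unfolding RC[symmetric] by (simp add: mult_ac)
    qed
    have van: "F (coeff (R * (l + smult t w) ^ e i)) = 0" for t
    proof -
      have "degree (l + smult t w) \<le> 1"
        unfolding l_def using w by (intro degree_add_le degree_lin) (auto intro: order_trans[OF degree_smult_le])
      then have lt: "l + smult t w = lin (- coeff (l + smult t w) 0) (coeff (l + smult t w) 1)" by (rule lin_of_degree_1)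
      define x' where "x' = x(i := - coeff (l + smult t w) 0)"
      define y' where "y' = y(i := coeff (l + smult t w) 1)"
      have "rootprod n e x' y' = lin (x' i) (y' i) ^ e i * (\<Prod>j\<in>{..<n} - {i}. lin (x' j) (y' j) ^ e j)"
        unfolding rootprod_def using i by (simp add: prod.remove)
      also have "(\<Prod>j\<in>{..<n} - {i}. lin (x' j) (y' j) ^ e j) = R"
        unfolding R_def x'_def y'_def by (intro prod.cong) auto
      also have "lin (x' i) (y' i) = l + smult t w" unfolding x'_def y'_def fun_upd_same by (rule lt[symmetric])
      finally have "R * (l + smult t w) ^ e i = smult 1 (rootprod n e x' y')" by (simp add: mult.commute)
      then show ?thesis using F(2) unfolding on_locus_def by metis
    qed
    have g0: "coeff (R * (l + smult 0 w) ^ e i) = ?g"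
      unfolding R_def l_def rootprod_def using i by (simp add: prod.remove mult.commute)
    have "((\<lambda>t. F (coeff (R * (l + smult t w) ^ e i))) has_field_derivative
        (\<Sum>m\<in>{..d}. pder m F (coeff (R * (l + smult 0 w) ^ e i)) *
           coeff (R * (smult (of_nat (e i)) (l ^ (e i - 1)) * w)) m)) (at 0)"
      by (intro hpoly_pder(2)[OF F(1)] coeff_power_derivative) auto
    moreover have "((\<lambda>t. F (coeff (R * (l + smult t w) ^ e i))) has_field_derivative 0) (at 0)"
      unfolding van by simp
    ultimately have "(\<Sum>m\<le>d. pder m F ?g * coeff (R * (smult (of_nat (e i)) (l ^ (e i - 1)) * w)) m) = 0"
      unfolding g0 using DERIV_unique by blast
    moreover have eqm: "coeff (R * (smult (of_nat (e i)) (l ^ (e i - 1)) * w)) m = of_nat (e i) * coeff (?q * (w * ?C i)) m" for m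
      unfolding q by simp
    ultimately have "(\<Sum>m\<le>d. pder m F ?g * (of_nat (e i) * coeff (?q * (w * ?C i)) m)) = 0"
      by (simp only:)
    then have "of_nat (e i) * (\<Sum>m\<le>d. pder m F ?g * coeff (?q * (w * ?C i)) m) = 0"
      unfolding sum_distrib_left by (simp only: mult.left_commute)
    then show ?thesis using e_pos[OF i] by simp
  qed
  obtain w where w: "\<And>i. i < n \<Longrightarrow> degree (w i) \<le> 1" "u = (\<Sum>i<n. w i * ?C i)"
    using linear_combinations_of_cofactors[OF dist u] by blast
  have "(\<Sum>m\<le>d. pder m F ?g * coeff (?q * u) m) = (\<Sum>i<n. \<Sum>m\<le>d. pder m F ?g * coeff (?q * (w i * ?C i)) m)"
    unfolding w(2) sum_distrib_left coeff_sum by (rule sum.swap)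
  then show ?thesis using one w(1) by simp
qed

text \<open>The condition is closed, and the products with distinct roots are dense.\<close>

lemma tangent_contains:
  assumes F: "hpoly {..d} k F" "on_locus F" and u: "degree u \<le> n"
  shows "(\<Sum>m\<le>d. pder m F (coeff (rootprod n e x y)) * coeff (rootprod n e1 x y * u) m) = 0"
proof -
  let ?R = "\<lambda>f X. rootprod n f (\<lambda>i. X (2 * i)) (\<lambda>i. X (2 * i + 1))"
  let ?G = "\<lambda>X. \<Sum>m\<le>d. pder m F (coeff (?R e X)) * coeff (?R e1 X * u) m"
  let ?D = "\<lambda>X. (\<Prod>i<n. X (2 * i + 1)) * (\<Prod>i<n. \<Prod>j\<in>{..<n} - {i}. X (2 * i + 1) * X (2 * j) - X (2 * i) * X (2 * j + 1))"
  obtain X where X: "\<And>i. X (2 * i) = x i" "\<And>i. X (2 * i + 1) = y i" using odd_even_coords[of x y] by metis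
  obtain b :: "nat \<Rightarrow> complex" where b: "\<And>i. b (2 * i) = of_nat i" "\<And>i. b (2 * i + 1) = 1" using odd_even_coords[of of_nat "\<lambda>_. 1"] by metis
  have "?G X = 0"
  proof (rule polyfun_zero_on_dense[where G = ?G and X = X and D = ?D and b = b and I = UNIV and J = UNIV])
    show "?G \<in> polyfun UNIV"
    proof (intro polyfun_sum polyfun_mult)
      fix m
      show "(\<lambda>X. pder m F (coeff (?R e X))) \<in> polyfun UNIV"
        by (rule polyfun_compose[OF hpoly_imp_polyfun[OF hpoly_pder(1)[OF F(1) finite_atMost]]])
           (intro polycoeffD polycoeff_rootprod)
      show "(\<lambda>X. coeff (?R e1 X * u) m) \<in> polyfun UNIV"
        by (intro polycoeffD polycoeff_mult polycoeff_const polycoeff_rootprod)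
    qed
    show "?D \<in> polyfun UNIV" by (intro polyfun_intros UNIV_I)
    show "?D b \<noteq> 0" unfolding b by auto
  next
    fix X :: "nat \<Rightarrow> complex" assume "?D X \<noteq> 0"
    then have "distinct_points {..<n} (\<lambda>i. X (2 * i)) (\<lambda>i. X (2 * i + 1))"
      by (auto simp: distinct_points_def)
    then show "?G X = 0" by (rule tangent_at_distinct_roots[OF F _ u])
  qed
  then show ?thesis unfolding X by simp
qed

text \<open>The coordinates in \<open>J\<close> are algebraically independent on the cone over the locus; on a cone it is
  enough to consider homogeneous relations.\<close>

definition independent_coords :: "nat set \<Rightarrow> bool" where
  "independent_coords J \<longleftrightarrow> (\<forall>k f. hpoly J k f \<longrightarrow> on_locus f \<longrightarrow> f = (\<lambda>_. 0))"

lemma polycoeff_rootprod_monic: "{..<n} \<subseteq> I \<Longrightarrow> polycoeff I (\<lambda>X. rootprod n f X (\<lambda>_. 1))"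
  unfolding rootprod_def by (intro polycoeff_intros polyfun_intros) auto

text \<open>The cone is parametrized by \<open>n\<close> roots and a scalar factor.\<close>

lemma card_independent_coords:
  assumes "independent_coords J" "J \<subseteq> {..d}" shows "card J \<le> n + 1"
proof (rule ccontr)
  assume "\<not> card J \<le> n + 1"
  then obtain J' where J': "J' \<subseteq> J" "card J' = n + 2" "finite J'"
    by (metis Suc_eq_plus1 add_2_eq_Suc' not_less_eq_eq obtain_subset_with_card_n)
  obtain h where h: "bij_betw h {..n + 1} J'"
    using finite_same_card_bij[of "{..n + 1}" J'] J' by auto
  let ?g = "\<lambda>j X. X n * coeff (rootprod n e X (\<lambda>_. 1)) (h j)"
  have "?g j \<in> polyfun {..n}" for j
    by (intro polyfun_mult polyfun_coord polycoeffD polycoeff_rootprod_monic) auto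
  then obtain P where P: "P \<in> polyfun {..n + 1}" "\<exists>X. P X \<noteq> 0" "\<And>X. P (\<lambda>j. ?g j X) = 0"
    using algebraically_dependent[of "{..n}" "n + 1" ?g] by auto
  define f where "f = (\<lambda>Z. P (\<lambda>j. Z (h j)))"
  have fJ: "f \<in> polyfun J"
    unfolding f_def using h J'(1) by (intro polyfun_compose[OF P(1)] polyfun_coord) (auto simp: bij_betw_def)
  obtain X where X: "P X \<noteq> 0" using P(2) by blast
  have "P (\<lambda>j. X (the_inv_into {..n + 1} h (h j))) = P X"
    using h by (intro polyfun_cong[OF P(1)]) (auto simp: the_inv_into_f_f bij_betw_def)
  then have fz: "f (\<lambda>i. X (the_inv_into {..n + 1} h i)) \<noteq> 0" unfolding f_def using X by simp
  define S :: "(nat \<Rightarrow> complex) set" where "S = {Z. \<exists>c t. Z = coeff (smult c (rootprod n e t (\<lambda>_. 1)))}"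
  have "\<exists>k g. hpoly J k g \<and> (\<forall>Z\<in>S. g Z = 0) \<and> g (\<lambda>i. X (the_inv_into {..n + 1} h i)) \<noteq> 0"
  proof (rule polyfun_nonvanishing_hpoly[OF fJ _ _ fz])
    fix Z and a :: complex assume "Z \<in> S"
    then obtain c t where "Z = coeff (smult c (rootprod n e t (\<lambda>_. 1)))" unfolding S_def by blast
    then have "(\<lambda>i. a * Z i) = coeff (smult (a * c) (rootprod n e t (\<lambda>_. 1)))" by (simp add: fun_eq_iff mult.assoc)
    then show "(\<lambda>i. a * Z i) \<in> S" unfolding S_def by blast
  next
    fix Z assume "Z \<in> S"
    then obtain c t where Z: "Z = coeff (smult c (rootprod n e t (\<lambda>_. 1)))" unfolding S_def by blast
    have "rootprod n e (t(n := c)) (\<lambda>_. 1) = rootprod n e t (\<lambda>_. 1)"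
      unfolding rootprod_def by (intro prod.cong) auto
    then show "f Z = 0" using P(3)[of "t(n := c)"] unfolding f_def Z by simp
  qed
  then obtain k g where g: "hpoly J k g" "\<forall>Z\<in>S. g Z = 0" "g \<noteq> (\<lambda>_. 0)" by auto
  have "on_locus g"
    using g(2) by (intro on_locusI hpoly_imp_polyfun[OF hpoly_mono[OF g(1) assms(2)]]) (auto simp: S_def)
  then show False using assms(1) g unfolding independent_coords_def by blast
qed

lemma independent_coords_empty: "independent_coords {}"
  unfolding independent_coords_def
proof (intro allI impI)
  fix k f assume f: "hpoly {} k f" "on_locus f"
  have "f x = f (coeff (smult 1 (rootprod n e (\<lambda>_. 0) (\<lambda>_. 1))))" for x
    by (rule polyfun_cong[OF hpoly_imp_polyfun[OF f(1)]]) auto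
  moreover have "f (coeff (smult 1 (rootprod n e (\<lambda>_. 0) (\<lambda>_. 1)))) = 0"
    using f(2) unfolding on_locus_def by blast
  ultimately show "f = (\<lambda>_. 0)" by (intro ext) simp
qed

lemma maximal_independent_coords:
  "\<exists>J. independent_coords J \<and> J \<subseteq> {..d} \<and> card J \<le> n + 1 \<and>
     (\<forall>k\<in>{..d} - J. \<not> independent_coords (insert k J))"
proof -
  let ?A = "{J. J \<subseteq> {..d} \<and> independent_coords J}"
  have "finite ?A" by (rule finite_subset[of _ "Pow {..d}"]) auto
  moreover have "?A \<noteq> {}" using independent_coords_empty by blast
  ultimately have "Max (card ` ?A) \<in> card ` ?A" "\<And>K. K \<in> ?A \<Longrightarrow> card K \<le> Max (card ` ?A)"
    by (auto intro!: Max_in)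
  then obtain J where J0: "J \<in> ?A" "card J = Max (card ` ?A)" by auto
  have J: "J \<in> ?A" "\<And>K. K \<in> ?A \<Longrightarrow> card K \<le> card J"
    using J0 \<open>\<And>K. K \<in> ?A \<Longrightarrow> card K \<le> Max (card ` ?A)\<close> by simp_all
  have "\<not> independent_coords (insert k J)" if "k \<in> {..d} - J" for k
  proof
    assume "independent_coords (insert k J)"
    then have "card (insert k J) \<le> card J" using J that by auto
    moreover have "finite J" using J(1) finite_subset by auto
    ultimately show False using that by simp
  qed
  then show ?thesis using J(1) card_independent_coords by blast
qed

text \<open>A relation of least degree that expresses the algebraicity of the \<open>k\<close>-th coordinate over the
  coordinates in \<open>J\<close> has a derivative in the \<open>k\<close>-th direction that does not vanish on the locus.\<close>

lemma separating_relation: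
  assumes J: "independent_coords J" "J \<subseteq> {..d}" and k: "k \<in> {..d} - J" "\<not> independent_coords (insert k J)"
  shows "\<exists>m f. hpoly (insert k J) m f \<and> on_locus f \<and> (\<exists>t. pder k f (coeff (rootprod n e t (\<lambda>_. 1))) \<noteq> 0)"
proof -
  let ?P = "\<lambda>m. \<exists>f. hpoly (insert k J) m f \<and> on_locus f \<and> f \<noteq> (\<lambda>_. 0)"
  have "\<exists>m. ?P m" using k(2) unfolding independent_coords_def by blast
  then have "?P (LEAST m. ?P m)" by (rule LeastI_ex)
  then obtain f where f: "hpoly (insert k J) (LEAST m. ?P m) f" "on_locus f" "f \<noteq> (\<lambda>_. 0)" by blast
  define m where "m = (LEAST m. ?P m)"
  have fin: "finite J" using J(2) finite_subset by auto
  have hd: "hpoly (insert k J) (m - 1) (pder k f)" using hpoly_pder(1)[OF f(1)] fin unfolding m_def by simp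
  have "\<exists>t. pder k f (coeff (rootprod n e t (\<lambda>_. 1))) \<noteq> 0"
  proof (rule ccontr)
    assume "\<not> ?thesis"
    then have "on_locus (pder k f)"
      using J(2) k(1) by (intro on_locus_homogeneousI[OF hpoly_mono[OF hd]]) auto
    have "pder k f x = 0" for x
    proof (cases "m = 0")
      case True
      then show ?thesis using hpoly_pder(3)[OF f(1)] fin unfolding m_def by simp
    next
      case False
      then have "\<not> ?P (m - 1)" using not_less_Least[of "m - 1" ?P] unfolding m_def by simp
      then show ?thesis using hd \<open>on_locus (pder k f)\<close> by metis
    qed
    then have "hpoly J m f" using hpoly_pder_zero_independent[OF f(1) fin] unfolding m_def by blast
    then show False using J(1) f(2,3) unfolding independent_coords_def by blast
  qed
  then show ?thesis using f by blast
qed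

definition tangent_vector :: "(nat \<Rightarrow> complex) \<Rightarrow> complex poly \<Rightarrow> bool" where
  "tangent_vector z h \<longleftrightarrow> (\<forall>k F. hpoly {..d} k F \<longrightarrow> on_locus F \<longrightarrow>
     (\<Sum>m\<le>d. pder m F z * coeff h m) = 0)"

text \<open>For a maximal independent set \<open>J\<close> of coordinates, the separating relations compute the coordinates
  outside \<open>J\<close> of a tangent vector from those in \<open>J\<close>, wherever the product \<open>\<Delta>\<close> of the relevant
  derivatives does not vanish. So the tangent vectors form a space of dimension at most
  \<open>card J \<le> n + 1\<close>, which is already exhausted by the multiples of \<open>rootprod n e1 t (\<lambda>_. 1)\<close>.\<close>

lemma generic_tangent_space:
  "\<exists>\<Delta>\<in>polyfun {..<n}. (\<exists>t. \<Delta> t \<noteq> 0) \<and> (\<forall>t h. \<Delta> t \<noteq> 0 \<longrightarrow> degree h \<le> d \<longrightarrow>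
     tangent_vector (coeff (rootprod n e t (\<lambda>_. 1))) h \<longrightarrow>
     (\<exists>u. degree u \<le> n \<and> h = rootprod n e1 t (\<lambda>_. 1) * u))"
proof -
  obtain J where J: "independent_coords J" "J \<subseteq> {..d}" "card J \<le> n + 1"
    "\<And>k. k \<in> {..d} - J \<Longrightarrow> \<not> independent_coords (insert k J)"
    using maximal_independent_coords by blast
  have finJ: "finite J" using J(2) finite_subset by auto
  let ?g = "\<lambda>t. coeff (rootprod n e t (\<lambda>_. 1))" and ?q = "\<lambda>t. rootprod n e1 t (\<lambda>_. 1)"
  have "\<forall>k\<in>{..d} - J. \<exists>f. (\<exists>m. hpoly (insert k J) m f) \<and> on_locus f \<and> (\<exists>t. pder k f (?g t) \<noteq> 0)"
    using separating_relation[OF J(1,2) _ J(4)] by blast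
  from bchoice[OF this] obtain f where f:
    "\<And>k. k \<in> {..d} - J \<Longrightarrow> \<exists>m. hpoly (insert k J) m (f k)"
    "\<And>k. k \<in> {..d} - J \<Longrightarrow> on_locus (f k)"
    "\<And>k. k \<in> {..d} - J \<Longrightarrow> \<exists>t. pder k (f k) (?g t) \<noteq> 0" by blast
  have fd: "\<exists>m. hpoly {..d} m (f k)" if "k \<in> {..d} - J" for k
    using f(1)[OF that] that J(2) by (auto intro: hpoly_mono)
  define \<Delta> where "\<Delta> = (\<lambda>t. \<Prod>k\<in>{..d} - J. pder k (f k) (?g t))"
  have pf: "(\<lambda>t. pder k (f k) (?g t)) \<in> polyfun {..<n}" if k: "k \<in> {..d} - J" for k
  proof -
    obtain m where "hpoly {..d} m (f k)" using fd[OF k] by blast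
    from hpoly_imp_polyfun[OF hpoly_pder(1)[OF this finite_atMost]] show ?thesis
      by (rule polyfun_compose) (intro polycoeffD polycoeff_rootprod_monic order_refl)
  qed
  have D1: "\<Delta> \<in> polyfun {..<n}" unfolding \<Delta>_def using pf by (intro polyfun_prod)
  have D2: "\<exists>t. \<Delta> t \<noteq> 0" unfolding \<Delta>_def using pf f(3) by (intro polyfun_prod_nonzero) auto
  have "\<exists>u. degree u \<le> n \<and> h = ?q t * u"
    if t: "\<Delta> t \<noteq> 0" and h: "degree h \<le> d" and
       tv: "tangent_vector (?g t) h" for t h
  proof -
    have tan: "(\<Sum>m\<le>d. pder m F (?g t) * coeff h m) = 0" if "hpoly {..d} k F" "on_locus F" for k F
      using tv that unfolding tangent_vector_def by blast
    have nz: "pder k (f k) (?g t) \<noteq> 0" if "k \<in> {..d} - J" for k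
      using t that unfolding \<Delta>_def by auto
    have inj: "r = 0" if r: "degree r \<le> d" "\<And>j. j \<in> J \<Longrightarrow> coeff r j = 0"
      "\<And>k F. hpoly {..d} k F \<Longrightarrow> on_locus F \<Longrightarrow> (\<Sum>m\<le>d. pder m F (?g t) * coeff r m) = 0" for r
    proof -
      have "coeff r k = 0" if k: "k \<in> {..d} - J" for k
      proof -
        obtain m where m: "hpoly (insert k J) m (f k)" using f(1)[OF k] by blast
        have "(\<Sum>l\<le>d. pder l (f k) (?g t) * coeff r l) = (\<Sum>l\<in>{k}. pder l (f k) (?g t) * coeff r l)"
        proof (intro sum.mono_neutral_right ballI)
          fix l assume l: "l \<in> {..d} - {k}"
          show "pder l (f k) (?g t) * coeff r l = 0"
          proof (cases "l \<in> J")
            case False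
            then show ?thesis using pder_other_variable[OF hpoly_imp_polyfun[OF m], of l] l by simp
          qed (use r(2) in simp)
        qed (use k in auto)
        moreover have "(\<Sum>l\<le>d. pder l (f k) (?g t) * coeff r l) = 0"
          using fd[OF k] r(3) f(2)[OF k] by blast
        ultimately show ?thesis using nz[OF k] by simp
      qed
      then have "coeff r k = 0" for k
        using r(1,2) by (cases "k \<in> J"; cases "k \<le> d") (auto simp: coeff_eq_0)
      then show ?thesis by (simp add: poly_eq_iff)
    qed
    \<comment> \<open>\<open>n + 2\<close> tangent vectors are dependent, as they are determined by their coordinates in \<open>J\<close>\<close>
    define v where "v a = (if a \<le> n then ?q t * monom 1 a else h)" for a
    have vd: "degree (v a) \<le> d" for a
      unfolding v_def using h degree_rootprod_e1[of t "\<lambda>_. 1"] degree_mult_le[of "?q t" "monom 1 a"]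
        degree_monom_le[of "1 :: complex" a] by auto
    have vt: "(\<Sum>m\<le>d. pder m F (?g t) * coeff (v a) m) = 0" if "hpoly {..d} k F" "on_locus F" for k F a
    proof (cases "a \<le> n")
      case True
      have "degree (monom (1 :: complex) a) \<le> n" using True degree_monom_le le_trans by blast
      then show ?thesis using tangent_contains[OF that] True unfolding v_def by simp
    qed (use tan[OF that] in \<open>simp add: v_def\<close>)
    obtain c where c: "\<exists>a\<le>n + 1. c a \<noteq> 0" "\<And>j. j \<in> J \<Longrightarrow> (\<Sum>a\<le>n + 1. c a * coeff (v a) j) = 0"
      using homogeneous_system_nontrivial_solution[of J "{..n + 1}" "\<lambda>a j. coeff (v a) j"] finJ J(3) by auto
    define r where "r = (\<Sum>a\<le>n + 1. smult (c a) (v a))"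
    have "r = 0"
    proof (rule inj)
      show "degree r \<le> d" unfolding r_def using vd
        by (intro degree_sum_le) (auto intro: order_trans[OF degree_smult_le])
      show "coeff r j = 0" if "j \<in> J" for j using c(2)[OF that] unfolding r_def by (simp add: coeff_sum)
      fix k F assume F: "hpoly {..d} k F" "on_locus F"
      have "(\<Sum>m\<le>d. pder m F (?g t) * coeff r m) = (\<Sum>a\<le>n + 1. c a * (\<Sum>m\<le>d. pder m F (?g t) * coeff (v a) m))"
        unfolding r_def coeff_sum sum_distrib_left by (subst sum.swap) (simp add: mult_ac)
      then show "(\<Sum>m\<le>d. pder m F (?g t) * coeff r m) = 0" using vt[OF F] by simp
    qed
    define s where "s = (\<Sum>a\<le>n. monom (c a) a)"
    have "r = ?q t * s + smult (c (n + 1)) h"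
      unfolding r_def s_def v_def sum_distrib_left
      by (simp add: smult_monom flip: mult_smult_right)
    then have eq: "?q t * s + smult (c (n + 1)) h = 0" using \<open>r = 0\<close> by simp
    have sd: "degree s \<le> n" unfolding s_def
      by (intro degree_sum_le) (auto intro: order_trans[OF degree_monom_le])
    have sc: "coeff s a = c a" if "a \<le> n" for a unfolding s_def coeff_sum using that by simp
    have q0: "?q t \<noteq> 0" unfolding rootprod_def by (simp add: lin_eq_0_iff)
    have cn: "c (n + 1) \<noteq> 0"
    proof
      assume 0: "c (n + 1) = 0"
      then have "s = 0" using eq q0 by simp
      then have "c a = 0" if "a \<le> n" for a using sc[OF that] by simp
      then show False using c(1) 0 by (auto simp: le_Suc_eq)
    qed
    have "smult (c (n + 1)) h = - (?q t * s)" using eq by (simp add: eq_neg_iff_add_eq_0 add.commute)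
    then have "smult (1 / c (n + 1)) (smult (c (n + 1)) h) = ?q t * smult (- 1 / c (n + 1)) s" by simp
    then have "h = ?q t * smult (- 1 / c (n + 1)) s" using cn by simp
    moreover have "degree (smult (- 1 / c (n + 1)) s) \<le> n" using sd degree_smult_le le_trans by blast
    ultimately show ?thesis by blast
  qed
  then show ?thesis using D1 D2 by (intro bexI[of _ \<Delta>]) auto
qed

end

section \<open>The dimension of a coincident root locus\<close>

text \<open>An irreducible set on which a product vanishes is contained in the zero locus of one of the factors;
  the factor \<open>g\<close> is replaced by its homogeneous components.\<close>

lemma irreducible_cancel:
  assumes irr: "zariski_irreducible d C" and pts: "\<And>p. p \<in> C \<Longrightarrow> \<exists>f. p = proj_point f \<and> f \<in> binary_forms d - {0}"
    and F: "hpoly {..d} k F" "proj_point f0 \<in> C" "F (coords d f0) \<noteq> 0"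
    and g: "g \<in> polyfun {..d}" "\<And>f. proj_point f \<in> C \<Longrightarrow> F (coords d f) * g (coords d f) = 0"
    and f: "proj_point f \<in> C"
  shows "g (coords d f) = 0"
proof -
  obtain h N where h: "\<And>k. hpoly {..d} k (h k)" "g = (\<lambda>x. \<Sum>k\<le>N. h k x)"
    using polyfun_decompose[OF g(1)] by blast
  obtain F' where F': "F' \<in> homogeneous_polys d" "eval_poly F' = F" using hpoly_eval_poly[OF F(1)] by blast
  have "h j (coords d f) = 0" if j: "j \<le> N" for j
  proof -
    obtain H where H: "H \<in> homogeneous_polys d" "eval_poly H = h j" using hpoly_eval_poly[OF h(1)] by blast
    let ?Z1 = "zero_locus d {F'}" and ?Z2 = "zero_locus d {H}"
    have closed: "zariski_closed d ?Z1" "zariski_closed d ?Z2" using F'(1) H(1) unfolding zariski_closed_def by blast+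
    have "C \<subseteq> ?Z1 \<union> ?Z2"
    proof
      fix p assume "p \<in> C"
      then obtain q where q: "p = proj_point q" "q \<in> binary_forms d - {0}" "proj_point q \<in> C" using pts by blast
      show "p \<in> ?Z1 \<union> ?Z2"
      proof (cases "F (coords d q) = 0")
        case True
        then have "p \<in> ?Z1" using q F'(2) by (auto simp: zero_locus_def)
        then show ?thesis by simp
      next
        case False
        let ?S = "{x. \<exists>c. c \<noteq> 0 \<and> x = coords d (scale c q)}"
        have "h j (coords d q) = 0"
        proof (rule hpoly_components_vanish_on_cone[where S = ?S, OF h(1)])
          fix x t assume x: "x \<in> ?S" "t \<noteq> (0 :: complex)"
          then obtain c where c: "c \<noteq> 0" "x = coords d (scale c q)" by blast
          then have "(\<lambda>i. t * x i) = coords d (scale (t * c) q)" by (simp add: coords_scale fun_eq_iff)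
          then show "(\<lambda>i. t * x i) \<in> ?S" using c(1) x(2) by (intro CollectI exI[of _ "t * c"]) simp
        next
          fix x assume "x \<in> ?S"
          then obtain c where c: "c \<noteq> 0" "x = coords d (scale c q)" by blast
          have pc: "proj_point (scale c q) = proj_point q" using c(1) proj_point_eq_iff by blast
          have "coords d (scale c q) = (\<lambda>i. c * coords d q i)" by (simp add: coords_scale fun_eq_iff)
          then have "F x \<noteq> 0" using False c hpoly_scale[OF F(1)] by simp
          moreover have "F x * g x = 0" using g(2)[of "scale c q"] q(3) pc c(2) by simp
          ultimately show "(\<Sum>k\<le>N. h k x) = 0" using h(2) by simp
        next
          show "coords d q \<in> ?S" by (intro CollectI exI[of _ 1]) simp
        qed (rule j)
        then have "p \<in> ?Z2" using q H(2) by (auto simp: zero_locus_def)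
        then show ?thesis by simp
      qed
    qed
    then have "C \<subseteq> ?Z1 \<or> C \<subseteq> ?Z2" using irr closed unfolding zariski_irreducible_def by blast
    moreover have "\<not> C \<subseteq> ?Z1"
    proof
      assume "C \<subseteq> ?Z1"
      then have "proj_point f0 \<in> ?Z1" using F(2) by blast
      then show False using proj_point_in_zero_locus[of "{F'}" d f0] F'(1,2) F(3) by simp
    qed
    ultimately have "proj_point f \<in> ?Z2" using f by blast
    then show ?thesis using proj_point_in_zero_locus[of "{H}" d f] H(1,2) by simp
  qed
  then show ?thesis unfolding h(2) by simp
qed

lemma zariski_closed_points:
  "zariski_closed d Z \<Longrightarrow> p \<in> Z \<Longrightarrow> \<exists>f. p = proj_point f \<and> f \<in> binary_forms d - {0}"
  unfolding zariski_closed_def zero_locus_def by blast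

text \<open>Along a strictly increasing chain \<open>C 0 \<subset> C 1 \<subset> \<dots>\<close> of irreducible closed sets, choose for each
  step a form that vanishes on the smaller but not on the larger set; these forms together with a
  coordinate function are algebraically independent on the cone of the last set.\<close>

lemma chain_algebraically_independent:
  assumes C: "\<And>i. i \<le> m \<Longrightarrow> zariski_closed d (C i)" "\<And>i. i \<le> m \<Longrightarrow> zariski_irreducible d (C i)"
    "\<And>i. i < m \<Longrightarrow> C i \<subset> C (Suc i)"
  shows "\<exists>x. (\<forall>j\<le>m. \<exists>k. hpoly {..d} k (x j)) \<and>
     (\<forall>P\<in>polyfun {..m}. (\<forall>f. proj_point f \<in> C m \<longrightarrow> P (\<lambda>j. x j (coords d f)) = 0) \<longrightarrow> (\<forall>X. P X = 0))"
  using C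
proof (induction m)
  case 0
  have "C 0 \<noteq> {}" using 0(2)[of 0] unfolding zariski_irreducible_def by blast
  then obtain p where "p \<in> C 0" by blast
  with zariski_closed_points[OF 0(1)[OF order_refl]]
  obtain f where f: "proj_point f \<in> C 0" "f \<in> binary_forms d - {0}" by metis
  have "coords d f \<noteq> (\<lambda>_. 0)"
  proof
    assume "coords d f = (\<lambda>_. 0)"
    then have "coeff (deh f) = (\<lambda>_. 0)" using f(2) coords_eq_coeff_deh[of f d] by simp
    then have "deh f = 0" by (simp add: poly_eq_iff)
    then show False using f(2) deh_eq_0_iff by blast
  qed
  then obtain i where i: "coords d f i \<noteq> 0" by auto
  have "i \<le> d" using i f(2) by (metis DiffD1 coeff_deh_binary_form coords_eq_coeff_deh)
  define x where "x = (\<lambda>(j :: nat) (z :: nat \<Rightarrow> complex). z i)"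
  have "P X = 0" if P: "P \<in> polyfun {..0}" and van: "\<And>f. proj_point f \<in> C 0 \<Longrightarrow> P (\<lambda>j. x j (coords d f)) = 0" for P X
  proof -
    obtain p where p: "\<And>t. P (\<lambda>i. 0 + t * 1) = poly p t" using polyfun_along_line[OF P, of "\<lambda>_. 0" "\<lambda>_. 1"] by blast
    have "poly p t = 0" if "t \<noteq> 0" for t
    proof -
      define c where "c = t / coords d f i"
      have c: "c \<noteq> 0" using that i by (simp add: c_def)
      have "proj_point (scale c f) = proj_point f" using c proj_point_eq_iff by blast
      then have "P (\<lambda>j. x j (coords d (scale c f))) = 0" using van f(1) by metis
      then show ?thesis using i p[of t] by (simp add: x_def coords_scale c_def)
    qed
    then have "UNIV - {0} \<subseteq> {t. poly p t = 0}" by auto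
    moreover have "infinite (UNIV - {0 :: complex})" using infinite_UNIV_char_0 by simp
    ultimately have "p = 0" using poly_roots_finite finite_subset by blast
    moreover have "P X = P (\<lambda>i. 0 + X 0 * 1)" by (rule polyfun_cong[OF P]) simp
    ultimately show ?thesis using p by simp
  qed
  moreover have "hpoly {..d} (Suc 0) (x j)" for j unfolding x_def using \<open>i \<le> d\<close> by (intro hpoly_coord) simp
  ultimately show ?case by (intro exI[of _ x]) blast
next
  case (Suc m)
  obtain x where x: "\<And>j. j \<le> m \<Longrightarrow> \<exists>k. hpoly {..d} k (x j)"
    "\<And>P. P \<in> polyfun {..m} \<Longrightarrow> (\<And>f. proj_point f \<in> C m \<Longrightarrow> P (\<lambda>j. x j (coords d f)) = 0) \<Longrightarrow> (\<forall>X. P X = 0)"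
    using Suc.IH Suc.prems by (metis le_Suc_eq less_Suc_eq)
  obtain p where p: "p \<in> C (Suc m)" "p \<notin> C m" using Suc.prems(3)[of m] by blast
  obtain f0 where f0: "p = proj_point f0" "f0 \<in> binary_forms d - {0}"
    using zariski_closed_points[OF Suc.prems(1)[OF order_refl] p(1)] by blast
  obtain kF F where F: "hpoly {..d} kF F" "F (coords d f0) \<noteq> 0" "\<And>g. proj_point g \<in> C m \<Longrightarrow> F (coords d g) = 0"
    using not_in_zariski_closedE[OF Suc.prems(1)[of m] f0(2)] p(2) f0(1) by auto
  define y where "y = x(Suc m := F)"
  have y: "\<exists>k. hpoly {..d} k (y j)" if "j \<le> Suc m" for j
    using that x(1)[of j] F(1) unfolding y_def by auto
  have "P X = 0" if P: "P \<in> polyfun {..Suc m}"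
    and van: "\<And>f. proj_point f \<in> C (Suc m) \<Longrightarrow> P (\<lambda>j. y j (coords d f)) = 0" for P X
  proof (rule ccontr)
    assume PX: "P X \<noteq> 0"
    have "{..Suc m} = insert (Suc m) {..m}" by auto
    then obtain Q N where Q: "\<And>k. (\<lambda>X. coeff (Q X) k) \<in> polyfun {..m}" "\<And>X. degree (Q X) \<le> N"
      "P = (\<lambda>X. poly (Q X) (X (Suc m)))"
      using polyfun_expand_variable[of P "Suc m" "{..m}"] P by auto
    have ex: "\<exists>l. \<exists>X. coeff (Q X) l \<noteq> 0"
    proof (rule ccontr)
      assume "\<not> ?thesis"
      then have "Q X = 0" for X by (auto simp: poly_eq_iff)
      then show False using PX Q(3) by simp
    qed
    define l where "l = (LEAST l. \<exists>X. coeff (Q X) l \<noteq> 0)"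
    have l: "\<exists>X. coeff (Q X) l \<noteq> 0" unfolding l_def using ex by (rule LeastI_ex)
    have below: "coeff (Q X) i = 0" if "i < l" for i X
      using not_less_Least[of i "\<lambda>l. \<exists>X. coeff (Q X) l \<noteq> 0"] that unfolding l_def by auto
    define R where "R = (\<lambda>z. \<Sum>i\<le>N. coeff (Q (\<lambda>j. x j z)) (i + l) * F z ^ i)"
    have Qy: "Q (\<lambda>j. y j z) = Q (\<lambda>j. x j z)" for z
    proof -
      have "coeff (Q (\<lambda>j. y j z)) k = coeff (Q (\<lambda>j. x j z)) k" for k
        by (rule polyfun_cong[OF Q(1)]) (auto simp: y_def)
      then show ?thesis by (simp add: poly_eq_iff)
    qed
    have prodzero: "F (coords d f) ^ l * R (coords d f) = 0" if f: "proj_point f \<in> C (Suc m)" for f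
    proof -
      let ?c = "\<lambda>i. coeff (Q (\<lambda>j. x j (coords d f))) i" and ?F = "F (coords d f)"
      have "0 = poly (Q (\<lambda>j. x j (coords d f))) ?F" using van[OF f] unfolding Q(3) Qy by (simp add: y_def)
      also have "\<dots> = (\<Sum>i\<le>N + l. ?c i * ?F ^ i)"
        using Q(2)[of "\<lambda>j. x j (coords d f)"] by (intro poly_altdef[THEN trans] sum.mono_neutral_left)
          (auto simp: coeff_eq_0 not_le)
      also have "\<dots> = (\<Sum>i\<in>{l..N + l}. ?c i * ?F ^ i)"
        by (intro sum.mono_neutral_right) (auto simp: below not_le)
      also have "\<dots> = (\<Sum>i\<le>N. ?c (i + l) * ?F ^ (i + l))"
        by (rule sum.reindex_bij_witness[of _ "\<lambda>i. i + l" "\<lambda>i. i - l"]) auto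
      also have "\<dots> = ?F ^ l * R (coords d f)" unfolding R_def by (simp add: sum_distrib_left power_add mult_ac)
      finally show ?thesis by simp
    qed
    have xp: "x j \<in> polyfun {..d}" if "j \<in> {..m}" for j using x(1)[of j] hpoly_imp_polyfun that by auto
    have Qx: "(\<lambda>z. coeff (Q (\<lambda>j. x j z)) k) \<in> polyfun {..d}" for k
      by (rule polyfun_compose[OF Q(1) xp])
    have "R \<in> polyfun {..d}" unfolding R_def
      by (intro polyfun_sum polyfun_mult polyfun_power Qx hpoly_imp_polyfun[OF F(1)])
    have R0: "R (coords d f) = 0" if f: "proj_point f \<in> C (Suc m)" for f
    proof (rule irreducible_cancel[OF Suc.prems(2)[OF order_refl] _ hpoly_power[OF F(1), of l] _ _ \<open>R \<in> polyfun {..d}\<close> prodzero f])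
      show "proj_point f0 \<in> C (Suc m)" using p(1) f0(1) by simp
    qed (use zariski_closed_points[OF Suc.prems(1)[OF order_refl]] F(2) in auto)
    have "coeff (Q X) l = 0" for X
    proof -
      have "coeff (Q (\<lambda>j. x j (coords d f))) l = 0" if f: "proj_point f \<in> C m" for f
      proof -
        have "R (coords d f) = (\<Sum>i\<le>N. if i = 0 then coeff (Q (\<lambda>j. x j (coords d f))) l else 0)"
          unfolding R_def using F(3)[OF f] by (intro sum.cong) auto
        moreover have "proj_point f \<in> C (Suc m)" using f Suc.prems(3)[of m] by blast
        ultimately show ?thesis using R0 by simp
      qed
      then show ?thesis using x(2)[OF Q(1)[of l]] by blast
    qed
    then show False using l by blast
  qed
  then show ?case using y by (intro exI[of _ y]) blast
qed

context root_locus
begin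

text \<open>The cone over the locus has a parametrization by \<open>n + 1\<close> variables, on which \<open>n + 2\<close> functions are
  dependent.\<close>

lemma chain_length_le:
  assumes C: "\<And>i. i \<le> m \<Longrightarrow> zariski_closed d (C i)" "\<And>i. i \<le> m \<Longrightarrow> zariski_irreducible d (C i)"
    "\<And>i. i \<le> m \<Longrightarrow> C i \<subseteq> locus" "\<And>i. i < m \<Longrightarrow> C i \<subset> C (Suc i)"
  shows "m \<le> n"
proof (rule ccontr)
  assume "\<not> m \<le> n"
  then have m: "n + 1 \<le> m" by simp
  have "\<exists>x. (\<forall>j\<le>n + 1. \<exists>k. hpoly {..d} k (x j)) \<and> (\<forall>P\<in>polyfun {..n + 1}.
      (\<forall>f. proj_point f \<in> C (n + 1) \<longrightarrow> P (\<lambda>j. x j (coords d f)) = 0) \<longrightarrow> (\<forall>X. P X = 0))"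
    using C m by (intro chain_algebraically_independent) auto
  then obtain x where x': "\<forall>j\<le>n + 1. \<exists>k. hpoly {..d} k (x j)"
    "\<forall>P\<in>polyfun {..n + 1}. (\<forall>f. proj_point f \<in> C (n + 1) \<longrightarrow> P (\<lambda>j. x j (coords d f)) = 0) \<longrightarrow> (\<forall>X. P X = 0)"
    by (elim exE conjE) (rule that)
  have x: "\<exists>k. hpoly {..d} k (x j)" if "j \<le> n + 1" for j using x'(1) that by simp
  have xp: "x j \<in> polyfun {..d}" if "j \<le> n + 1" for j using x[OF that] hpoly_imp_polyfun by blast
  let ?g = "\<lambda>j X. x j (coeff (smult (X n) (rootprod n e X (\<lambda>_. 1))))"
  have "?g j \<in> polyfun {..n}" if "j \<le> n + 1" for j
    by (rule polyfun_compose[OF xp[OF that]])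
       (intro polycoeffD polycoeff_smult polycoeff_rootprod_monic polyfun_coord; auto)
  then obtain P where P: "P \<in> polyfun {..n + 1}" "\<exists>X. P X \<noteq> 0" "\<And>X. P (\<lambda>j. ?g j X) = 0"
    using algebraically_dependent[of "{..n}" "n + 1" ?g] by auto
  have Pp: "(\<lambda>z. P (\<lambda>j. x j z)) \<in> polyfun {..d}" using xp by (intro polyfun_compose[OF P(1)]) auto
  have "on_locus (\<lambda>z. P (\<lambda>j. x j z))"
  proof (rule on_locusI[OF Pp])
    fix c :: complex and t :: "nat \<Rightarrow> complex"
    have "rootprod n e (t(n := c)) (\<lambda>_. 1) = rootprod n e t (\<lambda>_. 1)"
      unfolding rootprod_def by (intro prod.cong) auto
    then show "P (\<lambda>j. x j (coeff (smult c (rootprod n e t (\<lambda>_. 1))))) = 0" using P(3)[of "t(n := c)"] by simp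
  qed
  moreover have "P (\<lambda>j. x j (coords d f)) = 0" if f: "proj_point f \<in> C (n + 1)"
    and ol: "on_locus (\<lambda>z. P (\<lambda>j. x j z))" for f
  proof -
    have "proj_point f \<in> locus" using f C(3)[OF m] by blast
    then obtain c a b where "f \<in> binary_forms d" "deh f = smult c (rootprod n e a b)" unfolding locus_iff by blast
    then show ?thesis using ol coords_eq_coeff_deh unfolding on_locus_def by metis
  qed
  ultimately have "\<forall>X. P X = 0" using x'(2) P(1) by simp
  then show False using P(2) by blast
qed

text \<open>The products in which only the first \<open>j\<close> roots vary, whereas the other ones are \<open>0\<close>. Their
  closures form a chain of length \<open>n\<close>.\<close>

definition partial_locus :: "nat \<Rightarrow> complex bipoly set set" where
  "partial_locus j = {proj_point f | f. f \<in> binary_forms d - {0} \<and>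
     (\<exists>c x y. (\<forall>i\<in>{j..<n}. x i = 0 \<and> y i = 1) \<and> deh f = smult c (rootprod n e x y))}"

lemma partial_locus_subset: "partial_locus j \<subseteq> locus"
  unfolding partial_locus_def using locus_iff by blast

lemma partial_locus_mono: "i \<le> j \<Longrightarrow> partial_locus i \<subseteq> partial_locus j"
proof
  fix p assume ij: "i \<le> j" and "p \<in> partial_locus i"
  then obtain f c x y where f: "p = proj_point f" "f \<in> binary_forms d - {0}"
    "\<forall>k\<in>{i..<n}. x k = 0 \<and> y k = 1" "deh f = smult c (rootprod n e x y)"
    unfolding partial_locus_def by blast
  then have "\<forall>k\<in>{j..<n}. x k = 0 \<and> y k = 1" using ij by auto
  then show "p \<in> partial_locus j" unfolding partial_locus_def using f by blast
qed

text \<open>The set is the image of an affine space.\<close>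

lemma partial_locus_irreducible:
  assumes "zariski_closed d Z1" "zariski_closed d Z2" "partial_locus j \<subseteq> Z1 \<union> Z2"
  shows "partial_locus j \<subseteq> Z1 \<or> partial_locus j \<subseteq> Z2"
proof (rule ccontr)
  assume neg: "\<not> ?thesis"
  let ?x = "\<lambda>X i. if i < j then X (2 * i) else 0 :: complex" and ?y = "\<lambda>X i. if i < j then X (2 * i + 1) else 1 :: complex"
  let ?R = "\<lambda>X. rootprod n e (?x X) (?y X)"
  have pc: "polycoeff UNIV ?R"
    unfolding rootprod_def
  proof (intro polycoeff_prod polycoeff_power polycoeff_lin)
    fix i
    show "(\<lambda>X. ?x X i) \<in> polyfun UNIV" by (cases "i < j") (auto intro: polyfun_intros)
    show "(\<lambda>X. ?y X i) \<in> polyfun UNIV" by (cases "i < j") (auto intro: polyfun_intros)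
  qed
  have point: "\<exists>k F X. hpoly {..d} k F \<and> F (coeff (?R X)) \<noteq> 0 \<and> (\<forall>g. proj_point g \<in> Z \<longrightarrow> F (coords d g) = 0)"
    if Z: "zariski_closed d Z" "\<not> partial_locus j \<subseteq> Z" for Z
  proof -
    obtain f c x y where f: "f \<in> binary_forms d - {0}" "proj_point f \<notin> Z"
      "\<And>i. i \<in> {j..<n} \<Longrightarrow> x i = 0 \<and> y i = 1" "deh f = smult c (rootprod n e x y)"
      using Z(2) unfolding partial_locus_def by blast
    obtain k F where F: "hpoly {..d} k F" "F (coords d f) \<noteq> 0" "\<And>g. proj_point g \<in> Z \<Longrightarrow> F (coords d g) = 0"
      using not_in_zariski_closedE[OF Z(1) f(1,2)] by metis
    obtain X where X: "\<And>i. X (2 * i) = x i" "\<And>i. X (2 * i + 1) = y i" using odd_even_coords[of x y] by metis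
    have "?R X = rootprod n e x y"
      unfolding rootprod_def X using f(3) by (intro prod.cong) auto
    moreover have "coords d f = (\<lambda>i. c * coeff (rootprod n e x y) i)"
      using coords_eq_coeff_deh[of f d] f(1,4) by (auto simp: fun_eq_iff)
    ultimately have "F (coeff (?R X)) \<noteq> 0" using F(2) hpoly_scale[OF F(1), of c] by auto
    then show ?thesis using F by blast
  qed
  obtain k1 F1 X1 where F1: "hpoly {..d} k1 F1" "F1 (coeff (?R X1)) \<noteq> 0" "\<And>g. proj_point g \<in> Z1 \<Longrightarrow> F1 (coords d g) = 0"
    using point[OF assms(1)] neg by blast
  obtain k2 F2 X2 where F2: "hpoly {..d} k2 F2" "F2 (coeff (?R X2)) \<noteq> 0" "\<And>g. proj_point g \<in> Z2 \<Longrightarrow> F2 (coords d g) = 0"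
    using point[OF assms(2)] neg by blast
  have p: "(\<lambda>X. F1 (coeff (?R X))) \<in> polyfun UNIV" "(\<lambda>X. F2 (coeff (?R X))) \<in> polyfun UNIV"
    "(\<lambda>X. coeff (?R X) d) \<in> polyfun UNIV"
    using polyfun_compose[OF hpoly_imp_polyfun[OF F1(1)] polycoeffD[OF pc]]
      polyfun_compose[OF hpoly_imp_polyfun[OF F2(1)] polycoeffD[OF pc]] polycoeffD[OF pc] by auto
  have "coeff (?R (\<lambda>_. 1)) d \<noteq> 0"
    using coeff_rootprod_top[of n e "?x (\<lambda>_. 1)" "?y (\<lambda>_. 1)"] sum_e by simp
  moreover obtain X0 where "F1 (coeff (?R X0)) * F2 (coeff (?R X0)) \<noteq> 0"
    using polyfun_mult_nonzero[OF p(1,2) F1(2) F2(2)] by blast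
  ultimately have "\<exists>X. (F1 (coeff (?R X)) * F2 (coeff (?R X))) * coeff (?R X) d \<noteq> 0"
    by (intro polyfun_mult_nonzero[OF polyfun_mult[OF p(1,2)] p(3)])
  then obtain X where X: "(F1 (coeff (?R X)) * F2 (coeff (?R X))) * coeff (?R X) d \<noteq> 0"
    by blast
  define f where "f = form_of d (coeff (?R X))"
  have df: "deh f = ?R X" unfolding f_def by (rule deh_form_of_coeff[OF degree_rootprod_e])
  have fb: "f \<in> binary_forms d" unfolding f_def by (rule form_of_in_binary_forms)
  have f0: "f \<noteq> 0"
  proof
    assume "f = 0"
    then have "deh f = 0" by simp
    then show False using df X by simp
  qed
  have "proj_point f \<in> partial_locus j"
    unfolding partial_locus_def using fb f0 df
    by (intro CollectI exI[of _ f] conjI refl DiffI exI[of _ 1] exI[of _ "?x X"] exI[of _ "?y X"]) auto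
  then have "proj_point f \<in> Z1 \<or> proj_point f \<in> Z2" using assms(3) by blast
  then show False using F1(3)[of f] F2(3)[of f] X coords_eq_coeff_deh[OF fb] df by auto
qed

lemma prod_monom: "(\<Prod>i\<in>A. monom 1 (k i)) = (monom 1 (\<Sum>i\<in>A. k i) :: 'a::comm_semiring_1 poly)"
  by (induction A rule: infinite_finite_induct) (auto simp: mult_monom)

lemma rootprod_tail:
  assumes "\<And>i. i \<in> {j..<n} \<Longrightarrow> x i = 0 \<and> y i = 1" "j \<le> n"
  shows "rootprod n e x y = (\<Prod>i<j. lin (x i) (y i) ^ e i) * monom 1 (\<Sum>i=j..<n. e i)"
proof -
  have "{..<n} = {..<j} \<union> {j..<n}" using assms(2) by auto
  then have "rootprod n e x y = (\<Prod>i<j. lin (x i) (y i) ^ e i) * (\<Prod>i=j..<n. lin (x i) (y i) ^ e i)"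
    unfolding rootprod_def by (simp add: prod.union_disjoint ivl_disj_int)
  also have "(\<Prod>i=j..<n. lin (x i) (y i) ^ e i) = (\<Prod>i=j..<n. monom 1 1 ^ e i)"
    using assms(1) by (intro prod.cong) (auto simp: lin_def monom_Suc one_pCons)
  also have "\<dots> = monom 1 (\<Sum>i=j..<n. e i)" by (simp add: monom_power prod_monom)
  finally show ?thesis .
qed

lemma zariski_dim_locus: "zariski_dim d locus = enat n"
proof (rule antisym)
  show "zariski_dim d locus \<le> enat n"
    unfolding zariski_dim_def
  proof (rule Sup_least)
    fix a assume "a \<in> {enat m | m. \<exists>C. (\<forall>i\<le>m. zariski_closed d (C i) \<and> zariski_irreducible d (C i) \<and> C i \<subseteq> locus) \<and>
                          (\<forall>i<m. C i \<subset> C (Suc i))}"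
    then obtain m C where "a = enat m" "\<forall>i\<le>m. zariski_closed d (C i) \<and> zariski_irreducible d (C i) \<and> C i \<subseteq> locus"
      "\<forall>i<m. C i \<subset> C (Suc i)" by blast
    then show "a \<le> enat n" using chain_length_le[of m C] by simp
  qed
next
  define C where "C j = zariski_closure d (partial_locus j)" for j
  have zl: "partial_locus j \<subseteq> zero_locus d {}" for j
  proof
    fix p assume "p \<in> partial_locus j"
    then obtain f where "p = proj_point f" "f \<in> binary_forms d - {0}"
      using partial_locus_subset locus_points by blast
    then show "p \<in> zero_locus d {}" by (simp add: zero_locus_def)
  qed
  have closed: "zariski_closed d (C j)" for j
    unfolding C_def by (rule zariski_closed_zariski_closure[OF zl])
  have sub: "C j \<subseteq> locus" for j
    unfolding C_def by (rule zariski_closure_minimal[OF locus_closed partial_locus_subset])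
  have deg1: "degree (rootprod n e x y) \<le> d" for x y :: "nat \<Rightarrow> complex" by (rule degree_rootprod_e)
  \<comment> \<open>the first \<open>j\<close> roots are put at infinity, which leaves a single monomial\<close>
  have witness: "\<exists>f. f \<in> binary_forms d - {0} \<and> proj_point f \<in> partial_locus j \<and> deh f = monom 1 (\<Sum>i=j..<n. e i)"
    if j: "j \<le> n" for j
  proof -
    define x :: "nat \<Rightarrow> complex" where "x i = (if i < j then -1 else 0)" for i
    define y :: "nat \<Rightarrow> complex" where "y i = (if i < j then 0 else 1)" for i
    have r: "rootprod n e x y = monom 1 (\<Sum>i=j..<n. e i)"
      using rootprod_tail[of j x y] j by (simp add: x_def y_def lin_def one_pCons[symmetric])
    define f where "f = form_of d (coeff (rootprod n e x y))"
    have df: "deh f = rootprod n e x y" unfolding f_def by (rule deh_form_of_coeff[OF degree_rootprod_e])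
    have fb: "f \<in> binary_forms d" unfolding f_def by (rule form_of_in_binary_forms)
    have f0: "f \<noteq> 0"
    proof
      assume "f = 0"
      then have "deh f = 0" by simp
      then show False using df r by simp
    qed
    have "proj_point f \<in> partial_locus j"
      unfolding partial_locus_def using fb f0 df
      by (intro CollectI exI[of _ f] conjI refl DiffI exI[of _ 1] exI[of _ x] exI[of _ y]) (auto simp: x_def y_def)
    then show ?thesis using fb f0 df r by auto
  qed
  have irr: "zariski_irreducible d (C j)" if j: "j \<le> n" for j
    unfolding zariski_irreducible_def
  proof (intro conjI allI impI)
    show "C j \<noteq> {}" using witness[OF j] zariski_closure_superset unfolding C_def by blast
    fix Z1 Z2 assume Z: "zariski_closed d Z1" "zariski_closed d Z2" "C j \<subseteq> Z1 \<union> Z2"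
    then have "partial_locus j \<subseteq> Z1 \<or> partial_locus j \<subseteq> Z2"
      using zariski_closure_superset by (intro partial_locus_irreducible) (auto simp: C_def)
    then show "C j \<subseteq> Z1 \<or> C j \<subseteq> Z2" unfolding C_def using Z zariski_closure_minimal by blast
  qed
  have strict: "C j \<subset> C (Suc j)" if j: "j < n" for j
  proof -
    have "partial_locus j \<subseteq> C (Suc j)"
      using partial_locus_mono[of j "Suc j"] zariski_closure_superset unfolding C_def by fastforce
    then have "C j \<subseteq> C (Suc j)" using zariski_closure_minimal[OF closed] unfolding C_def by blast
    moreover define m where "m = (\<Sum>i=Suc j..<n. e i)"
    have m: "m < (\<Sum>i=j..<n. e i)" unfolding m_def using j e_pos[OF j] by (simp add: sum.atLeast_Suc_lessThan)
    have md: "m \<le> d"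
    proof -
      have "m \<le> (\<Sum>i<n. e i)" unfolding m_def by (intro sum_mono2) auto
      then show ?thesis using sum_e by simp
    qed
    \<comment> \<open>the coordinate \<open>m\<close> vanishes on the smaller set, where \<open>0\<close> is a root of higher order\<close>
    obtain F where F: "F \<in> homogeneous_polys d" "eval_poly F = (\<lambda>X. X m)"
      using hpoly_eval_poly[OF hpoly_coord, of m d] md by auto
    have "partial_locus j \<subseteq> zero_locus d {F}"
    proof
      fix p assume "p \<in> partial_locus j"
      then obtain f c x y where f: "p = proj_point f" "f \<in> binary_forms d - {0}"
        "\<And>i. i \<in> {j..<n} \<Longrightarrow> x i = 0 \<and> y i = 1" "deh f = smult c (rootprod n e x y)"
        unfolding partial_locus_def by blast
      have "rootprod n e x y = (\<Prod>i<j. lin (x i) (y i) ^ e i) * monom 1 (\<Sum>i=j..<n. e i)"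
        using f(3) j by (intro rootprod_tail) auto
      then have "coeff (deh f) m = 0" using m f(4) by (simp add: mult.commute[of _ "monom _ _"] coeff_monom_mult)
      then show "p \<in> zero_locus d {F}"
        using f(1,2) F(2) coords_eq_coeff_deh[of f d] by (auto simp: zero_locus_def)
    qed
    moreover have "zariski_closed d (zero_locus d {F})" using F(1) unfolding zariski_closed_def by blast
    ultimately have CF: "C j \<subseteq> zero_locus d {F}" unfolding C_def by (intro zariski_closure_minimal)
    obtain f where f: "f \<in> binary_forms d - {0}" "proj_point f \<in> partial_locus (Suc j)" "deh f = monom 1 m"
      using witness[of "Suc j"] j unfolding m_def by auto
    have "proj_point f \<in> C (Suc j)" using f(2) zariski_closure_superset unfolding C_def by blast
    moreover have "proj_point f \<notin> C j"
    proof
      assume "proj_point f \<in> C j"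
      then have "eval_poly F (coords d f) = 0" using CF proj_point_in_zero_locus[of "{F}" d f] F(1) by auto
      then show False using f(1,3) F(2) coords_eq_coeff_deh[of f d] by simp
    qed
    ultimately show ?thesis using \<open>C j \<subseteq> C (Suc j)\<close> by blast
  qed
  show "enat n \<le> zariski_dim d locus"
    unfolding zariski_dim_def
  proof (rule Sup_upper, intro CollectI exI[of _ n] conjI refl exI[of _ C] allI impI)
    fix i assume "i \<le> n" then show "zariski_irreducible d (C i)" by (rule irr)
  next
    fix i assume "i < n" then show "C i \<subset> C (Suc i)" by (rule strict)
  qed (use closed sub in auto)
qed

section \<open>The dual varieties\<close>

lemma tangent_subspace_iff:
  assumes "h \<in> binary_forms d"
  shows "h \<in> tangent_subspace d locus g \<longleftrightarrow> tangent_vector (coords d g) (deh h)"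
  unfolding tangent_vector_def
proof
  assume h: "h \<in> tangent_subspace d locus g"
  show "\<forall>k F. hpoly {..d} k F \<longrightarrow> on_locus F \<longrightarrow> (\<Sum>m\<le>d. pder m F (coords d g) * coeff (deh h) m) = 0"
  proof (intro allI impI)
    fix k F assume F: "hpoly {..d} k F" "on_locus F"
    obtain G where G: "G \<in> homogeneous_polys d" "eval_poly G = F" using hpoly_eval_poly[OF F(1)] by blast
    then have "G \<in> vanishing_polys d locus" using F(2) on_locus_iff[OF F(1)] by (simp add: vanishing_polys_def)
    then have "(\<Sum>m\<le>d. partial_deriv m G (coords d g) * coords d h m) = 0"
      using h by (auto simp: tangent_subspace_def)
    then show "(\<Sum>m\<le>d. pder m F (coords d g) * coeff (deh h) m) = 0"
      by (simp add: partial_deriv_eq_pder G(2) coords_eq_coeff_deh[OF assms])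
  qed
next
  assume *: "\<forall>k F. hpoly {..d} k F \<longrightarrow> on_locus F \<longrightarrow> (\<Sum>m\<le>d. pder m F (coords d g) * coeff (deh h) m) = 0"
  have "(\<Sum>m\<le>d. partial_deriv m G (coords d g) * coords d h m) = 0" if G: "G \<in> vanishing_polys d locus" for G
  proof -
    have "G \<in> homogeneous_polys d" using G by (simp add: vanishing_polys_def)
    then obtain k where k: "hpoly {..d} k (eval_poly G)" using eval_poly_hpoly by blast
    then have "on_locus (eval_poly G)" using G on_locus_iff[OF k] by (simp add: vanishing_polys_def)
    then show ?thesis using * k by (simp add: partial_deriv_eq_pder coords_eq_coeff_deh[OF assms])
  qed
  then show "h \<in> tangent_subspace d locus g" using assms by (auto simp: tangent_subspace_def)
qed

text \<open>The factor \<open>c\<close> only rescales the derivatives, which are homogeneous.\<close>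

lemma cofactor_in_tangent_subspace:
  assumes g: "g \<in> binary_forms d" "deh g = smult c (rootprod n e x y)" "c \<noteq> 0" and u: "degree u \<le> n"
  shows "form_of d (coeff (rootprod n e1 x y * u)) \<in> tangent_subspace d locus g"
    and "deh (form_of d (coeff (rootprod n e1 x y * u))) = rootprod n e1 x y * u"
proof -
  have "degree (rootprod n e1 x y * u) \<le> d"
    using degree_mult_le[of "rootprod n e1 x y" u] degree_rootprod_e1[of x y] u by linarith
  then show dh: "deh (form_of d (coeff (rootprod n e1 x y * u))) = rootprod n e1 x y * u"
    by (rule deh_form_of_coeff)
  show "form_of d (coeff (rootprod n e1 x y * u)) \<in> tangent_subspace d locus g"
    unfolding tangent_subspace_iff[OF form_of_in_binary_forms] dh tangent_vector_def
  proof (intro allI impI)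
    fix k F assume F: "hpoly {..d} k F" "on_locus F"
    have "coords d g = (\<lambda>i. c * coeff (rootprod n e x y) i)"
      using coords_eq_coeff_deh[OF g(1)] g(2) by (auto simp: fun_eq_iff)
    then have "pder m F (coords d g) = c ^ (k - 1) * pder m F (coeff (rootprod n e x y))" for m
      using hpoly_scale[OF hpoly_pder(1)[OF F(1) finite_atMost]] by simp
    then have "(\<Sum>m\<le>d. pder m F (coords d g) * coeff (rootprod n e1 x y * u) m) =
      c ^ (k - 1) * (\<Sum>m\<le>d. pder m F (coeff (rootprod n e x y)) * coeff (rootprod n e1 x y * u) m)"
      by (simp add: sum_distrib_left mult.assoc)
    then show "(\<Sum>m\<le>d. pder m F (coords d g) * coeff (rootprod n e1 x y * u) m) = 0"
      using tangent_contains[OF F u] by simp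
  qed
qed

lemma dim_multiples:
  fixes q :: "complex poly"
  assumes q: "q \<noteq> 0" "degree q + n \<le> d"
  shows "bipoly.dim {h \<in> binary_forms d. \<exists>u. degree u \<le> n \<and> deh h = q * u} = n + 1"
    (is "bipoly.dim ?T = _")
proof (rule bipoly.dim_unique)
  define b where "b i = form_of d (coeff (q * monom 1 i))" for i :: nat
  have db: "deh (b i) = q * monom 1 i" if "i \<le> n" for i
    unfolding b_def using that q(2) degree_mult_le[of q "monom 1 i"] degree_monom_le[of "1 :: complex" i]
    by (intro deh_form_of_coeff) linarith
  have bb: "b i \<in> binary_forms d" for i unfolding b_def by (rule form_of_in_binary_forms)
  have inj: "inj_on b {..n}"
  proof (rule inj_onI)
    fix i j assume "i \<in> {..n}" "j \<in> {..n}" "b i = b j"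
    then have "q * monom 1 i = q * monom 1 j" using db[of i] db[of j] by (metis atMost_iff)
    then have "(monom 1 i :: complex poly) = monom 1 j" using q(1) mult_left_cancel by blast
    then show "i = j" by (metis degree_monom_eq zero_neq_one)
  qed
  show "b ` {..n} \<subseteq> ?T"
  proof (rule image_subsetI)
    fix i assume i: "i \<in> {..n}"
    then have "degree (monom (1 :: complex) i) \<le> n" using degree_monom_le le_trans atMost_iff by metis
    then show "b i \<in> ?T" using bb[of i] db[of i] i by auto
  qed
  show "card (b ` {..n}) = n + 1" using inj by (simp add: card_image)
  have deh_comb: "deh (\<Sum>i\<le>n. scale (c i) (b i)) = q * (\<Sum>i\<le>n. monom (c i) i)" for c
    unfolding deh_sum sum_distrib_left
    by (intro sum.cong) (auto simp: deh_scale db smult_monom simp flip: mult_smult_right)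
  show "?T \<subseteq> bipoly.span (b ` {..n})"
  proof
    fix h assume "h \<in> ?T"
    then obtain u where h: "h \<in> binary_forms d" "degree u \<le> n" "deh h = q * u" by blast
    have "deh h = deh (\<Sum>i\<le>n. scale (coeff u i) (b i))"
      unfolding deh_comb using h(2,3) by (simp add: poly_as_sum_of_monoms')
    then have "h = (\<Sum>i\<le>n. scale (coeff u i) (b i))"
      using h(1) bb by (intro deh_inj[of _ d]) (auto intro: binary_forms_sum scale_in_binary_forms)
    moreover have "(\<Sum>i\<le>n. scale (coeff u i) (b i)) \<in> bipoly.span (b ` {..n})"
      by (rule bipoly.span_sum, rule bipoly.span_scale, rule bipoly.span_base) auto
    ultimately show "h \<in> bipoly.span (b ` {..n})" by simp
  qed
  show "bipoly.independent (b ` {..n})"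
  proof (rule bipoly.independent_if_scalars_zero)
    fix f v assume *: "(\<Sum>x\<in>b ` {..n}. scale (f x) x) = 0" and v: "v \<in> b ` {..n}"
    have "(\<Sum>i\<le>n. scale (f (b i)) (b i)) = 0" using * by (simp add: sum.reindex[OF inj])
    then have "q * (\<Sum>i\<le>n. monom (f (b i)) i) = 0" using deh_comb[of "\<lambda>i. f (b i)"] by simp
    then have s0: "(\<Sum>i\<le>n. monom (f (b i)) i) = 0" using q(1) by simp
    obtain i where i: "i \<le> n" "v = b i" using v by auto
    have "coeff (\<Sum>i\<le>n. monom (f (b i)) i) i = f (b i)" using i(1) by (simp add: coeff_sum)
    then show "f v = 0" using s0 i by simp
  qed simp
qed

text \<open>Where the tangent space consists exactly of the multiples of \<open>q = rootprod n e1 t (\<lambda>_. 1)\<close>, its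
  dimension \<open>n + 1\<close> makes the point smooth, and the hyperplane of \<open>f\<close> contains the tangent space if
  and only if \<open>q\<close> annihilates \<open>f\<close>.\<close>

lemma generic_forms_in_dual_variety:
  "\<exists>\<Delta>\<in>polyfun {..<n}. (\<exists>t. \<Delta> t \<noteq> 0) \<and> (\<forall>t f. \<Delta> t \<noteq> 0 \<longrightarrow> f \<in> binary_forms d - {0} \<longrightarrow>
        kills d (d - n) (rootprod n e1 t (\<lambda>_. 1)) (nrm d f) \<longrightarrow> proj_point f \<in> dual_variety d locus)"
proof -
  obtain \<Delta> where D: "\<Delta> \<in> polyfun {..<n}" "\<exists>t. \<Delta> t \<noteq> 0"
    "\<forall>t h. \<Delta> t \<noteq> 0 \<longrightarrow> degree h \<le> d \<longrightarrow> tangent_vector (coeff (rootprod n e t (\<lambda>_. 1))) h \<longrightarrow>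
       (\<exists>u. degree u \<le> n \<and> h = rootprod n e1 t (\<lambda>_. 1) * u)"
    using generic_tangent_space by blast
  have "proj_point f \<in> dual_variety d locus"
    if t: "\<Delta> t \<noteq> 0" and f: "f \<in> binary_forms d - {0}" and k: "kills d (d - n) (rootprod n e1 t (\<lambda>_. 1)) (nrm d f)" for t f
  proof -
    let ?p = "rootprod n e t (\<lambda>_. 1)" and ?q = "rootprod n e1 t (\<lambda>_. 1)"
    define g where "g = form_of d (coeff (smult 1 ?p))"
    have gb: "g \<in> binary_forms d" unfolding g_def by (rule form_of_in_binary_forms)
    have dg: "deh g = smult 1 ?p" unfolding g_def using degree_rootprod_e by (intro deh_form_of_coeff) simp
    have cg: "coords d g = coeff ?p" using coords_eq_coeff_deh[OF gb] dg by simp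
    have q0: "?q \<noteq> 0" unfolding rootprod_def by (simp add: lin_eq_0_iff)
    have "?p \<noteq> 0" unfolding rootprod_def by (simp add: lin_eq_0_iff)
    then have gl: "proj_point g \<in> locus" unfolding g_def by (intro form_in_locus) simp
    have T: "tangent_subspace d locus g = {h \<in> binary_forms d. \<exists>u. degree u \<le> n \<and> deh h = ?q * u}"
    proof (intro equalityI subsetI)
      fix h assume h: "h \<in> tangent_subspace d locus g"
      then have hb: "h \<in> binary_forms d" by (simp add: tangent_subspace_def)
      have "\<exists>u. degree u \<le> n \<and> deh h = ?q * u"
        using h D(3) t degree_deh[OF hb] unfolding tangent_subspace_iff[OF hb] cg by simp
      then show "h \<in> {h \<in> binary_forms d. \<exists>u. degree u \<le> n \<and> deh h = ?q * u}" using hb by simp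
    next
      fix h assume "h \<in> {h \<in> binary_forms d. \<exists>u. degree u \<le> n \<and> deh h = ?q * u}"
      then obtain u where u: "h \<in> binary_forms d" "degree u \<le> n" "deh h = ?q * u" by blast
      then have "h = form_of d (coeff (?q * u))" using form_of_deh by metis
      then show "h \<in> tangent_subspace d locus g"
        using cofactor_in_tangent_subspace(1)[OF gb dg _ u(2)] by simp
    qed
    have "bipoly.dim (tangent_subspace d locus g) = n + 1"
      unfolding T by (rule dim_multiples[OF q0 degree_rootprod_e1])
    then have "smooth_point d locus g"
      unfolding smooth_point_def using gl by (simp add: zariski_dim_locus one_enat_def)
    moreover have "proj_tangent_space d locus g \<subseteq> hyperplane d f"
    proof -
      have "apply_operator h f = 0" if "h \<in> tangent_subspace d locus g" for h
      proof -
        have "h \<in> {h \<in> binary_forms d. \<exists>u. degree u \<le> n \<and> deh h = ?q * u}" using that T by simp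
        then obtain u where u: "h \<in> binary_forms d" "degree u \<le> n" "deh h = ?q * u" by auto
        have "degree ?q \<le> d - n" using degree_rootprod_e1[of t "\<lambda>_. 1"] by linarith
        moreover have "degree u + (d - n) \<le> d" using u(2) sum_e1 by linarith
        ultimately have "ap (nrm d f) (?q * u) = 0" using k kills_iff by blast
        then show ?thesis using apply_operator_same_degree[OF u(1)] f u(3) by simp
      qed
      then have "tangent_subspace d locus g - {0} \<subseteq> {h \<in> binary_forms d - {0}. apply_operator h f = 0}"
        by (auto simp: tangent_subspace_def)
      then show ?thesis unfolding proj_tangent_space_def hyperplane_def by (rule image_mono)
    qed
    ultimately have "proj_point f \<in> {proj_point f | f. f \<in> binary_forms d - {0} \<and>
          (\<exists>g. smooth_point d locus g \<and> proj_tangent_space d locus g \<subseteq> hyperplane d f)}"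
      using f by (intro CollectI exI[of _ f] conjI exI[of _ g]) auto
    then show ?thesis unfolding dual_variety_def by (rule subsetD[OF zariski_closure_superset])
  qed
  then show ?thesis using D(1,2) by (intro bexI[of _ \<Delta>]) auto
qed

text \<open>The multiples of \<open>rootprod n e1 x y\<close> are tangent vectors at every point of the locus.\<close>

lemma tangent_hyperplane_imp_kills:
  assumes f: "f \<in> binary_forms d" and g: "smooth_point d locus g" "proj_tangent_space d locus g \<subseteq> hyperplane d f"
  shows "\<exists>x y. (\<forall>i<n. x i \<noteq> 0 \<or> y i \<noteq> 0) \<and> kills d (d - n) (rootprod n e1 x y) (nrm d f)"
proof -
  have "proj_point g \<in> locus" using g(1) by (simp add: smooth_point_def)
  then obtain c x y where gb: "g \<in> binary_forms d" "g \<noteq> 0" "deh g = smult c (rootprod n e x y)"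
    unfolding locus_iff by blast
  have dg: "deh g \<noteq> 0" using gb(1,2) deh_eq_0_iff by blast
  then have c: "c \<noteq> 0" and "rootprod n e x y \<noteq> 0" using gb(3) by auto
  then have nz: "x i \<noteq> 0 \<or> y i \<noteq> 0" if "i < n" for i
    using that e_pos[OF that] lin_eq_0_iff[of "x i" "y i"] unfolding rootprod_def by auto
  have dq: "degree (rootprod n e1 x y) \<le> d - n" using degree_rootprod_e1[of x y] by linarith
  have "ap (nrm d f) (rootprod n e1 x y * u) = 0" if u: "degree u + (d - n) \<le> d" for u
  proof -
    have un: "degree u \<le> n" using u sum_e1 by linarith
    define h where "h = form_of d (coeff (rootprod n e1 x y * u))"
    have h: "h \<in> tangent_subspace d locus g" "deh h = rootprod n e1 x y * u"
      unfolding h_def using cofactor_in_tangent_subspace[OF gb(1,3) c un] by auto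
    have hb: "h \<in> binary_forms d" unfolding h_def by (rule form_of_in_binary_forms)
    have "ap (nrm d f) (deh h) = 0"
    proof (cases "h = 0")
      case False
      then have "proj_point h \<in> hyperplane d f" using h(1) g(2) unfolding proj_tangent_space_def by blast
      then obtain h' where h': "proj_point h = proj_point h'" "h' \<in> binary_forms d" "apply_operator h' f = 0"
        unfolding hyperplane_def by auto
      obtain a where "h = scale a h'" using h'(1) proj_point_eq_iff by blast
      moreover have "ap (nrm d f) (deh h') = 0" using apply_operator_same_degree[OF h'(2) f] h'(3) by simp
      ultimately show ?thesis by (simp add: deh_scale ap_smult)
    qed simp
    then show ?thesis using h(2) by simp
  qed
  then have "kills d (d - n) (rootprod n e1 x y) (nrm d f)" using kills_iff[OF dq] by blast
  then show ?thesis using nz by blast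
qed

end

section \<open>Perturbation of linear systems and of kernels\<close>

text \<open>A matrix with independent rows has a right inverse, and so have the nearby matrices, with a common
  bound. The proof eliminates one equation and a pivot variable at a time.\<close>

lemma perturbed_linear_system:
  fixes A :: "'f \<Rightarrow> nat \<Rightarrow> nat \<Rightarrow> real"
  assumes "\<And>i j. i < N \<Longrightarrow> j < n \<Longrightarrow> ((\<lambda>f. A f i j) \<longlongrightarrow> A0 i j) F"
    "\<And>i. i < N \<Longrightarrow> ((\<lambda>f. b f i) \<longlongrightarrow> 0) F"
    "\<And>h. (\<forall>j<n. (\<Sum>i<N. h i * A0 i j) = 0) \<Longrightarrow> \<forall>i<N. h i = 0" "\<epsilon> > 0"
  shows "\<forall>\<^sub>F f in F. \<exists>u. (\<forall>j<n. \<bar>u j\<bar> < \<epsilon>) \<and> (\<forall>i<N. (\<Sum>j<n. A f i j * u j) = b f i)"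
  using assms
proof (induction N arbitrary: A A0 b \<epsilon>)
  case 0
  then show ?case by (intro always_eventually allI exI[of _ "\<lambda>_. 0"]) auto
next
  case (Suc N)
  obtain p where p: "p < n" "A0 N p \<noteq> 0"
  proof (rule ccontr)
    assume "\<not> thesis"
    then have "\<forall>j<n. (\<Sum>i<Suc N. (if i = N then 1 else 0) * A0 i j) = 0" using that by auto
    then have "\<forall>i<Suc N. (if i = N then 1 else 0) = (0 :: real)" by (rule Suc.prems(3))
    then show False by auto
  qed
  define A' where "A' f i j = A f i j - A f i p / A f N p * A f N j" for f i j
  define A0' where "A0' i j = A0 i j - A0 i p / A0 N p * A0 N j" for i j
  define b' where "b' f i = b f i - A f i p / A f N p * b f N" for f i
  define M where "M = (\<Sum>j<n. \<bar>A0 N j / A0 N p\<bar>) + 1"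
  have M: "M > 0" "\<And>j. j < n \<Longrightarrow> \<bar>A0 N j / A0 N p\<bar> < M"
  proof -
    show "M > 0" unfolding M_def by (intro add_nonneg_pos sum_nonneg) auto
    fix j assume "j < n"
    then have "\<bar>A0 N j / A0 N p\<bar> \<le> (\<Sum>j<n. \<bar>A0 N j / A0 N p\<bar>)" by (intro member_le_sum) auto
    then show "\<bar>A0 N j / A0 N p\<bar> < M" unfolding M_def by linarith
  qed
  \<comment> \<open>so small that the pivot variable, computed from the others, stays below \<open>\<epsilon>\<close>\<close>
  define \<epsilon>' where "\<epsilon>' = min \<epsilon> (\<epsilon> / (2 * (real n * M + 1)))"
  have nM: "real n * M + 1 > 0" using M(1) by (intro add_nonneg_pos) auto
  have e': "\<epsilon>' > 0" unfolding \<epsilon>'_def using Suc.prems(4) nM by simp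
  have lim: "((\<lambda>f. A f N j / A f N p) \<longlongrightarrow> A0 N j / A0 N p) F" if "j < n" for j
    using p that by (intro tendsto_divide Suc.prems(1)) auto
  have "\<forall>\<^sub>F f in F. \<exists>u. (\<forall>j<n. \<bar>u j\<bar> < \<epsilon>') \<and> (\<forall>i<N. (\<Sum>j<n. A' f i j * u j) = b' f i)"
  proof (rule Suc.IH)
    fix i j assume ij: "i < N" "j < n"
    show "((\<lambda>f. A' f i j) \<longlongrightarrow> A0' i j) F" unfolding A'_def A0'_def
      using p ij by (intro tendsto_diff tendsto_mult tendsto_divide Suc.prems(1)) auto
  next
    fix i assume i: "i < N"
    have "((\<lambda>f. b' f i) \<longlongrightarrow> 0 - A0 i p / A0 N p * 0) F" unfolding b'_def
      using p i by (intro tendsto_diff tendsto_mult tendsto_divide Suc.prems(1,2)) auto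
    then show "((\<lambda>f. b' f i) \<longlongrightarrow> 0) F" by simp
  next
    fix h assume h: "\<forall>j<n. (\<Sum>i<N. h i * A0' i j) = 0"
    define h' where "h' = h(N := - (\<Sum>i<N. h i * (A0 i p / A0 N p)))"
    have "(\<Sum>i<Suc N. h' i * A0 i j) = (\<Sum>i<N. h i * A0' i j)" for j
    proof -
      have "(\<Sum>i<N. h' i * A0 i j) = (\<Sum>i<N. h i * A0 i j)" unfolding h'_def by (intro sum.cong) auto
      then have "(\<Sum>i<Suc N. h' i * A0 i j) = (\<Sum>i<N. h i * A0 i j) - (\<Sum>i<N. h i * (A0 i p / A0 N p)) * A0 N j"
        by (simp add: h'_def)
      then show ?thesis unfolding A0'_def
        by (simp add: sum_distrib_right right_diff_distrib sum_subtractf mult.assoc)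
    qed
    then have "\<forall>i<Suc N. h' i = 0" using h by (intro Suc.prems(3)) simp
    then have "h' i = 0" if "i < N" for i using that by simp
    then show "\<forall>i<N. h i = 0" unfolding h'_def by auto
  qed (rule e')
  moreover have "\<forall>\<^sub>F f in F. A f N p \<noteq> 0"
    using p Suc.prems(1)[of N p] by (intro tendsto_imp_eventually_ne) auto
  moreover have "\<forall>\<^sub>F f in F. \<forall>j\<in>{..<n}. \<bar>A f N j / A f N p\<bar> < M"
    by (intro eventually_ball_finite ballI order_tendstoD(2)[OF tendsto_rabs[OF lim]] M(2)) auto
  moreover have "\<forall>\<^sub>F f in F. \<bar>b f N / A f N p\<bar> < \<epsilon> / 2"
  proof -
    have "((\<lambda>f. b f N / A f N p) \<longlongrightarrow> 0 / A0 N p) F"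
      using p by (intro tendsto_divide Suc.prems(1,2)) auto
    from order_tendstoD(2)[OF tendsto_rabs[OF this], of "\<epsilon> / 2"] show ?thesis using Suc.prems(4) by simp
  qed
  ultimately show ?case
  proof eventually_elim
    case (elim f)
    then obtain u where u: "\<forall>j<n. \<bar>u j\<bar> < \<epsilon>'" "\<forall>i<N. (\<Sum>j<n. A' f i j * u j) = b' f i" by blast
    define s where "s = (\<Sum>j\<in>{..<n} - {p}. A f N j / A f N p * u j)"
    define v where "v = u(p := b f N / A f N p - s)"
    have vsum: "(\<Sum>j<n. c j * v j) = c p * (b f N / A f N p - s) + (\<Sum>j\<in>{..<n} - {p}. c j * u j)" for c
      unfolding v_def using p(1) by (subst sum.remove[of _ p]) (auto intro!: sum.cong)
    have "A f N p * s = (\<Sum>j\<in>{..<n} - {p}. A f N j * u j)"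
      unfolding s_def sum_distrib_left using elim(2) by (intro sum.cong) auto
    then have rowN: "(\<Sum>j<n. A f N j * v j) = b f N"
      unfolding vsum using elim(2) by (simp add: right_diff_distrib)
    have "(\<Sum>j<n. A f i j * v j) = b f i" if i: "i < N" for i
    proof -
      have "(\<Sum>j<n. A' f i j * v j) = (\<Sum>j<n. A' f i j * u j)"
        using elim(2) by (intro sum.cong) (auto simp: v_def A'_def)
      then have "(\<Sum>j<n. A' f i j * v j) = b' f i" using u(2) i by simp
      moreover have "(\<Sum>j<n. A' f i j * v j) = (\<Sum>j<n. A f i j * v j) - A f i p / A f N p * (\<Sum>j<n. A f N j * v j)"
        unfolding A'_def by (simp add: left_diff_distrib sum_subtractf sum_distrib_left mult.assoc)
      ultimately show ?thesis unfolding rowN b'_def by simp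
    qed
    then have rows: "\<forall>i<Suc N. (\<Sum>j<n. A f i j * v j) = b f i" using rowN by (auto simp: less_Suc_eq)
    have "\<bar>s\<bar> \<le> (\<Sum>j\<in>{..<n} - {p}. M * \<epsilon>')"
      unfolding s_def
    proof (rule order_trans[OF sum_abs sum_mono])
      fix j assume "j \<in> {..<n} - {p}"
      then have "\<bar>A f N j / A f N p\<bar> \<le> M" "\<bar>u j\<bar> \<le> \<epsilon>'" using elim(3) u(1) by (auto intro: less_imp_le)
      then show "\<bar>A f N j / A f N p * u j\<bar> \<le> M * \<epsilon>'" unfolding abs_mult by (intro mult_mono) (use M(1) in auto)
    qed
    also have "\<dots> \<le> real n * M * \<epsilon>'"
    proof -
      have "real (card ({..<n} - {p})) \<le> real n" by (auto intro!: card_mono[of "{..<n}", simplified])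
      then show ?thesis using M(1) e' by (simp add: mult.assoc mult_right_mono)
    qed
    also have "\<dots> < (real n * M + 1) * \<epsilon>'" using e' by (simp add: distrib_right)
    also have "\<dots> \<le> (real n * M + 1) * (\<epsilon> / (2 * (real n * M + 1)))"
      using nM unfolding \<epsilon>'_def by (intro mult_left_mono) auto
    also have "\<dots> = \<epsilon> / 2" using nM by (simp add: field_simps)
    finally have "\<bar>b f N / A f N p - s\<bar> < \<epsilon>" using elim(4) by linarith
    then have "\<forall>j<n. \<bar>v j\<bar> < \<epsilon>" using u(1) unfolding v_def \<epsilon>'_def by auto
    then show ?case using rows by blast
  qed
qed

definition ptendsto :: "('f \<Rightarrow> 'a::real_normed_field poly) \<Rightarrow> 'a poly \<Rightarrow> 'f filter \<Rightarrow> bool" where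
  "ptendsto P p F \<longleftrightarrow> (\<forall>j. ((\<lambda>f. coeff (P f) j) \<longlongrightarrow> coeff p j) F)"

lemma ptendstoD: "ptendsto P p F \<Longrightarrow> ((\<lambda>f. coeff (P f) j) \<longlongrightarrow> coeff p j) F"
  by (simp add: ptendsto_def)

lemma ptendsto_const: "ptendsto (\<lambda>_. p) p F"
  by (simp add: ptendsto_def)

lemma ptendsto_mult: "ptendsto P p F \<Longrightarrow> ptendsto Q q F \<Longrightarrow> ptendsto (\<lambda>f. P f * Q f) (p * q) F"
  unfolding ptendsto_def coeff_mult by (intro allI tendsto_intros) auto

lemma ptendsto_prod:
  "(\<And>i. i \<in> A \<Longrightarrow> ptendsto (P i) (p i) F) \<Longrightarrow> ptendsto (\<lambda>f. \<Prod>i\<in>A. P i f) (\<Prod>i\<in>A. p i) F"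
  by (induction A rule: infinite_finite_induct) (auto intro: ptendsto_const ptendsto_mult)

lemma ptendsto_lin:
  assumes "(X \<longlongrightarrow> x) F" "(Y \<longlongrightarrow> y) F" shows "ptendsto (\<lambda>f. lin (X f) (Y f)) (lin x y) F"
  unfolding ptendsto_def
proof
  fix j
  consider "j = 0" | "j = 1" | i where "j = Suc (Suc i)" by (metis One_nat_def not0_implies_Suc)
  then show "((\<lambda>f. coeff (lin (X f) (Y f)) j) \<longlongrightarrow> coeff (lin x y) j) F"
    using assms by cases (auto simp: lin_def intro: tendsto_intros)
qed

text \<open>The linear factor is applied first and lowers the degree of the form by one.\<close>

lemma kills_Suc_lin:
  fixes x y :: "'a::field"
  assumes "degree q \<le> s" "d \<ge> 1"
  shows "kills d (Suc s) (q * lin x y) a \<longleftrightarrow> kills (d - 1) s q (\<lambda>j. y * a (Suc j) - x * a j)"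
proof -
  have deg: "degree (q * lin x y) \<le> Suc s"
    using degree_mult_le[of q "lin x y"] degree_lin[of x y] assms(1) by linarith
  have "ap a (lin x y * monom 1 i) = y * a (Suc i) - x * a i" for i
    by (subst ap_mult_monom[OF degree_lin]) (simp add: lin_def)
  then have "ap a (q * lin x y * u) = ap (\<lambda>j. y * a (Suc j) - x * a j) (q * u)" for u
    using ap_mult[of a "lin x y" "q * u"] by (simp add: mult_ac)
  moreover have "degree u + Suc s \<le> d \<longleftrightarrow> degree u + s \<le> d - 1" for u :: "'a poly" using assms(2) by linarith
  ultimately show ?thesis unfolding kills_iff[OF deg] kills_iff[OF assms(1)] by simp
qed

text \<open>The recurrence is solved upwards from \<open>a 0\<close> if \<open>y \<noteq> 0\<close> and downwards from \<open>a d\<close> if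
  \<open>x \<noteq> 0\<close>, so that the divisor stays away from zero.\<close>

lemma solve_antiderivative:
  fixes x y :: "'a::real_normed_field"
  assumes X: "(X \<longlongrightarrow> x) F" "(Y \<longlongrightarrow> y) F" "x \<noteq> 0 \<or> y \<noteq> 0"
    and B': "\<And>j. ((\<lambda>f. B' f j) \<longlongrightarrow> y * a (Suc j) - x * a j) F"
  shows "\<exists>B. (\<forall>j. ((\<lambda>f. B f j) \<longlongrightarrow> a j) F) \<and>
    (\<forall>\<^sub>F f in F. \<forall>j<d. Y f * B f (Suc j) - X f * B f j = B' f j)"
proof (cases "y = 0")
  case False
  define B where "B f = rec_nat (a 0) (\<lambda>j r. (B' f j + X f * r) / Y f)" for f
  have B0: "B f 0 = a 0" and BS: "B f (Suc j) = (B' f j + X f * B f j) / Y f" for f j by (simp_all add: B_def)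
  have "((\<lambda>f. B f j) \<longlongrightarrow> a j) F" for j
  proof (induction j)
    case (Suc j)
    have "((\<lambda>f. (B' f j + X f * B f j) / Y f) \<longlongrightarrow> (y * a (Suc j) - x * a j + x * a j) / y) F"
      using False by (intro tendsto_intros X B' Suc) auto
    then show ?case unfolding BS using False by simp
  qed (simp add: B0)
  moreover have "\<forall>\<^sub>F f in F. Y f \<noteq> 0" using X(2) False by (rule tendsto_imp_eventually_ne)
  then have "\<forall>\<^sub>F f in F. \<forall>j<d. Y f * B f (Suc j) - X f * B f j = B' f j"
    by eventually_elim (auto simp: BS)
  ultimately show ?thesis by blast
next
  case True
  then have x: "x \<noteq> 0" using X(3) by simp
  define C where "C f = rec_nat (a d) (\<lambda>k r. (Y f * r - B' f (d - Suc k)) / X f)" for f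
  have C0: "C f 0 = a d" and CS: "C f (Suc k) = (Y f * C f k - B' f (d - Suc k)) / X f" for f k by (simp_all add: C_def)
  have lim: "k \<le> d \<Longrightarrow> ((\<lambda>f. C f k) \<longlongrightarrow> a (d - k)) F" for k
  proof (induction k)
    case (Suc k)
    have "((\<lambda>f. (Y f * C f k - B' f (d - Suc k)) / X f) \<longlongrightarrow>
       (y * a (d - k) - (y * a (Suc (d - Suc k)) - x * a (d - Suc k))) / x) F"
      using Suc x by (intro tendsto_intros X B') auto
    then show ?case unfolding CS using x Suc.prems by (simp add: Suc_diff_Suc)
  qed (simp add: C0)
  define B where "B f j = (if j \<le> d then C f (d - j) else a j)" for f j
  have "((\<lambda>f. B f j) \<longlongrightarrow> a j) F" for j
    using lim[of "d - j"] by (cases "j \<le> d") (auto simp: B_def)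
  moreover have "\<forall>\<^sub>F f in F. X f \<noteq> 0" using X(1) x by (rule tendsto_imp_eventually_ne)
  then have "\<forall>\<^sub>F f in F. \<forall>j<d. Y f * B f (Suc j) - X f * B f j = B' f j"
  proof eventually_elim
    case (elim f)
    show ?case
    proof (intro allI impI)
      fix j assume j: "j < d"
      define k where "k = d - Suc j"
      have "d - j = Suc k" "d - Suc k = j" using j unfolding k_def by auto
      then have "B f j = (Y f * B f (Suc j) - B' f j) / X f" using j CS[of f k] by (simp add: B_def k_def)
      then show "Y f * B f (Suc j) - X f * B f j = B' f j" using elim by simp
    qed
  qed
  ultimately show ?thesis by blast
qed

text \<open>The kernels vary continuously with the roots because they have constant dimension; the proof
  splits off one linear factor at a time.\<close>

lemma kernel_continuity:
  fixes x y :: "nat \<Rightarrow> 'a::real_normed_field"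
  assumes "\<And>i. i < s \<Longrightarrow> ((\<lambda>f. X f i) \<longlongrightarrow> x i) F" "\<And>i. i < s \<Longrightarrow> ((\<lambda>f. Y f i) \<longlongrightarrow> y i) F"
    "\<And>i. i < s \<Longrightarrow> x i \<noteq> 0 \<or> y i \<noteq> 0" "s \<le> d" "kills d s (\<Prod>i<s. lin (x i) (y i)) a"
  shows "\<exists>B. (\<forall>j. ((\<lambda>f. B f j) \<longlongrightarrow> a j) F) \<and>
     (\<forall>\<^sub>F f in F. kills d s (\<Prod>i<s. lin (X f i) (Y f i)) (B f))"
  using assms
proof (induction s arbitrary: d a)
  case 0
  show ?case
  proof (intro exI[of _ "\<lambda>_. a"] conjI)
    show "\<forall>\<^sub>F f in F. kills d 0 (\<Prod>i<0. lin (X f i) (Y f i)) a" using 0(5) by (intro always_eventually) simp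
  qed simp
next
  case (Suc s)
  have d: "d \<ge> 1" "s \<le> d - 1" using Suc.prems(4) by auto
  have deg: "degree (\<Prod>i<s. lin (x' i) (y' i)) \<le> s" for x' y' :: "nat \<Rightarrow> 'a"
    using degree_prod_lin[of x' y' "{..<s}"] by simp
  let ?a = "\<lambda>j. y s * a (Suc j) - x s * a j"
  have "kills (d - 1) s (\<Prod>i<s. lin (x i) (y i)) ?a"
    using Suc.prems(5) kills_Suc_lin[OF deg d(1)] by simp
  then have "\<exists>B'. (\<forall>j. ((\<lambda>f. B' f j) \<longlongrightarrow> ?a j) F) \<and>
    (\<forall>\<^sub>F f in F. kills (d - 1) s (\<Prod>i<s. lin (X f i) (Y f i)) (B' f))"
    using Suc.prems(1-3) d(2) by (intro Suc.IH) auto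
  then obtain B' where B': "\<forall>j. ((\<lambda>f. B' f j) \<longlongrightarrow> ?a j) F"
    "\<forall>\<^sub>F f in F. kills (d - 1) s (\<Prod>i<s. lin (X f i) (Y f i)) (B' f)" by blast
  obtain B where B: "\<forall>j. ((\<lambda>f. B f j) \<longlongrightarrow> a j) F"
    "\<forall>\<^sub>F f in F. \<forall>j<d. Y f s * B f (Suc j) - X f s * B f j = B' f j"
    using solve_antiderivative[of "\<lambda>f. X f s" "x s" F "\<lambda>f. Y f s" "y s" B' a d] Suc.prems(1-3)[of s] B'(1) by auto
  have "\<forall>\<^sub>F f in F. kills d (Suc s) (\<Prod>i<Suc s. lin (X f i) (Y f i)) (B f)"
    using B'(2) B(2)
  proof eventually_elim
    case (elim f)
    have "kills (d - 1) s (\<Prod>i<s. lin (X f i) (Y f i)) (\<lambda>j. Y f s * B f (Suc j) - X f s * B f j) \<longleftrightarrow>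
      kills (d - 1) s (\<Prod>i<s. lin (X f i) (Y f i)) (B' f)"
      using elim(2) d(1) by (intro kills_cong) auto
    then show ?case using elim(1) kills_Suc_lin[OF deg d(1)] by simp
  qed
  then show ?case using B(1) by blast
qed

section \<open>Forms annihilated by real-rooted forms\<close>

text \<open>The linear form with the real root of direction \<open>\<theta>\<close>; all directions occur for angles in the half
  circle \<open>{0..<pi}\<close>, and \<open>pi / 2\<close> is the root at infinity.\<close>

definition cl :: "real \<Rightarrow> real poly" where
  "cl \<theta> = lin (sin \<theta>) (cos \<theta>)"

lemma sin_or_cos_nonzero: "sin \<theta> \<noteq> 0 \<or> cos \<theta> \<noteq> (0 :: real)"
  using sin_cos_squared_add[of \<theta>] by (metis power_zero_numeral add_0 zero_neq_one)

lemma degree_cl: "degree (cl \<theta>) \<le> 1"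
  unfolding cl_def by (rule degree_lin)

lemma cos_sin_det: "cos a * sin b - sin a * cos b = sin (b - a :: real)"
  by (simp add: sin_diff)

lemma hev_prod_cl: "hev (card A) (\<Prod>i\<in>A. cl (\<theta> i)) (sin \<phi>) (cos \<phi>) = (\<Prod>i\<in>A. sin (\<phi> - \<theta> i))"
  unfolding cl_def hev_prod_lin cos_sin_det ..

definition distinct_angles :: "'i set \<Rightarrow> ('i \<Rightarrow> real) \<Rightarrow> bool" where
  "distinct_angles I \<theta> \<longleftrightarrow> (\<forall>i\<in>I. \<forall>j\<in>I. i \<noteq> j \<longrightarrow> sin (\<theta> i - \<theta> j) \<noteq> 0)"

lemma distinct_points_of_angles:
  "distinct_angles I \<theta> \<Longrightarrow> distinct_points I (\<lambda>i. sin (\<theta> i)) (\<lambda>i. cos (\<theta> i))"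
  unfolding distinct_points_def distinct_angles_def cos_sin_det using sin_or_cos_nonzero by metis

lemma distinct_angles_in_half_circle:
  assumes "\<Theta> \<subseteq> {0..<pi}" shows "distinct_angles \<Theta> (\<lambda>\<theta>. \<theta>)"
  unfolding distinct_angles_def
proof (intro ballI impI)
  fix a b assume ab: "a \<in> \<Theta>" "b \<in> \<Theta>" "a \<noteq> b"
  then have r: "0 \<le> a" "a < pi" "0 \<le> b" "b < pi" using assms by auto
  consider "a < b" | "b < a" using ab by linarith
  then show "sin (a - b) \<noteq> 0"
  proof cases
    case 1 then show ?thesis using sin_gt_zero[of "b - a"] r sin_minus[of "b - a"] by simp
  next
    case 2 then show ?thesis using sin_gt_zero[of "a - b"] r by simp
  qed
qed

lemma angle_mod_pi: "\<exists>\<theta>' c. \<theta>' \<in> {0..<pi} \<and> c \<noteq> 0 \<and> cl \<theta> = smult c (cl \<theta>')"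
proof -
  obtain t where t: "0 \<le> t" "t < 2 * pi" "cos \<theta> = cos t" "sin \<theta> = sin t"
    using sincos_total_2pi[of "cos \<theta>" "sin \<theta>"] by auto
  show ?thesis
  proof (cases "t < pi")
    case True
    then show ?thesis using t by (intro exI[of _ t] exI[of _ 1]) (simp add: cl_def)
  next
    case False
    have "cos t = - cos (t - pi)" "sin t = - sin (t - pi)" by (simp_all add: cos_diff sin_diff)
    then have "cl \<theta> = smult (-1) (cl (t - pi))" using t by (simp add: cl_def lin_def)
    then show ?thesis using False t by (intro exI[of _ "t - pi"] exI[of _ "-1"]) auto
  qed
qed

lemma linear_form_angle:
  fixes u v :: real shows "\<exists>\<theta> \<rho>. u = \<rho> * sin \<theta> \<and> v = \<rho> * cos \<theta>"
proof -
  let ?r = "sqrt (u\<^sup>2 + v\<^sup>2)"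
  show ?thesis
  proof (cases "?r = 0")
    case True
    then have "u = 0" "v = 0" by (simp_all add: sum_power2_eq_zero_iff)
    then show ?thesis by (intro exI[of _ 0]) simp
  next
    case False
    then have "(v / ?r)\<^sup>2 + (u / ?r)\<^sup>2 = 1"
      by (simp add: power_divide add_divide_distrib[symmetric] add.commute)
    then obtain t where "v / ?r = cos t" "u / ?r = sin t" using sincos_total_2pi by metis
    then show ?thesis using False by (intro exI[of _ t] exI[of _ ?r]) (auto simp: field_simps)
  qed
qed

text \<open>The sequences of forms of real rank at most \<open>s\<close> lie between \<open>Wdist d s\<close> and \<open>Wbar d s\<close>.\<close>

definition Wbar :: "nat \<Rightarrow> nat \<Rightarrow> (nat \<Rightarrow> real) set" where
  "Wbar d s = {a. \<exists>\<theta>. kills d s (\<Prod>i<s. cl (\<theta> i)) a}"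

definition Wdist :: "nat \<Rightarrow> nat \<Rightarrow> (nat \<Rightarrow> real) set" where
  "Wdist d s = {a. \<exists>\<theta>. distinct_angles {..<s} \<theta> \<and> kills d s (\<Prod>i<s. cl (\<theta> i)) a}"

definition real_rooted :: "nat \<Rightarrow> real poly \<Rightarrow> bool" where
  "real_rooted s p \<longleftrightarrow> (\<exists>\<theta>. p = (\<Prod>i<s. cl (\<theta> i)))"

lemma real_rooted_cl: "real_rooted 1 (cl \<theta>)"
  unfolding real_rooted_def by (rule exI[of _ "\<lambda>_. \<theta>"]) simp

lemma real_rooted_1: "real_rooted 0 1"
  unfolding real_rooted_def by simp

lemma real_rooted_mult:
  assumes "real_rooted s p" "real_rooted t q" shows "real_rooted (s + t) (p * q)"
proof -
  obtain \<theta> \<phi> where p: "p = (\<Prod>i<s. cl (\<theta> i))" and q: "q = (\<Prod>i<t. cl (\<phi> i))"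
    using assms unfolding real_rooted_def by blast
  define \<psi> where "\<psi> i = (if i < s then \<theta> i else \<phi> (i - s))" for i
  have "(\<Prod>i<s + t. cl (\<psi> i)) = (\<Prod>i<s. cl (\<psi> i)) * (\<Prod>i=s..<s + t. cl (\<psi> i))"
    by (subst prod.union_disjoint[symmetric]) (auto intro!: prod.cong)
  also have "(\<Prod>i=s..<s + t. cl (\<psi> i)) = (\<Prod>i<t. cl (\<psi> (i + s)))"
    by (rule prod.reindex_bij_witness[of _ "\<lambda>i. i + s" "\<lambda>i. i - s"]) auto
  finally show ?thesis unfolding real_rooted_def p q
    by (intro exI[of _ \<psi>]) (simp add: \<psi>_def)
qed

lemma real_rooted_power: "real_rooted s p \<Longrightarrow> real_rooted (n * s) (p ^ n)"
  by (induction n) (auto simp: real_rooted_1 intro: real_rooted_mult)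

lemma real_rooted_prod:
  "(\<And>i. i \<in> A \<Longrightarrow> real_rooted (s i) (p i)) \<Longrightarrow> real_rooted (\<Sum>i\<in>A. s i) (\<Prod>i\<in>A. p i)"
  by (induction A rule: infinite_finite_induct) (auto simp: real_rooted_1 intro: real_rooted_mult)

lemma degree_real_rooted: "real_rooted s p \<Longrightarrow> degree p \<le> s"
  unfolding real_rooted_def cl_def using degree_prod_lin[of _ _ "{..<s}"] by auto

lemma WbarI: "real_rooted s p \<Longrightarrow> kills d s p a \<Longrightarrow> a \<in> Wbar d s"
  unfolding Wbar_def real_rooted_def by blast

lemma real_rooted_collect:
  fixes \<theta> :: "nat \<Rightarrow> real"
  shows "\<exists>\<Theta> \<mu> c. finite \<Theta> \<and> \<Theta> \<subseteq> {0..<pi} \<and> c \<noteq> 0 \<and> (\<forall>\<phi>\<in>\<Theta>. \<mu> \<phi> \<ge> (1 :: nat)) \<and> sum \<mu> \<Theta> = s \<and>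
     (\<Prod>i<s. cl (\<theta> i)) = smult c (\<Prod>\<phi>\<in>\<Theta>. cl \<phi> ^ \<mu> \<phi>)"
proof -
  have "\<forall>i. \<exists>\<phi> c. \<phi> \<in> {0..<pi} \<and> c \<noteq> 0 \<and> cl (\<theta> i) = smult c (cl \<phi>)" using angle_mod_pi by blast
  then obtain \<phi> c where pc: "\<And>i. \<phi> i \<in> {0..<pi}" "\<And>i. c i \<noteq> 0" "\<And>i. cl (\<theta> i) = smult (c i) (cl (\<phi> i))" by metis
  define \<Theta> where "\<Theta> = \<phi> ` {..<s}"
  define \<mu> where "\<mu> x = card {i \<in> {..<s}. \<phi> i = x}" for x
  have "(\<Prod>i<s. cl (\<theta> i)) = smult (\<Prod>i<s. c i) (\<Prod>i<s. cl (\<phi> i))"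
    unfolding pc(3) by (simp add: prod_smult)
  also have "(\<Prod>i<s. cl (\<phi> i)) = (\<Prod>x\<in>\<Theta>. \<Prod>i\<in>{i \<in> {..<s}. \<phi> i = x}. cl (\<phi> i))"
    unfolding \<Theta>_def by (rule prod.image_gen) simp
  also have "\<dots> = (\<Prod>x\<in>\<Theta>. cl x ^ \<mu> x)"
    unfolding \<mu>_def by (intro prod.cong refl) simp
  finally have eq: "(\<Prod>i<s. cl (\<theta> i)) = smult (\<Prod>i<s. c i) (\<Prod>x\<in>\<Theta>. cl x ^ \<mu> x)" .
  have "sum \<mu> \<Theta> = (\<Sum>i<s. 1)"
    unfolding \<Theta>_def \<mu>_def by (subst sum.image_gen[of "{..<s}" _ \<phi>]) auto
  moreover have "\<mu> x \<ge> 1" if "x \<in> \<Theta>" for x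
  proof -
    have "{i \<in> {..<s}. \<phi> i = x} \<noteq> {}" using that unfolding \<Theta>_def by blast
    then have "card {i \<in> {..<s}. \<phi> i = x} > 0" by (simp add: card_gt_0_iff)
    then show ?thesis unfolding \<mu>_def by simp
  qed
  moreover have "finite \<Theta>" "\<Theta> \<subseteq> {0..<pi}" unfolding \<Theta>_def using pc(1) by auto
  moreover have "(\<Prod>i<s. c i) \<noteq> 0" using pc(2) by simp
  ultimately show ?thesis using eq by (intro exI[of _ \<Theta>] exI[of _ \<mu>] exI[of _ "\<Prod>i<s. c i"]) simp
qed

definition near :: "nat \<Rightarrow> real \<Rightarrow> (nat \<Rightarrow> real) \<Rightarrow> (nat \<Rightarrow> real) \<Rightarrow> bool" where
  "near d \<delta> a b \<longleftrightarrow> (\<forall>i\<le>d. \<bar>b i - a i\<bar> < \<delta>)"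

text \<open>The neighbourhoods of \<open>a\<close> with respect to the entries up to \<open>d\<close>, which are those of a form.\<close>

definition nbhd :: "nat \<Rightarrow> (nat \<Rightarrow> real) \<Rightarrow> (nat \<Rightarrow> real) filter" where
  "nbhd d a = (INF \<delta>\<in>{0<..}. principal {b. near d \<delta> a b})"

lemma eventually_nbhd: "eventually P (nbhd d a) \<longleftrightarrow> (\<exists>\<delta>>0. \<forall>b. near d \<delta> a b \<longrightarrow> P b)"
proof -
  have "eventually P (nbhd d a) \<longleftrightarrow> (\<exists>\<delta>\<in>{0<..}. eventually P (principal {b. near d \<delta> a b}))"
    unfolding nbhd_def
  proof (rule eventually_INF_base)
    fix x y :: real assume "x \<in> {0<..}" "y \<in> {0<..}"
    then show "\<exists>z\<in>{0<..}. principal {b. near d z a b} \<le> inf (principal {b. near d x a b}) (principal {b. near d y a b})"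
      by (intro bexI[of _ "min x y"]) (auto simp: near_def)
  qed auto
  then show ?thesis by (auto simp: eventually_principal)
qed

lemma tendsto_nbhd: "i \<le> d \<Longrightarrow> ((\<lambda>b. b i) \<longlongrightarrow> a i) (nbhd d a)"
  unfolding tendsto_iff dist_real_def eventually_nbhd near_def by blast

lemma near_trans: "near d \<delta> a b \<Longrightarrow> near d \<epsilon> b c \<Longrightarrow> near d (\<delta> + \<epsilon>) a c"
  unfolding near_def
proof (intro allI impI)
  fix i assume "\<forall>i\<le>d. \<bar>b i - a i\<bar> < \<delta>" "\<forall>i\<le>d. \<bar>c i - b i\<bar> < \<epsilon>" "i \<le> d"
  then have "\<bar>b i - a i\<bar> < \<delta>" "\<bar>c i - b i\<bar> < \<epsilon>" by auto
  then show "\<bar>c i - a i\<bar> < \<delta> + \<epsilon>" by linarith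
qed

lemma near_interior: "near d \<delta> a b \<Longrightarrow> \<exists>\<epsilon>>0. \<forall>c. near d \<epsilon> b c \<longrightarrow> near d \<delta> a c"
proof -
  assume n: "near d \<delta> a b"
  define \<epsilon> where "\<epsilon> = Min ((\<lambda>i. \<delta> - \<bar>b i - a i\<bar>) ` {..d})"
  have "\<epsilon> > 0" unfolding \<epsilon>_def using n by (subst Min_gr_iff) (auto simp: near_def)
  moreover have "near d \<delta> a c" if "near d \<epsilon> b c" for c
    unfolding near_def
  proof (intro allI impI)
    fix i assume i: "i \<le> d"
    then have "\<epsilon> \<le> \<delta> - \<bar>b i - a i\<bar>" unfolding \<epsilon>_def by (intro Min_le) auto
    moreover have "\<bar>c i - b i\<bar> < \<epsilon>" using that i by (simp add: near_def)
    ultimately show "\<bar>c i - a i\<bar> < \<delta>" by linarith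
  qed
  ultimately show ?thesis by blast
qed

lemma convergent_subsequence_of_angles:
  fixes \<theta> :: "nat \<Rightarrow> nat \<Rightarrow> real"
  assumes "\<And>k i. \<theta> k i \<in> {0..2 * pi}"
  shows "\<exists>r l. strict_mono r \<and> (\<forall>i<s. (\<lambda>k. \<theta> (r k) i) \<longlonglongrightarrow> l i)"
proof (induction s)
  case 0
  show ?case by (rule exI[of _ id]) (auto simp: strict_mono_def)
next
  case (Suc s)
  then obtain r l where r: "strict_mono r" "\<forall>i<s. (\<lambda>k. \<theta> (r k) i) \<longlonglongrightarrow> l i" by blast
  have "compact {0..2 * pi}" by simp
  then obtain l' r' where r': "strict_mono r'" "((\<lambda>k. \<theta> (r k) s) \<circ> r') \<longlonglongrightarrow> l'"
    using assms unfolding compact_def by (metis (no_types, lifting))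
  have "(\<lambda>k. \<theta> ((r \<circ> r') k) i) \<longlonglongrightarrow> (l(s := l')) i" if i: "i < Suc s" for i
  proof (cases "i = s")
    case True
    then show ?thesis using r'(2) by (simp add: o_def)
  next
    case False
    then have "((\<lambda>k. \<theta> (r k) i) \<circ> r') \<longlonglongrightarrow> l i" using r(2) r'(1) i by (intro LIMSEQ_subseq_LIMSEQ) auto
    then show ?thesis using False by (simp add: o_def)
  qed
  moreover have "strict_mono (r \<circ> r')" using r(1) r'(1) by (rule strict_mono_o)
  ultimately show ?case by blast
qed

text \<open>The angles of a sequence of annihilators have a convergent subsequence.\<close>

lemma Wbar_closed:
  assumes "a \<notin> Wbar d s" shows "\<exists>\<delta>>0. \<forall>b. near d \<delta> a b \<longrightarrow> b \<notin> Wbar d s"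
proof (rule ccontr)
  assume "\<not> ?thesis"
  then have "\<forall>k. \<exists>b. near d (1 / real (Suc k)) a b \<and> b \<in> Wbar d s" by (metis of_nat_0_less_iff zero_less_Suc zero_less_divide_1_iff)
  then obtain b where b: "\<And>k. near d (1 / real (Suc k)) a (b k)" "\<And>k. b k \<in> Wbar d s" by metis
  have "\<exists>\<theta>. (\<forall>i. \<theta> i \<in> {0..2 * pi}) \<and> kills d s (\<Prod>i<s. cl (\<theta> i)) (b k)" for k
  proof -
    obtain \<phi> where \<phi>: "kills d s (\<Prod>i<s. cl (\<phi> i)) (b k)" using b(2) unfolding Wbar_def by blast
    have "\<forall>i. \<exists>t. t \<in> {0..2 * pi} \<and> cl (\<phi> i) = cl t"
    proof
      fix i
      obtain t where "0 \<le> t" "t \<le> 2 * pi" "cos (\<phi> i) = cos t" "sin (\<phi> i) = sin t"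
        using sincos_total_2pi_le[of "cos (\<phi> i)" "sin (\<phi> i)"] by auto
      then show "\<exists>t. t \<in> {0..2 * pi} \<and> cl (\<phi> i) = cl t" by (intro exI[of _ t]) (simp add: cl_def)
    qed
    then obtain \<theta> where \<theta>: "\<And>i. \<theta> i \<in> {0..2 * pi}" "\<And>i. cl (\<phi> i) = cl (\<theta> i)" by metis
    then show ?thesis using \<phi> by (intro exI[of _ \<theta>]) simp
  qed
  then have "\<forall>k. \<exists>\<theta>. (\<forall>i. \<theta> i \<in> {0..2 * pi}) \<and> kills d s (\<Prod>i<s. cl (\<theta> i)) (b k)" by blast
  from choice[OF this] obtain \<theta> where "\<forall>k. (\<forall>i. \<theta> k i \<in> {0..2 * pi}) \<and> kills d s (\<Prod>i<s. cl (\<theta> k i)) (b k)" by blast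
  then have \<theta>: "\<And>k i. \<theta> k i \<in> {0..2 * pi}" "\<And>k. kills d s (\<Prod>i<s. cl (\<theta> k i)) (b k)" by auto
  obtain r l where r: "strict_mono r" "\<forall>i<s. (\<lambda>k. \<theta> (r k) i) \<longlonglongrightarrow> l i"
    using convergent_subsequence_of_angles[where s = s and \<theta> = \<theta>, OF \<theta>(1)]
    by (elim exE conjE) (rule that)
  have bl: "(\<lambda>k. b (r k) i) \<longlonglongrightarrow> a i" if "i \<le> d" for i
  proof -
    have "(\<lambda>k. b k i) \<longlonglongrightarrow> a i"
    proof (rule LIMSEQ_I)
      fix e :: real assume "e > 0"
      then obtain N where N: "1 / real (Suc N) < e" using nat_approx_posE by blast
      have "norm (b k i - a i) < e" if "k \<ge> N" for k
      proof -
        have "\<bar>b k i - a i\<bar> < 1 / real (Suc k)" using b(1)[of k] \<open>i \<le> d\<close> by (simp add: near_def)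
        also have "\<dots> \<le> 1 / real (Suc N)" using that by (simp add: frac_le)
        finally show ?thesis using N by simp
      qed
      then show "\<exists>N. \<forall>k\<ge>N. norm (b k i - a i) < e" by blast
    qed
    from LIMSEQ_subseq_LIMSEQ[OF this r(1)] show ?thesis by (simp add: o_def)
  qed
  have "ptendsto (\<lambda>k. \<Prod>i<s. cl (\<theta> (r k) i)) (\<Prod>i<s. cl (l i)) sequentially"
    unfolding cl_def using r(2) by (intro ptendsto_prod ptendsto_lin tendsto_sin tendsto_cos) auto
  note pt = ptendstoD[OF this]
  have "kills d s (\<Prod>i<s. cl (l i)) a" unfolding kills_def
  proof (intro allI impI)
    fix i assume i: "i + s \<le> d"
    let ?S = "\<lambda>k. \<Sum>j\<le>s. coeff (\<Prod>i<s. cl (\<theta> (r k) i)) j * b (r k) (i + j)"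
    have "?S \<longlonglongrightarrow> (\<Sum>j\<le>s. coeff (\<Prod>i<s. cl (l i)) j * a (i + j))"
      using i by (intro tendsto_sum tendsto_mult pt bl) auto
    moreover have "?S k = 0" for k using \<theta>(2)[of "r k"] i unfolding kills_def by blast
    ultimately show "(\<Sum>j\<le>s. coeff (\<Prod>i<s. cl (l i)) j * a (i + j)) = 0"
      using LIMSEQ_unique[OF _ tendsto_const] by simp
  qed
  then show False using assms unfolding Wbar_def by blast
qed

text \<open>Rotating the roots at different speeds makes them distinct, and by \<open>kernel_continuity\<close> the form
  can follow.\<close>

lemma Wdist_dense:
  assumes "a \<in> Wbar d s" "s \<le> d" "\<epsilon> > 0" shows "\<exists>b\<in>Wdist d s. near d \<epsilon> a b"
proof -
  obtain \<theta> where \<theta>: "kills d s (\<Prod>i<s. cl (\<theta> i)) a" using assms(1) unfolding Wbar_def by blast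
  \<comment> \<open>for small \<open>h > 0\<close> the angles are distinct, even if some of the \<open>\<theta> i\<close> coincide\<close>
  define \<phi> where "\<phi> h i = \<theta> i + real i * h" for h i
  have lim: "((\<lambda>h. \<phi> h i) \<longlongrightarrow> \<theta> i) (at_right 0)" for i
    unfolding \<phi>_def by (rule tendsto_eq_intros refl tendsto_ident_at | simp)+
  have "\<exists>B. (\<forall>j. ((\<lambda>h. B h j) \<longlongrightarrow> a j) (at_right 0)) \<and>
     (\<forall>\<^sub>F h in at_right 0. kills d s (\<Prod>i<s. lin (sin (\<phi> h i)) (cos (\<phi> h i))) (B h))"
    using \<theta> assms(2) sin_or_cos_nonzero unfolding cl_def
    by (intro kernel_continuity[where x = "\<lambda>i. sin (\<theta> i)" and y = "\<lambda>i. cos (\<theta> i)"] tendsto_sin tendsto_cos lim) auto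
  then obtain B where B: "\<And>j. ((\<lambda>h. B h j) \<longlongrightarrow> a j) (at_right 0)"
    "\<forall>\<^sub>F h in at_right 0. kills d s (\<Prod>i<s. cl (\<phi> h i)) (B h)" unfolding cl_def by blast
  have "\<forall>\<^sub>F h in at_right 0. \<forall>i\<in>{..d}. \<bar>B h i - a i\<bar> < \<epsilon>"
    using B(1) assms(3) by (intro eventually_ball_finite ballI) (auto simp: tendsto_iff dist_real_def)
  moreover have "\<forall>\<^sub>F h in at_right 0. \<forall>i\<in>{..<s}. \<forall>j\<in>{..<s}. i \<noteq> j \<longrightarrow> sin (\<phi> h i - \<phi> h j) \<noteq> 0"
  proof (intro eventually_ball_finite ballI finite_lessThan)
    fix i j
    show "\<forall>\<^sub>F h in at_right 0. i \<noteq> j \<longrightarrow> sin (\<phi> h i - \<phi> h j) \<noteq> 0"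
    proof (cases "i = j \<or> sin (\<theta> i - \<theta> j) \<noteq> 0")
      case True
      have "((\<lambda>h. sin (\<phi> h i - \<phi> h j)) \<longlongrightarrow> sin (\<theta> i - \<theta> j)) (at_right 0)"
        by (intro tendsto_sin tendsto_diff lim)
      then show ?thesis using True by (cases "i = j") (auto intro: tendsto_imp_eventually_ne)
    next
      case False
      define k where "k = real i - real j"
      have k: "k \<noteq> 0" using False unfolding k_def by auto
      have cos: "cos (\<theta> i - \<theta> j) \<noteq> 0" using False sin_or_cos_nonzero by blast
      have "\<forall>\<^sub>F h in at_right 0. h < pi / \<bar>k\<bar>" using k by (intro eventually_at_right_real[THEN eventually_mono]) auto
      moreover have "\<forall>\<^sub>F h in at_right (0 :: real). h > 0" by (rule eventually_at_right_less)
      ultimately show ?thesis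
      proof eventually_elim
        case (elim h)
        have eq: "\<phi> h i - \<phi> h j = (\<theta> i - \<theta> j) + k * h" unfolding \<phi>_def k_def by (simp add: algebra_simps)
        have "\<bar>k\<bar> * h < pi" using elim k by (simp add: field_simps)
        then have "sin (\<bar>k\<bar> * h) > 0" using elim k by (intro sin_gt_zero) auto
        then have "sin (k * h) \<noteq> 0" by (cases "k < 0") auto
        then show ?case using False cos unfolding eq sin_add by simp
      qed
    qed
  qed
  ultimately have "\<forall>\<^sub>F h in at_right 0. B h \<in> Wdist d s \<and> near d \<epsilon> a (B h)"
    using B(2) by eventually_elim (auto simp: Wdist_def distinct_angles_def near_def)
  then obtain h where "B h \<in> Wdist d s \<and> near d \<epsilon> a (B h)"
    using eventually_happens'[OF trivial_limit_at_right_real] by blast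
  then show ?thesis by blast
qed

section \<open>Stability of real-rootedness\<close>

text \<open>The upper bound separates the directions across the ends of the half circle.\<close>

lemma angle_separation:
  assumes "finite \<Theta>" "\<Theta> \<subseteq> {0..<pi}"
  shows "\<exists>\<sigma>>0. \<sigma> \<le> 1 \<and> (\<forall>a\<in>\<Theta>. \<forall>b\<in>\<Theta>. a \<noteq> b \<longrightarrow> \<sigma> \<le> \<bar>a - b\<bar> \<and> \<bar>a - b\<bar> \<le> pi - \<sigma>)"
proof -
  define S where "S = insert 1 ((\<lambda>(a, b). min \<bar>a - b\<bar> (pi - \<bar>a - b\<bar>)) ` {(a, b). a \<in> \<Theta> \<and> b \<in> \<Theta> \<and> a \<noteq> b})"
  have "{(a, b). a \<in> \<Theta> \<and> b \<in> \<Theta> \<and> a \<noteq> b} \<subseteq> \<Theta> \<times> \<Theta>" by auto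
  then have fin: "finite S" unfolding S_def using assms(1) finite_subset by blast
  have "\<forall>x\<in>S. x > 0"
  proof
    fix x assume "x \<in> S"
    then consider "x = 1" | a b where "a \<in> \<Theta>" "b \<in> \<Theta>" "a \<noteq> b" "x = min \<bar>a - b\<bar> (pi - \<bar>a - b\<bar>)"
      unfolding S_def by auto
    then show "x > 0"
    proof cases
      case 2
      then have "0 \<le> a" "a < pi" "0 \<le> b" "b < pi" using assms(2) by auto
      then show ?thesis using 2 by (simp add: abs_if)
    qed simp
  qed
  then have pos: "Min S > 0" using fin unfolding S_def by (subst Min_gr_iff) auto
  have le: "Min S \<le> x" if "x \<in> S" for x using fin that by (rule Min_le)
  have "Min S \<le> \<bar>a - b\<bar> \<and> \<bar>a - b\<bar> \<le> pi - Min S" if "a \<in> \<Theta>" "b \<in> \<Theta>" "a \<noteq> b" for a b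
  proof -
    have "min \<bar>a - b\<bar> (pi - \<bar>a - b\<bar>) \<in> S" unfolding S_def using that by auto
    from le[OF this] show ?thesis by linarith
  qed
  moreover have "Min S \<le> 1" by (rule le) (simp add: S_def)
  ultimately show ?thesis using pos by blast
qed

lemma sin_mult_same_sign:
  assumes "0 < \<bar>t\<bar> - \<eta>" "\<bar>t\<bar> + \<eta> < pi" "\<eta> > 0" shows "sin (t - \<eta>) * sin (t + \<eta>) > 0"
proof (cases "t > 0")
  case True
  then have "sin (t - \<eta>) > 0" "sin (t + \<eta>) > 0" using assms by (intro sin_gt_zero; linarith)+
  then show ?thesis by simp
next
  case False
  then have "sin (- (t - \<eta>)) > 0" "sin (- (t + \<eta>)) > 0" using assms by (intro sin_gt_zero; linarith)+
  then have "sin (t - \<eta>) < 0" "sin (t + \<eta>) < 0" by (simp_all only: sin_minus)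
  then show ?thesis by (rule mult_neg_neg)
qed

text \<open>The product changes its sign at each of its roots, and so do the nearby forms; they have no more roots
  than that because of their degree.\<close>

lemma real_rooted_stable:
  assumes fin: "finite \<Theta>" and sub: "\<Theta> \<subseteq> {0..<pi}"
  shows "\<exists>\<epsilon>>0. \<forall>p. degree p \<le> card \<Theta> \<longrightarrow> (\<forall>j\<le>card \<Theta>. \<bar>coeff p j - coeff (\<Prod>\<phi>\<in>\<Theta>. cl \<phi>) j\<bar> < \<epsilon>) \<longrightarrow>
     (\<exists>\<Phi> c. finite \<Phi> \<and> card \<Phi> = card \<Theta> \<and> distinct_angles \<Phi> (\<lambda>\<phi>. \<phi>) \<and> c \<noteq> 0 \<and> p = smult c (\<Prod>\<phi>\<in>\<Phi>. cl \<phi>))"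
proof -
  let ?n = "card \<Theta>" and ?L = "\<Prod>\<phi>\<in>\<Theta>. cl \<phi>"
  let ?g = "\<lambda>p \<phi>. hev ?n p (sin \<phi>) (cos \<phi>)"
  obtain \<sigma> where \<sigma>: "\<sigma> > 0" "\<sigma> \<le> 1" "\<And>a b. a \<in> \<Theta> \<Longrightarrow> b \<in> \<Theta> \<Longrightarrow> a \<noteq> b \<Longrightarrow> \<sigma> \<le> \<bar>a - b\<bar> \<and> \<bar>a - b\<bar> \<le> pi - \<sigma>"
    using angle_separation[OF assms] by blast
  define \<eta> where "\<eta> = \<sigma> / 3"
  have \<eta>: "\<eta> > 0" "\<eta> < pi" "2 * \<eta> < \<sigma>" using \<sigma>(1,2) pi_gt3 by (auto simp: \<eta>_def)
  have gL: "?g ?L \<phi> = (\<Prod>\<theta>\<in>\<Theta>. sin (\<phi> - \<theta>))" for \<phi> using hev_prod_cl[of \<Theta> "\<lambda>x. x"] by simp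
  have change: "?g ?L (\<theta> - \<eta>) * ?g ?L (\<theta> + \<eta>) < 0" if \<theta>: "\<theta> \<in> \<Theta>" for \<theta>
  proof -
    have "?g ?L (\<theta> - \<eta>) * ?g ?L (\<theta> + \<eta>) = (\<Prod>\<theta>'\<in>\<Theta>. sin (\<theta> - \<eta> - \<theta>') * sin (\<theta> + \<eta> - \<theta>'))"
      unfolding gL by (simp add: prod.distrib)
    also have "\<dots> = sin (\<theta> - \<eta> - \<theta>) * sin (\<theta> + \<eta> - \<theta>) * (\<Prod>\<theta>'\<in>\<Theta> - {\<theta>}. sin (\<theta> - \<eta> - \<theta>') * sin (\<theta> + \<eta> - \<theta>'))"
      using fin \<theta> by (rule prod.remove)
    also have "\<dots> < 0"
    proof (rule mult_neg_pos)
      show "sin (\<theta> - \<eta> - \<theta>) * sin (\<theta> + \<eta> - \<theta>) < 0"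
        using sin_gt_zero[OF \<eta>(1,2)] by simp
      show "(\<Prod>\<theta>'\<in>\<Theta> - {\<theta>}. sin (\<theta> - \<eta> - \<theta>') * sin (\<theta> + \<eta> - \<theta>')) > 0"
      proof (rule prod_pos)
        fix \<theta>' assume "\<theta>' \<in> \<Theta> - {\<theta>}"
        then have "\<sigma> \<le> \<bar>\<theta> - \<theta>'\<bar> \<and> \<bar>\<theta> - \<theta>'\<bar> \<le> pi - \<sigma>" using \<sigma>(3) \<theta> by auto
        then have "sin (\<theta> - \<theta>' - \<eta>) * sin (\<theta> - \<theta>' + \<eta>) > 0" using \<eta> by (intro sin_mult_same_sign) auto
        then show "sin (\<theta> - \<eta> - \<theta>') * sin (\<theta> + \<eta> - \<theta>') > 0" by (simp add: algebra_simps)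
      qed
    qed
    finally show ?thesis .
  qed
  define T where "T = (\<lambda>\<theta>. \<theta> - \<eta>) ` \<Theta> \<union> (\<lambda>\<theta>. \<theta> + \<eta>) ` \<Theta>"
  have T0: "?g ?L \<phi> \<noteq> 0" if "\<phi> \<in> T" for \<phi>
    using that change unfolding T_def by (auto simp: less_le)
  define m where "m = Min (insert 1 ((\<lambda>\<phi>. \<bar>?g ?L \<phi>\<bar>) ` T))"
  have finT: "finite T" unfolding T_def using fin by simp
  then have m: "m > 0" "m \<le> 1" "\<And>\<phi>. \<phi> \<in> T \<Longrightarrow> m \<le> \<bar>?g ?L \<phi>\<bar>"
    unfolding m_def using T0 by (auto simp: Min_gr_iff)
  \<comment> \<open>a change of the \<open>?n + 1\<close> coefficients by less than \<open>\<epsilon>\<close> keeps the signs at the points of \<open>T\<close>\<close>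
  define \<epsilon> where "\<epsilon> = m / (real ?n + 1)"
  have \<epsilon>: "\<epsilon> > 0" unfolding \<epsilon>_def using m(1) by simp
  have "\<exists>\<Phi> c. finite \<Phi> \<and> card \<Phi> = ?n \<and> distinct_angles \<Phi> (\<lambda>\<phi>. \<phi>) \<and> c \<noteq> 0 \<and> p = smult c (\<Prod>\<phi>\<in>\<Phi>. cl \<phi>)"
    if p: "degree p \<le> ?n" "\<And>j. j \<le> ?n \<Longrightarrow> \<bar>coeff p j - coeff ?L j\<bar> < \<epsilon>" for p
  proof -
    have close: "\<bar>?g p \<phi> - ?g ?L \<phi>\<bar> < m" for \<phi>
    proof -
      have "?g p \<phi> - ?g ?L \<phi> = (\<Sum>j\<le>?n. (coeff p j - coeff ?L j) * (sin \<phi> ^ j * cos \<phi> ^ (?n - j)))"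
        unfolding hev_def by (simp add: sum_subtractf[symmetric] algebra_simps)
      also have "\<bar>\<dots>\<bar> \<le> (\<Sum>j\<le>?n. \<bar>coeff p j - coeff ?L j\<bar>)"
      proof (rule order_trans[OF sum_abs sum_mono])
        fix j
        have "\<bar>sin \<phi> ^ j * cos \<phi> ^ (?n - j)\<bar> \<le> 1"
          by (simp add: abs_mult power_abs mult_le_one power_le_one)
        then show "\<bar>(coeff p j - coeff ?L j) * (sin \<phi> ^ j * cos \<phi> ^ (?n - j))\<bar> \<le> \<bar>coeff p j - coeff ?L j\<bar>"
          using mult_left_mono[of "\<bar>sin \<phi> ^ j * cos \<phi> ^ (?n - j)\<bar>" 1 "\<bar>coeff p j - coeff ?L j\<bar>"]
          by (simp add: abs_mult)
      qed
      also have "\<dots> < (\<Sum>j\<le>?n. \<epsilon>)" using p(2) by (intro sum_strict_mono) auto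
      also have "\<dots> = m" unfolding \<epsilon>_def by (simp add: add.commute)
      finally show ?thesis .
    qed
    have sgn: "?g p \<phi> * ?g ?L \<phi> > 0" if "\<phi> \<in> T" for \<phi>
    proof (cases "?g ?L \<phi> > 0")
      case True
      then have "?g p \<phi> > 0" using close[of \<phi>] m(3)[OF that] by linarith
      then show ?thesis using True by simp
    next
      case False
      then have "?g ?L \<phi> < 0" "?g p \<phi> < 0" using close[of \<phi>] m(3)[OF that] m(1) by linarith+
      then show ?thesis by (simp add: mult_neg_neg)
    qed
    have "\<exists>r. \<bar>r - \<theta>\<bar> \<le> \<eta> \<and> ?g p r = 0" if \<theta>: "\<theta> \<in> \<Theta>" for \<theta>
    proof -
      have "(?g p (\<theta> - \<eta>) * ?g ?L (\<theta> - \<eta>)) * (?g p (\<theta> + \<eta>) * ?g ?L (\<theta> + \<eta>)) > 0"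
        using \<theta> by (intro mult_pos_pos sgn) (auto simp: T_def)
      then have "(?g p (\<theta> - \<eta>) * ?g p (\<theta> + \<eta>)) * (?g ?L (\<theta> - \<eta>) * ?g ?L (\<theta> + \<eta>)) > 0" by (simp add: mult_ac)
      then have neg: "?g p (\<theta> - \<eta>) * ?g p (\<theta> + \<eta>) < 0"
        using change[OF \<theta>] mult_nonneg_nonpos[of "?g p (\<theta> - \<eta>) * ?g p (\<theta> + \<eta>)" "?g ?L (\<theta> - \<eta>) * ?g ?L (\<theta> + \<eta>)"]
        by linarith
      have cont: "continuous_on {\<theta> - \<eta>..\<theta> + \<eta>} (?g p)" unfolding hev_def by (intro continuous_intros)
      consider "?g p (\<theta> - \<eta>) \<le> 0 \<and> 0 \<le> ?g p (\<theta> + \<eta>)" | "?g p (\<theta> + \<eta>) \<le> 0 \<and> 0 \<le> ?g p (\<theta> - \<eta>)"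
        using neg by (auto simp: mult_less_0_iff)
      then obtain r where "\<theta> - \<eta> \<le> r" "r \<le> \<theta> + \<eta>" "?g p r = 0"
      proof cases
        case 1 then show ?thesis using that IVT'[of "?g p" "\<theta> - \<eta>" 0 "\<theta> + \<eta>"] cont \<eta>(1) by auto
      next
        case 2 then show ?thesis using that IVT2'[of "?g p" "\<theta> + \<eta>" 0 "\<theta> - \<eta>"] cont \<eta>(1) by auto
      qed
      then show ?thesis by (intro exI[of _ r]) auto
    qed
    then obtain r where r: "\<And>\<theta>. \<theta> \<in> \<Theta> \<Longrightarrow> \<bar>r \<theta> - \<theta>\<bar> \<le> \<eta>" "\<And>\<theta>. \<theta> \<in> \<Theta> \<Longrightarrow> ?g p (r \<theta>) = 0" by metis
    have rsin: "sin (r a - r b) \<noteq> 0" if ab: "a \<in> \<Theta>" "b \<in> \<Theta>" "a \<noteq> b" for a b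
    proof -
      have "0 < \<bar>r a - r b\<bar>" "\<bar>r a - r b\<bar> < pi"
        using \<sigma>(3)[OF ab] r(1)[OF ab(1)] r(1)[OF ab(2)] \<eta>(3) by linarith+
      then have "sin \<bar>r a - r b\<bar> > 0" by (rule sin_gt_zero)
      moreover have "sin (r b - r a) = - sin (r a - r b)" using sin_minus[of "r a - r b"] by simp
      ultimately show ?thesis by (auto simp: abs_if split: if_splits)
    qed
    then have inj: "inj_on r \<Theta>" by (intro inj_onI) force
    define \<Phi> where "\<Phi> = r ` \<Theta>"
    have \<Phi>: "finite \<Phi>" "card \<Phi> = ?n" unfolding \<Phi>_def using fin inj by (auto simp: card_image)
    have dist: "distinct_angles \<Phi> (\<lambda>\<phi>. \<phi>)" unfolding distinct_angles_def \<Phi>_def using rsin by auto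
    have "p = 0 \<or> (\<exists>q. p = (\<Prod>\<phi>\<in>\<Phi>. lin (sin \<phi>) (cos \<phi>)) * q \<and> degree q + card \<Phi> \<le> ?n)"
      using r(2) p(1) by (intro vanishing_at_distinct_points[OF \<Phi>(1) distinct_points_of_angles[OF dist]]) (auto simp: \<Phi>_def)
    moreover have pn0: "p \<noteq> 0"
    proof
      assume p0: "p = 0"
      show False
      proof (cases "\<Theta> = {}")
        case True
        then show False using p(2)[of 0] p0 m(2) by (simp add: \<epsilon>_def)
      next
        case False
        then obtain \<theta> where "\<theta> - \<eta> \<in> T" unfolding T_def by blast
        then show False using sgn[of "\<theta> - \<eta>"] p0 by simp
      qed
    qed
    ultimately obtain q where q: "p = (\<Prod>\<phi>\<in>\<Phi>. cl \<phi>) * q" "degree q = 0" using \<Phi>(2) unfolding cl_def by auto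
    obtain c where "q = [:c:]" using q(2) by (rule degree_eq_zeroE)
    then have "p = smult c (\<Prod>\<phi>\<in>\<Phi>. cl \<phi>)" "c \<noteq> 0" using q(1) pn0 by auto
    then show ?thesis using \<Phi> dist by blast
  qed
  then show ?thesis using \<epsilon> by blast
qed

section \<open>Openness away from the degenerate forms\<close>

text \<open>\<open>transversal d m q n a\<close> says that the contraction \<open>u \<mapsto> (q u) \<cdot> a\<close> maps the forms of degree
  \<open>n\<close> onto the forms of degree \<open>d - (m + n)\<close>, where \<open>m\<close> is the degree of the form \<open>q\<close>; it is stated for
  the transposed map.\<close>

definition transversal :: "nat \<Rightarrow> nat \<Rightarrow> real poly \<Rightarrow> nat \<Rightarrow> (nat \<Rightarrow> real) \<Rightarrow> bool" where
  "transversal d m q n a \<longleftrightarrow> (\<forall>h. degree h + (m + n) \<le> d \<longrightarrow> kills d (d - n) (h * q) a \<longrightarrow> h = 0)"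

text \<open>The matrix of the contraction \<open>u \<mapsto> (q u) \<cdot> a\<close> with respect to monomials.\<close>

definition contraction :: "real poly \<Rightarrow> (nat \<Rightarrow> real) \<Rightarrow> nat \<Rightarrow> nat \<Rightarrow> real" where
  "contraction q a i j = ap a (q * monom 1 (i + j))"

lemma tendsto_contraction:
  assumes "degree q \<le> m" "i + j + m \<le> d"
  shows "((\<lambda>b. contraction q b i j) \<longlongrightarrow> contraction q a i j) (nbhd d a)"
  unfolding contraction_def ap_mult_monom[OF assms(1)] using assms(2)
  by (intro tendsto_sum tendsto_mult tendsto_const tendsto_nbhd) auto

lemma sum_lessThan_Suc_eq_atMost: "(\<Sum>i<Suc N. f i) = (\<Sum>i\<le>N. f i)"
  by (simp add: lessThan_Suc_atMost)

lemma contraction_sum_right: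
  "degree u \<le> n \<Longrightarrow> (\<Sum>j\<le>n. contraction q a i j * coeff u j) = ap a (q * monom 1 i * u)"
proof -
  assume u: "degree u \<le> n"
  have "ap a (q * monom 1 i * u) = ap (\<lambda>j. ap a (q * monom 1 i * monom 1 j)) u" by (rule ap_mult)
  also have "\<dots> = (\<Sum>j\<le>n. coeff u j * ap a (q * monom 1 (i + j)))"
    unfolding ap_bound[OF u] by (simp add: mult.assoc mult_monom)
  finally show ?thesis unfolding contraction_def by (simp only: mult.commute)
qed

lemma contraction_rows_independent:
  assumes q: "degree q \<le> m" "m + n \<le> d" and tr: "transversal d m q n a"
    and h: "\<forall>j<Suc n. (\<Sum>i<Suc (d - (m + n)). h i * contraction q a i j) = 0"
  shows "\<forall>i<Suc (d - (m + n)). h i = 0"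
proof -
  define N where "N = d - (m + n)"
  define p where "p = (\<Sum>i\<le>N. monom (h i) i)"
  have pc: "coeff p i = h i" if "i \<le> N" for i unfolding p_def coeff_sum using that by simp
  have pd: "degree p \<le> N" unfolding p_def
    by (intro degree_sum_le) (auto intro: order_trans[OF degree_monom_le])
  have deg: "degree (p * q) \<le> d - n"
    using degree_mult_le[of p q] pd q unfolding N_def by linarith
  have "ap a (q * monom 1 j * p) = 0" if "j \<le> n" for j
  proof -
    have "ap a (q * monom 1 j * p) = (\<Sum>i\<le>N. contraction q a j i * coeff p i)"
      by (rule contraction_sum_right[OF pd, symmetric])
    also have "\<dots> = (\<Sum>i\<le>N. h i * contraction q a i j)"
      by (intro sum.cong) (auto simp: pc contraction_def add.commute)
    also have "\<dots> = 0" using h that unfolding N_def sum_lessThan_Suc_eq_atMost by simp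
    finally show ?thesis .
  qed
  then have *: "ap a (p * q * monom 1 j) = 0" if "j \<le> n" for j using that by (simp add: mult_ac)
  have "kills d (d - n) (p * q) a" unfolding kills_def
  proof (intro allI impI)
    fix i assume "i + (d - n) \<le> d"
    then have "i \<le> n" using q(2) by linarith
    then show "(\<Sum>j\<le>d - n. coeff (p * q) j * a (i + j)) = 0"
      using * by (simp add: ap_mult_monom[OF deg])
  qed
  then have "p = 0" using tr pd q(2) unfolding transversal_def N_def by simp
  then show ?thesis using pc unfolding N_def by (metis coeff_0 less_Suc_eq_le)
qed

text \<open>For \<open>b\<close> near \<open>a\<close> an annihilator \<open>q (L + v)\<close> with small \<open>v\<close> is a small solution of a linear
  system, whose matrix has independent rows by transversality.\<close>

lemma perturbed_annihilator:
  assumes fin: "finite \<Theta>" and sub: "\<Theta> \<subseteq> {0..<pi}" and q: "degree q \<le> m" "m + card \<Theta> \<le> d"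
    and k: "kills d (m + card \<Theta>) (q * (\<Prod>\<phi>\<in>\<Theta>. cl \<phi>)) a" and tr: "transversal d m q (card \<Theta>) a"
  shows "\<forall>\<^sub>F b in nbhd d a. \<exists>\<Phi>. finite \<Phi> \<and> card \<Phi> = card \<Theta> \<and> distinct_angles \<Phi> (\<lambda>\<phi>. \<phi>) \<and>
     kills d (m + card \<Theta>) (q * (\<Prod>\<phi>\<in>\<Phi>. cl \<phi>)) b"
proof -
  let ?n = "card \<Theta>" and ?L = "\<Prod>\<phi>\<in>\<Theta>. cl \<phi>"
  define N where "N = d - (m + ?n)"
  have dL: "degree ?L \<le> ?n" unfolding cl_def by (rule degree_prod_lin)
  obtain \<epsilon> where \<epsilon>: "\<epsilon> > 0" "\<And>p. degree p \<le> ?n \<Longrightarrow> (\<And>j. j \<le> ?n \<Longrightarrow> \<bar>coeff p j - coeff ?L j\<bar> < \<epsilon>) \<Longrightarrow>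
     \<exists>\<Phi> c. finite \<Phi> \<and> card \<Phi> = ?n \<and> distinct_angles \<Phi> (\<lambda>\<phi>. \<phi>) \<and> c \<noteq> 0 \<and> p = smult c (\<Prod>\<phi>\<in>\<Phi>. cl \<phi>)"
    using real_rooted_stable[OF fin sub] by blast
  have dqL: "degree (q * ?L) \<le> m + ?n" using degree_mult_le[of q ?L] q(1) dL by linarith
  have "\<forall>\<^sub>F b in nbhd d a. \<exists>u. (\<forall>j<Suc ?n. \<bar>u j\<bar> < \<epsilon>) \<and>
     (\<forall>i<Suc N. (\<Sum>j<Suc ?n. contraction q b i j * u j) = - contraction (q * ?L) b i 0)"
  proof (rule perturbed_linear_system)
    fix i j assume "i < Suc N" "j < Suc ?n"
    then show "((\<lambda>b. contraction q b i j) \<longlongrightarrow> contraction q a i j) (nbhd d a)"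
      using q unfolding N_def by (intro tendsto_contraction) auto
  next
    fix i assume i: "i < Suc N"
    have "((\<lambda>b. - contraction (q * ?L) b i 0) \<longlongrightarrow> - contraction (q * ?L) a i 0) (nbhd d a)"
      using i q(2) unfolding N_def by (intro tendsto_minus tendsto_contraction[OF dqL]) auto
    moreover have "contraction (q * ?L) a i 0 = 0"
      using k i q(2) unfolding kills_def contraction_def ap_mult_monom[OF dqL] N_def by simp
    ultimately show "((\<lambda>b. - contraction (q * ?L) b i 0) \<longlongrightarrow> 0) (nbhd d a)" by simp
  next
    fix h assume "\<forall>j<Suc ?n. (\<Sum>i<Suc N. h i * contraction q a i j) = 0"
    then show "\<forall>i<Suc N. h i = 0"
      unfolding N_def by (rule contraction_rows_independent[OF q tr])
  qed (rule \<epsilon>(1))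
  then show ?thesis
  proof eventually_elim
    case (elim b)
    then obtain u where u: "\<And>j. j < Suc ?n \<Longrightarrow> \<bar>u j\<bar> < \<epsilon>"
      "\<And>i. i < Suc N \<Longrightarrow> (\<Sum>j<Suc ?n. contraction q b i j * u j) = - contraction (q * ?L) b i 0" by blast
    define v where "v = (\<Sum>j\<le>?n. monom (u j) j)"
    have vc: "coeff v j = u j" if "j \<le> ?n" for j unfolding v_def coeff_sum using that by simp
    have vd: "degree v \<le> ?n" unfolding v_def
      by (intro degree_sum_le) (auto intro: order_trans[OF degree_monom_le])
    have "degree (?L + v) \<le> ?n" using dL vd by (rule degree_add_le)
    moreover have "\<bar>coeff (?L + v) j - coeff ?L j\<bar> < \<epsilon>" if "j \<le> ?n" for j
      using u(1)[of j] vc[OF that] that by simp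
    ultimately obtain \<Phi> c where P: "finite \<Phi>" "card \<Phi> = ?n" "distinct_angles \<Phi> (\<lambda>\<phi>. \<phi>)" "c \<noteq> 0"
      "?L + v = smult c (\<Prod>\<phi>\<in>\<Phi>. cl \<phi>)" using \<epsilon>(2) by blast
    have "degree (q * (?L + v)) \<le> m + ?n"
      using degree_mult_le[of q "?L + v"] q(1) \<open>degree (?L + v) \<le> ?n\<close> by linarith
    note dq = this
    have "kills d (m + ?n) (q * (?L + v)) b" unfolding kills_def
    proof (intro allI impI)
      fix i assume i: "i + (m + ?n) \<le> d"
      have "(\<Sum>j\<le>?n. contraction q b i j * coeff v j) = (\<Sum>j<Suc ?n. contraction q b i j * u j)"
        unfolding sum_lessThan_Suc_eq_atMost by (intro sum.cong) (auto simp: vc)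
      also have "\<dots> = - contraction (q * ?L) b i 0" using i unfolding N_def by (intro u(2)) (simp add: N_def)
      finally have "ap b (q * monom 1 i * v) = - ap b (q * ?L * monom 1 i)"
        unfolding contraction_sum_right[OF vd] by (simp add: contraction_def)
      then have "ap b (q * (?L + v) * monom 1 i) = 0"
        using ap_add[of b "q * ?L * monom 1 i" "q * monom 1 i * v"] by (simp add: algebra_simps)
      then show "(\<Sum>j\<le>m + ?n. coeff (q * (?L + v)) j * b (i + j)) = 0" by (simp add: ap_mult_monom[OF dq])
    qed
    then have "kills d (m + ?n) (smult c (q * (\<Prod>\<phi>\<in>\<Phi>. cl \<phi>))) b" unfolding P(5) by simp
    then have "kills d (m + ?n) (q * (\<Prod>\<phi>\<in>\<Phi>. cl \<phi>)) b" using P(4) kills_smult_iff by blast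
    then show ?case using P by blast
  qed
qed

lemma transversal_1_of_transversal:
  assumes "transversal d m q n a" "degree q \<le> m" "m + n \<le> d"
  shows "transversal d 0 1 (m + n) a"
  unfolding transversal_def
proof (intro allI impI)
  fix h assume h: "degree h + (0 + (m + n)) \<le> d" "kills d (d - (m + n)) (h * 1) a"
  have "kills d (d - (m + n) + m) (h * q) a"
    using h assms(2) by (intro kills_mult) auto
  moreover have "d - (m + n) + m = d - n" using assms(3) by simp
  ultimately show "h = 0" using assms(1) h(1) unfolding transversal_def by simp
qed

text \<open>A nearby system still has solutions for multiples of all the unit vectors, hence independent rows.\<close>

lemma transversal_1_open:
  assumes tr: "transversal d 0 1 s a" and s: "s \<le> d"
  shows "\<forall>\<^sub>F b in nbhd d a. transversal d 0 1 s b"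
proof -
  define N where "N = d - s"
  have solvable: "\<forall>\<^sub>F z in nbhd d a \<times>\<^sub>F at_right 0. \<exists>u. (\<forall>j<Suc s. \<bar>u j\<bar> < 1) \<and>
     (\<forall>i<Suc N. (\<Sum>j<Suc s. contraction 1 (fst z) i j * u j) = (if i = i0 then snd z else 0))" for i0
  proof (rule perturbed_linear_system)
    fix i j assume "i < Suc N" "j < Suc s"
    then have "((\<lambda>b. contraction 1 b i j) \<longlongrightarrow> contraction 1 a i j) (nbhd d a)"
      using s unfolding N_def by (intro tendsto_contraction[of _ 0]) auto
    then show "((\<lambda>z. contraction 1 (fst z) i j) \<longlongrightarrow> contraction 1 a i j) (nbhd d a \<times>\<^sub>F at_right 0)"
      by (rule filterlim_compose[OF _ filterlim_fst])
  next
    fix i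
    have "((\<lambda>z. snd z) \<longlongrightarrow> 0) (nbhd d a \<times>\<^sub>F at_right (0::real))"
    proof -
      have "filterlim snd (at_right (0::real)) (nbhd d a \<times>\<^sub>F at_right 0)" by (rule filterlim_snd)
      from filterlim_compose[OF tendsto_ident_at this] show ?thesis by simp
    qed
    then show "((\<lambda>z. if i = i0 then snd z else 0) \<longlongrightarrow> 0) (nbhd d a \<times>\<^sub>F at_right (0::real))"
      by (cases "i = i0") auto
  next
    fix h assume "\<forall>j<Suc s. (\<Sum>i<Suc N. h i * contraction 1 a i j) = 0"
    then have "\<forall>j<Suc s. (\<Sum>i<Suc (d - (0 + s)). h i * contraction 1 a i j) = 0" unfolding N_def add_0 .
    then have "\<forall>i<Suc (d - (0 + s)). h i = 0"
      by (rule contraction_rows_independent[OF _ _ tr, rotated 2]) (use s in auto)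
    then show "\<forall>i<Suc N. h i = 0" unfolding N_def add_0 .
  qed simp
  define S where "S = (\<lambda>z :: (nat \<Rightarrow> real) \<times> real. \<forall>i0\<in>{..<Suc N}. \<exists>u. (\<forall>j<Suc s. \<bar>u j\<bar> < 1) \<and>
     (\<forall>i<Suc N. (\<Sum>j<Suc s. contraction 1 (fst z) i j * u j) = (if i = i0 then snd z else 0)))"
  have "eventually S (nbhd d a \<times>\<^sub>F at_right 0)"
    unfolding S_def by (intro eventually_ball_finite ballI solvable finite_lessThan)
  then obtain P Q where PQ: "eventually P (nbhd d a)" "eventually Q (at_right (0::real))"
    "\<And>b \<eta>. P b \<Longrightarrow> Q \<eta> \<Longrightarrow> S (b, \<eta>)"
    unfolding eventually_prod_filter by blast
  have "\<forall>\<^sub>F \<eta> in at_right (0::real). Q \<eta> \<and> \<eta> > 0"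
    using PQ(2) eventually_at_right_less by (rule eventually_conj)
  then obtain \<eta> where \<eta>: "Q \<eta>" "\<eta> > 0" using eventually_happens'[OF trivial_limit_at_right_real] by blast
  from PQ(1) show ?thesis
  proof eventually_elim
    case (elim b)
    show ?case unfolding transversal_def
    proof (intro allI impI)
      fix h assume h: "degree h + (0 + s) \<le> d" "kills d (d - s) (h * 1) b"
      then have hd: "degree h \<le> N" unfolding N_def by simp
      have h0: "(\<Sum>i\<le>N. contraction 1 b j i * coeff h i) = 0" if "j \<le> s" for j
      proof -
        have "ap b (h * 1 * monom 1 j) = 0"
          using h(2) hd that s unfolding N_def kills_iff[of "h * 1" "d - s", simplified]
          by (simp add: kills_iff degree_monom_eq)
        then show ?thesis unfolding contraction_sum_right[OF hd] by (simp add: mult.commute)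
      qed
      have "coeff h i0 = 0" if i0: "i0 \<le> N" for i0
      proof -
        obtain u where u: "\<And>i. i < Suc N \<Longrightarrow> (\<Sum>j<Suc s. contraction 1 b i j * u j) = (if i = i0 then \<eta> else 0)"
          using PQ(3)[OF elim \<eta>(1)] i0 unfolding S_def fst_conv snd_conv by (meson lessThan_iff less_Suc_eq_le)
        have "\<eta> * coeff h i0 = (\<Sum>i\<le>N. (if i = i0 then \<eta> else 0) * coeff h i)"
          using i0 by (simp add: if_distrib[of "\<lambda>x. x * _"] cong: if_cong)
        also have "\<dots> = (\<Sum>i\<le>N. (\<Sum>j\<le>s. contraction 1 b i j * u j) * coeff h i)"
          using u unfolding sum_lessThan_Suc_eq_atMost by (intro sum.cong) auto
        also have "\<dots> = (\<Sum>j\<le>s. u j * (\<Sum>i\<le>N. contraction 1 b j i * coeff h i))"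
          unfolding sum_distrib_left sum_distrib_right
          by (subst sum.swap) (simp add: contraction_def mult_ac add.commute)
        also have "\<dots> = 0" using h0 by simp
        finally show ?thesis using \<eta>(2) by simp
      qed
      then show "h = 0" using hd by (metis leading_coeff_0_iff)
    qed
  qed
qed

text \<open>If \<open>\<nu>\<close> sums up to \<open>d\<close>, these are the annihilators that belong to the dual variety of the
  coincident root locus of \<open>\<nu>\<close>.\<close>

definition degenerate :: "nat \<Rightarrow> (nat \<Rightarrow> real) \<Rightarrow> bool" where
  "degenerate d a \<longleftrightarrow> (\<exists>\<Theta> \<nu>. finite \<Theta> \<and> \<Theta> \<subseteq> {0..<pi} \<and> (\<forall>\<phi>\<in>\<Theta>. \<nu> \<phi> \<ge> (2 :: nat)) \<and> sum \<nu> \<Theta> \<le> d \<and>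
     kills d (\<Sum>\<phi>\<in>\<Theta>. \<nu> \<phi> - 1) (\<Prod>\<phi>\<in>\<Theta>. cl \<phi> ^ (\<nu> \<phi> - 1)) a)"

lemma degenerateI:
  assumes "finite \<Theta>" "\<Theta> \<subseteq> {0..<pi}" "\<forall>\<phi>\<in>\<Theta>. \<nu> \<phi> \<ge> (1 :: nat)" "sum \<nu> \<Theta> \<le> d"
    "kills d (\<Sum>\<phi>\<in>\<Theta>. \<nu> \<phi> - 1) (\<Prod>\<phi>\<in>\<Theta>. cl \<phi> ^ (\<nu> \<phi> - 1)) a"
  shows "degenerate d a"
  unfolding degenerate_def
proof (intro exI conjI)
  let ?\<Theta> = "{\<phi> \<in> \<Theta>. \<nu> \<phi> \<ge> 2}"
  show "finite ?\<Theta>" "?\<Theta> \<subseteq> {0..<pi}" "\<forall>\<phi>\<in>?\<Theta>. \<nu> \<phi> \<ge> 2" using assms(1,2) by auto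
  have "sum \<nu> ?\<Theta> \<le> sum \<nu> \<Theta>" using assms(1) by (intro sum_mono2) auto
  then show "sum \<nu> ?\<Theta> \<le> d" using assms(4) by simp
  have "(\<Sum>\<phi>\<in>?\<Theta>. \<nu> \<phi> - 1) = (\<Sum>\<phi>\<in>\<Theta>. \<nu> \<phi> - 1)" using assms(1) by (intro sum.mono_neutral_left) auto
  moreover have "(\<Prod>\<phi>\<in>?\<Theta>. cl \<phi> ^ (\<nu> \<phi> - 1)) = (\<Prod>\<phi>\<in>\<Theta>. cl \<phi> ^ (\<nu> \<phi> - 1))"
  proof (intro prod.mono_neutral_left ballI)
    fix \<phi> assume "\<phi> \<in> \<Theta> - ?\<Theta>"
    then have "\<nu> \<phi> - 1 = 0" by auto
    then show "cl \<phi> ^ (\<nu> \<phi> - 1) = 1" by simp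
  qed (use assms(1) in auto)
  ultimately show "kills d (\<Sum>\<phi>\<in>?\<Theta>. \<nu> \<phi> - 1) (\<Prod>\<phi>\<in>?\<Theta>. cl \<phi> ^ (\<nu> \<phi> - 1)) a" using assms(5) by simp
qed

text \<open>If transversality fails, then some form \<open>h q\<close> annihilates \<open>a\<close> along with \<open>q L\<close>. As \<open>L\<close> has
  distinct roots, \<open>q \<cdot> a\<close> is a combination of evaluations at the roots of \<open>L\<close>, and only the common
  roots of \<open>L\<close> and \<open>h\<close> can contribute: \<open>q gcd(L, h)\<close> annihilates \<open>a\<close>.\<close>

lemma degenerate_if_not_transversal:
  assumes fin: "finite \<Theta>" and sub: "\<Theta> \<subseteq> {0..<pi}" and \<mu>: "\<forall>\<phi>\<in>\<Theta>. \<mu> \<phi> \<ge> (1 :: nat)" "sum \<mu> \<Theta> = s" "s \<le> d"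
    and k: "kills d s (\<Prod>\<phi>\<in>\<Theta>. cl \<phi> ^ \<mu> \<phi>) a"
    and ntr: "\<not> transversal d (\<Sum>\<phi>\<in>\<Theta>. \<mu> \<phi> - 1) (\<Prod>\<phi>\<in>\<Theta>. cl \<phi> ^ (\<mu> \<phi> - 1)) (card \<Theta>) a"
  shows "degenerate d a"
proof -
  let ?L = "\<Prod>\<phi>\<in>\<Theta>. cl \<phi>" and ?q = "\<Prod>\<phi>\<in>\<Theta>. cl \<phi> ^ (\<mu> \<phi> - 1)"
  define m where "m = (\<Sum>\<phi>\<in>\<Theta>. \<mu> \<phi> - 1)"
  have "m + card \<Theta> = (\<Sum>\<phi>\<in>\<Theta>. (\<mu> \<phi> - 1) + 1)" unfolding m_def by (simp only: sum.distrib card_eq_sum)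
  also have "\<dots> = s" unfolding \<mu>(2)[symmetric] using \<mu>(1) by (intro sum.cong) auto
  finally have mn: "m + card \<Theta> = s" .
  have dq: "degree ?q \<le> m" unfolding cl_def m_def by (rule degree_prod_lin_power)
  have qL: "?q * ?L = (\<Prod>\<phi>\<in>\<Theta>. cl \<phi> ^ \<mu> \<phi>)"
    unfolding prod.distrib[symmetric]
  proof (intro prod.cong refl)
    fix \<phi> assume "\<phi> \<in> \<Theta>"
    then have "\<mu> \<phi> = Suc (\<mu> \<phi> - 1)" using \<mu>(1) by (simp add: Suc_le_eq)
    then show "cl \<phi> ^ (\<mu> \<phi> - 1) * cl \<phi> = cl \<phi> ^ \<mu> \<phi>" by (metis power_Suc2)
  qed
  obtain h where h: "degree h + s \<le> d" "kills d (d - card \<Theta>) (h * ?q) a" "h \<noteq> 0"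
    using ntr mn unfolding transversal_def m_def by auto
  define D where "D = d - m"
  have nD: "card \<Theta> \<le> D + 1" "card \<Theta> + (D - card \<Theta>) = D" "D - card \<Theta> = d - s"
    unfolding D_def using mn \<mu>(3) by auto
  define a' where "a' i = ap a (?q * monom 1 i)" for i
  have a': "ap a' w = ap a (?q * w)" for w unfolding a'_def by (rule ap_mult[symmetric])
  have dist: "distinct_angles \<Theta> (\<lambda>\<phi>. \<phi>)" using sub by (rule distinct_angles_in_half_circle)
  have dL: "degree ?L \<le> card \<Theta>" unfolding cl_def by (rule degree_prod_lin)
  have dqL: "degree (?q * ?L) \<le> s" using degree_mult_le[of ?q ?L] dq dL mn by linarith
  have "kills D (card \<Theta>) ?L a'"
    unfolding kills_iff[OF dL] a'
  proof (intro allI impI)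
    fix u :: "real poly" assume "degree u + card \<Theta> \<le> D"
    then have "degree u + s \<le> d" unfolding D_def using mn \<mu>(3) by linarith
    then have "ap a (?q * ?L * u) = 0" using k kills_iff[OF dqL] unfolding qL by blast
    then show "ap a (?q * (?L * u)) = 0" by (simp add: mult.assoc)
  qed
  then obtain \<alpha> where \<alpha>: "\<And>w. degree w \<le> D \<Longrightarrow> ap a' w = (\<Sum>\<phi>\<in>\<Theta>. \<alpha> \<phi> * hev D w (sin \<phi>) (cos \<phi>))"
    using apolar_to_distinct_linear_forms[OF fin distinct_points_of_angles[OF dist] nD(1)] unfolding cl_def by blast
  define E where "E = {\<phi> \<in> \<Theta>. hev (d - s) h (sin \<phi>) (cos \<phi>) = 0}"
  have finE: "finite E" "E \<subseteq> \<Theta>" unfolding E_def using fin by auto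
  have dh: "degree h \<le> d - s" using h(1) by linarith
  have \<alpha>0: "\<alpha> \<phi> = 0" if \<phi>: "\<phi> \<in> \<Theta> - E" for \<phi>
  proof -
    define u where "u = (\<Prod>\<theta>\<in>\<Theta> - {\<phi>}. cl \<theta>)"
    have cd: "card (\<Theta> - {\<phi>}) + 1 = card \<Theta>" using fin \<phi> card_Suc_Diff1[of \<Theta> \<phi>] by simp
    have du0: "degree u \<le> card (\<Theta> - {\<phi>})" unfolding u_def cl_def by (rule degree_prod_lin)
    \<comment> \<open>vanishes on \<open>\<Theta>\<close> except at \<open>\<phi>\<close>; the last factor fills up the degree\<close>
    define w where "w = u * cl (\<phi> + pi / 2)"
    have dw: "degree w \<le> card \<Theta>"
      unfolding w_def using degree_mult_le[of u "cl (\<phi> + pi / 2)"] du0 degree_cl[of "\<phi> + pi / 2"] cd by linarith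
    have hw: "hev (card \<Theta>) w (sin \<theta>) (cos \<theta>) = (\<Prod>\<theta>'\<in>\<Theta> - {\<phi>}. sin (\<theta> - \<theta>')) * sin (\<theta> - (\<phi> + pi / 2))" for \<theta>
    proof -
      have "hev (card (\<Theta> - {\<phi>}) + 1) w (sin \<theta>) (cos \<theta>) =
         hev (card (\<Theta> - {\<phi>})) u (sin \<theta>) (cos \<theta>) * hev 1 (cl (\<phi> + pi / 2)) (sin \<theta>) (cos \<theta>)"
        unfolding w_def by (intro hev_mult du0 degree_cl)
      then show ?thesis unfolding cd u_def hev_prod_cl[of _ "\<lambda>x. x", simplified]
        by (simp only: cl_def hev_lin cos_sin_det)
    qed
    have "degree (h * w) \<le> D" using degree_mult_le[of h w] dh dw nD by linarith
    then have "ap a' (h * w) = (\<Sum>\<theta>\<in>\<Theta>. \<alpha> \<theta> * hev D (h * w) (sin \<theta>) (cos \<theta>))" by (rule \<alpha>)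
    also have "\<dots> = (\<Sum>\<theta>\<in>\<Theta>. if \<theta> = \<phi> then \<alpha> \<phi> * hev D (h * w) (sin \<phi>) (cos \<phi>) else 0)"
    proof (intro sum.cong refl)
      fix \<theta> assume \<theta>: "\<theta> \<in> \<Theta>"
      have "hev D (h * w) (sin \<theta>) (cos \<theta>) = 0" if "\<theta> \<noteq> \<phi>"
      proof -
        have "(\<Prod>\<theta>'\<in>\<Theta> - {\<phi>}. sin (\<theta> - \<theta>')) = 0" using fin \<theta> that by (intro prod_zero) (auto intro!: bexI[of _ \<theta>])
        then have "hev (card \<Theta>) w (sin \<theta>) (cos \<theta>) = 0" unfolding hw by simp
        then show ?thesis using hev_mult[OF dh dw] nD by (simp add: add.commute)
      qed
      then show "\<alpha> \<theta> * hev D (h * w) (sin \<theta>) (cos \<theta>) = (if \<theta> = \<phi> then \<alpha> \<phi> * hev D (h * w) (sin \<phi>) (cos \<phi>) else 0)" by auto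
    qed
    also have "\<dots> = \<alpha> \<phi> * hev D (h * w) (sin \<phi>) (cos \<phi>)" using fin \<phi> by simp
    finally have "ap a' (h * w) = \<alpha> \<phi> * hev D (h * w) (sin \<phi>) (cos \<phi>)" .
    moreover have "ap a' (h * w) = 0"
    proof -
      have "degree (h * ?q) \<le> d - card \<Theta>" using degree_mult_le[of h ?q] dh dq mn \<mu>(3) by linarith
      moreover have "degree w + (d - card \<Theta>) \<le> d" using dw mn \<mu>(3) by linarith
      ultimately have "ap a (h * ?q * w) = 0" using h(2) kills_iff by blast
      then show ?thesis unfolding a' by (simp add: mult_ac)
    qed
    moreover have "hev D (h * w) (sin \<phi>) (cos \<phi>) \<noteq> 0"
    proof -
      have "hev (d - s + card \<Theta>) (h * w) (sin \<phi>) (cos \<phi>) \<noteq> 0"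
        unfolding hev_mult[OF dh dw] hw using \<phi> dist fin unfolding E_def distinct_angles_def by auto
      then show ?thesis using nD by (simp add: add.commute)
    qed
    ultimately show ?thesis by simp
  qed
  have cE: "card E \<le> d - s"
  proof -
    have "h = 0 \<or> (\<exists>r. h = (\<Prod>\<phi>\<in>E. lin (sin \<phi>) (cos \<phi>)) * r \<and> degree r + card E \<le> d - s)"
      using dh finE by (intro vanishing_at_distinct_points distinct_points_subset[OF distinct_points_of_angles[OF dist]])
        (auto simp: E_def)
    then show ?thesis using h(3) by auto
  qed
  let ?e = "\<Prod>\<phi>\<in>E. cl \<phi>"
  have de: "degree ?e \<le> card E" unfolding cl_def by (rule degree_prod_lin)
  have dqe: "degree (?q * ?e) \<le> m + card E" using degree_mult_le[of ?q ?e] dq de by linarith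
  have kE: "kills d (m + card E) (?q * ?e) a"
    unfolding kills_iff[OF dqe]
  proof (intro allI impI)
    fix u :: "real poly" assume u: "degree u + (m + card E) \<le> d"
    then have eu: "degree u + card E \<le> D" unfolding D_def by linarith
    then have "degree (?e * u) \<le> D" using degree_mult_le[of ?e u] de by linarith
    then have "ap a' (?e * u) = (\<Sum>\<phi>\<in>\<Theta>. \<alpha> \<phi> * hev D (?e * u) (sin \<phi>) (cos \<phi>))" by (rule \<alpha>)
    also have "\<dots> = 0"
    proof (rule sum.neutral, rule ballI)
      fix \<phi> assume \<phi>: "\<phi> \<in> \<Theta>"
      show "\<alpha> \<phi> * hev D (?e * u) (sin \<phi>) (cos \<phi>) = 0"
      proof (cases "\<phi> \<in> E")
        case True
        have "hev (card E + (D - card E)) (?e * u) (sin \<phi>) (cos \<phi>) = hev (card E) ?e (sin \<phi>) (cos \<phi>) * hev (D - card E) u (sin \<phi>) (cos \<phi>)"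
          using eu by (intro hev_mult de) auto
        moreover have "hev (card E) ?e (sin \<phi>) (cos \<phi>) = 0"
          unfolding hev_prod_cl[of E "\<lambda>x. x", simplified] using finE(1) True by (intro prod_zero) (auto intro!: bexI[of _ \<phi>])
        ultimately show ?thesis using eu by simp
      qed (use \<alpha>0 \<phi> in simp)
    qed
    finally show "ap a (?q * ?e * u) = 0" unfolding a' by (simp add: mult.assoc)
  qed
  define \<nu> where "\<nu> \<phi> = \<mu> \<phi> + (if \<phi> \<in> E then 1 else 0)" for \<phi>
  have cardE: "(\<Sum>\<phi>\<in>\<Theta>. if \<phi> \<in> E then 1 else 0) = card E"
    using fin finE(2) by (simp add: sum.If_cases Int_absorb1[OF finE(2)] Int_absorb2[OF finE(2)])
  have "sum \<nu> \<Theta> = s + card E" unfolding \<nu>_def sum.distrib cardE \<mu>(2) ..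
  moreover have "(\<Sum>\<phi>\<in>\<Theta>. \<nu> \<phi> - 1) = m + card E"
  proof -
    have "(\<Sum>\<phi>\<in>\<Theta>. \<nu> \<phi> - 1) = (\<Sum>\<phi>\<in>\<Theta>. (\<mu> \<phi> - 1) + (if \<phi> \<in> E then 1 else 0))"
      using \<mu>(1) by (intro sum.cong) (auto simp: \<nu>_def)
    then show ?thesis unfolding sum.distrib cardE m_def .
  qed
  moreover have "(\<Prod>\<phi>\<in>\<Theta>. cl \<phi> ^ (\<nu> \<phi> - 1)) = ?q * ?e"
  proof -
    have "?e = (\<Prod>\<phi>\<in>\<Theta>. if \<phi> \<in> E then cl \<phi> else 1)"
      using fin finE(2) by (simp add: prod.If_cases Int_absorb1[OF finE(2)] Int_absorb2[OF finE(2)])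
    moreover have "cl \<phi> ^ (\<nu> \<phi> - 1) = cl \<phi> ^ (\<mu> \<phi> - 1) * (if \<phi> \<in> E then cl \<phi> else 1)" if "\<phi> \<in> \<Theta>" for \<phi>
    proof -
      have "\<mu> \<phi> = Suc (\<mu> \<phi> - 1)" using \<mu>(1) that by (simp add: Suc_le_eq)
      then obtain k where "\<mu> \<phi> = Suc k" by blast
      then show ?thesis by (simp add: \<nu>_def mult.commute)
    qed
    ultimately show ?thesis by (simp add: prod.distrib)
  qed
  ultimately show ?thesis
    using kE cE \<mu> by (intro degenerateI[OF fin sub, of \<nu>]) (auto simp: \<nu>_def)
qed

text \<open>Transversality puts all forms near \<open>a\<close> into \<open>Wbar d s\<close>, so that \<open>Wdist d s\<close> is dense near \<open>a\<close>.
  Transversality for the trivial factor \<open>1\<close> is an open condition, and where it holds \<open>Wdist d s\<close> is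
  open, because distinct roots can be perturbed.\<close>

lemma open_dense_near_nondegenerate:
  assumes a: "a \<in> Wbar d s" "s \<le> d" and nd: "\<not> degenerate d a"
  shows "\<exists>\<delta>>0. \<forall>b. near d \<delta> a b \<longrightarrow> (\<forall>\<epsilon>>0. \<exists>c. near d \<epsilon> b c \<and> (\<exists>\<gamma>>0. \<forall>c'. near d \<gamma> c c' \<longrightarrow> c' \<in> Wdist d s))"
proof -
  obtain \<theta> where "kills d s (\<Prod>i<s. cl (\<theta> i)) a" using a(1) unfolding Wbar_def by blast
  moreover obtain \<Theta> \<mu> c where T: "finite \<Theta>" "\<Theta> \<subseteq> {0..<pi}" "c \<noteq> 0" "\<forall>\<phi>\<in>\<Theta>. \<mu> \<phi> \<ge> (1 :: nat)" "sum \<mu> \<Theta> = s"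
     "(\<Prod>i<s. cl (\<theta> i)) = smult c (\<Prod>\<phi>\<in>\<Theta>. cl \<phi> ^ \<mu> \<phi>)"
    using real_rooted_collect[of s \<theta>] by metis
  ultimately have k: "kills d s (\<Prod>\<phi>\<in>\<Theta>. cl \<phi> ^ \<mu> \<phi>) a" using kills_smult_iff by metis
  let ?q = "\<Prod>\<phi>\<in>\<Theta>. cl \<phi> ^ (\<mu> \<phi> - 1)"
  define m where "m = (\<Sum>\<phi>\<in>\<Theta>. \<mu> \<phi> - 1)"
  have tr: "transversal d m ?q (card \<Theta>) a"
    using degenerate_if_not_transversal[OF T(1,2,4,5) a(2) k] nd unfolding m_def by blast
  have "m + card \<Theta> = (\<Sum>\<phi>\<in>\<Theta>. (\<mu> \<phi> - 1) + 1)" unfolding m_def by (simp only: sum.distrib card_eq_sum)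
  also have "\<dots> = s" unfolding T(5)[symmetric] using T(4) by (intro sum.cong) auto
  finally have mn: "m + card \<Theta> = s" .
  have rq: "real_rooted m ?q"
    unfolding m_def using real_rooted_prod[of \<Theta> "\<lambda>\<phi>. (\<mu> \<phi> - 1) * 1" "\<lambda>\<phi>. cl \<phi> ^ (\<mu> \<phi> - 1)"]
    by (simp add: real_rooted_power[OF real_rooted_cl, simplified])
  have dq: "degree ?q \<le> m" by (rule degree_real_rooted[OF rq])
  have qL: "?q * (\<Prod>\<phi>\<in>\<Theta>. cl \<phi>) = (\<Prod>\<phi>\<in>\<Theta>. cl \<phi> ^ \<mu> \<phi>)"
    unfolding prod.distrib[symmetric]
  proof (intro prod.cong refl)
    fix \<phi> assume "\<phi> \<in> \<Theta>"
    then have "\<mu> \<phi> = Suc (\<mu> \<phi> - 1)" using T(4) by (simp add: Suc_le_eq)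
    then show "cl \<phi> ^ (\<mu> \<phi> - 1) * cl \<phi> = cl \<phi> ^ \<mu> \<phi>" by (metis power_Suc2)
  qed
  have "\<forall>\<^sub>F b in nbhd d a. \<exists>\<Phi>. finite \<Phi> \<and> card \<Phi> = card \<Theta> \<and> distinct_angles \<Phi> (\<lambda>\<phi>. \<phi>) \<and>
     kills d (m + card \<Theta>) (?q * (\<Prod>\<phi>\<in>\<Phi>. cl \<phi>)) b"
  proof (rule perturbed_annihilator[OF T(1,2) dq _ _ tr])
    show "m + card \<Theta> \<le> d" unfolding mn by (rule a(2))
    show "kills d (m + card \<Theta>) (?q * (\<Prod>\<phi>\<in>\<Theta>. cl \<phi>)) a" unfolding qL mn by (rule k)
  qed
  then have "\<forall>\<^sub>F b in nbhd d a. b \<in> Wbar d s"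
  proof eventually_elim
    case (elim b)
    then obtain \<Phi> where P: "card \<Phi> = card \<Theta>" "kills d (m + card \<Theta>) (?q * (\<Prod>\<phi>\<in>\<Phi>. cl \<phi>)) b" by blast
    have "real_rooted (\<Sum>\<phi>\<in>\<Phi>. 1) (\<Prod>\<phi>\<in>\<Phi>. cl \<phi>)" by (rule real_rooted_prod) (rule real_rooted_cl)
    then have "real_rooted (m + card \<Theta>) (?q * (\<Prod>\<phi>\<in>\<Phi>. cl \<phi>))" using P(1) by (intro real_rooted_mult rq) simp
    then show ?case using P(2) mn WbarI by blast
  qed
  moreover have "\<forall>\<^sub>F b in nbhd d a. transversal d 0 1 s b"
    using transversal_1_of_transversal[OF tr dq] mn a(2) transversal_1_open by simp
  ultimately have "\<forall>\<^sub>F b in nbhd d a. b \<in> Wbar d s \<and> transversal d 0 1 s b" by (rule eventually_conj)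
  then obtain \<delta> where \<delta>: "\<delta> > 0" "\<And>b. near d \<delta> a b \<Longrightarrow> b \<in> Wbar d s \<and> transversal d 0 1 s b"
    unfolding eventually_nbhd by blast
  have "\<exists>c. near d \<epsilon> b c \<and> (\<exists>\<gamma>>0. \<forall>c'. near d \<gamma> c c' \<longrightarrow> c' \<in> Wdist d s)"
    if b: "near d \<delta> a b" and \<epsilon>: "\<epsilon> > 0" for b \<epsilon>
  proof -
    obtain \<epsilon>' where \<epsilon>': "\<epsilon>' > 0" "\<And>c. near d \<epsilon>' b c \<Longrightarrow> near d \<delta> a c" using near_interior[OF b] by blast
    obtain c where c: "c \<in> Wdist d s" "near d (min \<epsilon> \<epsilon>') b c"
      using Wdist_dense[of b d s "min \<epsilon> \<epsilon>'"] \<delta>(2)[OF b] a(2) \<epsilon> \<epsilon>'(1) by auto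
    have bc: "near d \<epsilon> b c" "near d \<epsilon>' b c" using c(2) by (auto simp: near_def)
    have trc: "transversal d 0 1 s c" using \<delta>(2) \<epsilon>'(2) bc(2) by blast
    obtain \<psi> where \<psi>: "distinct_angles {..<s} \<psi>" "kills d s (\<Prod>i<s. cl (\<psi> i)) c"
      using c(1) unfolding Wdist_def by blast
    have "\<forall>i. \<exists>t b. t \<in> {0..<pi} \<and> b \<noteq> 0 \<and> cl (\<psi> i) = smult b (cl t)" using angle_mod_pi by blast
    then obtain t b' where t: "\<And>i. t i \<in> {0..<pi}" "\<And>i. b' i \<noteq> 0" "\<And>i. cl (\<psi> i) = smult (b' i) (cl (t i))" by metis
    have inj: "inj_on t {..<s}"
    proof (rule inj_onI)
      fix i j assume ij: "i \<in> {..<s}" "j \<in> {..<s}" "t i = t j"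
      show "i = j"
      proof (rule ccontr)
        assume "i \<noteq> j"
        then have "sin (\<psi> i - \<psi> j) \<noteq> 0" using \<psi>(1) ij unfolding distinct_angles_def by blast
        moreover have "hev 1 (cl (\<psi> j)) (sin (\<psi> i)) (cos (\<psi> i)) = sin (\<psi> i - \<psi> j)"
          by (simp only: cl_def hev_lin cos_sin_det)
        moreover have "cl (\<psi> j) = smult (b' j / b' i) (cl (\<psi> i))"
          using t(2,3) ij(3) by simp
        moreover have "hev 1 (cl (\<psi> i)) (sin (\<psi> i)) (cos (\<psi> i)) = 0"
          by (simp only: cl_def hev_lin) simp
        ultimately show False by (simp only: hev_smult mult_zero_right)
      qed
    qed
    define \<Omega> where "\<Omega> = t ` {..<s}"
    have \<Omega>: "finite \<Omega>" "\<Omega> \<subseteq> {0..<pi}" "card \<Omega> = s" unfolding \<Omega>_def using t(1) inj by (auto simp: card_image)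
    have "(\<Prod>i<s. cl (\<psi> i)) = smult (\<Prod>i<s. b' i) (\<Prod>i<s. cl (t i))" unfolding t(3) by (simp add: prod_smult)
    also have "(\<Prod>i<s. cl (t i)) = (\<Prod>\<phi>\<in>\<Omega>. cl \<phi>)" unfolding \<Omega>_def by (simp add: prod.reindex[OF inj])
    finally have "kills d s (\<Prod>\<phi>\<in>\<Omega>. cl \<phi>) c" using \<psi>(2) kills_smult_iff[of "\<Prod>i<s. b' i"] t(2) by simp
    then have "\<forall>\<^sub>F c' in nbhd d c. \<exists>\<Phi>. finite \<Phi> \<and> card \<Phi> = card \<Omega> \<and> distinct_angles \<Phi> (\<lambda>\<phi>. \<phi>) \<and>
       kills d (0 + card \<Omega>) (1 * (\<Prod>\<phi>\<in>\<Phi>. cl \<phi>)) c'"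
      using trc \<Omega> a(2) by (intro perturbed_annihilator) auto
    then have "\<forall>\<^sub>F c' in nbhd d c. c' \<in> Wdist d s"
    proof eventually_elim
      case (elim c')
      then obtain \<Phi> where P: "finite \<Phi>" "card \<Phi> = s" "distinct_angles \<Phi> (\<lambda>\<phi>. \<phi>)" "kills d s (\<Prod>\<phi>\<in>\<Phi>. cl \<phi>) c'"
        using \<Omega>(3) by auto
      obtain g where g: "bij_betw g {..<s} \<Phi>" using finite_same_card_bij[of "{..<s}" \<Phi>] P(1,2) by auto
      have "(\<Prod>i<s. cl (g i)) = (\<Prod>\<phi>\<in>\<Phi>. cl \<phi>)" by (rule prod.reindex_bij_betw[OF g])
      moreover have "distinct_angles {..<s} g"
        unfolding distinct_angles_def
      proof (intro ballI impI)
        fix i j assume ij: "i \<in> {..<s}" "j \<in> {..<s}" "i \<noteq> j"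
        then have "g i \<in> \<Phi>" "g j \<in> \<Phi>" "g i \<noteq> g j" using g by (auto simp: bij_betw_def inj_on_def)
        then show "sin (g i - g j) \<noteq> 0" using P(3) unfolding distinct_angles_def by blast
      qed
      ultimately show ?case unfolding Wdist_def using P(4) by (intro CollectI exI[of _ g]) simp
    qed
    then show ?thesis using bc(1) unfolding eventually_nbhd by blast
  qed
  then show ?thesis using \<delta>(1) by blast
qed

section \<open>Real rank and annihilators\<close>

definition decomp :: "nat \<Rightarrow> real bipoly \<Rightarrow> nat \<Rightarrow> bool" where
  "decomp d f r \<longleftrightarrow> (\<exists>\<alpha> l. (\<forall>i<r. l i \<in> binary_forms 1) \<and> f = (\<Sum>i<r. scale (\<alpha> i) (l i ^ d)))"

lemma real_rank_decomp: "real_rank d f = (LEAST r. decomp d f r)"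
  by (simp add: real_rank_def decomp_def)

lemma nrm_power_of_linear:
  fixes l :: "real bipoly"
  assumes l: "l \<in> binary_forms 1" "deh l = [:v, u:]" and m: "m \<le> d"
  shows "nrm d (l ^ d) m = fact d * (u ^ m * v ^ (d - m))"
proof -
  have "l ^ d \<in> binary_forms (d * 1)" by (rule binary_forms_power[OF l(1)])
  then have "l ^ d \<in> binary_forms d" by simp
  then have "coords d (l ^ d) m = coeff ([:v, u:] ^ d) m"
    using coords_eq_coeff_deh[of "l ^ d" d] l(2) m by (simp add: deh_power)
  also have "\<dots> = of_nat (d choose m) * u ^ m * v ^ (d - m)" by (rule coeff_linear_poly_power[OF m])
  finally have "nrm d (l ^ d) m = (fact m * fact (d - m) * of_nat (d choose m)) * (u ^ m * v ^ (d - m))"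
    using m by (simp add: nrm_def mult_ac)
  also have "fact m * fact (d - m) * of_nat (d choose m) = (fact d :: real)"
    using m by (simp add: binomial_fact)
  finally show ?thesis .
qed

lemma nrm_sum: "nrm d (\<Sum>i\<in>A. f i) m = (\<Sum>i\<in>A. nrm d (f i) m)"
  by (simp add: nrm_def coords_def coeff_sum sum_distrib_right)

lemma nrm_scale: "nrm d (scale c f) m = c * nrm d f m"
  by (simp add: nrm_def coords_scale)

text \<open>A linear form is annihilated by the first-order operator with the same root, and then so are its
  powers by the product of these operators and any further ones.\<close>

lemma decomp_imp_Wbar:
  assumes d: "d \<ge> 1" and f: "decomp d f r" and s: "r \<le> s"
  shows "nrm d f \<in> Wbar d s"
proof -
  obtain \<alpha> l where l: "\<And>i. i < r \<Longrightarrow> l i \<in> binary_forms 1" "f = (\<Sum>i<r. scale (\<alpha> i) (l i ^ d))"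
    using f unfolding decomp_def by blast
  define u v where "u i = coeff (deh (l i)) 1" and "v i = coeff (deh (l i)) 0" for i
  have dl: "deh (l i) = [:v i, u i:]" if "i < r" for i
    using degree_deh[OF l(1)[OF that]] unfolding u_def v_def
    by (intro poly_eqI) (auto simp: coeff_pCons coeff_eq_0 split: nat.split)
  have "\<forall>i. \<exists>\<theta> \<rho>. u i = \<rho> * sin \<theta> \<and> v i = \<rho> * cos \<theta>" using linear_form_angle by blast
  then obtain \<theta> \<rho> where uv: "\<And>i. u i = \<rho> i * sin (\<theta> i)" "\<And>i. v i = \<rho> i * cos (\<theta> i)" by metis
  have nf: "nrm d f m = (\<Sum>i<r. \<alpha> i * fact d * (u i ^ m * v i ^ (d - m)))" if "m \<le> d" for m
    unfolding l(2) nrm_sum nrm_scale using nrm_power_of_linear[OF l(1) dl] that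
    by (intro sum.cong) (auto simp: mult.assoc)
  have apf: "ap (nrm d f) w = (\<Sum>i<r. \<alpha> i * fact d * hev d w (u i) (v i))" if "degree w \<le> d" for w
  proof -
    have "ap (nrm d f) w = (\<Sum>m\<le>d. \<Sum>i<r. coeff w m * (\<alpha> i * fact d * (u i ^ m * v i ^ (d - m))))"
      unfolding ap_bound[OF that] by (simp add: nf sum_distrib_left)
    also have "\<dots> = (\<Sum>i<r. \<alpha> i * fact d * hev d w (u i) (v i))"
      unfolding hev_def by (subst sum.swap) (simp add: sum_distrib_left mult_ac)
    finally show ?thesis .
  qed
  let ?p = "\<Prod>j<s. cl (\<theta> j)"
  have dp: "degree ?p \<le> s" unfolding cl_def using degree_prod_lin[of _ _ "{..<s}"] by simp
  have "kills d s ?p (nrm d f)"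
    unfolding kills_iff[OF dp]
  proof (intro allI impI)
    fix w :: "real poly" assume w: "degree w + s \<le> d"
    have dpw: "degree (?p * w) \<le> d" using degree_mult_le[of ?p w] dp w by linarith
    have "hev d (?p * w) (u i) (v i) = 0" if i: "i < r" for i
    proof -
      have "hev (s + (d - s)) (?p * w) (u i) (v i) = hev s ?p (u i) (v i) * hev (d - s) w (u i) (v i)"
        using w by (intro hev_mult dp) auto
      moreover have "hev s ?p (u i) (v i) = (\<Prod>j<s. cos (\<theta> j) * u i - sin (\<theta> j) * v i)"
        unfolding cl_def using hev_prod_lin[of "{..<s}" "\<lambda>j. sin (\<theta> j)" "\<lambda>j. cos (\<theta> j)"] by simp
      moreover have "\<dots> = 0" using i s by (intro prod_zero) (auto simp: uv intro!: bexI[of _ i])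
      ultimately show ?thesis using w by simp
    qed
    then show "ap (nrm d f) (?p * w) = 0" unfolding apf[OF dpw] by simp
  qed
  then show ?thesis unfolding Wbar_def by blast
qed

lemma Wdist_imp_decomp:
  assumes f: "f \<in> binary_forms d" and W: "nrm d f \<in> Wdist d s" and s: "s \<le> d + 1"
  shows "decomp d f s"
proof -
  obtain \<theta> where \<theta>: "distinct_angles {..<s} \<theta>" "kills d s (\<Prod>i<s. cl (\<theta> i)) (nrm d f)"
    using W unfolding Wdist_def by blast
  obtain \<alpha> where \<alpha>: "\<And>w. degree w \<le> d \<Longrightarrow> ap (nrm d f) w = (\<Sum>i<s. \<alpha> i * hev d w (sin (\<theta> i)) (cos (\<theta> i)))"
    using apolar_to_distinct_linear_forms[OF _ distinct_points_of_angles[OF \<theta>(1)], of d "nrm d f"] \<theta>(2) s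
    unfolding cl_def by auto
  define l where "l i = form_of 1 (coeff [:cos (\<theta> i), sin (\<theta> i):])" for i
  have l: "l i \<in> binary_forms 1" for i unfolding l_def by (rule form_of_in_binary_forms)
  have dl: "deh (l i) = [:cos (\<theta> i), sin (\<theta> i):]" for i unfolding l_def by (rule deh_form_of_coeff) simp
  define g where "g = (\<Sum>i<s. scale (\<alpha> i / fact d) (l i ^ d))"
  have gb: "g \<in> binary_forms d"
    unfolding g_def using binary_forms_power[OF l, of _ d] by (intro binary_forms_sum scale_in_binary_forms) simp
  have "nrm d f m = nrm d g m" if m: "m \<le> d" for m
  proof -
    have hm: "hev d (monom 1 m) a b = a ^ m * b ^ (d - m)" for a b :: real
    proof -
      have "hev d (monom 1 m) a b = (\<Sum>i\<le>d. if i = m then a ^ m * b ^ (d - m) else 0)"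
        unfolding hev_def by (intro sum.cong) auto
      then show ?thesis using m by simp
    qed
    have "ap (nrm d f) (monom 1 m) = nrm d f m"
      using ap_mult_monom[of 1 0 "nrm d f" m] by simp
    moreover have "degree (monom (1 :: real) m) \<le> d" using m degree_monom_le le_trans by blast
    ultimately have "nrm d f m = (\<Sum>i<s. \<alpha> i * (sin (\<theta> i) ^ m * cos (\<theta> i) ^ (d - m)))"
      using \<alpha> hm by simp
    also have "\<dots> = nrm d g m"
      unfolding g_def nrm_sum nrm_scale by (simp add: nrm_power_of_linear[OF l dl m])
    finally show ?thesis .
  qed
  then have "coords d f m = coords d g m" if "m \<le> d" for m using that by (simp add: nrm_def)
  then have "coeff (deh f) m = coeff (deh g) m" for m
    by (simp add: coeff_deh_binary_form[OF f] coeff_deh_binary_form[OF gb])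
  then have "f = g" using deh_inj[OF f gb] by (simp add: poly_eq_iff)
  then show ?thesis unfolding decomp_def g_def using l
    by (intro exI[of _ "\<lambda>i. \<alpha> i / fact d"] exI[of _ l]) simp
qed

text \<open>The definition of the rank presupposes that there is a decomposition. One with \<open>d + 1\<close> summands
  exists for any distinct linear forms, as their product has too large a degree to impose a condition.\<close>

lemma decomp_real_rank:
  assumes f: "f \<in> binary_forms d" shows "decomp d f (real_rank d f)"
proof -
  have "distinct_angles {..<d + 1} (\<lambda>i. real i * (pi / real (d + 1)))"
    unfolding distinct_angles_def
  proof (intro ballI impI)
    fix i j assume ij: "i \<in> {..<d + 1}" "j \<in> {..<d + 1}" "i \<noteq> j"
    let ?h = "pi / real (d + 1)"
    have pos: "sin ((real a - real b) * ?h) > 0" if "b < a" "a < d + 1" for a b :: nat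
    proof (rule sin_gt_zero)
      show "0 < (real a - real b) * ?h" using that by simp
      have "(real a - real b) * ?h < real (d + 1) * ?h" using that by (intro mult_strict_right_mono) auto
      then show "(real a - real b) * ?h < pi" by simp
    qed
    consider "i < j" | "j < i" using ij by linarith
    then show "sin (real i * ?h - real j * ?h) \<noteq> 0"
    proof cases
      case 1
      have "real i * ?h - real j * ?h = - ((real j - real i) * ?h)" by (simp only: left_diff_distrib)
      then show ?thesis using pos[of i j] 1 ij by simp
    next
      case 2
      have "real i * ?h - real j * ?h = (real i - real j) * ?h" by (simp only: left_diff_distrib)
      then show ?thesis using pos[of j i] 2 ij by simp
    qed
  qed
  then have "nrm d f \<in> Wdist d (d + 1)" unfolding Wdist_def kills_def by auto
  then have "decomp d f (d + 1)" using f by (intro Wdist_imp_decomp) auto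
  then show ?thesis unfolding real_rank_decomp by (rule LeastI)
qed

lemma real_rank_le_imp_Wbar:
  "d \<ge> 1 \<Longrightarrow> f \<in> binary_forms d \<Longrightarrow> real_rank d f \<le> s \<Longrightarrow> nrm d f \<in> Wbar d s"
  using decomp_imp_Wbar decomp_real_rank by blast

lemma Wdist_imp_real_rank_le:
  "f \<in> binary_forms d \<Longrightarrow> nrm d f \<in> Wdist d s \<Longrightarrow> s \<le> d + 1 \<Longrightarrow> real_rank d f \<le> s"
  unfolding real_rank_decomp using Wdist_imp_decomp by (intro Least_le) blast

section \<open>The topology on the space of forms\<close>

lemma near_refl: "\<delta> > 0 \<Longrightarrow> near d \<delta> a a"
  by (simp add: near_def)

lemma near_commute: "near d \<delta> a b \<longleftrightarrow> near d \<delta> b a"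
  by (simp add: near_def abs_minus_commute)

lemma near_cong: "(\<And>i. i \<le> d \<Longrightarrow> b i = b' i) \<Longrightarrow> near d \<delta> a b \<longleftrightarrow> near d \<delta> a b'"
  by (auto simp: near_def)

lemma coords_above: "f \<in> binary_forms d \<Longrightarrow> i > d \<Longrightarrow> coords d f i = 0"
  unfolding coords_def by (rule binary_forms_coeff_0) auto

lemma topspace_form_topology: "topspace (form_topology d) = binary_forms d"
  by (simp add: form_topology_def topspace_pullback_topology)

lemma openin_form_topology_imp:
  assumes "openin (form_topology d) U" "f \<in> U"
  shows "\<exists>\<delta>>0. \<forall>g\<in>binary_forms d. near d \<delta> (nrm d f) (nrm d g) \<longrightarrow> g \<in> U"
proof -
  obtain V where V: "open V" "U = coords d -` V \<inter> binary_forms d"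
    using assms(1) unfolding form_topology_def openin_pullback_topology by auto
  have fb: "f \<in> binary_forms d" "coords d f \<in> V" using V(2) assms(2) by auto
  have "openin (product_topology (\<lambda>i. euclidean) UNIV) V"
    using V(1) by (simp add: open_fun_def)
  from product_topology_open_contains_basis[OF this fb(2)] obtain X
    where X: "coords d f \<in> PiE UNIV X" "\<And>i. open (X i)" "PiE UNIV X \<subseteq> V" by auto
  have "\<forall>i. \<exists>e>0. \<forall>y. \<bar>y - coords d f i\<bar> < e \<longrightarrow> y \<in> X i"
  proof
    fix i
    have "coords d f i \<in> X i" using X(1) by auto
    then show "\<exists>e>0. \<forall>y. \<bar>y - coords d f i\<bar> < e \<longrightarrow> y \<in> X i"
      using X(2)[of i] unfolding open_dist dist_real_def by blast
  qed
  then obtain e where e: "\<And>i. e i > 0" "\<And>i y. \<bar>y - coords d f i\<bar> < e i \<Longrightarrow> y \<in> X i" by metis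
  define \<delta> where "\<delta> = Min (e ` {..d})"
  have \<delta>: "\<delta> > 0" unfolding \<delta>_def using e(1) by (subst Min_gr_iff) auto
  have "g \<in> U" if g: "g \<in> binary_forms d" "near d \<delta> (nrm d f) (nrm d g)" for g
  proof -
    have "coords d g i \<in> X i" for i
    proof (cases "i \<le> d")
      case True
      let ?c = "fact i * fact (d - i) :: real"
      have c: "?c \<ge> 1" using mult_mono[of 1 "fact i :: real" 1 "fact (d - i)"] fact_ge_1[of i] fact_ge_1[of "d - i"] by simp
      have "nrm d g i - nrm d f i = (coords d g i - coords d f i) * ?c" by (simp add: nrm_def algebra_simps)
      then have *: "\<bar>coords d g i - coords d f i\<bar> * ?c < \<delta>"
        using g(2) True unfolding near_def by (metis abs_mult abs_of_nonneg c zero_le_one order_trans)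
      have "\<bar>coords d g i - coords d f i\<bar> * 1 \<le> \<bar>coords d g i - coords d f i\<bar> * ?c"
        using c by (intro mult_left_mono) auto
      then have "\<bar>coords d g i - coords d f i\<bar> \<le> \<bar>coords d g i - coords d f i\<bar> * ?c" by (simp only: mult_1_right)
      also note *
      also have "\<delta> \<le> e i" unfolding \<delta>_def using True by (intro Min_le) auto
      finally show ?thesis by (rule e(2))
    next
      case False
      then have "coords d g i = coords d f i" using coords_above[OF g(1)] coords_above[OF fb(1)] by simp
      then show ?thesis using e(1)[of i] by (intro e(2)) simp
    qed
    then show ?thesis using X(3) V(2) g(1) by auto
  qed
  then show ?thesis using \<delta> by blast
qed

lemma openin_form_topology_if:
  assumes "U \<subseteq> binary_forms d"
    "\<And>f. f \<in> U \<Longrightarrow> \<exists>\<delta>>0. \<forall>g\<in>binary_forms d. near d \<delta> (nrm d f) (nrm d g) \<longrightarrow> g \<in> U"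
  shows "openin (form_topology d) U"
proof -
  have "\<forall>f\<in>U. \<exists>\<delta>>0. \<forall>g\<in>binary_forms d. near d \<delta> (nrm d f) (nrm d g) \<longrightarrow> g \<in> U" using assms(2) by blast
  from bchoice[OF this] obtain \<delta> where
    \<delta>: "\<forall>f\<in>U. \<delta> f > 0 \<and> (\<forall>g\<in>binary_forms d. near d (\<delta> f) (nrm d f) (nrm d g) \<longrightarrow> g \<in> U)" by blast
  define V where "V = (\<Union>f\<in>U. \<Inter>i\<in>{..d}. {z. \<bar>z i * (fact i * fact (d - i)) - nrm d f i\<bar> < \<delta> f})"
  have "open V" unfolding V_def
    by (intro open_UN ballI open_INT finite_atMost open_Collect_less continuous_intros continuous_on_product_coordinates)
  moreover have "U = coords d -` V \<inter> binary_forms d"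
  proof
    show "U \<subseteq> coords d -` V \<inter> binary_forms d"
      using \<delta> assms(1) unfolding V_def by (fastforce simp: nrm_def mult.assoc)
    show "coords d -` V \<inter> binary_forms d \<subseteq> U"
    proof
      fix g assume g: "g \<in> coords d -` V \<inter> binary_forms d"
      then obtain f where f: "f \<in> U" "\<forall>i\<in>{..d}. \<bar>coords d g i * (fact i * fact (d - i)) - nrm d f i\<bar> < \<delta> f"
        unfolding V_def by auto
      then have "near d (\<delta> f) (nrm d f) (nrm d g)" by (simp add: near_def nrm_def mult.assoc)
      then show "g \<in> U" using \<delta> f(1) g by blast
    qed
  qed
  ultimately show ?thesis unfolding form_topology_def openin_pullback_topology by auto
qed

lemma interior_form_topology:
  assumes "S \<subseteq> binary_forms d"
  shows "f \<in> form_topology d interior_of S \<longleftrightarrow>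
     f \<in> binary_forms d \<and> (\<exists>\<delta>>0. \<forall>g\<in>binary_forms d. near d \<delta> (nrm d f) (nrm d g) \<longrightarrow> g \<in> S)"
proof
  assume "f \<in> form_topology d interior_of S"
  then obtain U where U: "openin (form_topology d) U" "f \<in> U" "U \<subseteq> S" unfolding interior_of_def by blast
  then show "f \<in> binary_forms d \<and> (\<exists>\<delta>>0. \<forall>g\<in>binary_forms d. near d \<delta> (nrm d f) (nrm d g) \<longrightarrow> g \<in> S)"
    using openin_form_topology_imp[OF U(1,2)] assms by blast
next
  assume f: "f \<in> binary_forms d \<and> (\<exists>\<delta>>0. \<forall>g\<in>binary_forms d. near d \<delta> (nrm d f) (nrm d g) \<longrightarrow> g \<in> S)"
  let ?U = "{f \<in> binary_forms d. \<exists>\<delta>>0. \<forall>g\<in>binary_forms d. near d \<delta> (nrm d f) (nrm d g) \<longrightarrow> g \<in> S}"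
  have "openin (form_topology d) ?U"
  proof (rule openin_form_topology_if)
    fix h assume "h \<in> ?U"
    then obtain \<delta> where \<delta>: "\<delta> > 0" "\<forall>g\<in>binary_forms d. near d \<delta> (nrm d h) (nrm d g) \<longrightarrow> g \<in> S" by blast
    have "g \<in> ?U" if g: "g \<in> binary_forms d" "near d \<delta> (nrm d h) (nrm d g)" for g
    proof -
      obtain \<epsilon> where \<epsilon>: "\<epsilon> > 0" "\<forall>c. near d \<epsilon> (nrm d g) c \<longrightarrow> near d \<delta> (nrm d h) c" using near_interior[OF g(2)] by blast
      then show ?thesis using \<delta>(2) g(1) by blast
    qed
    then show "\<exists>\<delta>>0. \<forall>g\<in>binary_forms d. near d \<delta> (nrm d h) (nrm d g) \<longrightarrow> g \<in> ?U" using \<delta>(1) by blast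
  qed blast
  moreover have "?U \<subseteq> S" using near_refl by blast
  ultimately show "f \<in> form_topology d interior_of S" using f unfolding interior_of_def by blast
qed

lemma closure_form_topology:
  assumes "S \<subseteq> binary_forms d"
  shows "f \<in> form_topology d closure_of S \<longleftrightarrow>
     f \<in> binary_forms d \<and> (\<forall>\<delta>>0. \<exists>g\<in>S. near d \<delta> (nrm d f) (nrm d g))"
proof
  assume f: "f \<in> form_topology d closure_of S"
  have fb: "f \<in> binary_forms d" using f by (simp add: in_closure_of topspace_form_topology)
  have "\<exists>g\<in>S. near d \<delta> (nrm d f) (nrm d g)" if \<delta>: "\<delta> > 0" for \<delta>
  proof -
    let ?U = "{g \<in> binary_forms d. near d \<delta> (nrm d f) (nrm d g)}"
    have "openin (form_topology d) ?U"
    proof (rule openin_form_topology_if)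
      fix h assume "h \<in> ?U"
      then show "\<exists>\<delta>>0. \<forall>g\<in>binary_forms d. near d \<delta> (nrm d h) (nrm d g) \<longrightarrow> g \<in> ?U"
        using near_interior[of d \<delta> "nrm d f" "nrm d h"] by blast
    qed blast
    moreover have "f \<in> ?U" using fb near_refl[OF \<delta>] by simp
    moreover have "\<forall>T. f \<in> T \<and> openin (form_topology d) T \<longrightarrow> (\<exists>y. y \<in> S \<and> y \<in> T)"
      using f by (simp add: in_closure_of)
    ultimately have "\<exists>y. y \<in> S \<and> y \<in> ?U" by (metis (no_types, lifting))
    then show ?thesis by blast
  qed
  then show "f \<in> binary_forms d \<and> (\<forall>\<delta>>0. \<exists>g\<in>S. near d \<delta> (nrm d f) (nrm d g))" using fb by blast
next
  assume f: "f \<in> binary_forms d \<and> (\<forall>\<delta>>0. \<exists>g\<in>S. near d \<delta> (nrm d f) (nrm d g))"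
  have "\<exists>y. y \<in> S \<and> y \<in> T" if T: "f \<in> T" "openin (form_topology d) T" for T
    using openin_form_topology_imp[OF T(2,1)] f assms by blast
  then show "f \<in> form_topology d closure_of S" unfolding in_closure_of topspace_form_topology using f by blast
qed

section \<open>Boundary forms are degenerate\<close>

lemma rank_region_iff:
  "f \<in> rank_region d r \<longleftrightarrow> f \<in> binary_forms d \<and>
     (\<exists>\<delta>>0. \<forall>g\<in>binary_forms d. near d \<delta> (nrm d f) (nrm d g) \<longrightarrow> real_rank d g = r)"
  unfolding rank_region_def by (subst interior_form_topology) auto

lemma rank_region_subset: "rank_region d r \<subseteq> binary_forms d"
  using rank_region_iff by blast

text \<open>If \<open>f\<close> is not degenerate and is in \<open>Wbar d s\<close>, then forms of rank at most \<open>s\<close> contain a dense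
  open set near \<open>f\<close>. For \<open>s = r - 1\<close> this is impossible, since \<open>f\<close> is a limit of interior points of
  rank \<open>r\<close>. So all forms near \<open>f\<close> have rank at least \<open>r\<close>, and for \<open>s = r\<close> the region is dense near
  \<open>f\<close>, which makes \<open>f\<close> an interior point of its closure.\<close>

lemma boundary_degenerate:
  assumes f: "f \<in> rank_boundary d r" and r: "1 \<le> r" "r \<le> d"
  shows "degenerate d (nrm d f)"
proof (rule ccontr)
  assume nd: "\<not> degenerate d (nrm d f)"
  let ?T = "form_topology d" and ?R = "rank_region d r"
  have clR: "?T closure_of ?R \<subseteq> binary_forms d" using closure_of_subset_topspace[of ?T ?R] by (simp add: topspace_form_topology)
  have f1: "f \<in> ?T closure_of ?R" and f2: "f \<notin> ?T interior_of (?T closure_of ?R)"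
    using f unfolding rank_boundary_def by auto
  have fb: "f \<in> binary_forms d" using f1 clR by blast
  have d: "d \<ge> 1" using r by simp
  have dense: "\<exists>\<delta>>0. \<forall>b. near d \<delta> (nrm d f) b \<longrightarrow> (\<forall>\<epsilon>>0. \<exists>c. near d \<epsilon> b c \<and> (\<exists>\<gamma>>0. \<forall>c'. near d \<gamma> c c' \<longrightarrow> c' \<in> Wdist d s))"
    if "nrm d f \<in> Wbar d s" "s \<le> d" for s
    using open_dense_near_nondegenerate[OF that nd] .
  have low: "real_rank d g \<le> s" if "g \<in> binary_forms d" "nrm d g \<in> Wdist d s" "s \<le> d" for g s
    using Wdist_imp_real_rank_le[OF that(1,2)] that(3) by simp
  have regR: "real_rank d g = r" if "g \<in> ?R" for g
    using that near_refl unfolding rank_region_iff by blast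
  have ofn: "near d \<delta> a (nrm d (of_nrm d c)) \<longleftrightarrow> near d \<delta> a c" for \<delta> a c
    by (rule near_cong) (simp add: nrm_of_nrm)
  have fr: "nrm d f \<in> Wbar d r"
  proof (rule ccontr)
    assume "nrm d f \<notin> Wbar d r"
    then obtain \<delta> where \<delta>: "\<delta> > 0" "\<And>b. near d \<delta> (nrm d f) b \<Longrightarrow> b \<notin> Wbar d r" using Wbar_closed by blast
    obtain g where g: "g \<in> ?R" "near d \<delta> (nrm d f) (nrm d g)"
      using f1 \<delta>(1) unfolding closure_form_topology[OF rank_region_subset] by blast
    have "g \<in> binary_forms d" using g(1) rank_region_subset by blast
    then show False using \<delta>(2)[OF g(2)] real_rank_le_imp_Wbar[OF d, of g r] regR[OF g(1)] by simp
  qed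
  obtain \<delta> where \<delta>: "\<delta> > 0" "\<And>b \<epsilon>. near d \<delta> (nrm d f) b \<Longrightarrow> \<epsilon> > 0 \<Longrightarrow>
      \<exists>c. near d \<epsilon> b c \<and> (\<exists>\<gamma>>0. \<forall>c'. near d \<gamma> c c' \<longrightarrow> c' \<in> Wdist d r)"
    using dense[OF fr r(2)] by blast
  show False
  proof (cases "nrm d f \<in> Wbar d (r - 1)")
    case True
    \<comment> \<open>near \<open>f\<close> the forms of rank less than \<open>r\<close> contain a dense open set\<close>
    obtain \<delta>' where \<delta>': "\<delta>' > 0" "\<And>b \<epsilon>. near d \<delta>' (nrm d f) b \<Longrightarrow> \<epsilon> > 0 \<Longrightarrow>
      \<exists>c. near d \<epsilon> b c \<and> (\<exists>\<gamma>>0. \<forall>c'. near d \<gamma> c c' \<longrightarrow> c' \<in> Wdist d (r - 1))"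
      using dense[OF True le_trans[OF diff_le_self r(2)]] by blast
    obtain g where g: "g \<in> ?R" "near d \<delta>' (nrm d f) (nrm d g)"
      using f1 \<delta>'(1) unfolding closure_form_topology[OF rank_region_subset] by blast
    obtain \<epsilon> where \<epsilon>: "\<epsilon> > 0" "\<forall>h\<in>binary_forms d. near d \<epsilon> (nrm d g) (nrm d h) \<longrightarrow> real_rank d h = r"
      using g(1) unfolding rank_region_iff by blast
    obtain c \<gamma> where c: "near d \<epsilon> (nrm d g) c" "\<gamma> > 0" "\<forall>c'. near d \<gamma> c c' \<longrightarrow> c' \<in> Wdist d (r - 1)"
      using \<delta>'(2)[OF g(2) \<epsilon>(1)] by blast
    have "real_rank d (of_nrm d c) = r" using \<epsilon>(2) c(1) of_nrm_in_binary_forms ofn by blast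
    moreover have "nrm d (of_nrm d c) \<in> Wdist d (r - 1)"
      using c(2,3) near_refl ofn by blast
    then have "real_rank d (of_nrm d c) \<le> r - 1" using low[OF of_nrm_in_binary_forms] r(2) by simp
    ultimately show False using r(1) by simp
  next
    case False
    then obtain \<delta>' where \<delta>': "\<delta>' > 0" "\<And>b. near d \<delta>' (nrm d f) b \<Longrightarrow> b \<notin> Wbar d (r - 1)" using Wbar_closed by blast
    have "g \<in> ?T closure_of ?R" if g: "g \<in> binary_forms d" "near d (min \<delta> \<delta>') (nrm d f) (nrm d g)" for g
      unfolding closure_form_topology[OF rank_region_subset]
    proof (intro conjI g(1) allI impI)
      fix \<epsilon> :: real assume \<epsilon>: "\<epsilon> > 0"
      have gn: "near d \<delta> (nrm d f) (nrm d g)" "near d \<delta>' (nrm d f) (nrm d g)" using g(2) by (auto simp: near_def)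
      obtain \<epsilon>' where \<epsilon>': "\<epsilon>' > 0" "\<forall>c. near d \<epsilon>' (nrm d g) c \<longrightarrow> near d \<delta>' (nrm d f) c" using near_interior[OF gn(2)] by blast
      obtain c \<gamma> where c: "near d (min \<epsilon> \<epsilon>') (nrm d g) c" "\<gamma> > 0" "\<forall>c'. near d \<gamma> c c' \<longrightarrow> c' \<in> Wdist d r"
        using \<delta>(2)[OF gn(1), of "min \<epsilon> \<epsilon>'"] \<epsilon> \<epsilon>'(1) by auto
      have c': "near d \<epsilon> (nrm d g) c" "near d \<epsilon>' (nrm d g) c" using c(1) by (auto simp: near_def)
      obtain \<gamma>' where \<gamma>': "\<gamma>' > 0" "\<forall>x. near d \<gamma>' c x \<longrightarrow> near d \<delta>' (nrm d f) x"
        using near_interior[of d \<delta>' "nrm d f" c] \<epsilon>'(2) c'(2) by blast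
      have "of_nrm d c \<in> ?R" unfolding rank_region_iff
      proof (intro conjI of_nrm_in_binary_forms exI[of _ "min \<gamma> \<gamma>'"] ballI impI)
        show "min \<gamma> \<gamma>' > 0" using c(2) \<gamma>'(1) by simp
        fix h assume h: "h \<in> binary_forms d" "near d (min \<gamma> \<gamma>') (nrm d (of_nrm d c)) (nrm d h)"
        have "near d (min \<gamma> \<gamma>') (nrm d h) c" using h(2) ofn near_commute by blast
        then have hc: "near d \<gamma> c (nrm d h)" "near d \<gamma>' c (nrm d h)" by (auto simp: near_def abs_minus_commute)
        have "real_rank d h \<le> r" using low[OF h(1)] c(3) hc(1) r(2) by blast
        moreover have "\<not> real_rank d h \<le> r - 1"
          using real_rank_le_imp_Wbar[OF d h(1)] \<gamma>'(2) hc(2) \<delta>'(2) by blast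
        ultimately show "real_rank d h = r" by linarith
      qed
      then show "\<exists>g'\<in>?R. near d \<epsilon> (nrm d g) (nrm d g')" using c'(1) ofn by blast
    qed
    then have "f \<in> ?T interior_of (?T closure_of ?R)"
      unfolding interior_form_topology[OF clR] using fb \<delta>(1) \<delta>'(1) by (intro conjI exI[of _ "min \<delta> \<delta>'"]) auto
    then show False using f2 by blast
  qed
qed

section \<open>Parametrization of degenerate forms by linear recurrences\<close>

lemma polyfun_tendsto:
  assumes "f \<in> polyfun I" "\<And>i. i \<in> I \<Longrightarrow> ((\<lambda>h. u h i) \<longlongrightarrow> v i) F"
  shows "((\<lambda>h. f (u h)) \<longlongrightarrow> f v) F"
  using assms by (induction rule: polyfun.induct) (auto intro: tendsto_intros)

text \<open>The sequence with prescribed entries below \<open>K\<close> and above \<open>N\<close>, and determined in between by the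
  linear recurrence with the monic characteristic polynomial \<open>q\<close> of degree \<open>K\<close>.\<close>

function rec_seq :: "'a::comm_ring_1 poly \<Rightarrow> nat \<Rightarrow> nat \<Rightarrow> (nat \<Rightarrow> 'a) \<Rightarrow> nat \<Rightarrow> 'a" where
  "rec_seq q K N v i = (if i < K \<or> N < i then v i
     else - (\<Sum>j<K. coeff q j * rec_seq q K N v (i - K + j)))"
  by pat_completeness auto
termination by (relation "Wellfounded.measure (\<lambda>(q, K, N, v, i). i)") auto

declare rec_seq.simps [simp del]

lemma polyfun_rec_seq:
  assumes "polycoeff W Q" "\<And>i. i \<le> d \<Longrightarrow> i < K \<or> N < i \<Longrightarrow> (\<lambda>x. v x i) \<in> polyfun W" "i \<le> d"
  shows "(\<lambda>x. rec_seq (Q x) K N (v x) i) \<in> polyfun W"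
  using assms(3)
proof (induction i rule: less_induct)
  case (less i)
  show ?case
  proof (cases "i < K \<or> N < i")
    case True
    then show ?thesis using assms(2) less.prems by (subst rec_seq.simps) simp
  next
    case False
    then show ?thesis
      using less by (subst rec_seq.simps)
        (auto intro!: polyfun_uminus polyfun_sum polyfun_mult polycoeffD[OF assms(1)])
  qed
qed

lemma kills_imp_rec_seq:
  assumes k: "kills d (K + m) q a" and q: "degree q \<le> K" "coeff q K = 1" and d: "m \<le> d"
    and v: "\<And>i. i \<le> d \<Longrightarrow> i < K \<or> d - m < i \<Longrightarrow> v i = a i" and i: "i \<le> d"
  shows "rec_seq q K (d - m) v i = a i"
  using i
proof (induction i rule: less_induct)
  case (less i)
  show ?case
  proof (cases "i < K \<or> d - m < i")
    case True
    then show ?thesis using v less.prems by (subst rec_seq.simps) simp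
  next
    case False
    have "(\<Sum>j\<le>K + m. coeff q j * a (i - K + j)) = 0"
    proof -
      have "i - K + (K + m) \<le> d" using False d by linarith
      then show ?thesis using k unfolding kills_def by blast
    qed
    moreover have "(\<Sum>j\<le>K + m. coeff q j * a (i - K + j)) = (\<Sum>j\<le>K. coeff q j * a (i - K + j))"
      using q(1) by (intro sum.mono_neutral_right) (auto simp: coeff_eq_0)
    moreover have "\<dots> = (\<Sum>j<K. coeff q j * a (i - K + j)) + a i"
      using False q(2) by (simp flip: lessThan_Suc_atMost)
    ultimately have "a i = - (\<Sum>j<K. coeff q j * a (i - K + j))" by (simp add: eq_neg_iff_add_eq_0 add.commute)
    also have "\<dots> = - (\<Sum>j<K. coeff q j * rec_seq q K (d - m) v (i - K + j))"
      using less False by (intro arg_cong[of _ _ uminus] sum.cong) auto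
    also have "\<dots> = rec_seq q K (d - m) v i" using False by (subst (2) rec_seq.simps) simp
    finally show ?thesis by simp
  qed
qed

text \<open>The parameters are the roots of the characteristic polynomial, with multiplicities \<open>es\<close>, followed by
  the free entries. The last \<open>m\<close> entries are free if the annihilator has a root of multiplicity \<open>m\<close>
  at infinity.\<close>

definition param_seq :: "nat \<Rightarrow> nat list \<Rightarrow> nat \<Rightarrow> (nat \<Rightarrow> complex) \<Rightarrow> nat \<Rightarrow> complex" where
  "param_seq d es m x = rec_seq (rootprod (length es) ((!) es) x (\<lambda>_. 1)) (sum_list es) (d - m)
     (\<lambda>i. x (length es + i))"

definition param_vars :: "nat \<Rightarrow> nat list \<Rightarrow> nat \<Rightarrow> nat set" where
  "param_vars d es m =
     {..<length es} \<union> (\<lambda>i. length es + i) ` ({..<sum_list es} \<union> {d - m<..d})"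

lemma finite_param_vars: "finite (param_vars d es m)"
  by (simp add: param_vars_def)

lemma card_param_vars: "m \<le> d \<Longrightarrow> card (param_vars d es m) \<le> length es + sum_list es + m"
proof -
  assume m: "m \<le> d"
  have "card (param_vars d es m) \<le> card {..<length es} + card ((\<lambda>i. length es + i) ` ({..<sum_list es} \<union> {d - m<..d}))"
    unfolding param_vars_def by (rule card_Un_le)
  also have "card ((\<lambda>i. length es + i) ` ({..<sum_list es} \<union> {d - m<..d})) \<le> card ({..<sum_list es} \<union> {d - m<..d})"
    by (rule card_image_le) simp
  also have "\<dots> \<le> card {..<sum_list es} + card {d - m<..d}" by (rule card_Un_le)
  finally show ?thesis using m by simp
qed

lemma param_seq_polyfun:
  "i \<le> d \<Longrightarrow> (\<lambda>x. param_seq d es m x i) \<in> polyfun (param_vars d es m)"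
  unfolding param_seq_def
proof (rule polyfun_rec_seq)
  show "polycoeff (param_vars d es m) (\<lambda>x. rootprod (length es) ((!) es) x (\<lambda>_. 1))"
    unfolding rootprod_def
    by (intro polycoeff_prod polycoeff_power polycoeff_lin polyfun_coord polyfun_const)
      (simp add: param_vars_def)
qed (auto simp: param_vars_def intro!: polyfun_coord)

lemma sum_list_nth: "(\<Sum>i<length es. es ! i) = sum_list es"
  by (simp add: sum_list_sum_nth atLeast0LessThan)

lemma kills_imp_param_seq:
  assumes "kills d (sum_list es + m) (rootprod (length es) ((!) es) t (\<lambda>_. 1)) a" "m \<le> d"
  shows "\<exists>x. (\<forall>i<length es. x i = t i) \<and> (\<forall>i\<le>d. param_seq d es m x i = a i)"
proof (intro exI conjI allI impI)
  let ?k = "length es"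
  let ?x = "\<lambda>i. if i < ?k then t i else a (i - ?k)"
  have r: "rootprod ?k ((!) es) ?x (\<lambda>_. 1) = rootprod ?k ((!) es) t (\<lambda>_. 1)"
    unfolding rootprod_def by (intro prod.cong) auto
  show "?x i = t i" if "i < ?k" for i using that by simp
  show "param_seq d es m ?x i = a i" if "i \<le> d" for i
    unfolding param_seq_def r using that
    by (intro kills_imp_rec_seq[OF assms(1)] assms(2))
      (use rootprod_unit_leading[of ?k "(!) es" t] in \<open>simp_all add: sum_list_nth\<close>)
qed

lemma rootprod_cong: "(\<And>i. i < n \<Longrightarrow> x i = x' i) \<Longrightarrow> rootprod n e x y = rootprod n e x' y"
  unfolding rootprod_def by (intro prod.cong) auto

lemma kills_of_real:
  assumes "kills d k q a"
  shows "kills d k (map_poly complex_of_real q) (\<lambda>i. of_real (a i))"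
  unfolding kills_def
proof (intro allI impI)
  fix i assume "i + k \<le> d"
  then have "(\<Sum>j\<le>k. coeff q j * a (i + j)) = 0" using assms by (simp add: kills_def)
  then have "complex_of_real (\<Sum>j\<le>k. coeff q j * a (i + j)) = 0" by simp
  then show "(\<Sum>j\<le>k. coeff (map_poly complex_of_real q) j * complex_of_real (a (i + j))) = 0"
    by (simp add: coeff_map_poly)
qed

lemma map_poly_of_real_mult:
  "map_poly complex_of_real (p * q) = map_poly complex_of_real p * map_poly complex_of_real q"
  by (rule poly_eqI) (simp add: coeff_map_poly coeff_mult)

lemma map_poly_of_real_power: "map_poly complex_of_real (p ^ n) = map_poly complex_of_real p ^ n"
  by (induction n) (simp_all add: map_poly_of_real_mult)

lemma map_poly_of_real_prod:
  "map_poly complex_of_real (\<Prod>i\<in>A. p i) = (\<Prod>i\<in>A. map_poly complex_of_real (p i))"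
  by (induction A rule: infinite_finite_induct) (simp_all add: map_poly_of_real_mult)

lemma map_poly_of_real_lin: "map_poly complex_of_real (lin x y) = lin (of_real x) (of_real y)"
  by (simp add: lin_def map_poly_pCons)

text \<open>The root at infinity is treated separately. As a root that occurs \<open>\<nu> - 1\<close> times is counted
  with \<open>\<nu>\<close>, there are at most \<open>d\<close> parameters, and fewer if there is a root at infinity: its position
  is not a parameter.\<close>

lemma degenerate_imp_param_seq:
  assumes "degenerate d a"
  shows "\<exists>es m x. (\<forall>i\<le>d. param_seq d es m x i = of_real (a i)) \<and>
    (length es + sum_list es + m < d \<or> m = 0 \<and> length es + sum_list es = d \<and>
       kills d (sum_list es) (rootprod (length es) ((!) es) x (\<lambda>_. 1)) (\<lambda>i. of_real (a i)))"
proof -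
  obtain \<Theta> \<nu> where T: "finite \<Theta>" "\<Theta> \<subseteq> {0..<pi}" "\<forall>\<phi>\<in>\<Theta>. \<nu> \<phi> \<ge> (2 :: nat)" "sum \<nu> \<Theta> \<le> d"
    "kills d (\<Sum>\<phi>\<in>\<Theta>. \<nu> \<phi> - 1) (\<Prod>\<phi>\<in>\<Theta>. cl \<phi> ^ (\<nu> \<phi> - 1)) a"
    using assms unfolding degenerate_def by blast
  define \<Theta>' where "\<Theta>' = \<Theta> - {pi / 2}"
  define m where "m = (if pi / 2 \<in> \<Theta> then \<nu> (pi / 2) - 1 else 0)"
  have fin: "finite \<Theta>'" using T(1) by (simp add: \<Theta>'_def)
  obtain xs where xs: "set xs = \<Theta>'" "distinct xs" using finite_distinct_list[OF fin] by blast
  define es where "es = map (\<lambda>\<phi>. \<nu> \<phi> - 1) xs"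
  define t where "t i = complex_of_real (tan (xs ! i))" for i
  let ?k = "length es"
  have nth: "bij_betw ((!) xs) {..<?k} \<Theta>'"
    using bij_betw_nth[OF xs(2), of "{..<?k}" \<Theta>'] xs(1) by (simp add: es_def)
  have K: "sum_list es = (\<Sum>\<phi>\<in>\<Theta>'. \<nu> \<phi> - 1)"
    unfolding es_def using sum.distinct_set_conv_list[OF xs(2), of "\<lambda>\<phi>. \<nu> \<phi> - 1"] xs(1) by simp
  have k: "?k = card \<Theta>'" using distinct_card[OF xs(2)] xs(1) by (simp add: es_def)
  have split: "(\<Sum>\<phi>\<in>\<Theta>. \<nu> \<phi> - 1) = sum_list es + m"
    unfolding K m_def \<Theta>'_def using T(1) by (auto simp: sum.remove add.commute)
  have "?k + sum_list es = (\<Sum>\<phi>\<in>\<Theta>'. (\<nu> \<phi> - 1) + 1)" unfolding K k by (simp only: sum.distrib card_eq_sum)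
  also have "\<dots> = sum \<nu> \<Theta>'" using T(3) by (intro sum.cong) (force simp: \<Theta>'_def)+
  finally have kK: "?k + sum_list es = sum \<nu> \<Theta>'" .
  have bound: "?k + sum_list es + m < d \<or> m = 0 \<and> ?k + sum_list es = d"
  proof (cases "pi / 2 \<in> \<Theta>")
    case True
    then have "sum \<nu> \<Theta> = \<nu> (pi / 2) + sum \<nu> \<Theta>'" using T(1) by (simp add: \<Theta>'_def sum.remove)
    moreover have "\<nu> (pi / 2) \<ge> 2" using T(3) True by blast
    ultimately show ?thesis using T(4) True kK by (simp add: m_def)
  next
    case False
    then have "\<Theta>' = \<Theta>" by (simp add: \<Theta>'_def)
    then show ?thesis using T(4) False kK by (auto simp: m_def)
  qed
  \<comment> \<open>the factor between the product of the \<open>cl \<phi>\<close> and the monic one; \<open>cl (pi / 2)\<close> is the constant \<open>- 1\<close>\<close>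
  define c where "c = (\<Prod>\<phi>\<in>\<Theta>. if \<phi> = pi / 2 then (- 1) ^ (\<nu> \<phi> - 1) else complex_of_real (cos \<phi>) ^ (\<nu> \<phi> - 1))"
  have cos_nz: "cos \<phi> \<noteq> 0" if "\<phi> \<in> \<Theta>" "\<phi> \<noteq> pi / 2" for \<phi>
  proof
    assume "cos \<phi> = 0"
    moreover have "0 \<le> \<phi>" "\<phi> < pi" using that T(2) by auto
    ultimately show False using cos_inj_pi[of \<phi> "pi / 2"] that(2) pi_gt_zero by simp
  qed
  have c: "c \<noteq> 0" unfolding c_def using T(1) cos_nz by (auto simp: prod_zero_iff)
  let ?q = "rootprod ?k ((!) es) t (\<lambda>_. 1)"
  have "map_poly complex_of_real (\<Prod>\<phi>\<in>\<Theta>. cl \<phi> ^ (\<nu> \<phi> - 1)) =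
     (\<Prod>\<phi>\<in>\<Theta>. smult (if \<phi> = pi / 2 then (- 1) ^ (\<nu> \<phi> - 1) else complex_of_real (cos \<phi>) ^ (\<nu> \<phi> - 1))
        (if \<phi> = pi / 2 then 1 else lin (complex_of_real (tan \<phi>)) 1 ^ (\<nu> \<phi> - 1)))"
    unfolding map_poly_of_real_prod map_poly_of_real_power cl_def map_poly_of_real_lin
  proof (intro prod.cong refl)
    fix \<phi> assume p: "\<phi> \<in> \<Theta>"
    show "lin (complex_of_real (sin \<phi>)) (complex_of_real (cos \<phi>)) ^ (\<nu> \<phi> - 1) =
       smult (if \<phi> = pi / 2 then (- 1) ^ (\<nu> \<phi> - 1) else complex_of_real (cos \<phi>) ^ (\<nu> \<phi> - 1))
        (if \<phi> = pi / 2 then 1 else lin (complex_of_real (tan \<phi>)) 1 ^ (\<nu> \<phi> - 1))"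
    proof (cases "\<phi> = pi / 2")
      case True
      have "lin (1 :: complex) 0 ^ n = smult ((- 1) ^ n) 1" for n
        by (induction n) (simp_all add: lin_def one_pCons)
      then show ?thesis unfolding True by simp
    next
      case False
      have "lin (complex_of_real (sin \<phi>)) (complex_of_real (cos \<phi>)) = smult (complex_of_real (cos \<phi>)) (lin (complex_of_real (tan \<phi>)) 1)"
        using cos_nz[OF p False] by (simp add: lin_def tan_def)
      then show ?thesis using False by (simp add: smult_power)
    qed
  qed
  also have "\<dots> = smult c (\<Prod>\<phi>\<in>\<Theta>. if \<phi> = pi / 2 then 1 else lin (complex_of_real (tan \<phi>)) 1 ^ (\<nu> \<phi> - 1))"
    unfolding c_def by (rule prod_smult)
  also have "(\<Prod>\<phi>\<in>\<Theta>. if \<phi> = pi / 2 then 1 else lin (complex_of_real (tan \<phi>)) 1 ^ (\<nu> \<phi> - 1)) =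
     (\<Prod>\<phi>\<in>\<Theta>'. lin (complex_of_real (tan \<phi>)) 1 ^ (\<nu> \<phi> - 1))"
    using T(1) by (intro prod.mono_neutral_cong_right) (auto simp: \<Theta>'_def)
  also have "\<dots> = (\<Prod>i<?k. lin (t i) 1 ^ (\<nu> (xs ! i) - 1))"
    unfolding t_def by (rule prod.reindex_bij_betw[OF nth, symmetric])
  also have "\<dots> = ?q" unfolding rootprod_def by (intro prod.cong) (auto simp: es_def)
  finally have "map_poly complex_of_real (\<Prod>\<phi>\<in>\<Theta>. cl \<phi> ^ (\<nu> \<phi> - 1)) = smult c ?q" .
  then have kq: "kills d (sum_list es + m) ?q (\<lambda>i. of_real (a i))"
    using kills_of_real[OF T(5)] c unfolding split by (simp add: kills_smult_iff)
  moreover have "m \<le> d" using bound by auto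
  ultimately obtain x where x: "\<forall>i<?k. x i = t i" "\<forall>i\<le>d. param_seq d es m x i = of_real (a i)"
    using kills_imp_param_seq by blast
  have "rootprod ?k ((!) es) x (\<lambda>_. 1) = ?q" using x(1) by (intro rootprod_cong) auto
  then show ?thesis using x(2) bound kq by (intro exI[of _ es] exI[of _ m] exI[of _ x]) auto
qed

lemma rootprod_as_linear_product:
  "\<exists>\<sigma>. (\<forall>j<\<Sum>i<n. e i. \<sigma> j < n) \<and> (\<forall>x y :: nat \<Rightarrow> 'a::field. rootprod n e x y = (\<Prod>j<\<Sum>i<n. e i. lin (x (\<sigma> j)) (y (\<sigma> j))))"
proof -
  define js where "js = concat (map (\<lambda>i. replicate (e i) i) [0..<n])"
  have len: "length js = (\<Sum>i<n. e i)"
    unfolding js_def by (simp add: length_concat o_def interv_sum_list_conv_sum_set_nat atLeast0LessThan)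
  have "prod_list (map f js) = (\<Prod>i<n. f i ^ e i)" for f :: "nat \<Rightarrow> 'a poly"
    unfolding js_def by (induction n) (auto simp: prod_list_replicate)
  moreover have "prod_list (map f js) = (\<Prod>j<length js. f (js ! j))" for f :: "nat \<Rightarrow> 'a poly"
    by (simp add: prod.list_conv_set_nth atLeast0LessThan)
  ultimately have "(\<Prod>i<n. f i ^ e i) = (\<Prod>j<length js. f (js ! j))" for f :: "nat \<Rightarrow> 'a poly" by metis
  then have "\<forall>x y :: nat \<Rightarrow> 'a. rootprod n e x y = (\<Prod>j<\<Sum>i<n. e i. lin (x (js ! j)) (y (js ! j)))"
    unfolding rootprod_def len by simp
  moreover have "js ! j < n" if "j < (\<Sum>i<n. e i)" for j
    using nth_mem[of j js] that len unfolding js_def by auto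
  ultimately show ?thesis by blast
qed

text \<open>A form whose annihilator has roots at infinity is a limit of forms whose annihilators have only
  finite roots, so that inequations persist.\<close>

lemma move_roots_from_infinity:
  fixes a :: "nat \<Rightarrow> complex"
  assumes k: "kills d (\<Sum>i<n. e i) (rootprod n e x y) a" and d: "(\<Sum>i<n. e i) \<le> d"
    and xy: "\<forall>i<n. x i \<noteq> 0 \<or> y i \<noteq> 0" and F: "F \<in> polyfun {..d}" "F a \<noteq> 0"
  shows "\<exists>t b. kills d (\<Sum>i<n. e i) (rootprod n e t (\<lambda>_. 1)) b \<and> F b \<noteq> 0"
proof -
  let ?K = "\<Sum>i<n. e i"
  obtain \<sigma> where s: "\<forall>j<?K. \<sigma> j < n"
    "\<forall>x y :: nat \<Rightarrow> complex. rootprod n e x y = (\<Prod>j<?K. lin (x (\<sigma> j)) (y (\<sigma> j)))"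
    using rootprod_as_linear_product by blast
  \<comment> \<open>the roots at infinity are moved to \<open>x i / h\<close>\<close>
  define Y where "Y h i = (if y i = 0 then h else y i)" for h :: complex and i
  have Y: "((\<lambda>h. Y h i) \<longlongrightarrow> y i) (at 0)" for i
    unfolding Y_def by (cases "y i = 0") (auto intro: tendsto_eq_intros)
  have "\<exists>B. (\<forall>j. ((\<lambda>h. B h j) \<longlongrightarrow> a j) (at 0)) \<and>
     (\<forall>\<^sub>F h in at 0. kills d ?K (\<Prod>j<?K. lin (x (\<sigma> j)) (Y h (\<sigma> j))) (B h))"
  proof (rule kernel_continuity)
    show "((\<lambda>h. x (\<sigma> j)) \<longlongrightarrow> x (\<sigma> j)) (at 0)" for j by simp
    show "((\<lambda>h. Y h (\<sigma> j)) \<longlongrightarrow> y (\<sigma> j)) (at 0)" for j by (rule Y)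
    show "x (\<sigma> j) \<noteq> 0 \<or> y (\<sigma> j) \<noteq> 0" if "j < ?K" for j using s(1) xy that by blast
    show "kills d ?K (\<Prod>j<?K. lin (x (\<sigma> j)) (y (\<sigma> j))) a" using k s(2) by simp
  qed (rule d)
  then obtain B where B: "\<And>j. ((\<lambda>h. B h j) \<longlongrightarrow> a j) (at 0)"
    "\<forall>\<^sub>F h in at 0. kills d ?K (\<Prod>j<?K. lin (x (\<sigma> j)) (Y h (\<sigma> j))) (B h)" by blast
  have "((\<lambda>h. F (B h)) \<longlongrightarrow> F a) (at 0)" by (rule polyfun_tendsto[OF F(1)]) (rule B(1))
  then have "\<forall>\<^sub>F h in at 0. F (B h) \<noteq> 0" using F(2) tendsto_imp_eventually_ne by blast
  moreover have "\<forall>\<^sub>F h in at (0 :: complex). h \<noteq> 0" by (simp add: eventually_at_filter)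
  ultimately have "\<forall>\<^sub>F h in at 0. kills d ?K (\<Prod>j<?K. lin (x (\<sigma> j)) (Y h (\<sigma> j))) (B h) \<and> F (B h) \<noteq> 0 \<and> h \<noteq> 0"
    using B(2) by eventually_elim auto
  then obtain h where h: "kills d ?K (\<Prod>j<?K. lin (x (\<sigma> j)) (Y h (\<sigma> j))) (B h)" "F (B h) \<noteq> 0" "h \<noteq> 0"
    using eventually_happens[of _ "at (0 :: complex)"] by (auto simp: trivial_limit_at)
  have nz: "Y h i \<noteq> 0" for i using h(3) by (simp add: Y_def)
  have "kills d ?K (rootprod n e x (Y h)) (B h)" using h(1) s(2) by simp
  then have "kills d ?K (rootprod n e (\<lambda>i. x i / Y h i) (\<lambda>_. 1)) (B h)"
    unfolding rootprod_monic[OF nz] using nz by (subst (asm) kills_smult_iff) (auto simp: prod_zero_iff)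
  then show ?thesis using h(2) by blast
qed


section \<open>The cone argument\<close>

lemma finite_partitions: "finite (partitions d)"
proof (rule finite_subset)
  have size: "size \<mu> \<le> sum_mset \<mu>" if "0 \<notin># \<mu>" for \<mu> :: "nat multiset"
    using that by (induction \<mu>) auto
  have elem: "x \<le> sum_mset \<mu>" if "x \<in># \<mu>" for x and \<mu> :: "nat multiset"
    using that by (metis le_add1 multi_member_split sum_mset.add_mset)
  show "partitions d \<subseteq> mset ` {xs. set xs \<subseteq> {..d} \<and> length xs \<le> d}"
  proof
    fix \<mu> assume m: "\<mu> \<in> partitions d"
    obtain xs where xs: "mset xs = \<mu>" using ex_mset by blast
    have "0 \<notin># \<mu>" "sum_mset \<mu> = d" using m by (auto simp: partitions_def)
    then have "size \<mu> \<le> d" "\<forall>x\<in>#\<mu>. x \<le> d" using size elem by blast+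
    then show "\<mu> \<in> mset ` {xs. set xs \<subseteq> {..d} \<and> length xs \<le> d}" using xs by (intro image_eqI[of _ _ xs]) auto
  qed
  show "finite (mset ` {xs. set xs \<subseteq> {..d} \<and> length xs \<le> d})"
    by (intro finite_imageI finite_lists_length_le) simp
qed

text \<open>The factor \<open>\<rho>\<close> is one more variable, and together with the equation \<open>G\<close> this leaves the
  hypersurface \<open>G = 0\<close> in a space of at most \<open>d + 1\<close> variables.\<close>

lemma cone_over_parametrization:
  assumes W: "finite W" "card W \<le> d" and g: "\<And>i. i \<le> d \<Longrightarrow> g i \<in> polyfun W"
    and G: "G \<in> polyfun W" "G b \<noteq> 0"
  shows "\<exists>H\<in>polyfun {..<Suc d}. (\<exists>X. H X \<noteq> 0) \<and>
     (\<forall>x \<rho>. G x = 0 \<longrightarrow> H (\<lambda>i. a i + \<rho> * (g i x - a i)) = 0)"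
proof -
  obtain v where v: "v \<notin> W" using ex_new_if_finite[OF infinite_UNIV_nat W(1)] by blast
  have "\<exists>H\<in>polyfun {..<Suc d}. (\<exists>X. H X \<noteq> 0) \<and>
     (\<forall>x. G x = 0 \<longrightarrow> H (\<lambda>j. a j + x v * (g j x - a j)) = 0)"
  proof (rule algebraically_dependent_modulo[of "insert v W" "Suc d" "\<lambda>j x. a j + x v * (g j x - a j)" G b])
    show "finite (insert v W)" using W(1) by simp
    show "card (insert v W) \<le> Suc d" using W v by simp
    show "(\<lambda>x. a j + x v * (g j x - a j)) \<in> polyfun (insert v W)" if "j < Suc d" for j
      using polyfun_mono[OF g, of j "insert v W"] that by (intro polyfun_intros) auto
    show "G \<in> polyfun (insert v W)" using polyfun_mono[OF G(1)] by blast
  qed (rule G(2))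
  then obtain H where H: "H \<in> polyfun {..<Suc d}" "\<exists>X. H X \<noteq> 0"
    "\<And>x. G x = 0 \<Longrightarrow> H (\<lambda>j. a j + x v * (g j x - a j)) = 0" by blast
  have "H (\<lambda>i. a i + \<rho> * (g i x - a i)) = 0" if x: "G x = 0" for x \<rho>
  proof -
    have "G (x(v := \<rho>)) = G x" by (rule polyfun_cong[OF G(1)]) (use v in auto)
    then have "H (\<lambda>j. a j + \<rho> * (g j (x(v := \<rho>)) - a j)) = 0" using H(3)[of "x(v := \<rho>)"] x by simp
    moreover have "H (\<lambda>j. a j + \<rho> * (g j (x(v := \<rho>)) - a j)) = H (\<lambda>i. a i + \<rho> * (g i x - a i))"
    proof (rule polyfun_cong[OF H(1)])
      fix i assume "i \<in> {..<Suc d}"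
      then have "g i (x(v := \<rho>)) = g i x" by (intro polyfun_cong[OF g]) (use v in auto)
      then show "a i + \<rho> * (g i (x(v := \<rho>)) - a i) = a i + \<rho> * (g i x - a i)" by simp
    qed
    ultimately show ?thesis by simp
  qed
  then show ?thesis using H(1,2) by blast
qed

lemma near_convex:
  assumes "near d \<delta> p a" "near d \<delta> p c" "0 \<le> t" "t \<le> 1"
  shows "near d \<delta> p (\<lambda>i. a i + t * (c i - a i))"
  unfolding near_def
proof (intro allI impI)
  fix i assume "i \<le> d"
  then have a: "\<bar>a i - p i\<bar> < \<delta>" and c: "\<bar>c i - p i\<bar> < \<delta>" using assms by (auto simp: near_def)
  have eq: "a i + t * (c i - a i) - p i = (1 - t) * (a i - p i) + t * (c i - p i)" by (simp add: algebra_simps)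
  have "\<bar>(1 - t) * (a i - p i) + t * (c i - p i)\<bar> \<le> (1 - t) * \<bar>a i - p i\<bar> + t * \<bar>c i - p i\<bar>"
    using assms(3,4) abs_triangle_ineq[of "(1 - t) * (a i - p i)" "t * (c i - p i)"] by (simp add: abs_mult)
  also have "\<dots> < \<delta>"
  proof (cases "t = 1")
    case False
    then have "(1 - t) * \<bar>a i - p i\<bar> < (1 - t) * \<delta>" using a assms(4) by (intro mult_strict_left_mono) auto
    moreover have "t * \<bar>c i - p i\<bar> \<le> t * \<delta>" using c assms(3) by (intro mult_left_mono) auto
    moreover have "(1 - t) * \<delta> + t * \<delta> = \<delta>" by (simp add: algebra_simps)
    ultimately show ?thesis by linarith
  qed (use c in simp)
  finally show "\<bar>a i + t * (c i - a i) - p i\<bar> < \<delta>" unfolding eq .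
qed

lemma near_on_segment:
  assumes "\<delta> > 0"
  shows "\<exists>\<eta>>0. \<forall>s t. \<bar>s - t\<bar> < \<eta> \<longrightarrow> near d \<delta> (\<lambda>i. a i + s * (c i - a i)) (\<lambda>i. a i + t * (c i - a i))"
proof -
  define M where "M = 1 + (\<Sum>i\<le>d. \<bar>c i - a i\<bar>)"
  have M: "M > 0" unfolding M_def by (intro add_pos_nonneg sum_nonneg) auto
  have "near d \<delta> (\<lambda>i. a i + s * (c i - a i)) (\<lambda>i. a i + t * (c i - a i))" if st: "\<bar>s - t\<bar> < \<delta> / M" for s t
    unfolding near_def
  proof (intro allI impI)
    fix i assume i: "i \<le> d"
    have "(a i + t * (c i - a i)) - (a i + s * (c i - a i)) = (t - s) * (c i - a i)" by (simp add: algebra_simps)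
    then have "\<bar>(a i + t * (c i - a i)) - (a i + s * (c i - a i))\<bar> = \<bar>s - t\<bar> * \<bar>c i - a i\<bar>"
      by (simp add: abs_mult abs_minus_commute)
    also have "\<bar>c i - a i\<bar> \<le> (\<Sum>i\<le>d. \<bar>c i - a i\<bar>)" using i by (intro member_le_sum) auto
    then have "\<bar>c i - a i\<bar> \<le> M" by (simp add: M_def)
    then have "\<bar>s - t\<bar> * \<bar>c i - a i\<bar> \<le> \<bar>s - t\<bar> * M" by (intro mult_left_mono) auto
    also have "\<dots> < \<delta>" using st M by (simp add: pos_less_divide_eq)
    finally show "\<bar>(a i + t * (c i - a i)) - (a i + s * (c i - a i))\<bar> < \<delta>" .
  qed
  then show ?thesis using M assms by (intro exI[of _ "\<delta> / M"]) auto
qed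

text \<open>The last point of the segment in the closure of the region is not an interior point of the closure.\<close>

lemma segment_meets_boundary:
  assumes a: "of_nrm d a \<in> rank_region d r" and c: "of_nrm d c \<notin> form_topology d closure_of rank_region d r"
  shows "\<exists>t. 0 < t \<and> t \<le> 1 \<and> of_nrm d (\<lambda>i. a i + t * (c i - a i)) \<in> rank_boundary d r"
proof -
  let ?C = "form_topology d closure_of rank_region d r"
  define \<gamma> where "\<gamma> t = (\<lambda>i. a i + t * (c i - a i))" for t
  define T where "T = {t \<in> {0..1}. of_nrm d (\<gamma> t) \<in> ?C}"
  have near_of: "near d \<delta> (nrm d (of_nrm d u)) (nrm d (of_nrm d v)) \<longleftrightarrow> near d \<delta> u v" for \<delta> u v
    by (auto simp: near_def nrm_of_nrm)
  have C_iff: "of_nrm d u \<in> ?C \<longleftrightarrow> (\<forall>\<delta>>0. \<exists>g\<in>rank_region d r. near d \<delta> u (nrm d g))" for u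
    unfolding closure_form_topology[OF rank_region_subset]
    using of_nrm_in_binary_forms near_cong near_commute by (auto simp: near_def nrm_of_nrm)
  have C_sub: "?C \<subseteq> binary_forms d" using closure_of_subset_topspace[of "form_topology d"] by (simp add: topspace_form_topology)
  have R_sub: "rank_region d r \<subseteq> ?C" by (rule closure_of_subset) (simp add: topspace_form_topology rank_region_subset)
  have "\<gamma> 0 = a" "\<gamma> 1 = c" by (simp_all add: \<gamma>_def)
  then have T01: "0 \<in> T" "1 \<notin> T" using a c R_sub by (auto simp: T_def)
  have bdd: "bdd_above T" by (rule bdd_aboveI[of _ 1]) (auto simp: T_def)
  define s where "s = Sup T"
  have s01: "0 \<le> s" "s \<le> 1"
    unfolding s_def using T01(1) bdd by (auto intro: cSup_upper cSup_least simp: T_def)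
  have sC: "of_nrm d (\<gamma> s) \<in> ?C"
    unfolding C_iff
  proof (intro allI impI)
    fix \<delta> :: real assume "\<delta> > 0"
    then obtain \<eta> where \<eta>: "\<eta> > 0" "\<forall>s t. \<bar>s - t\<bar> < \<eta> \<longrightarrow> near d (\<delta> / 2) (\<gamma> s) (\<gamma> t)"
      using near_on_segment[of "\<delta> / 2" d a c] unfolding \<gamma>_def by auto
    obtain t where t: "t \<in> T" "s - \<eta> < t" using less_cSupE[of "s - \<eta>" T] T01(1) \<eta>(1) unfolding s_def by auto
    have "t \<le> s" unfolding s_def using t(1) bdd by (rule cSup_upper)
    then have n1: "near d (\<delta> / 2) (\<gamma> s) (\<gamma> t)" using \<eta>(2) t(2) by simp
    have "of_nrm d (\<gamma> t) \<in> ?C" using t(1) by (simp add: T_def)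
    then obtain g where g: "g \<in> rank_region d r" "near d (\<delta> / 2) (\<gamma> t) (nrm d g)"
      unfolding C_iff using \<open>\<delta> > 0\<close> half_gt_zero by blast
    show "\<exists>g\<in>rank_region d r. near d \<delta> (\<gamma> s) (nrm d g)" using g(1) near_trans[OF n1 g(2)] by auto
  qed
  have s1: "s < 1" using sC T01(2) s01 by (cases "s = 1") (auto simp: T_def)
  have not_int: "of_nrm d (\<gamma> s) \<notin> form_topology d interior_of ?C"
  proof
    assume "of_nrm d (\<gamma> s) \<in> form_topology d interior_of ?C"
    then obtain \<delta> where \<delta>: "\<delta> > 0"
      "\<forall>g\<in>binary_forms d. near d \<delta> (nrm d (of_nrm d (\<gamma> s))) (nrm d g) \<longrightarrow> g \<in> ?C"
      unfolding interior_form_topology[OF C_sub] by blast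
    obtain \<eta> where \<eta>: "\<eta> > 0" "\<forall>s t. \<bar>s - t\<bar> < \<eta> \<longrightarrow> near d \<delta> (\<gamma> s) (\<gamma> t)"
      using near_on_segment[OF \<delta>(1), of d a c] unfolding \<gamma>_def by auto
    define t where "t = s + min (\<eta> / 2) (1 - s)"
    have t: "s < t" "t \<le> 1" "\<bar>s - t\<bar> < \<eta>" using \<eta>(1) s1 by (auto simp: t_def min_def)
    then have "near d \<delta> (\<gamma> s) (\<gamma> t)" using \<eta>(2) by blast
    then have "of_nrm d (\<gamma> t) \<in> ?C" using \<delta>(2) of_nrm_in_binary_forms near_of by blast
    then have "t \<in> T" using t s01 by (simp add: T_def)
    then have "t \<le> s" unfolding s_def using bdd by (rule cSup_upper)
    then show False using t(1) by simp
  qed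
  have "s \<noteq> 0"
  proof
    assume "s = 0"
    have "rank_region d r \<subseteq> form_topology d interior_of ?C"
      by (rule interior_of_maximal[OF R_sub]) (simp add: rank_region_def)
    then show False using a not_int \<open>s = 0\<close> \<open>\<gamma> 0 = a\<close> by auto
  qed
  then show ?thesis using s01 sC not_int unfolding rank_boundary_def \<gamma>_def by (intro exI[of _ s]) auto
qed


text \<open>A variable that does not occur in \<open>g\<close> takes the role of the equation.\<close>

lemma cone_over_small_parametrization:
  assumes W: "finite W" "card W < d" and g: "\<And>i. i \<le> d \<Longrightarrow> g i \<in> polyfun W"
  shows "\<exists>H\<in>polyfun {..<Suc d}. (\<exists>X. H X \<noteq> 0) \<and> (\<forall>x \<rho>. H (\<lambda>i. a i + \<rho> * (g i x - a i)) = 0)"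
proof -
  obtain v where v: "v \<notin> W" using ex_new_if_finite[OF infinite_UNIV_nat W(1)] by blast
  have "\<exists>H\<in>polyfun {..<Suc d}. (\<exists>X. H X \<noteq> 0) \<and>
     (\<forall>x \<rho>. x v = 0 \<longrightarrow> H (\<lambda>i. a i + \<rho> * (g i x - a i)) = 0)"
  proof (rule cone_over_parametrization[of "insert v W" d g "\<lambda>x. x v" "\<lambda>_. 1"])
    show "card (insert v W) \<le> d" using W v by simp
    show "g i \<in> polyfun (insert v W)" if "i \<le> d" for i using polyfun_mono[OF g[OF that]] by blast
  qed (use W(1) in \<open>auto intro: polyfun_coord\<close>)
  then obtain H where H: "H \<in> polyfun {..<Suc d}" "\<exists>X. H X \<noteq> 0"
    "\<And>x \<rho>. x v = 0 \<Longrightarrow> H (\<lambda>i. a i + \<rho> * (g i x - a i)) = 0" by blast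
  have "H (\<lambda>i. a i + \<rho> * (g i x - a i)) = 0" for x \<rho>
  proof -
    have "H (\<lambda>i. a i + \<rho> * (g i x - a i)) = H (\<lambda>i. a i + \<rho> * (g i (x(v := 0)) - a i))"
    proof (rule polyfun_cong[OF H(1)])
      fix i assume "i \<in> {..<Suc d}"
      then have "g i (x(v := 0)) = g i x" by (intro polyfun_cong[OF g]) (use v in auto)
      then show "a i + \<rho> * (g i x - a i) = a i + \<rho> * (g i (x(v := 0)) - a i)" by simp
    qed
    then show ?thesis using H(3)[of "x(v := 0)"] by simp
  qed
  then show ?thesis using H(1,2) by blast
qed

text \<open>If the dual variety is contained in \<open>A\<close>, hence in \<open>Z\<close>, then general roots would put \<open>f\<close> into
  \<open>Z\<close>. Otherwise some equation of \<open>A\<close> does not hold on the dual variety, and it is not an identity on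
  the family, because the forms that generate the dual variety are limits of members of the family.\<close>

lemma maximal_family_equation:
  assumes kK: "length es + sum_list es = d" and d: "d \<ge> 1" and A: "zariski_closed d A"
    and Z: "dual_variety d (coincident_root_locus (mset (map Suc es))) \<subseteq> A \<Longrightarrow>
            dual_variety d (coincident_root_locus (mset (map Suc es))) \<subseteq> Z"
  shows "\<exists>G\<in>polyfun (param_vars d es 0). (\<exists>b. G b \<noteq> 0) \<and>
    (\<forall>x f. f \<in> binary_forms d - {0} \<longrightarrow> proj_point f \<in> A - Z \<longrightarrow>
       (\<forall>i\<le>d. param_seq d es 0 x i = nrm d f i) \<longrightarrow>
       kills d (sum_list es) (rootprod (length es) ((!) es) x (\<lambda>_. 1)) (nrm d f) \<longrightarrow> G x = 0)"
proof -
  let ?k = "length es" and ?K = "sum_list es"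
  have k: "?k > 0" using kK d by (cases es) auto
  interpret root_locus ?k d "\<lambda>i. Suc (es ! i)"
  proof
    have "(\<Sum>i<?k. Suc (es ! i)) = (\<Sum>i<?k. es ! i) + ?k" by (simp only: Suc_eq_plus1 sum.distrib) simp
    then show "(\<Sum>i<?k. Suc (es ! i)) = d" using kK by (simp add: sum_list_nth)
  qed (use k in auto)
  have loc: "locus = coincident_root_locus (mset (map Suc es))"
  proof -
    have "map (\<lambda>i. Suc (es ! i)) [0..<?k] = map Suc es" by (rule nth_equalityI) simp_all
    then show ?thesis by (simp only: locus_def)
  qed
  have e1: "(\<lambda>i. Suc (es ! i) - 1) = (!) es" by (simp add: fun_eq_iff)
  have dn: "d - ?k = ?K" using kK by simp
  show ?thesis
  proof (cases "dual_variety d locus \<subseteq> A")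
    case True
    obtain \<Delta> where D: "\<Delta> \<in> polyfun {..<?k}" "\<exists>t. \<Delta> t \<noteq> 0"
      "\<And>t f. \<Delta> t \<noteq> 0 \<Longrightarrow> f \<in> binary_forms d - {0} \<Longrightarrow>
        kills d ?K (rootprod ?k ((!) es) t (\<lambda>_. 1)) (nrm d f) \<Longrightarrow> proj_point f \<in> dual_variety d locus"
      using generic_forms_in_dual_variety unfolding e1 dn by blast
    have "\<Delta> \<in> polyfun (param_vars d es 0)" using polyfun_mono[OF D(1)] by (auto simp: param_vars_def)
    moreover have "dual_variety d locus \<subseteq> Z" using Z True unfolding loc by blast
    ultimately show ?thesis using D(2,3) by (intro bexI[of _ \<Delta>]) blast+
  next
    case False
    let ?D = "{proj_point f | f. f \<in> binary_forms d - {0} \<and>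
      (\<exists>g. smooth_point d locus g \<and> proj_tangent_space d locus g \<subseteq> hyperplane d f)}"
    have "\<not> ?D \<subseteq> A" using False zariski_closure_minimal[OF A] unfolding dual_variety_def by blast
    then obtain f0 g0 where f0: "f0 \<in> binary_forms d - {0}" "smooth_point d locus g0"
      "proj_tangent_space d locus g0 \<subseteq> hyperplane d f0" "proj_point f0 \<notin> A" by blast
    obtain l F where F: "hpoly {..d} l F" "F (coords d f0) \<noteq> 0" "\<And>g. proj_point g \<in> A \<Longrightarrow> F (coords d g) = 0"
      using not_in_zariski_closedE[OF A f0(1,4)] by metis
    define F' where "F' a = F (\<lambda>i. a i * (1 / (fact i * fact (d - i))))" for a :: "nat \<Rightarrow> complex"
    have F': "F' \<in> polyfun {..d}" unfolding F'_def
      by (rule polyfun_compose[OF hpoly_imp_polyfun[OF F(1)]]) (intro polyfun_mult polyfun_coord polyfun_const)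
    have F'_nrm: "F' (nrm d f) = F (coords d f)" for f
      unfolding F'_def by (rule arg_cong[of _ _ F]) (simp add: nrm_def fun_eq_iff)
    obtain x y where xy: "\<forall>i<?k. x i \<noteq> 0 \<or> y i \<noteq> 0" "kills d ?K (rootprod ?k ((!) es) x y) (nrm d f0)"
      using tangent_hyperplane_imp_kills[OF _ f0(2,3)] f0(1) unfolding e1 dn by blast
    have "\<exists>t b. kills d (\<Sum>i<?k. es ! i) (rootprod ?k ((!) es) t (\<lambda>_. 1)) b \<and> F' b \<noteq> 0"
      by (rule move_roots_from_infinity[OF _ _ xy(1) F', where a = "nrm d f0"])
        (use xy(2) kK F(2) F'_nrm in \<open>simp_all add: sum_list_nth\<close>)
    then obtain t b where tb: "kills d (?K + 0) (rootprod ?k ((!) es) t (\<lambda>_. 1)) b" "F' b \<noteq> 0"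
      by (auto simp: sum_list_nth)
    obtain w where w: "\<forall>i\<le>d. param_seq d es 0 w i = b i" using kills_imp_param_seq[OF tb(1)] by auto
    define G where "G w = F' (param_seq d es 0 w)" for w
    have "G \<in> polyfun (param_vars d es 0)"
      unfolding G_def by (rule polyfun_compose[OF F', of "\<lambda>i x. param_seq d es 0 x i"]) (simp add: param_seq_polyfun)
    moreover have "G w = F' b" unfolding G_def by (rule polyfun_cong[OF F']) (use w in auto)
    moreover have "G x = 0" if "proj_point f \<in> A" "\<forall>i\<le>d. param_seq d es 0 x i = nrm d f i" for x f
    proof -
      have "G x = F' (nrm d f)" unfolding G_def by (rule polyfun_cong[OF F']) (use that in auto)
      then show ?thesis using F(3)[OF that(1)] F'_nrm by simp
    qed
    ultimately show ?thesis using tb(2) by (intro bexI[of _ G]) (metis DiffD1)+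
  qed
qed

lemma rank_boundary_subset: "rank_boundary d r \<subseteq> binary_forms d"
  unfolding rank_boundary_def using closure_of_subset_topspace[of "form_topology d"] by (auto simp: topspace_form_topology)

lemma complexify_boundary_form:
  "f \<in> rank_boundary d r - {0} \<Longrightarrow> complexify f \<in> binary_forms d - {0}"
  using rank_boundary_subset complexify_in_binary_forms complexify_eq_0_iff by blast

lemma zariski_closed_algebraic_boundary: "zariski_closed d (algebraic_boundary d r)"
  unfolding algebraic_boundary_def
  by (rule zariski_closed_zariski_closure) (use complexify_boundary_form in \<open>auto simp: zero_locus_def\<close>)

lemma zariski_closed_dual_variety: "zariski_closed d (dual_variety d V)"
  unfolding dual_variety_def
  by (rule zariski_closed_zariski_closure) (auto simp: zero_locus_def)

text \<open>The segments from a point \<open>a\<close> of the region near \<open>p\<close> to the points of an open set outside its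
  closure meet the boundary in degenerate forms outside \<open>Z\<close>. These are covered by finitely many
  families, and the cone with vertex \<open>a\<close> over the relevant part of each satisfies an equation. The
  product of the equations vanishes on an open set, which is absurd.\<close>

lemma boundary_in_dual_varieties:
  assumes r: "1 \<le> r" "r \<le> d" and p: "p \<in> rank_boundary d r - {0}" and Z: "zariski_closed d Z"
    and dual: "\<And>\<mu>. \<mu> \<in> partitions d \<Longrightarrow> dual_variety d (coincident_root_locus \<mu>) \<subseteq> algebraic_boundary d r \<Longrightarrow>
      dual_variety d (coincident_root_locus \<mu>) \<subseteq> Z"
  shows "proj_point (complexify p) \<in> Z"
proof (rule ccontr)
  let ?A = "algebraic_boundary d r" and ?C = "form_topology d closure_of rank_region d r"
  assume pZ: "proj_point (complexify p) \<notin> Z"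
  have d: "d \<ge> 1" using r by simp
  have pb: "p \<in> binary_forms d" "complexify p \<in> binary_forms d - {0}"
    using p rank_boundary_subset complexify_boundary_form by blast+
  obtain l F where F: "hpoly {..d} l F" "F (coords d (complexify p)) \<noteq> 0"
    "\<And>g. proj_point g \<in> Z \<Longrightarrow> F (coords d g) = 0"
    using not_in_zariski_closedE[OF Z pb(2) pZ] by metis
  obtain i0 where i0: "i0 \<le> d" "coords d p i0 \<noteq> 0"
  proof -
    have "deh p \<noteq> 0" using p pb(1) deh_eq_0_iff by blast
    then obtain i where "coeff (deh p) i \<noteq> 0" by (auto simp: poly_eq_iff)
    then show ?thesis using that coeff_deh_binary_form[OF pb(1), of i] by (auto split: if_splits)
  qed
  \<comment> \<open>the factor \<open>a i0\<close> keeps the zero form out of the neighbourhood of \<open>p\<close>\<close>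
  define F1 where "F1 a = F (\<lambda>i. a i * (1 / (fact i * fact (d - i)))) * a i0" for a :: "nat \<Rightarrow> complex"
  have F1: "F1 \<in> polyfun {..d}" unfolding F1_def
    by (intro polyfun_mult polyfun_coord polyfun_compose[OF hpoly_imp_polyfun[OF F(1)]] polyfun_const) (use i0 in auto)
  have F1_nrm: "F1 (\<lambda>i. of_real (nrm d f i)) = F (coords d (complexify f)) * of_real (nrm d f i0)" for f
    unfolding F1_def by (intro arg_cong2[of _ _ _ _ "(*)"] arg_cong[of _ _ F]) (simp_all add: nrm_def fun_eq_iff coords_complexify)
  have "F1 (\<lambda>i. of_real (nrm d p i)) \<noteq> 0" unfolding F1_nrm using F(2) i0 by (simp add: nrm_def)
  moreover have "((\<lambda>b. F1 (\<lambda>i. complex_of_real (b i))) \<longlongrightarrow> F1 (\<lambda>i. of_real (nrm d p i))) (nbhd d (nrm d p))"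
    by (rule polyfun_tendsto[OF F1]) (intro tendsto_of_real tendsto_nbhd, simp)
  ultimately have "\<forall>\<^sub>F b in nbhd d (nrm d p). F1 (\<lambda>i. of_real (b i)) \<noteq> 0" using tendsto_imp_eventually_ne by blast
  then obtain \<delta> where \<delta>: "\<delta> > 0" "\<And>b. near d \<delta> (nrm d p) b \<Longrightarrow> F1 (\<lambda>i. of_real (b i)) \<noteq> 0"
    unfolding eventually_nbhd by blast
  have away: "f \<noteq> 0 \<and> proj_point (complexify f) \<notin> Z" if "near d \<delta> (nrm d p) (nrm d f)" for f
  proof -
    have "F (coords d (complexify f)) * of_real (nrm d f i0) \<noteq> 0" using \<delta>(2)[OF that] F1_nrm by simp
    moreover have "nrm d (0 :: real bipoly) i0 = 0" by (simp add: nrm_def coords_def)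
    ultimately show ?thesis using F(3) by auto
  qed
  have pC: "p \<in> ?C" "p \<notin> form_topology d interior_of ?C" using p by (auto simp: rank_boundary_def)
  have C_sub: "?C \<subseteq> binary_forms d" using closure_of_subset_topspace[of "form_topology d"] by (simp add: topspace_form_topology)
  obtain g where g: "g \<in> rank_region d r" "near d \<delta> (nrm d p) (nrm d g)"
    using pC(1) \<delta>(1) unfolding closure_form_topology[OF rank_region_subset] by blast
  define a where "a = nrm d g"
  have a: "of_nrm d a \<in> rank_region d r" "near d \<delta> (nrm d p) a"
    using g rank_region_subset of_nrm_nrm unfolding a_def by (metis subsetD)+
  obtain h where h: "h \<in> binary_forms d" "near d \<delta> (nrm d p) (nrm d h)" "h \<notin> ?C"
    using pC(2) pb(1) \<delta>(1) unfolding interior_form_topology[OF C_sub] by blast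
  obtain \<epsilon>1 where \<epsilon>1: "\<epsilon>1 > 0" "\<forall>g\<in>rank_region d r. \<not> near d \<epsilon>1 (nrm d h) (nrm d g)"
    using h(1,3) unfolding closure_form_topology[OF rank_region_subset] by blast
  obtain \<epsilon>2 where \<epsilon>2: "\<epsilon>2 > 0" "\<forall>c. near d \<epsilon>2 (nrm d h) c \<longrightarrow> near d \<delta> (nrm d p) c" using near_interior[OF h(2)] by blast
  \<comment> \<open>half of \<open>\<epsilon>1\<close>, because a point of the closure is only approximated by the region\<close>
  define \<epsilon> where "\<epsilon> = min (\<epsilon>1 / 2) \<epsilon>2"
  have \<epsilon>: "\<epsilon> > 0" using \<epsilon>1(1) \<epsilon>2(1) by (simp add: \<epsilon>_def)
  have outside: "of_nrm d c \<notin> ?C" and inside: "near d \<delta> (nrm d p) c" if c: "near d \<epsilon> (nrm d h) c" for c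
  proof -
    have c': "near d (\<epsilon>1 / 2) (nrm d h) c" "near d \<epsilon>2 (nrm d h) c" using c by (auto simp: near_def \<epsilon>_def)
    show "near d \<delta> (nrm d p) c" using \<epsilon>2(2) c'(2) by blast
    show "of_nrm d c \<notin> ?C"
    proof
      assume "of_nrm d c \<in> ?C"
      then obtain g where g: "g \<in> rank_region d r" "near d (\<epsilon>1 / 2) (nrm d (of_nrm d c)) (nrm d g)"
        unfolding closure_form_topology[OF rank_region_subset] using \<epsilon>1(1) half_gt_zero by blast
      have "near d (\<epsilon>1 / 2) c (nrm d g)" using g(2) by (simp add: near_def nrm_of_nrm)
      then show False using near_trans[OF c'(1)] \<epsilon>1(2) g(1) by fastforce
    qed
  qed
  define I where "I = {(es, m). set es \<subseteq> {..d} \<and> length es \<le> d \<and> m \<le> d \<and>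
    (length es + sum_list es + m < d \<or> m = 0 \<and> length es + sum_list es = d)}"
  have finI: "finite I"
  proof (rule finite_subset)
    show "I \<subseteq> {es. set es \<subseteq> {..d} \<and> length es \<le> d} \<times> {..d}" by (auto simp: I_def)
    show "finite ({es. set es \<subseteq> {..d} \<and> length es \<le> d} \<times> {..d})"
      by (intro finite_cartesian_product finite_lists_length_le) auto
  qed
  \<comment> \<open>the parameters of the degenerate boundary forms outside \<open>Z\<close>\<close>
  define good where "good es m x \<longleftrightarrow> (\<exists>f\<in>rank_boundary d r. f \<noteq> 0 \<and> proj_point (complexify f) \<notin> Z \<and>
    (\<forall>i\<le>d. param_seq d es m x i = of_real (nrm d f i)) \<and>
    (length es + sum_list es + m < d \<or> m = 0 \<and> length es + sum_list es = d \<and>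
     kills d (sum_list es) (rootprod (length es) ((!) es) x (\<lambda>_. 1)) (\<lambda>i. of_real (nrm d f i))))" for es m x
  have "\<exists>H\<in>polyfun {..<Suc d}. (\<exists>X. H X \<noteq> 0) \<and>
     (\<forall>x \<rho>. good (fst c) (snd c) x \<longrightarrow> H (\<lambda>i. of_real (a i) + \<rho> * (param_seq d (fst c) (snd c) x i - of_real (a i))) = 0)"
    if c: "c \<in> I" for c
  proof -
    obtain es m where esm: "c = (es, m)" by (cases c)
    have m: "m \<le> d" and cases: "length es + sum_list es + m < d \<or> m = 0 \<and> length es + sum_list es = d"
      using c by (auto simp: I_def esm)
    have card: "card (param_vars d es m) \<le> length es + sum_list es + m" by (rule card_param_vars[OF m])
    show ?thesis
    proof (cases "length es + sum_list es + m < d")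
      case True
      then have "\<exists>H\<in>polyfun {..<Suc d}. (\<exists>X. H X \<noteq> 0) \<and>
        (\<forall>x \<rho>. H (\<lambda>i. of_real (a i) + \<rho> * (param_seq d es m x i - of_real (a i))) = 0)"
        using card by (intro cone_over_small_parametrization[OF finite_param_vars[of d es m]] param_seq_polyfun) auto
      then show ?thesis unfolding esm by auto
    next
      case False
      then have m0: "m = 0" and kK: "length es + sum_list es = d" using cases by auto
      let ?\<mu> = "mset (map Suc es)"
      have "?\<mu> \<in> partitions d"
      proof -
        have "sum_mset ?\<mu> = sum_list (map Suc es)" by (rule sum_mset_sum_list)
        also have "\<dots> = d" using kK by (simp add: sum_list_Suc)
        finally show ?thesis by (auto simp: partitions_def)
      qed
      then obtain G b where G: "G \<in> polyfun (param_vars d es 0)" "G b \<noteq> 0"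
        "\<And>x f. f \<in> binary_forms d - {0} \<Longrightarrow> proj_point f \<in> ?A - Z \<Longrightarrow>
          \<forall>i\<le>d. param_seq d es 0 x i = nrm d f i \<Longrightarrow>
          kills d (sum_list es) (rootprod (length es) ((!) es) x (\<lambda>_. 1)) (nrm d f) \<Longrightarrow> G x = 0"
        using maximal_family_equation[OF kK d zariski_closed_algebraic_boundary[of d r], of Z] dual by metis
      have Gx: "G x = 0" if good: "good es 0 x" for x
      proof -
        obtain f where f: "f \<in> rank_boundary d r" "f \<noteq> 0" "proj_point (complexify f) \<notin> Z"
          "\<forall>i\<le>d. param_seq d es 0 x i = of_real (nrm d f i)"
          "kills d (sum_list es) (rootprod (length es) ((!) es) x (\<lambda>_. 1)) (\<lambda>i. of_real (nrm d f i))"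
          using good kK unfolding good_def by auto
        have "proj_point (complexify f) \<in> ?A" unfolding algebraic_boundary_def
          by (rule subsetD[OF zariski_closure_superset]) (use f(1,2) in blast)
        moreover have "nrm d (complexify f) = (\<lambda>i. of_real (nrm d f i))" by (simp add: fun_eq_iff nrm_complexify)
        ultimately show ?thesis using G(3)[of "complexify f" x] f complexify_boundary_form[of f d r] by simp
      qed
      have "\<exists>H\<in>polyfun {..<Suc d}. (\<exists>X. H X \<noteq> 0) \<and>
        (\<forall>x \<rho>. G x = 0 \<longrightarrow> H (\<lambda>i. of_real (a i) + \<rho> * (param_seq d es 0 x i - of_real (a i))) = 0)"
        using card kK m0 G(1,2)
        by (intro cone_over_parametrization[OF finite_param_vars[of d es 0]] param_seq_polyfun) auto
      then show ?thesis unfolding esm m0 fst_conv snd_conv using Gx by blast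
    qed
  qed
  then have "\<forall>c\<in>I. \<exists>H. H \<in> polyfun {..<Suc d} \<and> (\<exists>X. H X \<noteq> 0) \<and>
     (\<forall>x \<rho>. good (fst c) (snd c) x \<longrightarrow> H (\<lambda>i. of_real (a i) + \<rho> * (param_seq d (fst c) (snd c) x i - of_real (a i))) = 0)"
    by blast
  from bchoice[OF this] obtain H where H: "\<And>c. c \<in> I \<Longrightarrow> H c \<in> polyfun {..<Suc d}" "\<And>c. c \<in> I \<Longrightarrow> \<exists>X. H c X \<noteq> 0"
    "\<And>c x \<rho>. c \<in> I \<Longrightarrow> good (fst c) (snd c) x \<Longrightarrow>
      H c (\<lambda>i. of_real (a i) + \<rho> * (param_seq d (fst c) (snd c) x i - of_real (a i))) = 0" by blast
  define P where "P x = (\<Prod>c\<in>I. H c x)" for x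
  have P: "P \<in> polyfun {..<Suc d}" unfolding P_def using H(1) by (rule polyfun_prod)
  have vanish: "P (\<lambda>i. of_real (y i)) = 0"
    if y: "\<And>i. i \<in> {..<Suc d} \<Longrightarrow> \<bar>y i - nrm d h i\<bar> < \<epsilon>" for y :: "nat \<Rightarrow> real"
  proof -
    have yn: "near d \<epsilon> (nrm d h) y" using y by (simp add: near_def)
    obtain t where t: "0 < t" "t \<le> 1" "of_nrm d (\<lambda>i. a i + t * (y i - a i)) \<in> rank_boundary d r"
      using segment_meets_boundary[OF a(1) outside[OF yn]] by blast
    define f where "f = of_nrm d (\<lambda>i. a i + t * (y i - a i))"
    have fn: "nrm d f i = a i + t * (y i - a i)" if "i \<le> d" for i using that by (simp add: f_def nrm_of_nrm)
    have "near d \<delta> (nrm d p) (\<lambda>i. a i + t * (y i - a i))" using near_convex[OF a(2) inside[OF yn]] t by simp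
    then have "near d \<delta> (nrm d p) (nrm d f)" using fn by (simp add: near_def)
    then have f: "f \<noteq> 0" "proj_point (complexify f) \<notin> Z" "f \<in> rank_boundary d r" using away t(3) by (auto simp: f_def)
    obtain es m x where esm: "\<forall>i\<le>d. param_seq d es m x i = of_real (nrm d f i)"
      "length es + sum_list es + m < d \<or> m = 0 \<and> length es + sum_list es = d \<and>
        kills d (sum_list es) (rootprod (length es) ((!) es) x (\<lambda>_. 1)) (\<lambda>i. of_real (nrm d f i))"
      using degenerate_imp_param_seq[OF boundary_degenerate[OF f(3) r]] by blast
    have "e \<le> sum_list es" if "e \<in> set es" for e using that by (intro member_le_sum_list) auto
    then have c: "(es, m) \<in> I" using esm(2) unfolding I_def by fastforce
    have gd: "good es m x" unfolding good_def using f esm by blast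
    have "H (es, m) (\<lambda>i. of_real (a i) + of_real (1 / t) * (param_seq d es m x i - of_real (a i))) = 0"
      by (rule H(3)[OF c, unfolded fst_conv snd_conv, OF gd])
    moreover have "H (es, m) (\<lambda>i. of_real (y i)) =
       H (es, m) (\<lambda>i. of_real (a i) + of_real (1 / t) * (param_seq d es m x i - of_real (a i)))"
    proof (rule polyfun_cong[OF H(1)[OF c]])
      fix i assume "i \<in> {..<Suc d}"
      then have i: "i \<le> d" by simp
      have "y i = a i + 1 / t * (nrm d f i - a i)" using fn[OF i] t(1) by simp
      then show "complex_of_real (y i) = of_real (a i) + of_real (1 / t) * (param_seq d es m x i - of_real (a i))"
        using esm(1) i by (metis of_real_add of_real_diff of_real_mult)
    qed
    ultimately have "H (es, m) (\<lambda>i. of_real (y i)) = 0" by simp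
    then show ?thesis unfolding P_def using c finI by (intro prod_zero) blast+
  qed
  have "P x = 0" for x by (rule polyfun_zero_on_real_box[OF P finite_lessThan \<epsilon> vanish])
  moreover have "\<exists>x. P x \<noteq> 0" unfolding P_def by (rule polyfun_prod_nonzero[OF finI H(1,2)])
  ultimately show False by blast
qed

theorem theorem0p1:
  fixes d r :: nat
  assumes "(real d + 1) / 2 \<le> real r" and "r \<le> d"
  shows "\<exists>\<Lambda> \<subseteq> partitions d.
           algebraic_boundary d r = (\<Union>\<mu>\<in>\<Lambda>. dual_variety d (coincident_root_locus \<mu>))"
proof -
  define \<Lambda> where "\<Lambda> = {\<mu> \<in> partitions d. dual_variety d (coincident_root_locus \<mu>) \<subseteq> algebraic_boundary d r}"
  let ?Z = "\<Union>\<mu>\<in>\<Lambda>. dual_variety d (coincident_root_locus \<mu>)"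
  have r: "1 \<le> r" using assms(1) by (cases r) auto
  have "finite \<Lambda>" by (rule finite_subset[OF _ finite_partitions[of d]]) (auto simp: \<Lambda>_def)
  then have Z: "zariski_closed d ?Z" by (rule zariski_closed_finite_UN) (rule zariski_closed_dual_variety)
  have "proj_point (complexify p) \<in> ?Z" if "p \<in> rank_boundary d r - {0}" for p
    by (rule boundary_in_dual_varieties[OF r assms(2) that Z]) (auto simp: \<Lambda>_def)
  then have "algebraic_boundary d r \<subseteq> ?Z"
    unfolding algebraic_boundary_def by (intro zariski_closure_minimal[OF Z]) blast
  moreover have "?Z \<subseteq> algebraic_boundary d r" by (auto simp: \<Lambda>_def)
  ultimately show ?thesis by (intro exI[of _ \<Lambda>]) (auto simp: \<Lambda>_def)
qed

end
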